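(* Suppose $$|\psi\rangle=\sum_{\alpha_1,\dots,\alpha_d}\operatorname{tr}\bigl(Q_1^{(\alpha_1)}Q_2^{(\alpha_2)}\cdots Q_d^{(\alpha_d)}\bigr)\,|\alpha_1,\dots,\alpha_d\rangle\in\mathbb C^{n_1}\otimes\cdots\otimes\mathbb C^{n_d}$$ is a matrix product state (a unit vector of this form) with bond dimension $r$, where $d\ge3$, $r\ge2$, and $n_k\ge r^2$ for all $k\in[d]$. Assume that the elements of the cores $\mathcal Q_k\in\mathbb C^{n_k\times r\times r}$, $k\in[d]$, are randomly drawn from a measure $\mu$ that is absolutely continuous with respect to the standard Euclidean measure, and suppose we are given access to the $3$-body marginals of $|\psi\rangle$. Then with probability one, the parameters $\mathcal Q_1,\dots,\mathcal Q_d$ can be recovered by the MPS recovery algorithm described in the context up to gauge invariance and a global phase factor. That is, its output $(\check{\mathcal Q}_1,\dots,\check{\mathcal Q}_d)$ satisfies, for some $\lambda\in\mathbb C$ with $|\lambda|=1$ and some $L_1,\dots,L_d\in\mathrm{GL}(r,\mathbb C)$, $L_{d+1}:=L_1$, $$\check Q_1^{(\alpha_1)}=\lambda\,L_1^{-1}Q_1^{(\alpha_1)}L_2,\qquad \check Q_k^{(\alpha_k)}=L_k^{-1}Q_k^{(\alpha_k)}L_{k+1}\quad(2\le k\le d)$$ for all $\alpha_k\in[n_k]$, $k\in[d]$.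
   Context: **Notation.** $[n]=\{1,\dots,n\}$, and $[d]$ is taken cyclically (indices modulo $d$). $|\alpha_1,\dots,\alpha_d\rangle$ are the standard basis vectors. For a core $\mathcal Q\in\mathbb C^{n\times r\times r}$, $Q^{(a)}\in\mathbb C^{r\times r}$ is its $a$-th slice, $Q^{(a)}_{i,j}=\mathcal Q_{a,i,j}$. Its two unfoldings $Q_{\langle1\rangle},Q_{[1]}\in\mathbb C^{n\times r^2}$ are, for $i,j\in[r]$, $$Q_{\langle 1\rangle}(a,(i-1)r+j)=Q^{(a)}_{i,j},\qquad Q_{[1]}(a,(i-1)r+j)=Q^{(a)}_{j,i}.$$ $A^\top$ is the transpose, $A^\dagger$ the Moore–Penrose inverse, $v^*$ the complex conjugate of a scalar. For an $r^2\times r^2$ matrix $X$, $\Pi(X)$ is the $r^2\times r^2$ matrix with $$\Pi(X)_{(j_2-1)r+j_1,(k_2-1)r+k_1}=X_{(j_1-1)r+j_2,(k_1-1)r+k_2},\qquad j_1,j_2,k_1,k_2\in[r].$$ **Marginals.** For $S\subseteq[d]$, the marginal $\rho^S=\operatorname{tr}_{S^c}(|\psi\rangle\langle\psi|)$ is the matrix indexed by $\prod_{k\in S}[n_k]$ with entries $\rho^S(\alpha,\beta)=\sum_{\gamma\in\prod_{k\notin S}[n_k]}\psi_{\alpha\gamma}\psi^*_{\beta\gamma}$, where $\alpha\gamma$ is the full index tuple with entries $\alpha_k$ for $k\in S$ and $\gamma_k$ for $k\notin S$. A $3$-body marginal is one with $|S|=3$. For $j\in[d]$, $k=j+1$ (mod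 $d$), $h\in[d]\setminus\{j,k\}$ and a unit vector $v\in\mathbb C^{n_h}$, let $M_{j,k}^{h,v}\in\mathbb C^{n_k\times n_j}$ be the matrix obtained from $\rho^{\{h,j,k\}}$ by $$M_{j,k}^{h,v}(\alpha_k,\alpha_j)=\sum_{\alpha_h,\alpha_h'=1}^{n_h}v_{\alpha_h}v^*_{\alpha'_h}\,\rho^{\{h,j,k\}}\bigl((\alpha_h,\alpha_j,\alpha_k),(\alpha'_h,1,1)\bigr),$$ where the triples list the indices of modes $h,j,k$. **MPS recovery algorithm.** Input: for each $j\in[d]$, with $k=j+1$ (mod $d$), the matrices $M_\iota=M_{j,k}^{h_\iota,v_\iota}$, $\iota=1,2,3,4$, for four different choices of $(h,v)$, where $h_\iota\in[d]\setminus\{j,k\}$ and $v_\iota\in\mathbb C^{n_{h_\iota}}$ is a unit vector. A. For each $j\in[d]$, $k=j+1$ (mod $d$): 1. Compute the eigendecompositions of $M_1M_2^\dagger$ and $M_3M_4^\dagger$, and stack the eigenvectors for the nonzero spectrum as $E,E'\in\mathbb C^{n_k\times r^2}$ respectively. Arrange the columns of $E$ (resp. $E'$) in $r$ consecutive blocks of size $r$ so that each block contains eigenvectors corresponding to the $r$ distinct nonzero eigenvalues in a fixed order (so column $(p-1)r+q$ belongs to the $q$-th eigenvalue, $p,q\in[r]$). 2. Let $F=E^\dagger E'$ and, for $a,b\in[r]$, let $F^{(a,b)}\in\mathbb C^{r\times r}$, $F^{(a,b)}_{p,q}=F_{(p-1)r+a,(q-1)r+b}$. Set $\hat K_1=I_r$,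 $\hat K_\ell=F^{(1,1)}(F^{(\ell,1)})^{-1}$ for $2\le\ell\le r$, $\hat K=\mathrm{blockdiag}(\hat K_1,\dots,\hat K_r)$. 3. Let $\hat{\mathcal Q}_k$ be the core with $\hat Q_{k\langle1\rangle}=E(\Pi(\hat K))^{-1}$, and let $\tilde{\mathcal Q}_j$ be the core with $\tilde Q_{j[1]}=\bigl(\hat Q_{k\langle1\rangle}^\dagger M_1\bigr)^\top$. B. For each $k\in[d]$, let $N_k$ be the top-left $r\times r$ submatrix of $\tilde Q_{k[1]}^\dagger\hat Q_{k[1]}\in\mathbb C^{r^2\times r^2}$, and let $\check Q_k^{(a)}=N_k^\top\tilde Q_k^{(a)}$ for $a\in[n_k]$. C. Replace $\check{\mathcal Q}_1$ by $\check{\mathcal Q}_1/\|\,|\psi'\rangle\|$, where $|\psi'\rangle=\sum_{\alpha_1,\dots,\alpha_d}\operatorname{tr}\bigl(\check Q_1^{(\alpha_1)}\cdots\check Q_d^{(\alpha_d)}\bigr)|\alpha_1,\dots,\alpha_d\rangle$. Output: $(\check{\mathcal Q}_1,\dots,\check{\mathcal Q}_d)$.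
   Formalization: The drawn state is normalized through its first core; the v's used at one site are pairwise non-proportional and, for d=3, the four v's do not lie in a plane; recovery holds for every choice of eigenvectors with |ψ'> nonzero, and such a choice exists. *)

theory Defs
  imports
    "HOL-Probability.Probability"
    "Jordan_Normal_Form.Schur_Decomposition"
    "Jordan_Normal_Form.DL_Rank"
begin

unbundle no vec_syntax
unbundle no inner_syntax

text \<open>
  All index ranges are shifted to start at 0: sites are \<open>{..<d}\<close> with cyclic successor
  \<open>Suc j mod d\<close>, physical indices of site \<open>k\<close> are \<open>{..<n k}\<close>, and the pair \<open>(i, j)\<close> of bond
  indices is flattened to \<open>i * r + j\<close>. A core is the function \<open>a \<mapsto> Q a\<close> of its slices, and a
  multi-index over a set \<open>S\<close> of sites is a function in \<open>tuples n S\<close>.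
\<close>

section \<open>Matrix notions\<close>

definition mat_trace :: "complex mat \<Rightarrow> complex" where
  "mat_trace A = (\<Sum>i<dim_row A. A $$ (i, i))"

definition minv :: "complex mat \<Rightarrow> complex mat" where
  "minv A = the (mat_inverse A)"

definition is_pinv :: "complex mat \<Rightarrow> complex mat \<Rightarrow> bool" where
  "is_pinv A X \<longleftrightarrow> X \<in> carrier_mat (dim_col A) (dim_row A) \<and>
     A * X * A = A \<and> X * A * X = X \<and>
     mat_adjoint (A * X) = A * X \<and> mat_adjoint (X * A) = X * A"

definition pinv :: "complex mat \<Rightarrow> complex mat" where
  "pinv A = (THE X. is_pinv A X)"

definition unfold1 :: "nat \<Rightarrow> nat \<Rightarrow> (nat \<Rightarrow> complex mat) \<Rightarrow> complex mat" where
  "unfold1 m r C = Matrix.mat m (r * r) (\<lambda>(a, c). C a $$ (c div r, c mod r))"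

definition unfold2 :: "nat \<Rightarrow> nat \<Rightarrow> (nat \<Rightarrow> complex mat) \<Rightarrow> complex mat" where
  "unfold2 m r C = Matrix.mat m (r * r) (\<lambda>(a, c). C a $$ (c mod r, c div r))"

definition core_of_unfold1 :: "nat \<Rightarrow> complex mat \<Rightarrow> nat \<Rightarrow> complex mat" where
  "core_of_unfold1 r X a = Matrix.mat r r (\<lambda>(i, j). X $$ (a, i * r + j))"

definition core_of_unfold2 :: "nat \<Rightarrow> complex mat \<Rightarrow> nat \<Rightarrow> complex mat" where
  "core_of_unfold2 r X a = Matrix.mat r r (\<lambda>(i, j). X $$ (a, j * r + i))"

definition index_swap :: "nat \<Rightarrow> complex mat \<Rightarrow> complex mat" where
  "index_swap r X = Matrix.mat (r * r) (r * r)
     (\<lambda>(s, t). X $$ ((s mod r) * r + s div r, (t mod r) * r + t div r))"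

section \<open>Matrix product states and marginals\<close>

definition tuples :: "(nat \<Rightarrow> nat) \<Rightarrow> nat set \<Rightarrow> (nat \<Rightarrow> nat) set" where
  "tuples n S = (\<Pi>\<^sub>E k\<in>S. {..<n k})"

definition mps_state :: "nat \<Rightarrow> nat \<Rightarrow> (nat \<Rightarrow> nat \<Rightarrow> complex mat) \<Rightarrow> (nat \<Rightarrow> nat) \<Rightarrow> complex" where
  "mps_state d r Q \<alpha> = mat_trace (foldr (*) (map (\<lambda>k. Q k (\<alpha> k)) [0..<d]) (1\<^sub>m r))"

definition mps_norm :: "nat \<Rightarrow> nat \<Rightarrow> (nat \<Rightarrow> nat) \<Rightarrow> (nat \<Rightarrow> nat \<Rightarrow> complex mat) \<Rightarrow> real" where
  "mps_norm d r n Q = sqrt (\<Sum>\<alpha>\<in>tuples n {..<d}. (cmod (mps_state d r Q \<alpha>))\<^sup>2)"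

definition normalize_mps ::
  "nat \<Rightarrow> nat \<Rightarrow> (nat \<Rightarrow> nat) \<Rightarrow> (nat \<Rightarrow> nat \<Rightarrow> complex mat) \<Rightarrow> nat \<Rightarrow> nat \<Rightarrow> complex mat" where
  "normalize_mps d r n Q k a =
     (if k = 0 then complex_of_real (1 / mps_norm d r n Q) \<cdot>\<^sub>m Q 0 a else Q k a)"

definition marginal ::
  "nat \<Rightarrow> (nat \<Rightarrow> nat) \<Rightarrow> ((nat \<Rightarrow> nat) \<Rightarrow> complex) \<Rightarrow> nat set
     \<Rightarrow> (nat \<Rightarrow> nat) \<Rightarrow> (nat \<Rightarrow> nat) \<Rightarrow> complex" where
  "marginal d n \<psi> S \<alpha> \<beta> =
     (\<Sum>\<gamma>\<in>tuples n ({..<d} - S). \<psi> (override_on \<gamma> \<alpha> S) * cnj (\<psi> (override_on \<gamma> \<beta> S)))"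

text \<open>The argument \<open>\<rho>\<close> is the family of marginals; only \<open>\<rho> {h, j, k}\<close> is read, and the default
  value 0 of the triples outside \<open>{h, j, k}\<close> is irrelevant.\<close>

definition marginal_slice ::
  "(nat \<Rightarrow> nat) \<Rightarrow> (nat set \<Rightarrow> (nat \<Rightarrow> nat) \<Rightarrow> (nat \<Rightarrow> nat) \<Rightarrow> complex)
     \<Rightarrow> nat \<Rightarrow> complex vec \<Rightarrow> nat \<Rightarrow> nat \<Rightarrow> complex mat" where
  "marginal_slice n \<rho> h v j k = Matrix.mat (n k) (n j) (\<lambda>(ak, aj).
     \<Sum>ah<n h. \<Sum>ah'<n h. (v $ ah) * cnj (v $ ah') *
       \<rho> {h, j, k} ((\<lambda>_. 0)(h := ah, j := aj, k := ak)) ((\<lambda>_. 0)(h := ah', j := 0, k := 0)))"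

section \<open>The recovery algorithm\<close>

text \<open>
  \<open>E\<close> is a possible result of stacking the eigenvectors of \<open>A\<close> for its nonzero spectrum
  \<open>e 0, \<dots>, e (r - 1)\<close>: the order of the eigenvalues and the bases of the (\<open>r\<close>-dimensional)
  eigenspaces are not determined by \<open>A\<close>.
\<close>

definition eigenvector_stack :: "nat \<Rightarrow> complex mat \<Rightarrow> complex mat \<Rightarrow> bool" where
  "eigenvector_stack r A E \<longleftrightarrow>
     E \<in> carrier_mat (dim_row A) (r * r) \<and>
     vec_space.rank (dim_row A) E = r * r \<and>
     (\<exists>e. inj_on e {..<r} \<and> e ` {..<r} = {x. x \<noteq> 0 \<and> eigenvalue A x} \<and>
        (\<forall>p<r. \<forall>q<r. eigenvector A (col E (p * r + q)) (e q)))"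

text \<open>
  The input matrices are \<open>M j 0, \<dots>, M j 3\<close> for the pair of sites \<open>(j, Suc j mod d)\<close>. The stacks
  computed from that pair, and the core \<open>Q_hat\<close>, belong to its second site, \<open>Q_tilde\<close> to its first.
\<close>

definition eigen_choice ::
  "nat \<Rightarrow> nat \<Rightarrow> (nat \<Rightarrow> nat \<Rightarrow> complex mat) \<Rightarrow> (nat \<Rightarrow> complex mat) \<Rightarrow> (nat \<Rightarrow> complex mat) \<Rightarrow> bool"
  where
  "eigen_choice d r M E E' \<longleftrightarrow> (\<forall>j<d.
     eigenvector_stack r (M j 0 * pinv (M j 1)) (E (Suc j mod d)) \<and>
     eigenvector_stack r (M j 2 * pinv (M j 3)) (E' (Suc j mod d)))"

definition F_block :: "nat \<Rightarrow> complex mat \<Rightarrow> complex mat \<Rightarrow> nat \<Rightarrow> nat \<Rightarrow> complex mat" where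
  "F_block r E E' a b = Matrix.mat r r (\<lambda>(p, q). (pinv E * E') $$ (p * r + a, q * r + b))"

definition K_hat :: "nat \<Rightarrow> complex mat \<Rightarrow> complex mat \<Rightarrow> complex mat" where
  "K_hat r E E' = diag_block_mat (map
     (\<lambda>l. if l = 0 then 1\<^sub>m r else F_block r E E' 0 0 * minv (F_block r E E' l 0)) [0..<r])"

definition Q_hat :: "nat \<Rightarrow> complex mat \<Rightarrow> complex mat \<Rightarrow> nat \<Rightarrow> complex mat" where
  "Q_hat r E E' = core_of_unfold1 r (E * minv (index_swap r (K_hat r E E')))"

definition step_A_defined ::
  "nat \<Rightarrow> nat \<Rightarrow> (nat \<Rightarrow> complex mat) \<Rightarrow> (nat \<Rightarrow> complex mat) \<Rightarrow> bool" where
  "step_A_defined d r E E' \<longleftrightarrow> (\<forall>k<d.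
     (\<forall>l\<in>{1..<r}. invertible_mat (F_block r (E k) (E' k) l 0)) \<and>
     invertible_mat (index_swap r (K_hat r (E k) (E' k))))"

definition Q_tilde ::
  "nat \<Rightarrow> nat \<Rightarrow> (nat \<Rightarrow> nat) \<Rightarrow> (nat \<Rightarrow> nat \<Rightarrow> complex mat)
     \<Rightarrow> (nat \<Rightarrow> complex mat) \<Rightarrow> (nat \<Rightarrow> complex mat) \<Rightarrow> nat \<Rightarrow> nat \<Rightarrow> complex mat" where
  "Q_tilde d r n M E E' j = (let k = Suc j mod d in
     core_of_unfold2 r ((pinv (unfold1 (n k) r (Q_hat r (E k) (E' k))) * M j 0)\<^sup>T))"

definition Q_check ::
  "nat \<Rightarrow> nat \<Rightarrow> (nat \<Rightarrow> nat) \<Rightarrow> (nat \<Rightarrow> nat \<Rightarrow> complex mat)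
     \<Rightarrow> (nat \<Rightarrow> complex mat) \<Rightarrow> (nat \<Rightarrow> complex mat) \<Rightarrow> nat \<Rightarrow> nat \<Rightarrow> complex mat" where
  "Q_check d r n M E E' k a =
     (let T = Q_tilde d r n M E E' k;
          X = pinv (unfold2 (n k) r T) * unfold2 (n k) r (Q_hat r (E k) (E' k));
          N = Matrix.mat r r (\<lambda>(s, t). X $$ (s, t))
      in N\<^sup>T * T a)"

definition recovery_output ::
  "nat \<Rightarrow> nat \<Rightarrow> (nat \<Rightarrow> nat) \<Rightarrow> (nat \<Rightarrow> nat \<Rightarrow> complex mat)
     \<Rightarrow> (nat \<Rightarrow> complex mat) \<Rightarrow> (nat \<Rightarrow> complex mat) \<Rightarrow> nat \<Rightarrow> nat \<Rightarrow> complex mat" where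
  "recovery_output d r n M E E' = normalize_mps d r n (Q_check d r n M E E')"

text \<open>
  The sites \<open>h j i\<close> and unit vectors \<open>v j i\<close>, for \<open>i < 4\<close>, are the choices made for the pair \<open>(j, Suc j mod d)\<close>.
  A slice of a marginal depends on \<open>v\<close> only up to a phase, so different choices at the same site
  must be non-proportional. If \<open>d = 3\<close>, there is only one possible site, and the slice is
  proportional to a fixed linear function of \<open>v\<close>; if the four vectors spanned only a plane, the two
  matrices whose eigenvectors are computed would commute and the algorithm would fail for every
  state.
\<close>

definition different_choices ::
  "nat \<Rightarrow> (nat \<Rightarrow> nat) \<Rightarrow> (nat \<Rightarrow> nat \<Rightarrow> nat) \<Rightarrow> (nat \<Rightarrow> nat \<Rightarrow> complex vec) \<Rightarrow> bool" where
  "different_choices d n h v \<longleftrightarrow> (\<forall>j<d.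
     (\<forall>i<4. h j i \<in> {..<d} - {j, Suc j mod d} \<and> v j i \<in> carrier_vec (n (h j i)) \<and>
        (\<Sum>a<n (h j i). (cmod (v j i $ a))\<^sup>2) = 1) \<and>
     (\<forall>i<4. \<forall>i'<4. i \<noteq> i' \<and> h j i = h j i' \<longrightarrow> (\<forall>c. v j i \<noteq> c \<cdot>\<^sub>v v j i')) \<and>
     (d = 3 \<longrightarrow> \<not> (\<exists>x\<in>carrier_vec (n (h j 0)). \<exists>y\<in>carrier_vec (n (h j 0)).
        \<forall>i<4. \<exists>a b. v j i = a \<cdot>\<^sub>v x + b \<cdot>\<^sub>v y)))"

section \<open>Gauge equivalence and random cores\<close>

definition gauge_equivalent ::
  "nat \<Rightarrow> nat \<Rightarrow> (nat \<Rightarrow> nat)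
     \<Rightarrow> (nat \<Rightarrow> nat \<Rightarrow> complex mat) \<Rightarrow> (nat \<Rightarrow> nat \<Rightarrow> complex mat) \<Rightarrow> bool" where
  "gauge_equivalent d r n P Q \<longleftrightarrow> (\<exists>c L. cmod c = 1 \<and>
     (\<forall>k<d. L k \<in> carrier_mat r r \<and> invertible_mat (L k)) \<and>
     (\<forall>a<n 0. P 0 a = c \<cdot>\<^sub>m (minv (L 0) * Q 0 a * L (1 mod d))) \<and>
     (\<forall>k\<in>{1..<d}. \<forall>a<n k. P k a = minv (L k) * Q k a * L (Suc k mod d)))"

definition core_measure ::
  "nat \<Rightarrow> nat \<Rightarrow> (nat \<Rightarrow> nat) \<Rightarrow> (nat \<times> nat \<times> nat \<times> nat \<Rightarrow> complex) measure" where
  "core_measure d r n =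
     (\<Pi>\<^sub>M x\<in>(SIGMA k:{..<d}. {..<n k} \<times> {..<r} \<times> {..<r}). (lborel :: complex measure))"

definition cores_of ::
  "nat \<Rightarrow> (nat \<times> nat \<times> nat \<times> nat \<Rightarrow> complex) \<Rightarrow> nat \<Rightarrow> nat \<Rightarrow> complex mat" where
  "cores_of r \<omega> k a = Matrix.mat r r (\<lambda>(i, j). \<omega> (k, a, i, j))"

end

theory Submission
  imports Defs
begin

text \<open>
  By cyclicity of the trace, \<open>M\<^sub>i = U (1 \<otimes> W\<^sub>i) V\<^sup>T\<close>, where \<open>U\<close> and \<open>V\<close> are unfoldings of the
  cores of the two neighbouring sites and \<open>W\<^sub>i\<close> is the \<open>r \<times> r\<close> contraction of all other sites. If \<open>U\<close> and
  \<open>V\<close> have full column rank and \<open>W\<^sub>0 W\<^sub>1\<^sup>-\<^sup>1 = X D X\<^sup>-\<^sup>1\<close> and \<open>W\<^sub>2 W\<^sub>3\<^sup>-\<^sup>1 = X' D' X'\<^sup>-\<^sup>1\<close> have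
  simple spectra, then \<open>E = U (1 \<otimes> X) K\<close> and \<open>E' = U (1 \<otimes> X') K'\<close>, where \<open>K\<close> and \<open>K'\<close> only mix
  columns of the same eigenvalue, and \<open>F\<close> has the blocks \<open>K\<^sub>a\<^sup>-\<^sup>1 (X\<^sup>-\<^sup>1 X')\<^sub>a\<^sub>b K'\<^sub>b\<close>. If no entry
  of \<open>X\<^sup>-\<^sup>1 X'\<close> vanishes, they determine \<open>K\<close> up to a common gauge matrix and scalars.

  These conditions follow from the nonvanishing of finitely many polynomials in the entries of the
  cores and their conjugates, and the zero set of such a polynomial is null unless it is everything.
  So it suffices to find, for each polynomial separately, one family of cores at which it does not
  vanish. For the condition on the \<open>W\<^sub>i\<close> these are perturbations of families of scalar matrices, for
  which \<open>W\<^sub>0 W\<^sub>1\<^sup>-\<^sup>1\<close> and \<open>W\<^sub>2 W\<^sub>3\<^sup>-\<^sup>1\<close> are, up to scalars and to first order, a diagonal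
  matrix and a cyclic shift.
\<close>

section \<open>Zero sets of real polynomial functions\<close>

text \<open>Eigenvectors are not polynomial in the cores, so generic position has to be certified by
  quantities that are: a Hankel determinant of traces of powers for simple spectrum, and a
  determinant built from products of powers for the overlaps of left and right eigenvectors. Every
  site of the chain enters an environment together with its conjugate. Scalar base families make
  each site act as a number, so the first order term of an environment is a sum over sites that can
  be prescribed. If all four slices share a site and their vectors lie in a plane, the two first
  order differences obtained in this way are proportional. For d = 3 this is a genuine obstruction;
  for d \<ge> 4 a second free site makes the first order term only real linear in the coefficient of
  the slice, which restores independence. The bases of the eigenspaces are arbitrary, and an unlucky
  choice makes a scalar factor of step B vanish. Hence recovery is proved for all choices whose
  output state is nonzero, and one such choice is exhibited.\<close>

text \<open>
  A function of finitely many complex variables that is polynomial in the variables and their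
  conjugates is, along every real line, a polynomial in the real parameter of the line.
\<close>

definition line_poly :: "'i set \<Rightarrow> (('i \<Rightarrow> complex) \<Rightarrow> complex) \<Rightarrow> bool" where
  "line_poly I f \<longleftrightarrow> f \<in> borel_measurable (\<Pi>\<^sub>M i\<in>I. (lborel :: complex measure)) \<and>
     (\<forall>x y. (\<forall>i\<in>I. x i = y i) \<longrightarrow> f x = f y) \<and>
     (\<forall>x y. \<exists>p. \<forall>t::real. f (\<lambda>i. x i + of_real t * y i) = poly p (of_real t))"

lemma line_poly_const [simp, intro]: "line_poly I (\<lambda>_. c)"
  unfolding line_poly_def by (auto intro!: exI[of _ "[:c:]"])

lemma line_poly_coord: "i \<in> I \<Longrightarrow> line_poly I (\<lambda>w. w i)"
  unfolding line_poly_def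
proof (intro conjI allI impI, goal_cases)
  case (3 x y)
  show ?case by (rule exI[of _ "[:x i, y i:]"]) auto
qed auto

lemma line_poly_add:
  assumes "line_poly I f" and "line_poly I g"
  shows "line_poly I (\<lambda>w. f w + g w)"
  unfolding line_poly_def
proof (intro conjI allI impI, goal_cases)
  case (2 x y)
  then show ?case using assms unfolding line_poly_def by metis
next
  case (3 x y)
  obtain p q where "\<forall>t::real. f (\<lambda>i. x i + of_real t * y i) = poly p (of_real t)"
    "\<forall>t::real. g (\<lambda>i. x i + of_real t * y i) = poly q (of_real t)"
    using assms unfolding line_poly_def by metis
  then show ?case by (intro exI[of _ "p + q"]) auto
qed (use assms in \<open>auto simp: line_poly_def\<close>)

lemma line_poly_mult:
  assumes "line_poly I f" and "line_poly I g"
  shows "line_poly I (\<lambda>w. f w * g w)"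
  unfolding line_poly_def
proof (intro conjI allI impI, goal_cases)
  case (2 x y)
  then show ?case using assms unfolding line_poly_def by metis
next
  case (3 x y)
  obtain p q where "\<forall>t::real. f (\<lambda>i. x i + of_real t * y i) = poly p (of_real t)"
    "\<forall>t::real. g (\<lambda>i. x i + of_real t * y i) = poly q (of_real t)"
    using assms unfolding line_poly_def by metis
  then show ?case by (intro exI[of _ "p * q"]) auto
qed (use assms in \<open>auto simp: line_poly_def\<close>)

text \<open>Lines carry a real parameter, so conjugating the coefficients of a polynomial conjugates
  its values. This admits the conjugated cores in the environments.\<close>

lemma line_poly_cnj:
  assumes "line_poly I f"
  shows "line_poly I (\<lambda>w. cnj (f w))"
  unfolding line_poly_def
proof (intro conjI allI impI, goal_cases)
  case 1
  have "continuous_on UNIV cnj" by (intro continuous_intros)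
  then have "cnj \<in> borel_measurable borel" by (rule borel_measurable_continuous_onI)
  then show ?case using assms measurable_compose unfolding line_poly_def by blast
next
  case (2 x y)
  then show ?case using assms unfolding line_poly_def by metis
next
  case (3 x y)
  obtain p where p: "\<forall>t::real. f (\<lambda>i. x i + of_real t * y i) = poly p (of_real t)"
    using assms unfolding line_poly_def by metis
  have "cnj (poly p (of_real t)) = poly (map_poly cnj p) (of_real t)" for t
    by (induction p) (auto simp: map_poly_pCons)
  then show ?case using p by (intro exI[of _ "map_poly cnj p"]) auto
qed

lemma line_poly_sum:
  "(\<And>a. a \<in> A \<Longrightarrow> line_poly I (f a)) \<Longrightarrow> line_poly I (\<lambda>w. \<Sum>a\<in>A. f a w)"
  by (induction A rule: infinite_finite_induct) (auto intro: line_poly_add)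

text \<open>On each line through \<open>w\<close> there are finitely many zeros, so for every
  direction \<open>z\<close> almost every \<open>t\<close> is good. Exchanging the quantifiers by
  Fubini gives one nonzero \<open>t\<close> that is good for almost every \<open>z\<close>, and the
  affine map from \<open>z\<close> to \<open>w + of_real t * z\<close> preserves null sets.\<close>

lemma AE_nonzero_of_poly_on_lines:
  fixes g :: "complex \<Rightarrow> complex"
  assumes [measurable]: "g \<in> borel_measurable borel"
    and line: "\<And>x y. \<exists>p. \<forall>t::real. g (x + of_real t * y) = poly p (of_real t)"
    and w: "g w \<noteq> 0"
  shows "AE z in lborel. g z \<noteq> 0"
proof -
  have "AE t in lborel. g (w + of_real t * z) \<noteq> 0" for z
  proof -
    obtain p where p: "\<And>t::real. g (w + of_real t * z) = poly p (of_real t)"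
      using line[of w z] by auto
    have "p \<noteq> 0" using p[of 0] w by auto
    then have "finite (of_real -` {x. poly p x = 0} :: real set)"
      by (intro finite_vimageI poly_roots_finite) (auto simp: inj_def)
    then have "{t::real. g (w + of_real t * z) = 0} \<in> null_sets lborel"
      unfolding p vimage_def by (intro finite_imp_null_set_lborel) auto
    then show ?thesis by (rule AE_I') auto
  qed
  then have "AE z in lborel. AE t in lborel. g (w + complex_of_real t * z) \<noteq> 0" by simp
  moreover have "{x \<in> space (lborel \<Otimes>\<^sub>M lborel). g (w + complex_of_real (fst x) * snd x) \<noteq> 0}
      \<in> sets (lborel \<Otimes>\<^sub>M lborel)"
    by measurable
  ultimately have "AE t in lborel. AE z in lborel. g (w + complex_of_real t * z) \<noteq> 0"
    by (subst lborel_pair.AE_commute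
        [of "\<lambda>t z. g (w + complex_of_real t * z) \<noteq> 0"]) auto
  moreover have "AE t in lborel. t \<noteq> (0::real)"
    by (rule AE_I'[of "{0}"]) auto
  ultimately have "AE t in lborel. t \<noteq> 0 \<and> (AE z in lborel. g (w + complex_of_real t * z) \<noteq> 0)"
    by auto
  then have "\<exists>t. t \<noteq> 0 \<and> (AE z in lborel. g (w + complex_of_real t * z) \<noteq> 0)"
    by (rule eventually_happens'[rotated]) (simp add: ae_filter_eq_bot_iff)
  then obtain t where t: "t \<noteq> 0" and ae: "AE z in lborel. g (w + complex_of_real t * z) \<noteq> 0"
    by blast
  show ?thesis
    by (subst lborel_affine[OF t, of w])
      (use ae in \<open>simp add: AE_density AE_distr_iff scaleR_conv_of_real\<close>)
qed

text \<open>Fubini, one coordinate at a time. Freezing coordinate \<open>i\<close> at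
  \<open>w i\<close> gives a function that is nonzero for almost all remaining coordinates; over
  each such point the function of coordinate \<open>i\<close> alone is nonzero at
  \<open>w i\<close>, so the one-variable lemma applies.\<close>

lemma line_poly_AE_nonzero:
  assumes "finite I" and "line_poly I f" and "f w \<noteq> 0"
  shows "AE x in (\<Pi>\<^sub>M i\<in>I. (lborel :: complex measure)). f x \<noteq> 0"
  using assms
proof (induction I arbitrary: f rule: finite_induct)
  case empty
  have "f x = f w" for x
    using empty.prems(1) by (metis empty_iff line_poly_def)
  then have "f x \<noteq> 0" for x using empty.prems(2) by metis
  then show ?case by simp
next
  case (insert i I)
  interpret product_sigma_finite "\<lambda>_. lborel :: complex measure" ..
  have meas [measurable]:
    "f \<in> borel_measurable (\<Pi>\<^sub>M i\<in>insert i I. (lborel :: complex measure))"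
    and ext: "\<And>x y. (\<And>k. k \<in> insert i I \<Longrightarrow> x k = y k) \<Longrightarrow> f x = f y"
    and lines: "\<And>x y. \<exists>p. \<forall>t::real. f (\<lambda>i. x i + of_real t * y i) = poly p (of_real t)"
    using insert.prems(1) unfolding line_poly_def by blast+
  have "line_poly I (\<lambda>x. f (x(i := w i)))"
    unfolding line_poly_def
  proof (intro conjI allI impI, goal_cases)
    case 1
    show ?case using insert.hyps by measurable
  next
    case (2 x y)
    then show ?case by (intro ext) auto
  next
    case (3 x y)
    have "(\<lambda>k. x k + of_real t * y k)(i := w i)
        = (\<lambda>k. (x(i := w i)) k + of_real t * (y(i := 0)) k)" for t :: real
      by auto
    then show ?case using lines[of "x(i := w i)" "y(i := 0)"] by simp
  qed
  moreover have "f (w(i := w i)) \<noteq> 0" using insert.prems by simp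
  ultimately have IH: "AE x in (\<Pi>\<^sub>M i\<in>I. lborel). f (x(i := w i)) \<noteq> 0"
    using insert.IH by blast
  have "AE y in lborel. f (x(i := y)) \<noteq> 0"
    if "f (x(i := w i)) \<noteq> 0" and "x \<in> space (\<Pi>\<^sub>M i\<in>I. (lborel :: complex measure))" for x
  proof (rule AE_nonzero_of_poly_on_lines[where w = "w i"])
    show "(\<lambda>y. f (x(i := y))) \<in> borel_measurable borel"
      using that(2) insert.hyps by measurable
    show "\<exists>p. \<forall>t::real. f (x(i := a + of_real t * b)) = poly p (of_real t)" for a b
    proof -
      have "x(i := a + of_real t * b) = (\<lambda>k. (x(i := a)) k + of_real t * ((\<lambda>_. 0)(i := b)) k)"
        for t :: real by auto
      then show ?thesis using lines[of "x(i := a)" "(\<lambda>_. 0)(i := b)"] by simp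
    qed
  qed (use that in auto)
  note fibre = this
  have inner: "AE x in (\<Pi>\<^sub>M i\<in>I. lborel).
      (\<integral>\<^sup>+ y. indicator {x \<in> space (\<Pi>\<^sub>M i\<in>insert i I. (lborel :: complex measure)). f x = 0}
        (x(i := y)) \<partial>lborel) = 0"
    using IH AE_space
  proof eventually_elim
    case (elim x)
    then have "AE y in lborel. f (x(i := y)) \<noteq> 0" using fibre by blast
    then have "(\<integral>\<^sup>+ y. indicator {x \<in> space (\<Pi>\<^sub>M i\<in>insert i I. (lborel :: complex measure)). f x = 0}
        (x(i := y)) \<partial>lborel) = (\<integral>\<^sup>+ y. 0 \<partial>(lborel :: complex measure))"
      by (intro nn_integral_cong_AE) (auto elim!: eventually_mono simp: indicator_def)
    then show ?case by simp
  qed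
  have "emeasure (\<Pi>\<^sub>M i\<in>insert i I. (lborel :: complex measure))
      {x \<in> space (\<Pi>\<^sub>M i\<in>insert i I. (lborel :: complex measure)). f x = 0} = 0"
    by (subst nn_integral_indicator[symmetric], measurable,
        subst product_nn_integral_insert[OF insert.hyps])
      (use inner in \<open>auto simp: nn_integral_0_iff_AE cong: nn_integral_cong_AE\<close>)
  then show ?case
    by (intro AE_I'[of "{x \<in> space (\<Pi>\<^sub>M i\<in>insert i I. (lborel :: complex measure)). f x = 0}"])
      (auto intro!: null_setsI)
qed

section \<open>Diagonalization certificates\<close>

declare index_mult_mat(1)[simp del]

lemma mult_entry:
  assumes "A \<in> carrier_mat m k" and "B \<in> carrier_mat k l" and "i < m" and "j < l"
  shows "(A * B) $$ (i, j) = (\<Sum>x<k. A $$ (i, x) * B $$ (x, j))"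
  using assms by (simp add: index_mult_mat(1) scalar_prod_def atLeast0LessThan)

lemma mult_vec_entry:
  assumes "A \<in> carrier_mat m k" and "v \<in> carrier_vec k" and "i < m"
  shows "(A *\<^sub>v v) $ i = (\<Sum>x<k. A $$ (i, x) * v $ x)"
  using assms by (simp add: scalar_prod_def atLeast0LessThan)

lemma pair_index_less: "a < r \<Longrightarrow> b < r \<Longrightarrow> a * r + b < r * (r::nat)"
  using mult_le_mono1[of "Suc a" r r] by simp

lemma square_mult_carrier [simp]:
  "A \<in> carrier_mat n n \<Longrightarrow> B \<in> carrier_mat n n \<Longrightarrow> A * B \<in> carrier_mat n n"
  by simp

lemma sum_lessThan_square:
  fixes f :: "nat \<Rightarrow> nat \<Rightarrow> 'a::comm_monoid_add"
  shows "(\<Sum>t<r * r. f (t div r) (t mod r)) = (\<Sum>a<r. \<Sum>b<r. f a b)"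
proof -
  have "(\<Sum>t<r * r. f (t div r) (t mod r)) = (\<Sum>(a, b)\<in>{..<r} \<times> {..<r}. f a b)"
    by (rule sum.reindex_bij_witness[where i = "\<lambda>(a, b). a * r + b" and j = "\<lambda>t. (t div r, t mod r)"])
      (auto simp: less_mult_imp_div_less pair_index_less intro!: mod_less_divisor intro: gr0I)
  then show ?thesis by (simp add: sum.cartesian_product)
qed

lemma square_index_div_mod: "t < r * r \<Longrightarrow> t div r < r \<and> t mod r < (r::nat)"
  by (cases "r = 0") (auto simp: less_mult_imp_div_less)

lemma det_nonzeroI:
  fixes A :: "complex mat"
  assumes "A \<in> carrier_mat n n"
    and "\<And>y. (\<And>i. i < n \<Longrightarrow> (\<Sum>j<n. A $$ (i, j) * y j) = 0) \<Longrightarrow> \<forall>j<n. y j = 0"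
  shows "det A \<noteq> 0"
proof
  assume "det A = 0"
  then obtain v where v: "v \<in> carrier_vec n" "v \<noteq> 0\<^sub>v n" "A *\<^sub>v v = 0\<^sub>v n"
    using det_0_iff_vec_prod_zero[OF assms(1)] by blast
  have "(\<Sum>j<n. A $$ (i, j) * v $ j) = 0" if "i < n" for i
    using mult_vec_entry[OF assms(1) v(1) that] v(3) that by simp
  then have "\<forall>j<n. v $ j = 0" using assms(2) by blast
  then have "v = 0\<^sub>v n" using v(1) by (intro eq_vecI) auto
  then show False using v(2) by simp
qed

lemma det_nonzeroD:
  fixes A :: "complex mat"
  assumes "A \<in> carrier_mat n n" and "det A \<noteq> 0"
    and "\<And>i. i < n \<Longrightarrow> (\<Sum>j<n. A $$ (i, j) * y j) = 0" and "j < n"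
  shows "y j = 0"
proof -
  have "A *\<^sub>v vec n y = 0\<^sub>v n"
    using assms(1,3) by (intro eq_vecI) (auto simp: mult_vec_entry[OF assms(1)] simp del: index_mult_mat_vec)
  moreover have "vec n y \<in> carrier_vec n" by simp
  ultimately have "vec n y = 0\<^sub>v n"
    using det_0_iff_vec_prod_zero[OF assms(1)] assms(2) by blast
  then show ?thesis using assms(4) by (metis index_vec index_zero_vec(1))
qed

lemma minv:
  assumes A: "A \<in> carrier_mat n n" and "det A \<noteq> 0"
  shows "minv A \<in> carrier_mat n n" and "A * minv A = 1\<^sub>m n" and "minv A * A = 1\<^sub>m n"
proof -
  have "A \<in> Units (ring_mat TYPE(complex) n ())"
    by (rule det_non_zero_imp_unit[OF assms])
  then obtain B where "mat_inverse A = Some B"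
    using mat_inverse(1)[OF A, of "()"] by (cases "mat_inverse A") auto
  then show "minv A \<in> carrier_mat n n" "A * minv A = 1\<^sub>m n" "minv A * A = 1\<^sub>m n"
    using mat_inverse(2)[OF A] by (auto simp: minv_def)
qed

lemma det_nonzero_of_inverse:
  fixes A :: "complex mat"
  assumes "A \<in> carrier_mat n n" "B \<in> carrier_mat n n" "A * B = 1\<^sub>m n"
  shows "det A \<noteq> 0"
  using det_mult[OF assms(1,2)] assms(3) by auto

lemma minv_eqI:
  assumes A: "A \<in> carrier_mat n n" and B: "B \<in> carrier_mat n n" and "A * B = 1\<^sub>m n"
  shows "minv A = B"
proof -
  note m = minv[OF A det_nonzero_of_inverse[OF assms]]
  have "minv A = minv A * (A * B)" using assms m by simp
  also have "\<dots> = B" using m A B by (simp add: assoc_mult_mat[symmetric, of _ n n _ n _ n])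
  finally show ?thesis .
qed

section \<open>Diagonal matrices and explicit diagonalizations\<close>

definition dmat :: "nat \<Rightarrow> (nat \<Rightarrow> complex) \<Rightarrow> complex mat" where
  "dmat r e = Matrix.mat r r (\<lambda>(i, j). if i = j then e i else 0)"

lemma dmat_carrier [simp]: "dmat r e \<in> carrier_mat r r" by (simp add: dmat_def)
lemma dmat_dim [simp]: "dim_row (dmat r e) = r" "dim_col (dmat r e) = r" by (simp_all add: dmat_def)
lemma dmat_index: "i < r \<Longrightarrow> j < r \<Longrightarrow> dmat r e $$ (i, j) = (if i = j then e i else 0)"
  by (simp add: dmat_def)

lemma mult_dmat_entry:
  assumes "A \<in> carrier_mat m r" "i < m" "j < r"
  shows "(A * dmat r e) $$ (i, j) = A $$ (i, j) * e j"
  using assms by (simp add: mult_entry[OF assms(1) dmat_carrier] dmat_index if_distrib[of "\<lambda>x. A $$ _ * x"] cong: if_cong)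

lemma dmat_mult_entry:
  assumes "A \<in> carrier_mat r m" "i < r" "j < m"
  shows "(dmat r e * A) $$ (i, j) = e i * A $$ (i, j)"
  using assms by (simp add: mult_entry[OF dmat_carrier assms(1)] dmat_index if_distrib[of "\<lambda>x. x * A $$ _"] cong: if_cong)

lemma dmat_mult: "dmat r e * dmat r f = dmat r (\<lambda>i. e i * f i)"
proof (rule eq_matI)
  fix i j assume ij: "i < dim_row (dmat r (\<lambda>i. e i * f i))" "j < dim_col (dmat r (\<lambda>i. e i * f i))"
  then have "(dmat r e * dmat r f) $$ (i, j) = dmat r e $$ (i, j) * f j"
    by (intro mult_dmat_entry[of _ r]) auto
  then show "(dmat r e * dmat r f) $$ (i, j) = dmat r (\<lambda>i. e i * f i) $$ (i, j)"
    using ij by (simp add: dmat_index)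
qed auto

lemma dmat_pow: "dmat r e ^\<^sub>m k = dmat r (\<lambda>i. e i ^ k)"
  by (induction k) (auto simp: dmat_mult mult.commute, auto simp: dmat_def)

text \<open>The inverse \<open>Y\<close> of \<open>X\<close> is carried along because its rows are
  the left eigenvectors, whose overlaps with the eigenvectors of a second matrix matter
  later.\<close>

definition diag_by :: "nat \<Rightarrow> complex mat \<Rightarrow> complex mat \<Rightarrow> complex mat \<Rightarrow> (nat \<Rightarrow> complex) \<Rightarrow> bool" where
  "diag_by r A X Y e \<longleftrightarrow> X \<in> carrier_mat r r \<and> Y \<in> carrier_mat r r \<and> X * Y = 1\<^sub>m r \<and> Y * X = 1\<^sub>m r \<and>
     A = X * dmat r e * Y"

lemma similar_mat_wit_of_diag_by:
  assumes "diag_by r A X Y e"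
  shows "similar_mat_wit A (dmat r e) X Y"
  using assms unfolding diag_by_def similar_mat_wit_def Let_def by auto

lemma mat_trace_mult_commute:
  assumes "A \<in> carrier_mat m k" and "B \<in> carrier_mat k m"
  shows "mat_trace (A * B) = mat_trace (B * A)"
proof -
  have "mat_trace (A * B) = (\<Sum>i<m. \<Sum>x<k. A $$ (i, x) * B $$ (x, i))"
    using assms by (auto simp: mat_trace_def mult_entry[OF assms])
  also have "\<dots> = (\<Sum>x<k. \<Sum>i<m. B $$ (x, i) * A $$ (i, x))"
    by (subst sum.swap) (simp add: mult.commute)
  also have "\<dots> = mat_trace (B * A)"
    using assms by (auto simp: mat_trace_def mult_entry[OF assms(2,1)])
  finally show ?thesis .
qed

lemma mat_trace_similar:
  assumes "similar_mat_wit A B P Q" and "A \<in> carrier_mat n n"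
  shows "mat_trace A = mat_trace B"
proof -
  note s = similar_mat_witD2[OF assms(2,1)]
  have "mat_trace A = mat_trace (Q * (P * B))"
    unfolding s(3) by (rule mat_trace_mult_commute[of _ n n]) (use s(4-7) in auto)
  also have "Q * (P * B) = B"
    using s(2,5-7) by (simp add: assoc_mult_mat[symmetric, of _ n n _ n _ n])
  finally show ?thesis .
qed

section \<open>Simple spectrum certified by traces of powers\<close>

lemma upper_triangular_pow:
  assumes B: "B \<in> carrier_mat r r" and ut: "upper_triangular B"
  shows "i < r \<Longrightarrow> j \<le> i \<Longrightarrow> (B ^\<^sub>m k) $$ (i, j) = (if i = j then (B $$ (i, i) :: complex) ^ k else 0)"
proof (induction k arbitrary: i j)
  case (Suc k)
  have "(B ^\<^sub>m k * B) $$ (i, j) = (\<Sum>x<r. (B ^\<^sub>m k) $$ (i, x) * B $$ (x, j))"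
    using Suc.prems B by (intro mult_entry[of _ r]) auto
  also have "\<dots> = (\<Sum>x<r. if x = i then (if i = j then B $$ (i, i) ^ k * B $$ (i, i) else 0) else 0)"
  proof (rule sum.cong[OF refl])
    fix x assume "x \<in> {..<r}"
    then show "(B ^\<^sub>m k) $$ (i, x) * B $$ (x, j)
        = (if x = i then (if i = j then B $$ (i, i) ^ k * B $$ (i, i) else 0) else 0)"
      using Suc.IH[of i x] Suc.prems upper_triangularD[OF ut, of j x] B
      by (cases "x < i"; cases "x = i") auto
  qed
  finally show ?case using Suc.prems by (simp add: mult.commute)
qed (use B in auto)

text \<open>Testing the moments against the polynomial that vanishes at all nodes except
  \<open>e q\<close>, whose degree is below \<open>r\<close>, isolates \<open>y q\<close>.\<close>

lemma vandermonde_kernel: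
  fixes e y :: "nat \<Rightarrow> complex"
  assumes inj: "inj_on e {..<r}" and zero: "\<And>k. k < r \<Longrightarrow> (\<Sum>q<r. y q * e q ^ k) = 0" and q: "q < r"
  shows "y q = 0"
proof -
  define p where "p = (\<Prod>j\<in>{..<r} - {q}. [:- e j, 1:])"
  have deg: "degree p < r"
  proof -
    have "degree p \<le> (\<Sum>j\<in>{..<r} - {q}. 1)"
      unfolding p_def by (rule order_trans[OF degree_prod_sum_le]) (auto intro!: sum_mono)
    then show ?thesis using q by simp
  qed
  have "(\<Sum>j<r. y j * poly p (e j)) = (\<Sum>k\<le>degree p. coeff p k * (\<Sum>j<r. y j * e j ^ k))"
    unfolding poly_altdef sum_distrib_left by (subst sum.swap) (simp add: mult_ac)
  also have "\<dots> = 0" using zero deg by (intro sum.neutral) auto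
  finally have "(\<Sum>j<r. y j * poly p (e j)) = 0" .
  moreover have "(\<Sum>j<r. y j * poly p (e j)) = (\<Sum>j<r. if j = q then y q * poly p (e q) else 0)"
    by (intro sum.cong) (auto simp: p_def poly_prod)
  moreover have "poly p (e q) \<noteq> 0"
    using inj q by (auto simp: p_def poly_prod dest: inj_onD)
  ultimately show ?thesis using q by simp
qed

text \<open>
  The Hankel matrix of the power sums of the eigenvalues is a Vandermonde matrix times its transpose.
\<close>

definition hankel :: "nat \<Rightarrow> complex mat \<Rightarrow> complex" where
  "hankel r A = det (Matrix.mat r r (\<lambda>(i, j). mat_trace (A ^\<^sub>m (i + j))))"

text \<open>The determinant is the discriminant of the list \<open>b\<close> of eigenvalues, yet it
  is polynomial in the entries of \<open>A\<close>.\<close>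

lemma hankel_nonzero_iff:
  assumes "\<And>k. mat_trace (A ^\<^sub>m k) = (\<Sum>i<r. b i ^ k)"
  shows "hankel r A \<noteq> 0 \<longleftrightarrow> inj_on b {..<r}"
proof -
  define V where "V = Matrix.mat r r (\<lambda>(k, i). b i ^ k)"
  have V: "V \<in> carrier_mat r r" by (simp add: V_def)
  have "Matrix.mat r r (\<lambda>(i, j). mat_trace (A ^\<^sub>m (i + j))) = V * V\<^sup>T"
    using V by (intro eq_matI) (auto simp: assms mult_entry[of _ r r _ r] V_def power_add)
  then have "hankel r A = det V * det V"
    using det_mult[OF V, of "V\<^sup>T"] det_transpose[OF V] V by (simp add: hankel_def)
  moreover have "det V \<noteq> 0" if inj: "inj_on b {..<r}"
  proof (rule det_nonzeroI[OF V], intro allI impI)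
    fix y q assume "\<And>i. i < r \<Longrightarrow> (\<Sum>j<r. V $$ (i, j) * y j) = 0" and q: "q < r"
    then have "\<And>i. i < r \<Longrightarrow> (\<Sum>j<r. y j * b j ^ i) = 0" by (simp add: V_def mult.commute)
    then show "y q = 0" using vandermonde_kernel[OF inj] q by blast
  qed
  moreover have "det V = 0" if ninj: "\<not> inj_on b {..<r}"
  proof -
    obtain i j where "i < r" "j < r" "i \<noteq> j" "b i = b j"
      using ninj unfolding inj_on_def by blast
    moreover from this have "col V i = col V j" by (intro eq_vecI) (auto simp: V_def)
    ultimately show ?thesis using det_identical_columns[OF V] by blast
  qed
  ultimately show ?thesis by auto
qed

text \<open>A Schur form supplies the eigenvalues with multiplicity as its diagonal
  \<open>b\<close>; the Hankel determinant makes them distinct. One eigenvector for each is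
  collected in \<open>X\<close>, and these are independent by a Vandermonde argument.\<close>

lemma hankel_diagonalizable:
  assumes A: "A \<in> carrier_mat r r" and h: "hankel r A \<noteq> 0"
  obtains X Y e where "diag_by r A X Y e" "inj_on e {..<r}"
proof -
  obtain as where as: "char_poly A = (\<Prod>a\<leftarrow>as. [:- a, 1:])" using char_poly_factorized[OF A] by blast
  then obtain B where B: "B \<in> carrier_mat r r" and ut: "upper_triangular B" and sim: "similar_mat A B"
    using schur_decomposition_exists[OF A] by blast
  obtain P Q where w: "similar_mat_wit A B P Q" using sim unfolding similar_mat_def by blast
  define b where "b i = B $$ (i, i)" for i
  have "mat_trace (A ^\<^sub>m k) = (\<Sum>i<r. b i ^ k)" for k
    using mat_trace_similar[OF similar_mat_wit_pow[OF w] pow_carrier_mat[OF A], of k] B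
      upper_triangular_pow[OF B ut] by (simp add: mat_trace_def b_def)
  then have inj: "inj_on b {..<r}" using hankel_nonzero_iff h by blast
  have "char_poly A = (\<Prod>a\<leftarrow>diag_mat B. [:- a, 1:])"
    using char_poly_similar[OF sim] char_poly_upper_triangular[OF B ut] by simp
  then have "eigenvalue A (b q)" if "q < r" for q
    using that B by (auto simp: eigenvalue_root_char_poly[OF A] poly_prod_list diag_mat_def b_def
        prod_list_zero_iff image_iff)
  then have "\<exists>x. eigenvector A x (b q)" if "q < r" for q
    using that unfolding eigenvalue_def by blast
  then obtain x where x: "\<And>q. q < r \<Longrightarrow> eigenvector A (x q) (b q)" by metis
  define X where "X = Matrix.mat r r (\<lambda>(i, q). x q $ i)"
  have X: "X \<in> carrier_mat r r" by (simp add: X_def)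
  have xc: "x q \<in> carrier_vec r" "x q \<noteq> 0\<^sub>v r" "A *\<^sub>v x q = b q \<cdot>\<^sub>v x q" if "q < r" for q
    using x[OF that] A by (auto simp: eigenvector_def)
  have AX: "A * X = X * dmat r b"
  proof (rule eq_matI)
    fix i q assume "i < dim_row (X * dmat r b)" "q < dim_col (X * dmat r b)"
    then have iq: "i < r" "q < r" using X by auto
    have "(A * X) $$ (i, q) = (A *\<^sub>v x q) $ i"
      using iq by (simp add: mult_entry[OF A X] mult_vec_entry[OF A xc(1)] del: index_mult_mat_vec)
        (simp add: X_def)
    also have "\<dots> = (X * dmat r b) $$ (i, q)"
      using iq xc(1)[OF iq(2)] xc(3)[OF iq(2)] by (simp add: mult_dmat_entry[OF X] del: index_mult_mat_vec)
        (simp add: X_def mult.commute)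
    finally show "(A * X) $$ (i, q) = (X * dmat r b) $$ (i, q)" .
  qed (use A X in auto)
  have AkX: "A ^\<^sub>m k * X = X * dmat r (\<lambda>i. b i ^ k)" for k
  proof (induction k)
    case 0
    have "dmat r (\<lambda>i. 1) = 1\<^sub>m r" by (auto simp: dmat_def)
    then show ?case using A X by simp
  next
    case (Suc k)
    have "A ^\<^sub>m Suc k * X = A ^\<^sub>m k * (A * X)" using A X by (simp add: assoc_mult_mat[of _ r r _ r _ r])
    also have "\<dots> = A ^\<^sub>m k * X * dmat r b"
      unfolding AX using A X by (simp add: assoc_mult_mat[of _ r r _ r _ r])
    also have "\<dots> = X * dmat r (\<lambda>i. b i ^ Suc k)"
      unfolding Suc using A X by (simp add: assoc_mult_mat[of _ r r _ r _ r] dmat_mult mult.commute)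
    finally show ?case .
  qed
  have "det X \<noteq> 0"
  proof (rule det_nonzeroI[OF X], intro allI impI)
    fix c q assume c: "\<And>i. i < r \<Longrightarrow> (\<Sum>j<r. X $$ (i, j) * c j) = 0" and q: "q < r"
    \<comment> \<open>Row \<open>i\<close> of \<open>A ^\<^sub>m k * X\<close> applied to
      \<open>c\<close> is the moment of order \<open>k\<close> of the weights
      \<open>X $$ (i, j) * c j\<close> at the nodes \<open>b j\<close>. All moments vanish, hence so
      do the weights.\<close>
    have "X $$ (i, q) * c q = 0" if i: "i < r" for i
    proof (rule vandermonde_kernel[OF inj _ q])
      fix k assume "k < r"
      have "(\<Sum>j<r. X $$ (i, j) * c j * b j ^ k) = (\<Sum>j<r. (A ^\<^sub>m k * X) $$ (i, j) * c j)"
        unfolding AkX using i X by (intro sum.cong) (auto simp: mult_dmat_entry mult_ac)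
      also have "\<dots> = (\<Sum>j<r. \<Sum>l<r. (A ^\<^sub>m k) $$ (i, l) * X $$ (l, j) * c j)"
        using i A X by (simp add: mult_entry[of _ r r] sum_distrib_right)
      also have "\<dots> = (\<Sum>l<r. (A ^\<^sub>m k) $$ (i, l) * (\<Sum>j<r. X $$ (l, j) * c j))"
        by (subst sum.swap) (simp add: sum_distrib_left mult_ac)
      also have "\<dots> = 0" using c by simp
      finally show "(\<Sum>j<r. X $$ (i, j) * c j * b j ^ k) = 0" .
    qed
    moreover have "\<exists>i<r. X $$ (i, q) \<noteq> 0"
    proof (rule ccontr)
      assume "\<not> (\<exists>i<r. X $$ (i, q) \<noteq> 0)"
      then have "x q = 0\<^sub>v r" using xc(1)[OF q] q by (intro eq_vecI) (auto simp: X_def)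
      then show False using xc(2)[OF q] by simp
    qed
    ultimately show "c q = 0" by auto
  qed
  note Y = minv[OF X this]
  have "A = A * (X * minv X)" using A Y by simp
  also have "\<dots> = A * X * minv X" using A X Y(1) by (simp only: assoc_mult_mat[of _ r r _ r _ r])
  finally have "A = X * dmat r b * minv X" unfolding AX .
  then have "diag_by r A X (minv X) b" using X Y by (simp add: diag_by_def)
  then show thesis using inj that by blast
qed

lemma hankel_dmat:
  assumes "inj_on z {..<r}"
  shows "hankel r (dmat r z) \<noteq> 0"
proof -
  have "mat_trace (dmat r z ^\<^sub>m k) = (\<Sum>i<r. z i ^ k)" for k
    unfolding dmat_pow mat_trace_def by (simp add: dmat_index)
  then show ?thesis using hankel_nonzero_iff assms by blast
qed

section \<open>Overlaps between the eigenvectors of two matrices\<close>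

text \<open>Each row is one product \<open>A ^\<^sub>m i * C ^\<^sub>m j\<close>, flattened. A
  nonzero determinant says that these \<open>r * r\<close> products form a basis of all matrices of
  size \<open>r\<close>.\<close>

definition power_matrix :: "nat \<Rightarrow> complex mat \<Rightarrow> complex mat \<Rightarrow> complex mat" where
  "power_matrix r A C = Matrix.mat (r * r) (r * r)
     (\<lambda>(s, t). (A ^\<^sub>m (s div r) * C ^\<^sub>m (s mod r)) $$ (t div r, t mod r))"

lemma power_matrix_carrier [simp]: "power_matrix r A C \<in> carrier_mat (r * r) (r * r)"
  by (simp add: power_matrix_def)

text \<open>
  A left eigenvector \<open>u\<close> of \<open>A\<close> and a right eigenvector \<open>x\<close> of \<open>C\<close> with \<open>u x = 0\<close> satisfy
  \<open>u A\<^sup>i C\<^sup>j x = 0\<close> for all exponents, so the matrices \<open>A\<^sup>i C\<^sup>j\<close> do not span.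
\<close>

lemma power_matrix_eigenvectors:
  assumes A: "diag_by r A X Y e" and C: "diag_by r C X' Y' e'"
    and det: "det (power_matrix r A C) \<noteq> 0" and p: "p < r" and q: "q < r"
  shows "(Y * X') $$ (p, q) \<noteq> 0"
proof
  assume 0: "(Y * X') $$ (p, q) = 0"
  have c [simp]: "X \<in> carrier_mat r r" "Y \<in> carrier_mat r r" "X' \<in> carrier_mat r r" "Y' \<in> carrier_mat r r"
    and inv: "X * Y = 1\<^sub>m r" "Y * X = 1\<^sub>m r" "X' * Y' = 1\<^sub>m r" "Y' * X' = 1\<^sub>m r"
    and AC: "A = X * dmat r e * Y" "C = X' * dmat r e' * Y'"
    using A C by (auto simp: diag_by_def)
  have cA [simp]: "A \<in> carrier_mat r r" "C \<in> carrier_mat r r" unfolding AC by simp_all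
  note assoc = assoc_mult_mat[of _ r r _ r _ r]
  have YA: "Y * A ^\<^sub>m k = dmat r (\<lambda>i. e i ^ k) * Y" for k
    using similar_mat_witD2(3)[OF pow_carrier_mat[OF cA(1)]
        similar_mat_wit_pow[OF similar_mat_wit_of_diag_by[OF A]], of k]
    by (simp add: dmat_pow assoc[symmetric] inv)
  have CX: "C ^\<^sub>m k * X' = X' * dmat r (\<lambda>i. e' i ^ k)" for k
    using similar_mat_witD2(3)[OF pow_carrier_mat[OF cA(2)]
        similar_mat_wit_pow[OF similar_mat_wit_of_diag_by[OF C]], of k]
    by (simp add: dmat_pow assoc inv)
  define y where "y t = Y $$ (p, t div r) * X' $$ (t mod r, q)" for t
  have zero: "y t = 0" if "t < r * r" for t
  proof (rule det_nonzeroD[OF power_matrix_carrier det _ that])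
    fix s assume s: "s < r * r"
    define i j where "i = s div r" and "j = s mod r"
    have M: "A ^\<^sub>m i * C ^\<^sub>m j \<in> carrier_mat r r" by simp
    have "(\<Sum>t<r * r. power_matrix r A C $$ (s, t) * y t)
        = (\<Sum>t<r * r. (A ^\<^sub>m i * C ^\<^sub>m j) $$ (t div r, t mod r) * (Y $$ (p, t div r) * X' $$ (t mod r, q)))"
      using s by (intro sum.cong) (auto simp: power_matrix_def y_def i_def j_def)
    also have "\<dots> = (\<Sum>a<r. \<Sum>b<r. (A ^\<^sub>m i * C ^\<^sub>m j) $$ (a, b) * (Y $$ (p, a) * X' $$ (b, q)))"
      by (rule sum_lessThan_square)
    also have "\<dots> = (\<Sum>b<r. (\<Sum>a<r. Y $$ (p, a) * (A ^\<^sub>m i * C ^\<^sub>m j) $$ (a, b)) * X' $$ (b, q))"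
      by (subst sum.swap) (simp add: sum_distrib_left sum_distrib_right mult_ac)
    also have "\<dots> = (\<Sum>b<r. (Y * (A ^\<^sub>m i * C ^\<^sub>m j)) $$ (p, b) * X' $$ (b, q))"
      using p by (intro sum.cong refl arg_cong2[of _ _ _ _ times] mult_entry[OF c(2) M, symmetric]) auto
    also have "\<dots> = (Y * (A ^\<^sub>m i * C ^\<^sub>m j) * X') $$ (p, q)"
      using p q by (intro mult_entry[symmetric]) auto
    also have "Y * (A ^\<^sub>m i * C ^\<^sub>m j) * X' = (Y * A ^\<^sub>m i) * (C ^\<^sub>m j * X')"
      by (simp add: assoc)
    also have "\<dots> = dmat r (\<lambda>x. e x ^ i) * Y * (X' * dmat r (\<lambda>x. e' x ^ j))"
      by (simp only: YA CX)
    also have "\<dots> = dmat r (\<lambda>x. e x ^ i) * (Y * X') * dmat r (\<lambda>x. e' x ^ j)"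
      by (simp add: assoc)
    also have "\<dots> $$ (p, q) = 0"
      using p q 0 by (subst mult_dmat_entry[of _ r]) (auto simp: dmat_mult_entry[of _ r r])
    finally show "(\<Sum>t<r * r. power_matrix r A C $$ (s, t) * y t) = 0" .
  qed
  have "\<exists>a<r. Y $$ (p, a) \<noteq> 0"
  proof (rule ccontr)
    assume "\<not> ?thesis"
    then have "(Y * X) $$ (p, p) = 0" using p by (simp add: mult_entry[of _ r r _ r])
    then show False using p inv by simp
  qed
  moreover have "\<exists>b<r. X' $$ (b, q) \<noteq> 0"
  proof (rule ccontr)
    assume "\<not> ?thesis"
    then have "(Y' * X') $$ (q, q) = 0" using q by (simp add: mult_entry[of _ r r _ r])
    then show False using q inv by simp
  qed
  ultimately obtain a b where "a < r" "b < r" "Y $$ (p, a) * X' $$ (b, q) \<noteq> 0" by auto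
  then show False using zero[of "a * r + b"] pair_index_less[of a r b] by (simp add: y_def)
qed

section \<open>A diagonal matrix and a cyclic shift in general position\<close>

definition cyclic_shift :: "nat \<Rightarrow> complex mat" where
  "cyclic_shift r = Matrix.mat r r (\<lambda>(i, j). if j = Suc i mod r then 1 else 0)"

lemma cyclic_shift_carrier [simp]: "cyclic_shift r \<in> carrier_mat r r"
  by (simp add: cyclic_shift_def)

lemma cyclic_shift_pow:
  assumes "i < r" "j < r"
  shows "(cyclic_shift r ^\<^sub>m k) $$ (i, j) = (if j = (i + k) mod r then 1 else 0)"
  using assms
proof (induction k arbitrary: j)
  case (Suc k)
  have "(cyclic_shift r ^\<^sub>m Suc k) $$ (i, j)
      = (\<Sum>x<r. if x = (i + k) mod r then (if j = Suc x mod r then 1 else 0) else 0)"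
    unfolding pow_mat.simps mult_entry[OF pow_carrier_mat[OF cyclic_shift_carrier] cyclic_shift_carrier Suc.prems]
  proof (rule sum.cong[OF refl])
    fix x assume "x \<in> {..<r}"
    moreover from this have "cyclic_shift r $$ (x, j) = (if j = Suc x mod r then 1 else 0)"
      using Suc.prems by (simp add: cyclic_shift_def)
    ultimately show "(cyclic_shift r ^\<^sub>m k) $$ (i, x) * cyclic_shift r $$ (x, j)
        = (if x = (i + k) mod r then (if j = Suc x mod r then 1 else 0) else 0)"
      using Suc.IH[of x] Suc.prems by simp
  qed
  then show ?case using Suc.prems by (simp add: mod_Suc_eq)
qed (auto simp: cyclic_shift_def)

text \<open>The trace of a power of the shift vanishes unless the exponent is a multiple of
  \<open>r\<close>, so the Hankel matrix is \<open>r\<close> times a permutation matrix.\<close>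

lemma hankel_cyclic_shift:
  assumes "0 < r"
  shows "hankel r (cyclic_shift r) \<noteq> 0"
  unfolding hankel_def
proof (rule det_nonzeroI[of _ r])
  have tr: "mat_trace (cyclic_shift r ^\<^sub>m k) = (if k mod r = 0 then of_nat r else 0)" for k
  proof -
    have "i = (i + k) mod r \<longleftrightarrow> k mod r = 0" if "i < r" for i
    proof -
      have "i = (i + k) mod r \<longleftrightarrow> (i + k) mod r = i mod r"
        using that by (simp only: mod_less eq_commute[of i])
      also have "\<dots> \<longleftrightarrow> r dvd i + k - i" by (rule mod_eq_dvd_iff_nat) simp
      also have "\<dots> \<longleftrightarrow> k mod r = 0" by (simp only: add_diff_cancel_left' mod_eq_0_iff_dvd)
      finally show ?thesis .
    qed
    then have "(cyclic_shift r ^\<^sub>m k) $$ (i, i) = (if k mod r = 0 then 1 else 0)" if "i < r" for i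
      using cyclic_shift_pow[OF that that, of k] that by simp
    then show ?thesis unfolding mat_trace_def pow_mat_dim_square(1)[OF cyclic_shift_carrier] by simp
  qed
  fix y :: "nat \<Rightarrow> complex"
  assume y: "\<And>i. i < r \<Longrightarrow> (\<Sum>j<r. Matrix.mat r r
      (\<lambda>(i, j). mat_trace (cyclic_shift r ^\<^sub>m (i + j))) $$ (i, j) * y j) = 0"
  show "\<forall>j<r. y j = 0"
  proof (intro allI impI)
    fix q assume q: "q < r"
    \<comment> \<open>The row whose single nonzero entry stands in column \<open>q\<close>.\<close>
    define i where "i = (r - q) mod r"
    have i: "i < r" using assms by (simp add: i_def)
    have "(i + j) mod r = 0 \<longleftrightarrow> j = q" if "j < r" for j
    proof -
      have "(i + j) mod r = (r - q + j) mod r" unfolding i_def by (rule mod_add_left_eq)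
      also have "\<dots> = 0 \<longleftrightarrow> j = q"
      proof (cases "q \<le> j")
        case True
        then have "r - q + j = (j - q) + r" using q by simp
        then have "(r - q + j) mod r = (j - q) mod r" by (simp only: mod_add_self2)
        also have "\<dots> = j - q" using \<open>j < r\<close> by (intro mod_less) linarith
        finally show ?thesis using True by linarith
      next
        case False
        then have "(r - q + j) mod r = r - q + j" using \<open>j < r\<close> q by (intro mod_less) linarith
        then show ?thesis using False q by linarith
      qed
      finally show ?thesis .
    qed
    then have "(\<Sum>j<r. Matrix.mat r r (\<lambda>(i, j). mat_trace (cyclic_shift r ^\<^sub>m (i + j))) $$ (i, j) * y j)
        = (\<Sum>j<r. if j = q then of_nat r * y j else 0)"
      using i by (intro sum.cong) (auto simp: tr)
    then have "(\<Sum>j<r. if j = q then of_nat r * y j else 0) = 0" using y[OF i] by simp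
    then show "y q = 0" using q assms by simp
  qed
qed auto

text \<open>For fixed \<open>j\<close> the products are supported on the \<open>j\<close>-th cyclic
  diagonal, where row \<open>a\<close> carries \<open>z a ^ i\<close>. The cyclic diagonals
  partition all positions, and on each of them a Vandermonde system remains.\<close>

lemma power_matrix_dmat_cyclic_shift:
  assumes "inj_on z {..<r}"
  shows "det (power_matrix r (dmat r z) (cyclic_shift r)) \<noteq> 0"
proof (rule det_nonzeroI[OF power_matrix_carrier], intro allI impI)
  fix y t assume y: "\<And>s. s < r * r \<Longrightarrow>
      (\<Sum>t<r * r. power_matrix r (dmat r z) (cyclic_shift r) $$ (s, t) * y t) = 0" and t: "t < r * r"
  define y' where "y' a b = y (a * r + b)" for a b
  \<comment> \<open>\<open>j\<close> is the number of the cyclic diagonal through the position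
    encoded by \<open>t\<close>: column minus row modulo \<open>r\<close>, with \<open>r\<close>
    added to stay within the naturals.\<close>
  define q j where "q = t div r" and "j = (t mod r + (r - t div r)) mod r"
  have q: "q < r" "t mod r < r" using t square_index_div_mod[of t r] by (simp_all add: q_def)
  then have j: "j < r" unfolding j_def by (intro mod_less_divisor) linarith
  have entry: "(dmat r z ^\<^sub>m i * cyclic_shift r ^\<^sub>m j) $$ (a, b) = (if b = (a + j) mod r then z a ^ i else 0)"
    if "a < r" "b < r" for a b i
  proof -
    have "(dmat r z ^\<^sub>m i * cyclic_shift r ^\<^sub>m j) $$ (a, b) = z a ^ i * (cyclic_shift r ^\<^sub>m j) $$ (a, b)"
      unfolding dmat_pow by (rule dmat_mult_entry[OF pow_carrier_mat[OF cyclic_shift_carrier] that])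
    then show ?thesis using cyclic_shift_pow[OF that, of j] by (simp only: if_distrib[of "\<lambda>x. z a ^ i * x"] mult_1_right mult_zero_right)
  qed
  have "y' q ((q + j) mod r) = 0"
  proof (rule vandermonde_kernel[OF assms _ q(1)])
    fix i assume i: "i < r"
    have s: "i * r + j < r * r" using i j by (rule pair_index_less)
    have "0 = (\<Sum>t<r * r. (dmat r z ^\<^sub>m i * cyclic_shift r ^\<^sub>m j) $$ (t div r, t mod r) * y' (t div r) (t mod r))"
      unfolding y[OF s, symmetric]
    proof (rule sum.cong[OF refl])
      fix t assume "t \<in> {..<r * r}"
      moreover have "(i * r + j) div r = i" "(i * r + j) mod r = j" using j by simp_all
      ultimately show "power_matrix r (dmat r z) (cyclic_shift r) $$ (i * r + j, t) * y t
          = (dmat r z ^\<^sub>m i * cyclic_shift r ^\<^sub>m j) $$ (t div r, t mod r) * y' (t div r) (t mod r)"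
        using s by (simp add: power_matrix_def y'_def)
    qed
    also have "\<dots> = (\<Sum>a<r. \<Sum>b<r. (dmat r z ^\<^sub>m i * cyclic_shift r ^\<^sub>m j) $$ (a, b) * y' a b)"
      by (rule sum_lessThan_square)
    also have "\<dots> = (\<Sum>a<r. \<Sum>b<r. if b = (a + j) mod r then y' a b * z a ^ i else 0)"
      by (intro sum.cong refl) (simp add: entry)
    also have "\<dots> = (\<Sum>a<r. y' a ((a + j) mod r) * z a ^ i)"
      using j by (intro sum.cong refl) (simp add: sum.delta)
    finally show "(\<Sum>a<r. y' a ((a + j) mod r) * z a ^ i) = 0" by simp
  qed
  moreover have "(q + j) mod r = t mod r"
  proof -
    have "(q + j) mod r = (q + (t mod r + (r - q))) mod r"
      unfolding j_def q_def by (rule mod_add_right_eq)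
    also have "q + (t mod r + (r - q)) = t mod r + r" using q by simp
    finally show ?thesis using q by simp
  qed
  ultimately have "y' q (t mod r) = 0" by (simp only:)
  then show "y t = 0" unfolding y'_def q_def by (simp only: div_mult_mod_eq)
qed

section \<open>Rings of functions\<close>

text \<open>The same closure properties serve twice: for polynomial functions of the core entries,
  and for functions of a perturbation parameter that are continuous at 0.\<close>

locale function_ring =
  fixes R :: "('x \<Rightarrow> complex) \<Rightarrow> bool"
  assumes const: "R (\<lambda>_. c)"
    and add: "R f \<Longrightarrow> R g \<Longrightarrow> R (\<lambda>x. f x + g x)"
    and mult: "R f \<Longrightarrow> R g \<Longrightarrow> R (\<lambda>x. f x * g x)"
begin

lemma sum: "(\<And>a. a \<in> S \<Longrightarrow> R (f a)) \<Longrightarrow> R (\<lambda>x. \<Sum>a\<in>S. f a x)"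
  by (induction S rule: infinite_finite_induct) (auto intro: const add)

lemma prod: "(\<And>a. a \<in> S \<Longrightarrow> R (f a)) \<Longrightarrow> R (\<lambda>x. \<Prod>a\<in>S. f a x)"
  by (induction S rule: infinite_finite_induct) (auto intro: const mult)

definition mat_in :: "nat \<Rightarrow> nat \<Rightarrow> ('x \<Rightarrow> complex mat) \<Rightarrow> bool" where
  "mat_in m k A \<longleftrightarrow> (\<forall>x. A x \<in> carrier_mat m k) \<and> (\<forall>i<m. \<forall>j<k. R (\<lambda>x. A x $$ (i, j)))"

lemma mat_inI:
  "(\<And>x. A x \<in> carrier_mat m k) \<Longrightarrow> (\<And>i j. i < m \<Longrightarrow> j < k \<Longrightarrow> R (\<lambda>x. A x $$ (i, j))) \<Longrightarrow> mat_in m k A"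
  by (simp add: mat_in_def)

lemma mat_inD:
  assumes "mat_in m k A"
  shows "A x \<in> carrier_mat m k" and "i < m \<Longrightarrow> j < k \<Longrightarrow> R (\<lambda>x. A x $$ (i, j))"
  using assms by (auto simp: mat_in_def)

lemma mat_in_mult:
  assumes "mat_in m k A" and "mat_in k l B"
  shows "mat_in m l (\<lambda>x. A x * B x)"
proof (rule mat_inI)
  note c = mat_inD(1)[OF assms(1)] mat_inD(1)[OF assms(2)]
  show "A x * B x \<in> carrier_mat m l" for x by (rule mult_carrier_mat[OF c])
  fix i j assume ij: "i < m" "j < l"
  show "R (\<lambda>x. (A x * B x) $$ (i, j))"
    unfolding mult_entry[OF c ij] using ij assms by (intro sum mult) (auto intro: mat_inD)
qed

lemma mat_in_smult:
  assumes "mat_in m k A" and "R f"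
  shows "mat_in m k (\<lambda>x. f x \<cdot>\<^sub>m A x)"
proof (rule mat_inI)
  note c = mat_inD(1)[OF assms(1)]
  show "f x \<cdot>\<^sub>m A x \<in> carrier_mat m k" for x using c by simp
  fix i j assume ij: "i < m" "j < k"
  have "(f x \<cdot>\<^sub>m A x) $$ (i, j) = f x * A x $$ (i, j)" for x
    using c[of x] ij by simp
  then show "R (\<lambda>x. (f x \<cdot>\<^sub>m A x) $$ (i, j))"
    using mult[OF assms(2) mat_inD(2)[OF assms(1) ij]] by simp
qed

lemma mat_in_minus:
  assumes "mat_in m k A" and "mat_in m k B"
  shows "mat_in m k (\<lambda>x. A x - B x)"
proof (rule mat_inI)
  note c = mat_inD(1)[OF assms(1)] mat_inD(1)[OF assms(2)]
  show "A x - B x \<in> carrier_mat m k" for x by (rule minus_carrier_mat[OF c(2)])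
  fix i j assume ij: "i < m" "j < k"
  have "(A x - B x) $$ (i, j) = A x $$ (i, j) + (-1) * B x $$ (i, j)" for x
    using c(1)[of x] c(2)[of x] ij by simp
  then show "R (\<lambda>x. (A x - B x) $$ (i, j))"
    using add[OF mat_inD(2)[OF assms(1) ij] mult[OF const[of "-1"] mat_inD(2)[OF assms(2) ij]]] by simp
qed

lemma mat_in_const: "A \<in> carrier_mat m k \<Longrightarrow> mat_in m k (\<lambda>_. A)"
  by (auto intro: mat_inI const)

lemma mat_in_pow:
  assumes "mat_in m m A"
  shows "mat_in m m (\<lambda>x. A x ^\<^sub>m k)"
proof (induction k)
  case 0
  have "(\<lambda>x. A x ^\<^sub>m 0) = (\<lambda>_. 1\<^sub>m m)"
    using carrier_matD(1)[OF mat_inD(1)[OF assms]] by simp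
  then show ?case by (simp add: mat_in_const)
next
  case (Suc k)
  then show ?case using mat_in_mult[OF Suc assms] by simp
qed

lemma det_in:
  assumes "mat_in m m A"
  shows "R (\<lambda>x. det (A x))"
  unfolding det_def'[OF mat_inD(1)[OF assms]]
proof (intro sum mult const prod mat_inD(2)[OF assms])
  fix p i assume "p \<in> {p. p permutes {0..<m}}" "i \<in> {0..<m}"
  then show "p i < m" using permutes_in_image[of p "{0..<m}" i] by auto
qed auto

text \<open>Its entries are minors up to sign, so the adjugate can replace the inverse without
  leaving the ring.\<close>

lemma adj_in:
  assumes "mat_in m m A"
  shows "mat_in m m (\<lambda>x. adj_mat (A x))"
proof (rule mat_inI)
  note c = mat_inD(1)[OF assms]
  show "adj_mat (A x) \<in> carrier_mat m m" for x using c adj_mat(1) by blast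
  fix i j assume ij: "i < m" "j < m"
  have "mat_in (m - 1) (m - 1) (\<lambda>x. mat_delete (A x) j i)"
  proof (rule mat_inI)
    show "mat_delete (A x) j i \<in> carrier_mat (m - 1) (m - 1)" for x
      by (rule mat_delete_carrier[OF c])
    fix a b assume ab: "a < m - 1" "b < m - 1"
    have "mat_delete (A x) j i $$ (a, b) = A x $$ (if a < j then a else Suc a, if b < i then b else Suc b)" for x
      using c[of x] ab by (simp add: mat_delete_def)
    then show "R (\<lambda>x. mat_delete (A x) j i $$ (a, b))"
      using mat_inD(2)[OF assms] ab by simp
  qed
  then have "R (\<lambda>x. det (mat_delete (A x) j i))" by (rule det_in)
  moreover have "adj_mat (A x) $$ (i, j) = (- 1) ^ (j + i) * det (mat_delete (A x) j i)" for x
    using c[of x] ij by (simp add: adj_mat_def cofactor_def)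
  ultimately show "R (\<lambda>x. adj_mat (A x) $$ (i, j))" by (simp add: mult const)
qed

lemma trace_in:
  assumes "mat_in m m A"
  shows "R (\<lambda>x. mat_trace (A x))"
proof -
  have "mat_trace (A x) = (\<Sum>i<m. A x $$ (i, i))" for x
    using mat_inD(1)[OF assms, of x] by (simp add: mat_trace_def)
  then show ?thesis using assms by (auto intro: sum mat_inD)
qed

lemma hankel_in:
  assumes "mat_in r r A"
  shows "R (\<lambda>x. hankel r (A x))"
  unfolding hankel_def by (intro det_in mat_inI) (auto intro!: trace_in mat_in_pow assms)

lemma det_power_matrix_in:
  assumes "mat_in r r A" and "mat_in r r C"
  shows "R (\<lambda>x. det (power_matrix r (A x) (C x)))"
proof (intro det_in[of "r * r"] mat_inI power_matrix_carrier)
  fix i j assume ij: "i < r * r" "j < r * r"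
  have "mat_in r r (\<lambda>x. A x ^\<^sub>m (i div r) * C x ^\<^sub>m (i mod r))"
    by (intro mat_in_mult[of r r] mat_in_pow assms)
  then show "R (\<lambda>x. power_matrix r (A x) (C x) $$ (i, j))"
    using ij square_index_div_mod[OF ij(2)] by (auto simp: power_matrix_def mat_in_def)
qed

end

interpretation line_poly: function_ring "line_poly I"
  by standard (auto intro: line_poly_add line_poly_mult)

interpretation cont: function_ring "\<lambda>f :: real \<Rightarrow> complex. isCont f 0"
  by standard auto

section \<open>Certificates for two matrices and for four environments\<close>

text \<open>If this does not vanish, both matrices have simple spectrum and no left eigenvector of
  \<open>A\<close> annihilates a right eigenvector of \<open>C\<close>.\<close>

definition pair_cert :: "nat \<Rightarrow> complex mat \<Rightarrow> complex mat \<Rightarrow> complex" where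
  "pair_cert r A C = hankel r A * hankel r C * det (power_matrix r A C)"

lemma (in function_ring) pair_cert_in:
  assumes "mat_in r r A" and "mat_in r r C"
  shows "R (\<lambda>x. pair_cert r (A x) (C x))"
  unfolding pair_cert_def by (intro mult hankel_in det_power_matrix_in assms)

lemma pair_cert_dmat_cyclic_shift:
  assumes "0 < r" and "inj_on z {..<r}"
  shows "pair_cert r (dmat r z) (cyclic_shift r) \<noteq> 0"
  unfolding pair_cert_def
  using hankel_dmat[OF assms(2)] hankel_cyclic_shift[OF assms(1)] power_matrix_dmat_cyclic_shift[OF assms(2)]
  by simp

lemma isCont_nonzero_ex:
  fixes f :: "real \<Rightarrow> complex"
  assumes "isCont f 0" and "f 0 \<noteq> 0"
  obtains e where "0 < e" "f e \<noteq> 0"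
proof -
  have "(f \<longlongrightarrow> f 0) (at_right 0)"
    using assms(1) by (auto simp: isCont_def intro: filterlim_at_split[THEN iffD1, THEN conjunct2])
  then have "eventually (\<lambda>x. f x \<noteq> 0) (at_right 0)"
    using assms(2) tendsto_imp_eventually_ne by blast
  moreover have "eventually (\<lambda>x::real. 0 < x) (at_right 0)" by (rule eventually_at_right_less)
  ultimately have "eventually (\<lambda>x. 0 < x \<and> f x \<noteq> 0) (at_right 0)" by eventually_elim auto
  then show thesis using that eventually_happens'[OF trivial_limit_at_right_real] by blast
qed

text \<open>\<open>A\<close> and \<open>C\<close> are the quotients of \<open>W0\<close> by
  \<open>W1\<close> and of \<open>W2\<close> by \<open>W3\<close>, expressed without inverses. The
  entries of \<open>Y * X'\<close> become the scalar factors of the blocks of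
  \<open>F\<close>.\<close>

definition spectral_data ::
  "nat \<Rightarrow> complex mat \<Rightarrow> complex mat \<Rightarrow> complex mat \<Rightarrow> complex mat \<Rightarrow> bool" where
  "spectral_data r W0 W1 W2 W3 \<longleftrightarrow>
     det W0 \<noteq> 0 \<and> det W1 \<noteq> 0 \<and> det W2 \<noteq> 0 \<and> det W3 \<noteq> 0 \<and>
     (\<exists>A X Y e C X' Y' e'. diag_by r A X Y e \<and> inj_on e {..<r} \<and> W0 = A * W1 \<and>
        diag_by r C X' Y' e' \<and> inj_on e' {..<r} \<and> W2 = C * W3 \<and>
        (\<forall>p<r. \<forall>q<r. (Y * X') $$ (p, q) \<noteq> 0))"

text \<open>
  The matrix \<open>(\<alpha> W - \<tau> V) adj V\<close> is an affine function of \<open>W V\<^sup>-\<^sup>1\<close>, so that both have the same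
  eigenvectors. The constants \<open>\<alpha>\<close> and \<open>\<tau>\<close> are free to be adapted to the point at which
  nonvanishing is shown.
\<close>

definition pencil :: "complex \<Rightarrow> complex \<Rightarrow> complex mat \<Rightarrow> complex mat \<Rightarrow> complex mat" where
  "pencil \<alpha> \<tau> W V = (\<alpha> \<cdot>\<^sub>m W - \<tau> \<cdot>\<^sub>m V) * adj_mat V"

text \<open>The values at 0 of \<open>\<alpha>\<close> and \<open>\<tau>\<close> belong to the first
  pencil, those at 1 to the second.\<close>

definition spectral_cert ::
  "nat \<Rightarrow> (nat \<Rightarrow> complex) \<Rightarrow> (nat \<Rightarrow> complex) \<Rightarrow> complex mat \<Rightarrow> complex mat \<Rightarrow> complex mat \<Rightarrow> complex mat \<Rightarrow> complex" where
  "spectral_cert r \<alpha> \<tau> W0 W1 W2 W3 = det W0 * det W1 * det W2 * det W3 *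
     pair_cert r (pencil (\<alpha> 0) (\<tau> 0) W0 W1) (pencil (\<alpha> 1) (\<tau> 1) W2 W3)"

lemma (in function_ring) pencil_in:
  assumes "mat_in r r W" and "mat_in r r V"
  shows "mat_in r r (\<lambda>x. pencil \<alpha> \<tau> (W x) (V x))"
  unfolding pencil_def by (intro mat_in_mult[of r r] mat_in_minus mat_in_smult adj_in const assms)

lemma (in function_ring) spectral_cert_in:
  assumes "mat_in r r W0" "mat_in r r W1" "mat_in r r W2" "mat_in r r W3"
  shows "R (\<lambda>x. spectral_cert r \<alpha> \<tau> (W0 x) (W1 x) (W2 x) (W3 x))"
  unfolding spectral_cert_def by (intro mult det_in[of r] pair_cert_in pencil_in assms)

lemma diag_by_affine:
  assumes "diag_by r A X Y e"
  shows "diag_by r (a \<cdot>\<^sub>m A + b \<cdot>\<^sub>m 1\<^sub>m r) X Y (\<lambda>i. a * e i + b)"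
proof -
  have c: "X \<in> carrier_mat r r" "Y \<in> carrier_mat r r" and inv: "X * Y = 1\<^sub>m r" and A: "A = X * dmat r e * Y"
    using assms by (auto simp: diag_by_def)
  have "dmat r (\<lambda>i. a * e i + b) = a \<cdot>\<^sub>m dmat r e + b \<cdot>\<^sub>m 1\<^sub>m r"
    by (rule eq_matI) (auto simp: dmat_index)
  then have "X * dmat r (\<lambda>i. a * e i + b) * Y = (a \<cdot>\<^sub>m (X * dmat r e) + b \<cdot>\<^sub>m X) * Y"
    using c by (simp add: mult_add_distrib_mat[of _ r r _ r] mult_smult_distrib[of _ r r _ r])
  also have "\<dots> = a \<cdot>\<^sub>m (X * dmat r e * Y) + b \<cdot>\<^sub>m 1\<^sub>m r"
    using c inv by (subst add_mult_distrib_mat[of _ r r _ _ r]) (auto simp: mult_smult_assoc_mat[of _ r r _ r])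
  finally show ?thesis using assms unfolding A diag_by_def by simp
qed

text \<open>Since \<open>adj_mat V * V\<close> is \<open>det V\<close> times the identity, the
  pencil times \<open>V\<close> is a multiple of
  \<open>\<alpha> \<cdot>\<^sub>m W - \<tau> \<cdot>\<^sub>m V\<close>. Solving for \<open>W\<close>
  gives the constants \<open>a\<close> and \<open>b\<close> and an affine function of the pencil as
  quotient.\<close>

lemma pencil_diag_by:
  assumes W: "W \<in> carrier_mat r r" and V: "V \<in> carrier_mat r r" and "det V \<noteq> 0" and "\<alpha> \<noteq> 0"
    and d: "diag_by r (pencil \<alpha> \<tau> W V) X Y e" and "inj_on e {..<r}"
  shows "\<exists>A e'. diag_by r A X Y e' \<and> inj_on e' {..<r} \<and> W = A * V"
proof -
  define a b where "a = 1 / (\<alpha> * det V)" and "b = \<tau> / \<alpha>"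
  let ?P = "pencil \<alpha> \<tau> W V"
  have P: "?P \<in> carrier_mat r r"
    unfolding pencil_def using W V adj_mat(1)[OF V] by (simp add: minus_carrier_mat)
  have "?P * V = (\<alpha> \<cdot>\<^sub>m W - \<tau> \<cdot>\<^sub>m V) * (adj_mat V * V)"
    unfolding pencil_def using W V adj_mat(1)[OF V] by (intro assoc_mult_mat[of _ r r _ r _ r]) auto
  also have "\<dots> = det V \<cdot>\<^sub>m (\<alpha> \<cdot>\<^sub>m W - \<tau> \<cdot>\<^sub>m V)"
    unfolding adj_mat(3)[OF V] using W V by (subst mult_smult_distrib[of _ r r _ r]) auto
  finally have PV: "?P * V = det V \<cdot>\<^sub>m (\<alpha> \<cdot>\<^sub>m W - \<tau> \<cdot>\<^sub>m V)" .
  have "(a \<cdot>\<^sub>m ?P + b \<cdot>\<^sub>m 1\<^sub>m r) * V = a \<cdot>\<^sub>m (?P * V) + b \<cdot>\<^sub>m V"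
    using P V by (subst add_mult_distrib_mat[of _ r r _ _ r]) (auto simp: mult_smult_assoc_mat[of _ r r _ r])
  also have "\<dots> = W"
    unfolding PV using W V assms(3,4) by (intro eq_matI) (auto simp: a_def b_def field_simps)
  finally have "W = (a \<cdot>\<^sub>m ?P + b \<cdot>\<^sub>m 1\<^sub>m r) * V" by simp
  moreover have "inj_on (\<lambda>i. a * e i + b) {..<r}"
    using assms(3,4,6) by (auto simp: inj_on_def a_def)
  ultimately show ?thesis using diag_by_affine[OF d, of a b] by blast
qed

lemma spectral_data_of_cert:
  assumes c: "W0 \<in> carrier_mat r r" "W1 \<in> carrier_mat r r" "W2 \<in> carrier_mat r r" "W3 \<in> carrier_mat r r"
    and \<alpha>: "\<alpha> 0 \<noteq> 0" "\<alpha> 1 \<noteq> 0" and nz: "spectral_cert r \<alpha> \<tau> W0 W1 W2 W3 \<noteq> 0"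
  shows "spectral_data r W0 W1 W2 W3"
proof -
  let ?A = "pencil (\<alpha> 0) (\<tau> 0) W0 W1" and ?C = "pencil (\<alpha> 1) (\<tau> 1) W2 W3"
  have dets: "det W0 \<noteq> 0" "det W1 \<noteq> 0" "det W2 \<noteq> 0" "det W3 \<noteq> 0"
    and h: "hankel r ?A \<noteq> 0" "hankel r ?C \<noteq> 0" and pm: "det (power_matrix r ?A ?C) \<noteq> 0"
    using nz by (auto simp: spectral_cert_def pair_cert_def)
  have P: "?A \<in> carrier_mat r r" "?C \<in> carrier_mat r r"
    unfolding pencil_def using c adj_mat(1)[OF c(2)] adj_mat(1)[OF c(4)] by (simp_all add: minus_carrier_mat)
  obtain X Y e where d: "diag_by r ?A X Y e" "inj_on e {..<r}"
    using hankel_diagonalizable[OF P(1) h(1)] .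
  obtain X' Y' e' where d': "diag_by r ?C X' Y' e'" "inj_on e' {..<r}"
    using hankel_diagonalizable[OF P(2) h(2)] .
  have "\<forall>p<r. \<forall>q<r. (Y * X') $$ (p, q) \<noteq> 0"
    using power_matrix_eigenvectors[OF d(1) d'(1) pm] by blast
  then show ?thesis
    using dets pencil_diag_by[OF c(1,2) dets(2) \<alpha>(1) d] pencil_diag_by[OF c(3,4) dets(4) \<alpha>(2) d']
    unfolding spectral_data_def by blast
qed

section \<open>Slices of the three-body marginals\<close>

definition kron :: "nat \<Rightarrow> complex mat \<Rightarrow> complex mat \<Rightarrow> complex mat" where
  "kron r A B = Matrix.mat (r * r) (r * r)
     (\<lambda>(s, t). A $$ (s div r, t div r) * B $$ (s mod r, t mod r))"

text \<open>Entries of an ordered product, kept as a function of indices because at a contracted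
  site the factor is not a slice of a core.\<close>

fun lprod :: "nat \<Rightarrow> (nat \<Rightarrow> nat \<Rightarrow> nat \<Rightarrow> nat \<Rightarrow> complex) \<Rightarrow> (nat \<Rightarrow> nat) \<Rightarrow> nat list \<Rightarrow> nat \<Rightarrow> nat \<Rightarrow> complex" where
  "lprod r K \<gamma> [] x y = (if x = y then 1 else 0)"
| "lprod r K \<gamma> (s # ss) x y = (\<Sum>z<r. K s (\<gamma> s) x z * lprod r K \<gamma> ss z y)"

text \<open>
  The contraction of a chain of sites with its complex conjugate over the physical indices
  \<open>I s\<close> of all sites \<open>s\<close>.
\<close>

fun env :: "nat \<Rightarrow> (nat \<Rightarrow> nat \<Rightarrow> nat \<Rightarrow> nat \<Rightarrow> complex) \<Rightarrow> (nat \<Rightarrow> nat set) \<Rightarrow> nat list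
    \<Rightarrow> nat \<Rightarrow> nat \<Rightarrow> nat \<Rightarrow> nat \<Rightarrow> complex" where
  "env r K I [] x y x' y' = (if x = y \<and> x' = y' then 1 else 0)"
| "env r K I (s # ss) x y x' y' =
     (\<Sum>a\<in>I s. \<Sum>z<r. \<Sum>z'<r. K s a x z * cnj (K s a x' z') * env r K I ss z y z' y')"

text \<open>At the site \<open>h\<close> the physical index is contracted with \<open>v\<close>, which leaves a single level.\<close>

definition contracted ::
  "(nat \<Rightarrow> nat) \<Rightarrow> nat \<Rightarrow> complex Matrix.vec \<Rightarrow> (nat \<Rightarrow> nat \<Rightarrow> complex mat) \<Rightarrow> nat \<Rightarrow> nat \<Rightarrow> nat \<Rightarrow> nat \<Rightarrow> complex"
  where "contracted n h v Q s a i j =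
    (if s = h then \<Sum>b<n h. v $ b * Q h b $$ (i, j) else Q s a $$ (i, j))"

definition levels :: "(nat \<Rightarrow> nat) \<Rightarrow> nat \<Rightarrow> nat \<Rightarrow> nat set" where
  "levels n h s = (if s = h then {0} else {..<n s})"

text \<open>The \<open>d - 2\<close> sites outside the pair, in the cyclic order in which their
  factors follow those of \<open>j\<close> and \<open>Suc j mod d\<close> under the trace.\<close>

definition rest :: "nat \<Rightarrow> nat \<Rightarrow> nat list" where
  "rest d j = map (\<lambda>t. (j + 2 + t) mod d) [0..<d - 2]"

text \<open>The matrix \<open>W\<close> of the factorization. The bra has physical index 0 at both
  sites of the pair, so these enter through one fixed conjugated product with entries
  \<open>(p, q)\<close>. The chain leads from bond \<open>x\<close> to \<open>y\<close> in the ket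
  and from \<open>q\<close> to \<open>p\<close> in the bra.\<close>

definition env_matrix ::
  "nat \<Rightarrow> nat \<Rightarrow> (nat \<Rightarrow> nat) \<Rightarrow> (nat \<Rightarrow> nat \<Rightarrow> complex mat) \<Rightarrow> nat \<Rightarrow> nat \<Rightarrow> complex Matrix.vec \<Rightarrow> complex mat" where
  "env_matrix d r n Q j h v = Matrix.mat r r (\<lambda>(x, y). \<Sum>p<r. \<Sum>q<r.
     cnj (\<Sum>w<r. Q j 0 $$ (p, w) * Q (Suc j mod d) 0 $$ (w, q)) *
     env r (contracted n h v Q) (levels n h) (rest d j) x y q p)"

lemma lprod_append:
  assumes "x < r"
  shows "lprod r K \<gamma> (xs @ ys) x y = (\<Sum>z<r. lprod r K \<gamma> xs x z * lprod r K \<gamma> ys z y)"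
  using assms
proof (induction xs arbitrary: x)
  case (Cons s xs)
  have "lprod r K \<gamma> ((s # xs) @ ys) x y
      = (\<Sum>w<r. \<Sum>z<r. K s (\<gamma> s) x w * lprod r K \<gamma> xs w z * lprod r K \<gamma> ys z y)"
    by (simp add: Cons.IH sum_distrib_left mult.assoc)
  also have "\<dots> = (\<Sum>z<r. lprod r K \<gamma> (s # xs) x z * lprod r K \<gamma> ys z y)"
    by (subst sum.swap) (simp add: sum_distrib_right)
  finally show ?case .
qed (simp add: if_distrib[of "\<lambda>x. x * _"] cong: if_cong)

lemma lprod_trace_commute:
  "(\<Sum>x<r. lprod r K \<gamma> (xs @ ys) x x) = (\<Sum>x<r. lprod r K \<gamma> (ys @ xs) x x)"
proof -
  have "(\<Sum>x<r. lprod r K \<gamma> (xs @ ys) x x) = (\<Sum>x<r. \<Sum>z<r. lprod r K \<gamma> xs x z * lprod r K \<gamma> ys z x)"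
    by (simp add: lprod_append)
  also have "\<dots> = (\<Sum>x<r. lprod r K \<gamma> (ys @ xs) x x)"
    by (subst sum.swap) (simp add: lprod_append mult.commute)
  finally show ?thesis .
qed

lemma foldr_mult_entry:
  assumes "\<And>k a. Q k a \<in> carrier_mat r r"
  shows "foldr (*) (map (\<lambda>k. Q k (\<alpha> k)) xs) (1\<^sub>m r) \<in> carrier_mat r r"
    and "x < r \<Longrightarrow> y < r \<Longrightarrow> foldr (*) (map (\<lambda>k. Q k (\<alpha> k)) xs) (1\<^sub>m r) $$ (x, y)
      = lprod r (\<lambda>s a i j. Q s a $$ (i, j)) \<alpha> xs x y"
proof -
  show c: "foldr (*) (map (\<lambda>k. Q k (\<alpha> k)) xs) (1\<^sub>m r) \<in> carrier_mat r r" for xs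
    by (induction xs) (auto simp: assms)
  show "x < r \<Longrightarrow> y < r \<Longrightarrow> foldr (*) (map (\<lambda>k. Q k (\<alpha> k)) xs) (1\<^sub>m r) $$ (x, y)
      = lprod r (\<lambda>s a i j. Q s a $$ (i, j)) \<alpha> xs x y"
  proof (induction xs arbitrary: x)
    case (Cons k xs)
    have "(Q k (\<alpha> k) * foldr (*) (map (\<lambda>k. Q k (\<alpha> k)) xs) (1\<^sub>m r)) $$ (x, y)
        = (\<Sum>z<r. Q k (\<alpha> k) $$ (x, z) * foldr (*) (map (\<lambda>k. Q k (\<alpha> k)) xs) (1\<^sub>m r) $$ (z, y))"
      by (rule mult_entry[OF assms c Cons.prems])
    then show ?case using Cons by simp
  qed auto
qed

lemma cyclic_list:
  assumes "j < d" and "2 \<le> d"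
  shows "[j..<d] @ [0..<j] = j # Suc j mod d # rest d j"
proof (rule nth_equalityI)
  show "length ([j..<d] @ [0..<j]) = length (j # Suc j mod d # rest d j)"
    using assms by (simp add: rest_def)
  fix i assume i: "i < length ([j..<d] @ [0..<j])"
  then have id: "i < d" using assms by simp
  have "([j..<d] @ [0..<j]) ! i = (j + i) mod d"
  proof (cases "i < d - j")
    case True
    then show ?thesis by (simp add: nth_append)
  next
    case False
    then have "(j + i) mod d = (j + i - d) mod d" using assms by (intro le_mod_geq) linarith
    also have "\<dots> = j + i - d" using assms id by (intro mod_less) linarith
    also have "\<dots> = i - (d - j)" using assms False by linarith
    finally show ?thesis using False assms id by (simp add: nth_append)
  qed
  moreover have "(j # Suc j mod d # rest d j) ! i = (j + i) mod d"
  proof -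
    consider "i = 0" | "i = 1" | m where "i = Suc (Suc m)"
      by (metis One_nat_def not0_implies_Suc)
    then show ?thesis using assms id by cases (auto simp: rest_def)
  qed
  ultimately show "([j..<d] @ [0..<j]) ! i = (j # Suc j mod d # rest d j) ! i" by simp
qed

lemma rest_props:
  assumes "j < d" and "2 \<le> d"
  shows "distinct (rest d j)" and "set (rest d j) = {..<d} - {j, Suc j mod d}" and "j \<noteq> Suc j mod d"
proof -
  have "distinct ([j..<d] @ [0..<j])" by auto
  then have dist: "distinct (j # Suc j mod d # rest d j)" using cyclic_list[OF assms] by simp
  then show "distinct (rest d j)" "j \<noteq> Suc j mod d" by auto
  have "set ([j..<d] @ [0..<j]) = {..<d}" using assms by auto
  then have "{..<d} = insert j (insert (Suc j mod d) (set (rest d j)))"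
    using cyclic_list[OF assms] by simp
  then show "set (rest d j) = {..<d} - {j, Suc j mod d}" using dist by auto
qed

lemma mps_state_cyclic:
  assumes "\<And>k a. Q k a \<in> carrier_mat r r" and "j < d" and "2 \<le> d"
  shows "mps_state d r Q \<alpha> = (\<Sum>x<r. \<Sum>y<r. \<Sum>z<r. Q j (\<alpha> j) $$ (x, y) *
    Q (Suc j mod d) (\<alpha> (Suc j mod d)) $$ (y, z) *
    lprod r (\<lambda>s a i j. Q s a $$ (i, j)) \<alpha> (rest d j) z x)"
proof -
  let ?L = "lprod r (\<lambda>s a i j. Q s a $$ (i, j)) \<alpha>"
  have "mps_state d r Q \<alpha> = (\<Sum>x<r. ?L [0..<d] x x)"
    unfolding mps_state_def mat_trace_def
      carrier_matD(1)[OF foldr_mult_entry(1)[of Q r \<alpha> "[0..<d]", OF assms(1)]]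
    by (intro sum.cong refl foldr_mult_entry(2)[OF assms(1)]) auto
  also have "[0..<d] = [0..<j] @ [j..<d]" using assms(2) by (metis le_add_diff_inverse upt_add_eq_append zero_le less_imp_le)
  also have "(\<Sum>x<r. ?L ([0..<j] @ [j..<d]) x x) = (\<Sum>x<r. ?L (j # Suc j mod d # rest d j) x x)"
    unfolding cyclic_list[OF assms(2,3), symmetric] by (rule lprod_trace_commute)
  finally show ?thesis by (simp add: sum_distrib_left mult.assoc)
qed

lemma lprod_cong:
  assumes "\<And>s x y. s \<in> set ss \<Longrightarrow> K s (\<gamma> s) x y = K' s (\<gamma>' s) x y"
  shows "lprod r K \<gamma> ss x y = lprod r K' \<gamma>' ss x y"
  using assms by (induction ss arbitrary: x) auto

text \<open>The site \<open>h\<close> occurs exactly once in the list, so the product is linear in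
  its factor and the sum over \<open>b\<close> can be moved there.\<close>

lemma lprod_contracted:
  assumes "distinct ss" and "h \<in> set ss"
    and "\<And>b s. s \<in> set ss \<Longrightarrow> s \<noteq> h \<Longrightarrow> \<alpha> b s = \<gamma> s" and "\<And>b. \<alpha> b h = b"
  shows "(\<Sum>b<n h. v $ b * lprod r (\<lambda>s a i j. Q s a $$ (i, j)) (\<alpha> b) ss x y)
    = lprod r (contracted n h v Q) \<gamma> ss x y"
  using assms(1-3)
proof (induction ss arbitrary: x)
  case (Cons s ss)
  let ?L = "\<lambda>b. lprod r (\<lambda>s a i j. Q s a $$ (i, j)) (\<alpha> b) ss"
  show ?case
  proof (cases "s = h")
    case True
    have "?L b z y = lprod r (contracted n h v Q) \<gamma> ss z y" for b z
      using Cons.prems True by (intro lprod_cong) (auto simp: contracted_def)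
    then have "(\<Sum>b<n h. v $ b * lprod r (\<lambda>s a i j. Q s a $$ (i, j)) (\<alpha> b) (s # ss) x y)
      = (\<Sum>b<n h. \<Sum>z<r. v $ b * Q h b $$ (x, z) * lprod r (contracted n h v Q) \<gamma> ss z y)"
      using True assms(4) by (simp add: sum_distrib_left mult.assoc)
    also have "\<dots> = lprod r (contracted n h v Q) \<gamma> (s # ss) x y"
      using True by (subst sum.swap) (simp add: contracted_def sum_distrib_right)
    finally show ?thesis .
  next
    case False
    have IH: "(\<Sum>b<n h. v $ b * ?L b z y) = lprod r (contracted n h v Q) \<gamma> ss z y" for z
      using Cons.prems False by (intro Cons.IH) auto
    have "(\<Sum>b<n h. v $ b * lprod r (\<lambda>s a i j. Q s a $$ (i, j)) (\<alpha> b) (s # ss) x y)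
      = (\<Sum>b<n h. \<Sum>z<r. Q s (\<gamma> s) $$ (x, z) * (v $ b * ?L b z y))"
      using False Cons.prems(3)[of s] by (simp add: sum_distrib_left mult_ac)
    also have "\<dots> = (\<Sum>z<r. Q s (\<gamma> s) $$ (x, z) * (\<Sum>b<n h. v $ b * ?L b z y))"
      by (subst sum.swap) (simp add: sum_distrib_left)
    also have "\<dots> = lprod r (contracted n h v Q) \<gamma> (s # ss) x y"
      unfolding IH using False by (simp add: contracted_def)
    finally show ?thesis .
  qed
qed auto

lemma sum_PiE_insert:
  fixes f :: "('a \<Rightarrow> 'b) \<Rightarrow> complex"
  assumes "s \<notin> S"
  shows "(\<Sum>g\<in>Pi\<^sub>E (insert s S) I. f g) = (\<Sum>a\<in>I s. \<Sum>g\<in>Pi\<^sub>E S I. f (g(s := a)))"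
proof -
  have "inj_on (\<lambda>(a, g). g(s := a)) (I s \<times> Pi\<^sub>E S I)"
    using assms by (auto simp: inj_on_def PiE_def extensional_def fun_eq_iff; metis)
  then show ?thesis
    by (simp add: PiE_insert_eq sum.reindex sum.cartesian_product case_prod_unfold)
qed

lemma sum_lprod_eq_env:
  assumes "distinct ss"
  shows "(\<Sum>\<gamma>\<in>Pi\<^sub>E (set ss) I. lprod r K \<gamma> ss x y * cnj (lprod r K \<gamma> ss x' y')) = env r K I ss x y x' y'"
  using assms
proof (induction ss arbitrary: x x')
  case (Cons s ss)
  have s: "s \<notin> set ss" using Cons.prems by simp
  have L: "lprod r K (g(s := a)) ss z y = lprod r K g ss z y" for g a z y
    using s by (intro lprod_cong) auto
  have "(\<Sum>\<gamma>\<in>Pi\<^sub>E (set (s # ss)) I. lprod r K \<gamma> (s # ss) x y * cnj (lprod r K \<gamma> (s # ss) x' y'))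
    = (\<Sum>a\<in>I s. \<Sum>g\<in>Pi\<^sub>E (set ss) I. (\<Sum>z<r. K s a x z * lprod r K g ss z y) *
        cnj (\<Sum>z'<r. K s a x' z' * lprod r K g ss z' y'))"
    by (simp add: sum_PiE_insert[OF s] L)
  also have "\<dots> = (\<Sum>a\<in>I s. \<Sum>g\<in>Pi\<^sub>E (set ss) I. \<Sum>z<r. \<Sum>z'<r. K s a x z * cnj (K s a x' z') *
      (lprod r K g ss z y * cnj (lprod r K g ss z' y')))"
    by (simp add: sum_product cnj_sum mult_ac)
  also have "\<dots> = (\<Sum>a\<in>I s. \<Sum>z<r. \<Sum>z'<r. \<Sum>g\<in>Pi\<^sub>E (set ss) I. K s a x z * cnj (K s a x' z') *
      (lprod r K g ss z y * cnj (lprod r K g ss z' y')))"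
    by (intro sum.cong[OF refl], subst sum.swap, intro sum.cong[OF refl], rule sum.swap)
  also have "\<dots> = env r K I (s # ss) x y x' y'"
    using Cons by (simp add: sum_distrib_left[symmetric])
  finally show ?case .
qed (auto simp: PiE_def)

text \<open>The site \<open>h\<close> has a single level and \<open>contracted\<close> ignores its
  index there, so including \<open>h\<close> among the summed sites adds no term.\<close>

lemma sum_tuples_lprod_eq_env:
  assumes "distinct ss" and "h \<in> set ss"
  shows "(\<Sum>\<gamma>\<in>tuples n (set ss - {h}). lprod r (contracted n h v Q) \<gamma> ss x y *
      cnj (lprod r (contracted n h v Q) \<gamma> ss x' y'))
    = env r (contracted n h v Q) (levels n h) ss x y x' y'"
proof -
  let ?L = "\<lambda>\<gamma>. lprod r (contracted n h v Q) \<gamma> ss"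
  have L: "?L (g(h := a)) x y = ?L g x y" for g a x y
    by (rule lprod_cong) (auto simp: contracted_def)
  have "env r (contracted n h v Q) (levels n h) ss x y x' y'
      = (\<Sum>\<gamma>\<in>Pi\<^sub>E (insert h (set ss - {h})) (levels n h). ?L \<gamma> x y * cnj (?L \<gamma> x' y'))"
    using assms by (simp add: sum_lprod_eq_env insert_absorb)
  also have "\<dots> = (\<Sum>g\<in>Pi\<^sub>E (set ss - {h}) (levels n h). ?L g x y * cnj (?L g x' y'))"
    by (subst sum_PiE_insert) (simp_all add: L levels_def)
  also have "Pi\<^sub>E (set ss - {h}) (levels n h) = tuples n (set ss - {h})"
    unfolding tuples_def by (rule PiE_cong) (auto simp: levels_def)
  finally show ?thesis by simp
qed

text \<open>Both unfoldings put the bond \<open>y\<close> shared by the two sites in the slow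
  position, where the identity acts; \<open>W\<close> closes the ring by joining the outer bonds
  \<open>z\<close> and \<open>x\<close> in the fast position.\<close>

lemma unfold_kron_entry:
  assumes "W \<in> carrier_mat r r" and "a < m" and "b < m'"
  shows "(unfold1 m r Qk * kron r (1\<^sub>m r) W * (unfold2 m' r Qj)\<^sup>T) $$ (a, b)
    = (\<Sum>x<r. \<Sum>y<r. \<Sum>z<r. Qj b $$ (x, y) * Qk a $$ (y, z) * W $$ (z, x))"
proof -
  have U: "unfold1 m r Qk \<in> carrier_mat m (r * r)" and V: "(unfold2 m' r Qj)\<^sup>T \<in> carrier_mat (r * r) m'"
    and K: "kron r (1\<^sub>m r) W \<in> carrier_mat (r * r) (r * r)"
    by (auto simp: unfold1_def unfold2_def kron_def)
  have UK: "(unfold1 m r Qk * kron r (1\<^sub>m r) W) $$ (a, t) = (\<Sum>z<r. Qk a $$ (t div r, z) * W $$ (z, t mod r))"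
    if t: "t < r * r" for t
  proof -
    note tt = square_index_div_mod[OF t]
    have "(unfold1 m r Qk * kron r (1\<^sub>m r) W) $$ (a, t)
        = (\<Sum>s<r * r. Qk a $$ (s div r, s mod r) * ((1\<^sub>m r) $$ (s div r, t div r) * W $$ (s mod r, t mod r)))"
      unfolding mult_entry[OF U K assms(2) t]
      using assms t by (intro sum.cong) (auto simp: unfold1_def kron_def)
    also have "\<dots> = (\<Sum>y<r. \<Sum>z<r. Qk a $$ (y, z) * ((1\<^sub>m r) $$ (y, t div r) * W $$ (z, t mod r)))"
      by (rule sum_lessThan_square)
    also have "\<dots> = (\<Sum>y<r. if y = t div r then \<Sum>z<r. Qk a $$ (y, z) * W $$ (z, t mod r) else 0)"
      using tt by (intro sum.cong) auto
    also have "\<dots> = (\<Sum>z<r. Qk a $$ (t div r, z) * W $$ (z, t mod r))"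
      using tt by simp
    finally show ?thesis .
  qed
  have "(unfold1 m r Qk * kron r (1\<^sub>m r) W * (unfold2 m' r Qj)\<^sup>T) $$ (a, b)
      = (\<Sum>t<r * r. (\<Sum>z<r. Qk a $$ (t div r, z) * W $$ (z, t mod r)) * Qj b $$ (t mod r, t div r))"
    unfolding mult_entry[OF mult_carrier_mat[OF U K] V assms(2,3)]
    using assms by (intro sum.cong) (auto simp: UK unfold2_def)
  also have "\<dots> = (\<Sum>y<r. \<Sum>x<r. (\<Sum>z<r. Qk a $$ (y, z) * W $$ (z, x)) * Qj b $$ (x, y))"
    by (rule sum_lessThan_square)
  also have "\<dots> = (\<Sum>x<r. \<Sum>y<r. \<Sum>z<r. Qj b $$ (x, y) * Qk a $$ (y, z) * W $$ (z, x))"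
    by (subst sum.swap) (simp add: sum_distrib_left mult_ac)
  finally show ?thesis .
qed

text \<open>Both indices of site \<open>h\<close> are contracted with \<open>v\<close>, so each
  slice entry is a sum over the other sites of a contracted ket times a contracted bra. The bra does
  not depend on the entry and is absorbed into \<open>W\<close>.\<close>

lemma marginal_slice_eq:
  assumes Q: "\<And>k a. Q k a \<in> carrier_mat r r" and j: "j < d" and d: "3 \<le> d"
    and h: "h \<in> {..<d} - {j, Suc j mod d}"
  shows "marginal_slice n (marginal d n (mps_state d r Q)) h v j (Suc j mod d)
    = unfold1 (n (Suc j mod d)) r (Q (Suc j mod d)) * kron r (1\<^sub>m r) (env_matrix d r n Q j h v) *
      (unfold2 (n j) r (Q j))\<^sup>T"
proof (rule eq_matI)
  define k where "k = Suc j mod d"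
  define ss where "ss = rest d j"
  have d2: "2 \<le> d" using d by simp
  have dist: "distinct ss" and set: "set ss = {..<d} - {j, k}" and jk: "j \<noteq> k"
    using rest_props[OF j d2] by (auto simp: ss_def k_def)
  have hss: "h \<in> set ss" and hjk: "h \<noteq> j" "h \<noteq> k" using h set by (auto simp: k_def)
  let ?W = "env_matrix d r n Q j h v"
  let ?C = "contracted n h v Q"
  have W: "?W \<in> carrier_mat r r" by (simp add: env_matrix_def)
  fix a b
  assume "a < dim_row (unfold1 (n (Suc j mod d)) r (Q (Suc j mod d)) * kron r (1\<^sub>m r) ?W * (unfold2 (n j) r (Q j))\<^sup>T)"
    and "b < dim_col (unfold1 (n (Suc j mod d)) r (Q (Suc j mod d)) * kron r (1\<^sub>m r) ?W * (unfold2 (n j) r (Q j))\<^sup>T)"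
  then have a: "a < n k" and b: "b < n j" by (auto simp: unfold1_def unfold2_def k_def)
  define T where "T = {..<d} - {h, j, k}"
  have T: "tuples n T = tuples n (set ss - {h})" unfolding T_def set by (intro arg_cong[of _ _ "tuples n"]) auto
  define P where "P b a \<gamma> = (\<Sum>x<r. \<Sum>y<r. \<Sum>z<r. Q j b $$ (x, y) * Q k a $$ (y, z) * lprod r ?C \<gamma> ss z x)" for b a \<gamma>
  \<comment> \<open>With the trace opened at site \<open>j\<close>, the state is linear in the
    factor of \<open>h\<close>; contraction with \<open>v\<close> replaces that factor by the
    contracted one.\<close>
  have psi: "(\<Sum>c<n h. v $ c * mps_state d r Q (override_on \<gamma> ((\<lambda>_. 0)(h := c, j := b, k := a)) {h, j, k})) = P b a \<gamma>"
    for a b \<gamma>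
  proof -
    define \<alpha> where "\<alpha> c = override_on \<gamma> ((\<lambda>_. 0)(h := c, j := b, k := a)) {h, j, k}" for c
    have al: "\<alpha> c j = b" "\<alpha> c k = a" "\<alpha> c h = c" for c
      using jk hjk by (auto simp: \<alpha>_def override_on_def)
    have contr: "(\<Sum>c<n h. v $ c * lprod r (\<lambda>s a i j. Q s a $$ (i, j)) (\<alpha> c) ss z x) = lprod r ?C \<gamma> ss z x" for z x
      using dist hss set by (intro lprod_contracted al) (auto simp: \<alpha>_def override_on_def)
    have "(\<Sum>c<n h. v $ c * mps_state d r Q (\<alpha> c))
        = (\<Sum>c<n h. \<Sum>x<r. \<Sum>y<r. \<Sum>z<r. Q j b $$ (x, y) * Q k a $$ (y, z) *
            (v $ c * lprod r (\<lambda>s a i j. Q s a $$ (i, j)) (\<alpha> c) ss z x))"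
      by (simp add: mps_state_cyclic[OF Q j d2] al sum_distrib_left mult_ac flip: ss_def k_def)
    also have "\<dots> = (\<Sum>x<r. \<Sum>c<n h. \<Sum>y<r. \<Sum>z<r. Q j b $$ (x, y) * Q k a $$ (y, z) *
            (v $ c * lprod r (\<lambda>s a i j. Q s a $$ (i, j)) (\<alpha> c) ss z x))"
      by (rule sum.swap)
    also have "\<dots> = (\<Sum>x<r. \<Sum>y<r. \<Sum>z<r. \<Sum>c<n h. Q j b $$ (x, y) * Q k a $$ (y, z) *
            (v $ c * lprod r (\<lambda>s a i j. Q s a $$ (i, j)) (\<alpha> c) ss z x))"
      by (intro sum.cong[OF refl], subst sum.swap, intro sum.cong[OF refl], rule sum.swap)
    also have "\<dots> = P b a \<gamma>"
      by (simp add: P_def sum_distrib_left[symmetric] contr)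
    finally show ?thesis unfolding \<alpha>_def .
  qed
  \<comment> \<open>Index 0 at both sites of the pair makes their product a fixed matrix, which is
    exactly the conjugated factor in \<open>env_matrix\<close>.\<close>
  have P0: "P 0 0 \<gamma> = (\<Sum>p<r. \<Sum>q<r. (\<Sum>w<r. Q j 0 $$ (p, w) * Q k 0 $$ (w, q)) * lprod r ?C \<gamma> ss q p)" for \<gamma>
    unfolding P_def sum_distrib_right by (intro sum.cong[OF refl] sum.swap)
  have PP: "(\<Sum>\<gamma>\<in>tuples n T. lprod r ?C \<gamma> ss z x * cnj (P 0 0 \<gamma>)) = ?W $$ (z, x)" if "z < r" "x < r" for z x
  proof -
    have "(\<Sum>\<gamma>\<in>tuples n T. lprod r ?C \<gamma> ss z x * cnj (P 0 0 \<gamma>))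
      = (\<Sum>\<gamma>\<in>tuples n T. \<Sum>p<r. \<Sum>q<r. cnj (\<Sum>w<r. Q j 0 $$ (p, w) * Q k 0 $$ (w, q)) *
          (lprod r ?C \<gamma> ss z x * cnj (lprod r ?C \<gamma> ss q p)))"
      by (simp only: P0 cnj_sum complex_cnj_mult sum_distrib_left mult_ac)
    also have "\<dots> = (\<Sum>p<r. \<Sum>q<r. \<Sum>\<gamma>\<in>tuples n T. cnj (\<Sum>w<r. Q j 0 $$ (p, w) * Q k 0 $$ (w, q)) *
          (lprod r ?C \<gamma> ss z x * cnj (lprod r ?C \<gamma> ss q p)))"
      by (subst sum.swap, intro sum.cong[OF refl], rule sum.swap)
    also have "\<dots> = ?W $$ (z, x)"
      using that by (simp add: T env_matrix_def sum_tuples_lprod_eq_env[OF dist hss] sum_distrib_left[symmetric]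
          del: cnj_sum flip: ss_def k_def)
    finally show ?thesis .
  qed
  have "marginal_slice n (marginal d n (mps_state d r Q)) h v j (Suc j mod d) $$ (a, b)
    = (\<Sum>c<n h. \<Sum>c'<n h. (v $ c) * cnj (v $ c') * (\<Sum>\<gamma>\<in>tuples n T.
        mps_state d r Q (override_on \<gamma> ((\<lambda>_. 0)(h := c, j := b, k := a)) {h, j, k}) *
        cnj (mps_state d r Q (override_on \<gamma> ((\<lambda>_. 0)(h := c', j := 0, k := 0)) {h, j, k}))))"
    using a b by (simp add: marginal_slice_def marginal_def T_def flip: k_def)
  also have "\<dots> = (\<Sum>c<n h. \<Sum>c'<n h. \<Sum>\<gamma>\<in>tuples n T.
        (v $ c * mps_state d r Q (override_on \<gamma> ((\<lambda>_. 0)(h := c, j := b, k := a)) {h, j, k})) *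
        cnj (v $ c' * mps_state d r Q (override_on \<gamma> ((\<lambda>_. 0)(h := c', j := 0, k := 0)) {h, j, k})))"
    by (simp add: sum_distrib_left mult_ac)
  also have "\<dots> = (\<Sum>\<gamma>\<in>tuples n T. \<Sum>c<n h. \<Sum>c'<n h.
        (v $ c * mps_state d r Q (override_on \<gamma> ((\<lambda>_. 0)(h := c, j := b, k := a)) {h, j, k})) *
        cnj (v $ c' * mps_state d r Q (override_on \<gamma> ((\<lambda>_. 0)(h := c', j := 0, k := 0)) {h, j, k})))"
    by (subst (2) sum.swap, subst sum.swap, rule refl)
  also have "\<dots> = (\<Sum>\<gamma>\<in>tuples n T. P b a \<gamma> * cnj (P 0 0 \<gamma>))"
    unfolding sum_product[symmetric] cnj_sum[symmetric] psi ..
  also have "\<dots> = (\<Sum>\<gamma>\<in>tuples n T. \<Sum>x<r. \<Sum>y<r. \<Sum>z<r. Q j b $$ (x, y) * Q k a $$ (y, z) *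
      (lprod r ?C \<gamma> ss z x * cnj (P 0 0 \<gamma>)))"
    unfolding P_def[of b a] by (simp add: sum_distrib_right mult.assoc)
  also have "\<dots> = (\<Sum>x<r. \<Sum>y<r. \<Sum>z<r. \<Sum>\<gamma>\<in>tuples n T. Q j b $$ (x, y) * Q k a $$ (y, z) *
      (lprod r ?C \<gamma> ss z x * cnj (P 0 0 \<gamma>)))"
    by (subst sum.swap, intro sum.cong[OF refl], subst sum.swap, intro sum.cong[OF refl], rule sum.swap)
  also have "\<dots> = (\<Sum>x<r. \<Sum>y<r. \<Sum>z<r. Q j b $$ (x, y) * Q k a $$ (y, z) * ?W $$ (z, x))"
    by (intro sum.cong[OF refl]) (simp add: sum_distrib_left[symmetric] PP)
  also have "\<dots> = (unfold1 (n k) r (Q k) * kron r (1\<^sub>m r) ?W * (unfold2 (n j) r (Q j))\<^sup>T) $$ (a, b)"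
    by (rule unfold_kron_entry[OF W a b, symmetric])
  finally show "marginal_slice n (marginal d n (mps_state d r Q)) h v j (Suc j mod d) $$ (a, b)
    = (unfold1 (n (Suc j mod d)) r (Q (Suc j mod d)) * kron r (1\<^sub>m r) ?W * (unfold2 (n j) r (Q j))\<^sup>T) $$ (a, b)"
    by (simp add: k_def)
qed (auto simp: marginal_slice_def unfold1_def unfold2_def kron_def)

lemma env_line_poly:
  assumes "\<And>s a x y. s \<in> set ss \<Longrightarrow> a \<in> J s \<Longrightarrow> x < r \<Longrightarrow> y < r \<Longrightarrow> line_poly I (\<lambda>w. K w s a x y)"
    and "x < r" and "x' < r"
  shows "line_poly I (\<lambda>w. env r (K w) J ss x y x' y')"
  using assms
proof (induction ss arbitrary: x x')
  case (Cons s ss)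
  show ?case
    unfolding env.simps
    by (intro line_poly_sum line_poly_mult line_poly_cnj Cons.IH Cons.prems) (use Cons.prems in auto)
qed auto

section \<open>Pseudoinverses and full column rank\<close>

lemma mat_adjoint_eq: "mat_adjoint A = Matrix.mat (dim_col A) (dim_row A) (\<lambda>(i, j). cnj (A $$ (j, i)))"
  by (rule eq_matI) (auto simp: mat_adjoint_def mat_of_rows_def conjugate_vec_def)

lemma mat_adjoint_carrier [simp]: "(A :: complex mat) \<in> carrier_mat m k \<Longrightarrow> mat_adjoint A \<in> carrier_mat k m"
  by (auto simp: mat_adjoint_eq)

lemma mat_adjoint_index: "A \<in> carrier_mat m k \<Longrightarrow> i < k \<Longrightarrow> j < m \<Longrightarrow> mat_adjoint A $$ (i, j) = cnj (A $$ (j, i))"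
  by (auto simp: mat_adjoint_eq)

lemma mat_adjoint_adjoint: "mat_adjoint (mat_adjoint A) = (A :: complex mat)"
  by (rule eq_matI) (auto simp: mat_adjoint_eq)

lemma mat_adjoint_one: "mat_adjoint (1\<^sub>m r) = (1\<^sub>m r :: complex mat)"
  by (rule eq_matI) (auto simp: mat_adjoint_eq)

lemma mat_adjoint_mult:
  fixes A B :: "complex mat"
  assumes "A \<in> carrier_mat m k" and "B \<in> carrier_mat k l"
  shows "mat_adjoint (A * B) = mat_adjoint B * mat_adjoint A"
proof (rule eq_matI)
  fix i j assume "i < dim_row (mat_adjoint B * mat_adjoint A)" "j < dim_col (mat_adjoint B * mat_adjoint A)"
  then have ij: "i < l" "j < m" using assms by (auto simp: mat_adjoint_eq)
  show "mat_adjoint (A * B) $$ (i, j) = (mat_adjoint B * mat_adjoint A) $$ (i, j)"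
    unfolding mat_adjoint_index[OF mult_carrier_mat[OF assms] ij] mult_entry[OF assms ij(2,1)]
      mult_entry[OF mat_adjoint_carrier[OF assms(2)] mat_adjoint_carrier[OF assms(1)] ij]
    using ij assms by (simp add: mat_adjoint_index mult.commute)
qed (use assms in \<open>auto simp: mat_adjoint_eq\<close>)

lemma is_pinv_unique:
  assumes A: "A \<in> carrier_mat m k" and X: "is_pinv A X" and Y: "is_pinv A Y"
  shows "X = Y"
proof -
  have c: "X \<in> carrier_mat k m" "Y \<in> carrier_mat k m" using X Y A by (auto simp: is_pinv_def)
  have X1: "A * X * A = A" "X * A * X = X" "mat_adjoint (A * X) = A * X" "mat_adjoint (X * A) = X * A"
    and Y1: "A * Y * A = A" "Y * A * Y = Y" "mat_adjoint (A * Y) = A * Y" "mat_adjoint (Y * A) = Y * A"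
    using X Y by (auto simp: is_pinv_def)
  have cc: "A * X \<in> carrier_mat m m" "A * Y \<in> carrier_mat m m" "X * A \<in> carrier_mat k k" "Y * A \<in> carrier_mat k k"
    using A c by (auto intro: mult_carrier_mat)
  have "A * X = (A * Y) * (A * X)"
    using Y1(1) by (metis assoc_mult_mat[OF cc(2) A c(1)])
  then have "A * X = mat_adjoint ((A * Y) * (A * X))" using X1(3) by simp
  also have "\<dots> = (A * X) * (A * Y)" using mat_adjoint_mult[OF cc(2,1)] X1(3) Y1(3) by simp
  also have "\<dots> = A * Y" using X1(1) by (metis assoc_mult_mat[OF cc(1) A c(2)])
  finally have AXY: "A * X = A * Y" .
  have "X * A = (X * A) * (Y * A)"
    using Y1(1) by (metis assoc_mult_mat[OF c(1) A cc(4)] assoc_mult_mat[OF A c(2) A])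
  then have "X * A = mat_adjoint ((X * A) * (Y * A))" using X1(4) by simp
  also have "\<dots> = (Y * A) * (X * A)" using mat_adjoint_mult[OF cc(3,4)] X1(4) Y1(4) by simp
  also have "\<dots> = Y * A" using X1(1) by (metis assoc_mult_mat[OF c(2) A cc(3)] assoc_mult_mat[OF A c(1) A])
  finally have XYA: "X * A = Y * A" .
  have "X = Y * A * X" using X1(2) XYA by simp
  also have "\<dots> = Y * (A * Y)" using assoc_mult_mat[OF c(2) A c(1)] AXY by simp
  also have "\<dots> = Y" using assoc_mult_mat[OF c(2) A c(2)] Y1(2) by simp
  finally show ?thesis .
qed

lemma pinv_eqI:
  assumes "A \<in> carrier_mat m k" and "is_pinv A X"
  shows "pinv A = X"
  unfolding pinv_def using assms is_pinv_unique by (intro the_equality) blast+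

text \<open>The left inverse is what matrix identities use; the Gram determinant turns the condition
  into a polynomial one in the entries and their conjugates.\<close>

definition full_col_rank :: "nat \<Rightarrow> nat \<Rightarrow> complex mat \<Rightarrow> bool" where
  "full_col_rank m k P \<longleftrightarrow> P \<in> carrier_mat m k \<and> (\<exists>L\<in>carrier_mat k m. L * P = 1\<^sub>m k)"

lemma full_col_rank_of_gram:
  assumes P: "P \<in> carrier_mat m k" and det: "det (mat_adjoint P * P) \<noteq> 0"
  shows "full_col_rank m k P"
proof -
  let ?G = "mat_adjoint P * P"
  have G: "?G \<in> carrier_mat k k" using P by (intro mult_carrier_mat) auto
  note m = minv[OF G det]
  have "minv ?G * mat_adjoint P * P = 1\<^sub>m k"
    using assoc_mult_mat[OF m(1) mat_adjoint_carrier[OF P] P] m(3) by simp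
  then show ?thesis
    using P mult_carrier_mat[OF m(1) mat_adjoint_carrier[OF P]] unfolding full_col_rank_def by blast
qed

text \<open>A kernel vector \<open>y\<close> of the Gram matrix makes the squared norm of
  \<open>P\<close> applied to \<open>y\<close> vanish, and the left inverse of \<open>P\<close> then
  gives \<open>y = 0\<close>.\<close>

lemma gram_of_full_col_rank:
  assumes "full_col_rank m k P"
  shows "det (mat_adjoint P * P) \<noteq> 0"
proof -
  obtain L where P: "P \<in> carrier_mat m k" and L: "L \<in> carrier_mat k m" "L * P = 1\<^sub>m k"
    using assms unfolding full_col_rank_def by blast
  let ?G = "mat_adjoint P * P"
  have G: "?G \<in> carrier_mat k k" using P by (intro mult_carrier_mat) auto
  show ?thesis
  proof (rule det_nonzeroI[OF G], intro allI impI)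
    fix y j assume y: "\<And>i. i < k \<Longrightarrow> (\<Sum>j<k. ?G $$ (i, j) * y j) = 0" and j: "j < k"
    define z where "z a = (\<Sum>j<k. P $$ (a, j) * y j)" for a
    have "(\<Sum>i<k. cnj (y i) * (\<Sum>j<k. ?G $$ (i, j) * y j))
        = (\<Sum>i<k. \<Sum>j<k. \<Sum>a<m. cnj (P $$ (a, i) * y i) * (P $$ (a, j) * y j))"
      using P by (simp add: mult_entry[OF mat_adjoint_carrier[OF P] P] mat_adjoint_index[OF P]
          sum_distrib_left sum_distrib_right mult_ac)
    also have "\<dots> = (\<Sum>a<m. cnj (z a) * z a)"
      unfolding z_def cnj_sum sum_product
      by (subst sum.swap, subst (2) sum.swap, subst (3) sum.swap, rule sum.swap)
    finally have "(\<Sum>a<m. cnj (z a) * z a) = 0" using y by simp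
    moreover have "cnj (z a) * z a = of_real ((cmod (z a))\<^sup>2)" for a
      by (metis complex_norm_square mult.commute)
    ultimately have "of_real (\<Sum>a<m. (cmod (z a))\<^sup>2) = (0 :: complex)" by simp
    then have "(\<Sum>a<m. (cmod (z a))\<^sup>2) = 0" by (metis of_real_eq_0_iff)
    then have za: "z a = 0" if "a < m" for a
      using that by (subst (asm) sum_nonneg_eq_0_iff) auto
    have "y j = (\<Sum>i<k. (L * P) $$ (j, i) * y i)"
      using L(2) j by (simp add: if_distrib[of "\<lambda>x. x * y _"] cong: if_cong)
    also have "\<dots> = (\<Sum>i<k. \<Sum>a<m. L $$ (j, a) * (P $$ (a, i) * y i))"
      using j by (simp add: mult_entry[OF L(1) P] sum_distrib_right mult.assoc)
    also have "\<dots> = (\<Sum>a<m. L $$ (j, a) * z a)"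
      by (subst sum.swap) (simp add: z_def sum_distrib_left)
    finally show "y j = 0" using za by simp
  qed
qed

lemma mat_adjoint_minv:
  assumes G: "G \<in> carrier_mat k k" and "det G \<noteq> 0" and "mat_adjoint G = G"
  shows "mat_adjoint (minv G) = minv G"
proof (rule minv_eqI[OF G, symmetric])
  note m = minv[OF assms(1,2)]
  show "mat_adjoint (minv G) \<in> carrier_mat k k" using m by simp
  show "G * mat_adjoint (minv G) = 1\<^sub>m k"
    using mat_adjoint_mult[OF m(1) G] m(3) assms(3) by (simp add: mat_adjoint_one)
qed

lemma pinv_full_col_rank:
  assumes "full_col_rank m k P"
  shows "pinv P \<in> carrier_mat k m" and "pinv P * P = 1\<^sub>m k"
    and "mat_adjoint (P * pinv P) = P * pinv P"
proof -
  have P: "P \<in> carrier_mat m k" using assms unfolding full_col_rank_def by blast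
  let ?G = "mat_adjoint P * P" and ?H = "mat_adjoint P"
  have H: "?H \<in> carrier_mat k m" using P by simp
  have G: "?G \<in> carrier_mat k k" using P by (intro mult_carrier_mat) auto
  note det = gram_of_full_col_rank[OF assms]
  note m = minv[OF G det]
  define X where "X = minv ?G * ?H"
  have X: "X \<in> carrier_mat k m" unfolding X_def by (rule mult_carrier_mat[OF m(1) H])
  have XP: "X * P = 1\<^sub>m k"
    unfolding X_def assoc_mult_mat[OF m(1) H P] by (rule m(3))
  have "mat_adjoint ?G = ?G" using mat_adjoint_mult[OF H P] by (simp add: mat_adjoint_adjoint)
  note aG = mat_adjoint_minv[OF G det this]
  have "mat_adjoint (P * X) = mat_adjoint X * ?H" by (rule mat_adjoint_mult[OF P X])
  also have "mat_adjoint X = P * minv ?G"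
    unfolding X_def mat_adjoint_mult[OF m(1) H] aG mat_adjoint_adjoint ..
  also have "P * minv ?G * ?H = P * X" unfolding X_def by (rule assoc_mult_mat[OF P m(1) H])
  finally have PX: "mat_adjoint (P * X) = P * X" .
  have "is_pinv P X"
    unfolding is_pinv_def
  proof (intro conjI)
    show "P * X * P = P" using assoc_mult_mat[OF P X P] XP P by simp
  qed (use P X XP PX in \<open>auto simp: mat_adjoint_one\<close>)
  then have "pinv P = X" by (rule pinv_eqI[OF P])
  then show "pinv P \<in> carrier_mat k m" "pinv P * P = 1\<^sub>m k" "mat_adjoint (P * pinv P) = P * pinv P"
    using X XP PX by simp_all
qed

lemma full_col_rank_mult:
  assumes "full_col_rank m k P" and G: "G \<in> carrier_mat k k" and "det G \<noteq> 0"
  shows "full_col_rank m k (P * G)"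
proof -
  obtain L where P: "P \<in> carrier_mat m k" and L: "L \<in> carrier_mat k m" "L * P = 1\<^sub>m k"
    using assms(1) unfolding full_col_rank_def by blast
  note m = minv[OF assms(2,3)]
  have "minv G * L * (P * G) = minv G * (L * (P * G))"
    by (rule assoc_mult_mat[OF m(1) L(1) mult_carrier_mat[OF P G]])
  also have "L * (P * G) = L * P * G" by (rule assoc_mult_mat[OF L(1) P G, symmetric])
  finally have "minv G * L * (P * G) = 1\<^sub>m k" using L(2) G m(3) by simp
  then show ?thesis
    using mult_carrier_mat[OF P G] mult_carrier_mat[OF m(1) L(1)] unfolding full_col_rank_def by blast
qed

text \<open>\<open>P * N\<close> with \<open>N = H * V\<^sup>T\<close> is a full rank factorization,
  so its pseudoinverse is the product of those of \<open>N\<close> and \<open>P\<close> in reverse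
  order. Moreover \<open>V\<^sup>T\<close> times the pseudoinverse of \<open>N\<close> is the
  inverse of \<open>H\<close>, so \<open>V\<close> cancels.\<close>

lemma mult_pinv_cancel:
  assumes P: "full_col_rank m k P" and V: "full_col_rank l k V"
    and G: "G \<in> carrier_mat k k" and H: "H \<in> carrier_mat k k" and det: "det H \<noteq> 0"
  shows "(P * G * V\<^sup>T) * pinv (P * H * V\<^sup>T) = P * (G * minv H) * pinv P"
proof -
  have cP: "P \<in> carrier_mat m k" and cV: "V \<in> carrier_mat l k" using P V unfolding full_col_rank_def by blast+
  obtain LV where LV: "LV \<in> carrier_mat k l" "LV * V = 1\<^sub>m k" using V unfolding full_col_rank_def by blast
  have cVT: "V\<^sup>T \<in> carrier_mat k l" using cV by simp
  note m = minv[OF H det]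
  note p = pinv_full_col_rank[OF P]
  define N where "N = H * V\<^sup>T"
  have N: "N \<in> carrier_mat k l" unfolding N_def by (rule mult_carrier_mat[OF H cVT])
  \<comment> \<open>\<open>N\<close> has full row rank; its pseudoinverse \<open>R\<close> is
    obtained from that of its adjoint, which has full column rank.\<close>
  have "full_col_rank l k (mat_adjoint N)"
  proof -
    define R where "R = LV\<^sup>T * minv H"
    have R: "R \<in> carrier_mat l k" unfolding R_def using LV m by (intro mult_carrier_mat) auto
    have LVT: "LV\<^sup>T \<in> carrier_mat l k" using LV by simp
    have "V\<^sup>T * LV\<^sup>T = 1\<^sub>m k" using transpose_mult[OF LV(1) cV] LV(2) by simp
    then have "V\<^sup>T * R = minv H"
      unfolding R_def using assoc_mult_mat[OF cVT LVT m(1)] m(1) by simp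
    then have "N * R = 1\<^sub>m k"
      unfolding N_def using assoc_mult_mat[OF H cVT R] m(2) by simp
    then have "mat_adjoint R * mat_adjoint N = 1\<^sub>m k"
      using mat_adjoint_mult[OF N R] by (simp add: mat_adjoint_one)
    then show ?thesis
      using N R mat_adjoint_carrier[OF N] mat_adjoint_carrier[OF R] unfolding full_col_rank_def by blast
  qed
  note q = pinv_full_col_rank[OF this]
  define R where "R = mat_adjoint (pinv (mat_adjoint N))"
  have R: "R \<in> carrier_mat l k" unfolding R_def using q(1) by simp
  have NR: "N * R = 1\<^sub>m k"
    using mat_adjoint_mult[OF q(1) mat_adjoint_carrier[OF N]] q(2)
    by (simp add: R_def mat_adjoint_adjoint mat_adjoint_one)
  have RN: "mat_adjoint (R * N) = R * N"
    using mat_adjoint_mult[OF mat_adjoint_carrier[OF N] q(1)] mat_adjoint_mult[OF R N] q(3)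
    by (simp add: R_def mat_adjoint_adjoint)
  define A where "A = P * N"
  have A: "A \<in> carrier_mat m l" unfolding A_def by (rule mult_carrier_mat[OF cP N])
  define X where "X = R * pinv P"
  have X: "X \<in> carrier_mat l m" unfolding X_def by (rule mult_carrier_mat[OF R p(1)])
  have NX: "N * X = pinv P"
    unfolding X_def assoc_mult_mat[OF N R p(1), symmetric] NR using p(1) by simp
  have AX: "A * X = P * pinv P" unfolding A_def assoc_mult_mat[OF cP N X] NX ..
  have XA: "X * A = R * N"
  proof -
    have "pinv P * A = N"
      unfolding A_def assoc_mult_mat[OF p(1) cP N, symmetric] p(2) using N by simp
    then show ?thesis unfolding X_def assoc_mult_mat[OF R p(1) A] by simp
  qed
  have "is_pinv A X"
    unfolding is_pinv_def
  proof (intro conjI)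
    have "A * X * A = P * pinv P * A" unfolding AX ..
    also have "\<dots> = P * (pinv P * P * N)"
      unfolding A_def using assoc_mult_mat[OF mult_carrier_mat[OF cP p(1)] cP N]
        assoc_mult_mat[OF cP p(1) cP] assoc_mult_mat[OF cP mult_carrier_mat[OF p(1) cP] N] by simp
    also have "\<dots> = A" unfolding p(2) A_def using N by simp
    finally show "A * X * A = A" .
    have "X * A * X = R * (N * X)" unfolding XA by (rule assoc_mult_mat[OF R N X])
    then show "X * A * X = X" unfolding NX unfolding X_def .
  qed (use A X AX XA p(3) RN in auto)
  then have pA: "pinv A = X" by (rule pinv_eqI[OF A])
  have VR: "V\<^sup>T * R = minv H"
  proof -
    have "minv H * N = V\<^sup>T" unfolding N_def assoc_mult_mat[OF m(1) H cVT, symmetric] m(3) using cVT by simp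
    then have "V\<^sup>T * R = minv H * (N * R)" using assoc_mult_mat[OF m(1) N R] by simp
    then show ?thesis unfolding NR using m(1) by simp
  qed
  have PG: "P * G \<in> carrier_mat m k" by (rule mult_carrier_mat[OF cP G])
  have "P * H * V\<^sup>T = A" unfolding A_def N_def by (rule assoc_mult_mat[OF cP H cVT])
  then have "(P * G * V\<^sup>T) * pinv (P * H * V\<^sup>T) = P * G * V\<^sup>T * (R * pinv P)"
    using pA by (simp add: X_def)
  also have "\<dots> = P * G * (V\<^sup>T * R * pinv P)"
    using assoc_mult_mat[OF PG cVT mult_carrier_mat[OF R p(1)]] assoc_mult_mat[OF cVT R p(1)] by simp
  also have "\<dots> = P * (G * minv H) * pinv P"
    unfolding VR using assoc_mult_mat[OF PG m(1) p(1)] assoc_mult_mat[OF cP G m(1)] by simp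
  finally show ?thesis .
qed

section \<open>Full column rank and the rank of a set of columns\<close>

lemma full_col_rank_kernel:
  assumes "full_col_rank m k E" and "v \<in> carrier_vec k" and "E *\<^sub>v v = 0\<^sub>v m"
  shows "v = 0\<^sub>v k"
proof -
  obtain L where E: "E \<in> carrier_mat m k" and L: "L \<in> carrier_mat k m" "L * E = 1\<^sub>m k"
    using assms(1) unfolding full_col_rank_def by blast
  have "v = (L * E) *\<^sub>v v" using L(2) assms(2) by simp
  also have "\<dots> = L *\<^sub>v (E *\<^sub>v v)" by (rule assoc_mult_mat_vec[OF L(1) E assms(2)])
  also have "\<dots> = 0\<^sub>v k" unfolding assms(3) using L(1) by (intro eq_vecI) (auto simp: scalar_prod_def)
  finally show ?thesis .
qed

lemma full_col_rank_distinct_cols: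
  assumes "full_col_rank m k E"
  shows "distinct (cols E)"
proof -
  obtain L where E: "E \<in> carrier_mat m k" and L: "L \<in> carrier_mat k m" "L * E = 1\<^sub>m k"
    using assms(1) unfolding full_col_rank_def by blast
  show ?thesis
    unfolding distinct_conv_nth
  proof (intro allI impI notI)
    fix i j assume ij: "i < length (cols E)" "j < length (cols E)" "i \<noteq> j" "cols E ! i = cols E ! j"
    then have k: "i < k" "j < k" using E by auto
    have "E $$ (x, i) = E $$ (x, j)" if "x < m" for x
    proof -
      have "col E i = col E j" using ij k E by auto
      then have "col E i $ x = col E j $ x" by simp
      then show ?thesis using that k E by simp
    qed
    then have "(L * E) $$ (i, i) = (L * E) $$ (i, j)"
      using k by (simp add: mult_entry[OF L(1) E])
    then show False using k ij(3) L(2) by simp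
  qed
qed

lemma rank_full_col_rank:
  assumes "full_col_rank m k E"
  shows "vec_space.rank m E = k"
proof -
  interpret vec_space "TYPE(complex)" m .
  have E: "E \<in> carrier_mat m k" using assms unfolding full_col_rank_def by blast
  have dist: "distinct (cols E)" by (rule full_col_rank_distinct_cols[OF assms])
  have "lin_indpt (set (cols E))"
  proof
    assume "lin_dep (set (cols E))"
    then obtain v where "v \<in> carrier_vec k" "v \<noteq> 0\<^sub>v k" "E *\<^sub>v v = 0\<^sub>v m"
      using lin_depE[OF E _ dist] by blast
    then show False using full_col_rank_kernel[OF assms] by blast
  qed
  then show ?thesis by (rule lin_indpt_full_rank[OF E dist])
qed

text \<open>The rank is the size of a maximal independent subset of the set of columns. Rank
  \<open>k\<close> forces the \<open>k\<close> columns to be distinct, so independence of the set is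
  independence of the list.\<close>

lemma rank_kernel:
  fixes E :: "complex mat"
  assumes E: "E \<in> carrier_mat m k" and rank: "vec_space.rank m E = k"
    and v: "v \<in> carrier_vec k" "E *\<^sub>v v = 0\<^sub>v m"
  shows "v = 0\<^sub>v k"
proof -
  interpret vec_space "TYPE(complex)" m .
  have "distinct (cols E)"
  proof -
    obtain S where S: "maximal S (\<lambda>T. T \<subseteq> set (cols E) \<and> lin_indpt T)"
      using maximal_exists[of "(\<lambda>T. T \<subseteq> set (cols E) \<and> lin_indpt T)" "card (set (cols E))" "{}"]
      by (meson List.finite_set card_mono empty_iff empty_subsetI finite_lin_indpt2 rev_finite_subset)
    then have "card S = k" using rank_card_indpt[OF E S] rank by simp
    moreover have "S \<subseteq> set (cols E)" using S unfolding maximal_def by blast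
    ultimately have "k \<le> card (set (cols E))" using card_mono by blast
    then have "card (set (cols E)) = length (cols E)"
      using card_length[of "cols E"] E by (intro antisym) auto
    then show ?thesis by (rule card_distinct)
  qed
  then show ?thesis
    using full_rank_lin_indpt[OF E rank] lin_depI[OF E v(1) _ v(2)] by blast
qed

section \<open>Kronecker products and block diagonal matrices\<close>

lemma kron_carrier [simp]: "kron r A B \<in> carrier_mat (r * r) (r * r)"
  by (simp add: kron_def)

lemma kron_index:
  assumes "s < r * r" "t < r * r"
  shows "kron r A B $$ (s, t) = A $$ (s div r, t div r) * B $$ (s mod r, t mod r)"
  using assms by (simp add: kron_def)

lemma square_eq_matI:
  assumes "A \<in> carrier_mat n k" and "B \<in> carrier_mat n k"
    and "\<And>i j. i < n \<Longrightarrow> j < k \<Longrightarrow> A $$ (i, j) = B $$ (i, j)"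
  shows "A = B"
  using assms by (intro eq_matI) auto

lemma kron_mult:
  assumes "A \<in> carrier_mat r r" "B \<in> carrier_mat r r" "C \<in> carrier_mat r r" "D \<in> carrier_mat r r"
  shows "kron r A B * kron r C D = kron r (A * C) (B * D)"
proof (rule square_eq_matI[of _ "r * r" "r * r"])
  fix s t assume st: "s < r * r" "t < r * r"
  note sd = square_index_div_mod[OF st(1)] square_index_div_mod[OF st(2)]
  have "(kron r A B * kron r C D) $$ (s, t) = (\<Sum>u<r * r. A $$ (s div r, u div r) * B $$ (s mod r, u mod r) *
      (C $$ (u div r, t div r) * D $$ (u mod r, t mod r)))"
    unfolding mult_entry[OF kron_carrier kron_carrier st] using st by (simp add: kron_index)
  also have "\<dots> = (\<Sum>a<r. \<Sum>b<r. A $$ (s div r, a) * B $$ (s mod r, b) * (C $$ (a, t div r) * D $$ (b, t mod r)))"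
    by (rule sum_lessThan_square)
  also have "\<dots> = (\<Sum>a<r. A $$ (s div r, a) * C $$ (a, t div r)) * (\<Sum>b<r. B $$ (s mod r, b) * D $$ (b, t mod r))"
    by (simp add: sum_product mult_ac)
  also have "\<dots> = kron r (A * C) (B * D) $$ (s, t)"
    using st sd by (simp add: kron_index mult_entry[OF assms(1,3)] mult_entry[OF assms(2,4)])
  finally show "(kron r A B * kron r C D) $$ (s, t) = kron r (A * C) (B * D) $$ (s, t)" .
qed auto

lemma square_index_eq: "s div r = t div r \<and> s mod r = t mod r \<longleftrightarrow> s = (t::nat)"
  by (metis div_mult_mod_eq)

lemma kron_one: "kron r (1\<^sub>m r) (1\<^sub>m r) = 1\<^sub>m (r * r)"
proof (rule square_eq_matI[of _ "r * r" "r * r"])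
  fix s t assume st: "s < r * r" "t < r * r"
  then show "kron r (1\<^sub>m r) (1\<^sub>m r) $$ (s, t) = (1\<^sub>m (r * r)) $$ (s, t)"
    using square_index_div_mod[OF st(1)] square_index_div_mod[OF st(2)] square_index_eq[of s r t]
    by (auto simp: kron_index)
qed auto

lemma kron_transpose:
  assumes "A \<in> carrier_mat r r" "B \<in> carrier_mat r r"
  shows "(kron r A B)\<^sup>T = kron r A\<^sup>T B\<^sup>T"
proof (rule square_eq_matI[of _ "r * r" "r * r"])
  fix s t assume st: "s < r * r" "t < r * r"
  have "dim_row (kron r A B) = r * r" "dim_col (kron r A B) = r * r" by (simp_all add: kron_def)
  then show "(kron r A B)\<^sup>T $$ (s, t) = kron r A\<^sup>T B\<^sup>T $$ (s, t)"
    using st square_index_div_mod[OF st(1)] square_index_div_mod[OF st(2)] assms by (simp add: kron_index)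
qed auto

lemma kron_inverse:
  assumes "A \<in> carrier_mat r r" "B \<in> carrier_mat r r" "C \<in> carrier_mat r r" "D \<in> carrier_mat r r"
    and "A * C = 1\<^sub>m r" and "B * D = 1\<^sub>m r"
  shows "kron r A B * kron r C D = 1\<^sub>m (r * r)"
  using kron_mult[OF assms(1-4)] assms(5,6) by (simp add: kron_one)

lemma kron_det_nonzero:
  assumes "A \<in> carrier_mat r r" "B \<in> carrier_mat r r" "det A \<noteq> 0" "det B \<noteq> 0"
  shows "det (kron r A B) \<noteq> 0"
  by (rule det_nonzero_of_inverse[OF kron_carrier kron_carrier kron_inverse])
    (use assms minv[OF assms(1,3)] minv[OF assms(2,4)] in auto)

text \<open>The freedom in a stack: column \<open>p * r + q\<close> belongs to eigenvalue
  \<open>q\<close>, so block \<open>K q\<close> mixes the pairs whose fast component is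
  \<open>q\<close>.\<close>

definition sdiag :: "nat \<Rightarrow> (nat \<Rightarrow> complex mat) \<Rightarrow> complex mat" where
  "sdiag r K = Matrix.mat (r * r) (r * r)
     (\<lambda>(s, t). if s mod r = t mod r then K (s mod r) $$ (s div r, t div r) else 0)"

lemma sdiag_carrier [simp]: "sdiag r K \<in> carrier_mat (r * r) (r * r)"
  by (simp add: sdiag_def)

lemma sdiag_index:
  "s < r * r \<Longrightarrow> t < r * r \<Longrightarrow>
    sdiag r K $$ (s, t) = (if s mod r = t mod r then K (s mod r) $$ (s div r, t div r) else 0)"
  by (simp add: sdiag_def)

text \<open>This is the shape of \<open>F\<close>: sorted by fast components \<open>(a, b)\<close>,
  the block is the scalar \<open>Z $$ (a, b)\<close> times \<open>K a * K' b\<close>.\<close>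

lemma sdiag_kron_sdiag:
  assumes "\<And>q. q < r \<Longrightarrow> K q \<in> carrier_mat r r" "\<And>q. q < r \<Longrightarrow> K' q \<in> carrier_mat r r" "Z \<in> carrier_mat r r"
  shows "sdiag r K * kron r (1\<^sub>m r) Z * sdiag r K' = Matrix.mat (r * r) (r * r)
    (\<lambda>(s, t). Z $$ (s mod r, t mod r) * (K (s mod r) * K' (t mod r)) $$ (s div r, t div r))"
proof (rule square_eq_matI[of _ "r * r" "r * r"])
  have c: "sdiag r K * kron r (1\<^sub>m r) Z \<in> carrier_mat (r * r) (r * r)"
    by (rule mult_carrier_mat[OF sdiag_carrier kron_carrier])
  then show "sdiag r K * kron r (1\<^sub>m r) Z * sdiag r K' \<in> carrier_mat (r * r) (r * r)"
    by (rule mult_carrier_mat[OF _ sdiag_carrier])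
  have 1: "(sdiag r K * kron r (1\<^sub>m r) Z) $$ (s, t) = K (s mod r) $$ (s div r, t div r) * Z $$ (s mod r, t mod r)"
    if st: "s < r * r" "t < r * r" for s t
  proof -
    note sd = square_index_div_mod[OF st(1)] square_index_div_mod[OF st(2)]
    have "(sdiag r K * kron r (1\<^sub>m r) Z) $$ (s, t) = (\<Sum>u<r * r. (if s mod r = u mod r then K (s mod r) $$ (s div r, u div r) else 0) *
        ((1\<^sub>m r) $$ (u div r, t div r) * Z $$ (u mod r, t mod r)))"
      unfolding mult_entry[OF sdiag_carrier kron_carrier st] using st by (simp add: kron_index sdiag_index)
    also have "\<dots> = (\<Sum>a<r. \<Sum>b<r. (if s mod r = b then K (s mod r) $$ (s div r, a) else 0) *
        ((1\<^sub>m r) $$ (a, t div r) * Z $$ (b, t mod r)))"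
      by (rule sum_lessThan_square)
    also have "\<dots> = (\<Sum>a<r. \<Sum>b<r. if b = s mod r then (if a = t div r then K (s mod r) $$ (s div r, a) * Z $$ (b, t mod r) else 0) else 0)"
      using sd by (intro sum.cong) auto
    also have "\<dots> = K (s mod r) $$ (s div r, t div r) * Z $$ (s mod r, t mod r)"
      using sd by simp
    finally show ?thesis .
  qed
  fix s t assume st: "s < r * r" "t < r * r"
  note sd = square_index_div_mod[OF st(1)] square_index_div_mod[OF st(2)]
  have "(sdiag r K * kron r (1\<^sub>m r) Z * sdiag r K') $$ (s, t) = (\<Sum>u<r * r. K (s mod r) $$ (s div r, u div r) * Z $$ (s mod r, u mod r) *
      (if u mod r = t mod r then K' (u mod r) $$ (u div r, t div r) else 0))"
    unfolding mult_entry[OF c sdiag_carrier st] using st by (simp add: 1 sdiag_index)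
  also have "\<dots> = (\<Sum>a<r. \<Sum>b<r. K (s mod r) $$ (s div r, a) * Z $$ (s mod r, b) *
      (if b = t mod r then K' b $$ (a, t div r) else 0))"
    by (rule sum_lessThan_square)
  also have "\<dots> = (\<Sum>a<r. \<Sum>b<r. if b = t mod r then K (s mod r) $$ (s div r, a) * Z $$ (s mod r, b) * K' b $$ (a, t div r) else 0)"
    by (intro sum.cong) auto
  also have "\<dots> = (\<Sum>a<r. K (s mod r) $$ (s div r, a) * Z $$ (s mod r, t mod r) * K' (t mod r) $$ (a, t div r))"
    using sd by simp
  also have "\<dots> = Z $$ (s mod r, t mod r) * (K (s mod r) * K' (t mod r)) $$ (s div r, t div r)"
    using sd by (simp add: mult_entry[OF assms(1,2)] sum_distrib_left mult_ac)
  finally show "(sdiag r K * kron r (1\<^sub>m r) Z * sdiag r K') $$ (s, t) = Matrix.mat (r * r) (r * r)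
    (\<lambda>(s, t). Z $$ (s mod r, t mod r) * (K (s mod r) * K' (t mod r)) $$ (s div r, t div r)) $$ (s, t)"
    using st by simp
qed auto

lemma sdiag_mult:
  assumes "\<And>q. q < r \<Longrightarrow> K q \<in> carrier_mat r r" "\<And>q. q < r \<Longrightarrow> K' q \<in> carrier_mat r r"
  shows "sdiag r K * sdiag r K' = sdiag r (\<lambda>q. K q * K' q)"
proof -
  have "sdiag r K * kron r (1\<^sub>m r) (1\<^sub>m r) * sdiag r K' = sdiag r (\<lambda>q. K q * K' q)"
    by (rule trans[OF sdiag_kron_sdiag[OF assms one_carrier_mat]], assumption, assumption,
        rule square_eq_matI[of _ "r * r" "r * r"])
      (use square_index_div_mod[of _ r] in \<open>auto simp: sdiag_index\<close>)
  then show ?thesis by (simp add: kron_one right_mult_one_mat[OF sdiag_carrier])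
qed

lemma sdiag_cong: "(\<And>q. q < r \<Longrightarrow> K q = K' q) \<Longrightarrow> sdiag r K = sdiag r K'"
  by (rule square_eq_matI[of _ "r * r" "r * r"]) (use square_index_div_mod[of _ r] in \<open>auto simp: sdiag_def\<close>)

lemma sdiag_one: "sdiag r (\<lambda>_. 1\<^sub>m r) = 1\<^sub>m (r * r)"
  by (rule square_eq_matI[of _ "r * r" "r * r"])
    (use square_index_div_mod[of _ r] square_index_eq[of _ r] in \<open>auto simp: sdiag_def\<close>)

lemma sdiag_smult_eq_kron:
  assumes "K \<in> carrier_mat r r"
  shows "sdiag r (\<lambda>q. y q \<cdot>\<^sub>m K) = kron r K (dmat r y)"
  by (rule square_eq_matI[of _ "r * r" "r * r"])
    (use square_index_div_mod[of _ r] assms in \<open>auto simp: sdiag_def kron_index dmat_index\<close>)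

lemma diag_block_mat_uniform:
  assumes "\<forall>A\<in>set As. A \<in> carrier_mat r r"
  shows "diag_block_mat As \<in> carrier_mat (length As * r) (length As * r)"
    and "s < length As * r \<Longrightarrow> t < length As * r \<Longrightarrow> diag_block_mat As $$ (s, t)
      = (if s div r = t div r then (As ! (s div r)) $$ (s mod r, t mod r) else (0 :: complex))"
  using assms
proof (induction As arbitrary: s t)
  case (Cons A As)
  {
    case 1
    then show ?case using Cons.IH(1) by (auto simp: Let_def)
  next
    case 2
    have A: "dim_row A = r" "dim_col A = r" using 2 by auto
    have D: "dim_row (diag_block_mat As) = length As * r" "dim_col (diag_block_mat As) = length As * r"
      using Cons.IH(1) 2 by auto
    have r: "0 < r" using 2 by (cases r) auto
    have split: "x div r = Suc ((x - r) div r) \<and> (x - r) mod r = x mod r" if "r \<le> x" for x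
      using that r le_div_geq[of r x] le_mod_geq[of r x] by simp
    have E: "diag_block_mat (A # As) $$ (s, t) = (if s < r then if t < r then A $$ (s, t) else 0
        else if t < r then 0 else diag_block_mat As $$ (s - r, t - r))"
      using 2 by (simp add: Let_def A D)
    show ?case
    proof (cases "s < r \<or> t < r")
      case True
      then show ?thesis
        unfolding E using split[of s] split[of t] by (cases "s < r"; cases "t < r") auto
    next
      case False
      then have "diag_block_mat As $$ (s - r, t - r) = (if (s - r) div r = (t - r) div r
          then (As ! ((s - r) div r)) $$ ((s - r) mod r, (t - r) mod r) else 0)"
        using 2 by (intro Cons.IH(2)) auto
      then show ?thesis unfolding E using False split[of s] split[of t] by auto
    qed
  }
qed auto

text \<open>\<open>K_hat\<close> has its blocks along the slow component of index pairs, whereas the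
  stacks keep the eigenvalue in the fast one; \<open>index_swap\<close> reconciles the two.\<close>

lemma index_swap_diag_block:
  assumes "\<And>q. q < r \<Longrightarrow> K q \<in> carrier_mat r r"
  shows "index_swap r (diag_block_mat (map K [0..<r])) = sdiag r K"
proof (rule square_eq_matI[of _ "r * r" "r * r"])
  fix s t assume st: "s < r * r" "t < r * r"
  note sd = square_index_div_mod[OF st(1)] square_index_div_mod[OF st(2)]
  have "(s mod r) * r + s div r < r * r" "(t mod r) * r + t div r < r * r"
    using sd by (auto intro: pair_index_less)
  moreover have "\<forall>A\<in>set (map K [0..<r]). A \<in> carrier_mat r r" using assms by simp
  ultimately have "diag_block_mat (map K [0..<r]) $$ ((s mod r) * r + s div r, (t mod r) * r + t div r)
      = (if s mod r = t mod r then K (s mod r) $$ (s div r, t div r) else 0)"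
    using sd by (subst diag_block_mat_uniform(2)[of _ r]) auto
  then show "index_swap r (diag_block_mat (map K [0..<r])) $$ (s, t) = sdiag r K $$ (s, t)"
    using st by (simp add: index_swap_def sdiag_index)
qed (auto simp: index_swap_def)

lemma unfold1_carrier [simp]: "unfold1 m r C \<in> carrier_mat m (r * r)"
  by (simp add: unfold1_def)

lemma unfold2_carrier [simp]: "unfold2 m r C \<in> carrier_mat m (r * r)"
  by (simp add: unfold2_def)

lemma triple_mult_entry:
  fixes A B C :: "complex mat"
  assumes "A \<in> carrier_mat r r" "C \<in> carrier_mat r r" "B \<in> carrier_mat r r" "i < r" "j < r"
  shows "(A * C * B) $$ (i, j) = (\<Sum>a<r. \<Sum>b<r. C $$ (a, b) * (A $$ (i, a) * B $$ (b, j)))"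
proof -
  have "(A * C * B) $$ (i, j) = (\<Sum>b<r. (\<Sum>a<r. A $$ (i, a) * C $$ (a, b)) * B $$ (b, j))"
    unfolding mult_entry[OF mult_carrier_mat[OF assms(1,2)] assms(3-5)]
    using assms(4) by (simp add: mult_entry[OF assms(1,2)])
  also have "\<dots> = (\<Sum>a<r. \<Sum>b<r. C $$ (a, b) * (A $$ (i, a) * B $$ (b, j)))"
    unfolding sum_distrib_right by (subst sum.swap) (intro sum.cong refl, simp add: mult_ac)
  finally show ?thesis .
qed

text \<open>Vectorization of a two-sided product: row-major pairs give the factors in this order,
  the column-major pairs of \<open>unfold2\<close> give them exchanged.\<close>

lemma unfold1_gauge:
  assumes "\<And>a. a < m \<Longrightarrow> C a \<in> carrier_mat r r" "A \<in> carrier_mat r r" "B \<in> carrier_mat r r"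
  shows "unfold1 m r (\<lambda>a. A * C a * B) = unfold1 m r C * kron r A\<^sup>T B"
proof (rule square_eq_matI[of _ m "r * r"])
  fix a t assume at: "a < m" "t < r * r"
  note td = square_index_div_mod[OF at(2)]
  have "(unfold1 m r C * kron r A\<^sup>T B) $$ (a, t) = (\<Sum>s<r * r. C a $$ (s div r, s mod r) *
      (A\<^sup>T $$ (s div r, t div r) * B $$ (s mod r, t mod r)))"
    unfolding mult_entry[OF unfold1_carrier kron_carrier at] using at by (simp add: unfold1_def kron_index)
  also have "\<dots> = (\<Sum>x<r. \<Sum>y<r. C a $$ (x, y) * (A\<^sup>T $$ (x, t div r) * B $$ (y, t mod r)))"
    by (rule sum_lessThan_square)
  also have "\<dots> = (\<Sum>x<r. \<Sum>y<r. C a $$ (x, y) * (A $$ (t div r, x) * B $$ (y, t mod r)))"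
    using assms(2) td by (intro sum.cong) auto
  also have "\<dots> = unfold1 m r (\<lambda>a. A * C a * B) $$ (a, t)"
    using at td triple_mult_entry[OF assms(2) assms(1)[OF at(1)] assms(3), of "t div r" "t mod r"]
    by (simp add: unfold1_def)
  finally show "unfold1 m r (\<lambda>a. A * C a * B) $$ (a, t) = (unfold1 m r C * kron r A\<^sup>T B) $$ (a, t)" by simp
qed (auto intro: mult_carrier_mat[OF unfold1_carrier kron_carrier] mult_carrier_mat[OF unfold2_carrier kron_carrier])

lemma unfold2_gauge:
  assumes "\<And>a. a < m \<Longrightarrow> C a \<in> carrier_mat r r" "A \<in> carrier_mat r r" "B \<in> carrier_mat r r"
  shows "unfold2 m r (\<lambda>a. A * C a * B) = unfold2 m r C * kron r B A\<^sup>T"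
proof (rule square_eq_matI[of _ m "r * r"])
  fix a t assume at: "a < m" "t < r * r"
  note td = square_index_div_mod[OF at(2)]
  have "(unfold2 m r C * kron r B A\<^sup>T) $$ (a, t) = (\<Sum>s<r * r. C a $$ (s mod r, s div r) *
      (B $$ (s div r, t div r) * A\<^sup>T $$ (s mod r, t mod r)))"
    unfolding mult_entry[OF unfold2_carrier kron_carrier at] using at by (simp add: unfold2_def kron_index)
  also have "\<dots> = (\<Sum>y<r. \<Sum>x<r. C a $$ (x, y) * (B $$ (y, t div r) * A\<^sup>T $$ (x, t mod r)))"
    by (rule sum_lessThan_square)
  also have "\<dots> = (\<Sum>x<r. \<Sum>y<r. C a $$ (x, y) * (A $$ (t mod r, x) * B $$ (y, t div r)))"
    using assms(2) td by (subst sum.swap, intro sum.cong) auto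
  also have "\<dots> = unfold2 m r (\<lambda>a. A * C a * B) $$ (a, t)"
    using at td triple_mult_entry[OF assms(2) assms(1)[OF at(1)] assms(3), of "t mod r" "t div r"]
    by (simp add: unfold2_def)
  finally show "unfold2 m r (\<lambda>a. A * C a * B) $$ (a, t) = (unfold2 m r C * kron r B A\<^sup>T) $$ (a, t)" by simp
qed (auto intro: mult_carrier_mat[OF unfold1_carrier kron_carrier] mult_carrier_mat[OF unfold2_carrier kron_carrier])

lemma core_of_unfold1_unfold1:
  assumes "C a \<in> carrier_mat r r" "a < m"
  shows "core_of_unfold1 r (unfold1 m r C) a = C a"
  using assms by (intro square_eq_matI[of _ r r]) (auto simp: core_of_unfold1_def unfold1_def pair_index_less)

lemma core_of_unfold2_unfold2:
  assumes "C a \<in> carrier_mat r r" "a < m"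
  shows "core_of_unfold2 r (unfold2 m r C) a = C a"
  using assms by (intro square_eq_matI[of _ r r]) (auto simp: core_of_unfold2_def unfold2_def pair_index_less)

lemma unfold1_cong: "(\<And>a. a < m \<Longrightarrow> C a = C' a) \<Longrightarrow> unfold1 m r C = unfold1 m r C'"
  by (rule square_eq_matI[of _ m "r * r"]) (auto simp: unfold1_def)

lemma unfold2_cong: "(\<And>a. a < m \<Longrightarrow> C a = C' a) \<Longrightarrow> unfold2 m r C = unfold2 m r C'"
  by (rule square_eq_matI[of _ m "r * r"]) (auto simp: unfold2_def)

section \<open>The recovery algorithm on exact data\<close>


lemma smult_smult_mat: "a \<cdot>\<^sub>m (b \<cdot>\<^sub>m A) = (a * b :: complex) \<cdot>\<^sub>m A"
  by (rule eq_matI) auto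

lemma one_smult_mat: "(1 :: complex) \<cdot>\<^sub>m A = A"
  by (rule eq_matI) auto

lemma kron_one_dmat: "kron r (1\<^sub>m r) (dmat r e) = dmat (r * r) (\<lambda>s. e (s mod r))"
proof (rule square_eq_matI[of _ "r * r" "r * r"])
  fix s t assume st: "s < r * r" "t < r * r"
  then show "kron r (1\<^sub>m r) (dmat r e) $$ (s, t) = dmat (r * r) (\<lambda>s. e (s mod r)) $$ (s, t)"
    using square_index_div_mod[OF st(1)] square_index_div_mod[OF st(2)] square_index_eq[of s r t]
    by (auto simp: kron_index dmat_index)
qed auto

lemma diag_byD:
  assumes "diag_by r A X Y e"
  shows "X \<in> carrier_mat r r" "Y \<in> carrier_mat r r" "X * Y = 1\<^sub>m r" "Y * X = 1\<^sub>m r"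
    "A \<in> carrier_mat r r" "Y * A = dmat r e * Y" "A * X = X * dmat r e"
proof -
  show c: "X \<in> carrier_mat r r" "Y \<in> carrier_mat r r" "X * Y = 1\<^sub>m r" "Y * X = 1\<^sub>m r"
    using assms by (auto simp: diag_by_def)
  have A: "A = X * (dmat r e * Y)"
    using assms assoc_mult_mat[OF c(1) dmat_carrier c(2)] by (simp add: diag_by_def)
  have DY: "dmat r e * Y \<in> carrier_mat r r" using c by simp
  show "A \<in> carrier_mat r r" unfolding A using c by simp
  show "Y * A = dmat r e * Y"
    unfolding A assoc_mult_mat[OF c(2,1) DY, symmetric] c(4) using c by simp
  show "A * X = X * dmat r e"
    unfolding A assoc_mult_mat[OF c(1) DY c(1)] assoc_mult_mat[OF dmat_carrier c(2,1)] c(4) by simp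
qed

lemma diag_by_permute:
  assumes d: "diag_by r A X Y e" and pi: "bij_betw \<pi> {..<r} {..<r}"
  shows "diag_by r A (Matrix.mat r r (\<lambda>(i, q). X $$ (i, \<pi> q))) (Matrix.mat r r (\<lambda>(q, i). Y $$ (\<pi> q, i)))
    (e \<circ> \<pi>)"
proof -
  let ?X = "Matrix.mat r r (\<lambda>(i, q). X $$ (i, \<pi> q))" and ?Y = "Matrix.mat r r (\<lambda>(q, i). Y $$ (\<pi> q, i))"
  have X: "?X \<in> carrier_mat r r" and Y: "?Y \<in> carrier_mat r r" by simp_all
  note D = diag_byD[OF d]
  have lt: "\<pi> q < r" if "q < r" for q using pi that by (auto simp: bij_betw_def)
  have inj: "\<pi> q = \<pi> q' \<longleftrightarrow> q = q'" if "q < r" "q' < r" for q q'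
    using pi that by (auto simp: bij_betw_def inj_on_def)
  have re: "(\<Sum>q<r. f (\<pi> q)) = (\<Sum>q<r. f q)" for f :: "nat \<Rightarrow> complex"
    by (rule sum.reindex_bij_betw[OF pi])
  have XY: "?X * ?Y = 1\<^sub>m r"
  proof (rule square_eq_matI[of _ r r])
    fix i j assume ij: "i < r" "j < r"
    have "(?X * ?Y) $$ (i, j) = (\<Sum>q<r. X $$ (i, \<pi> q) * Y $$ (\<pi> q, j))"
      unfolding mult_entry[OF X Y ij] using ij by simp
    also have "\<dots> = (X * Y) $$ (i, j)"
      unfolding mult_entry[OF D(1,2) ij] by (rule re[of "\<lambda>q. X $$ (i, q) * Y $$ (q, j)"])
    finally show "(?X * ?Y) $$ (i, j) = (1\<^sub>m r) $$ (i, j)" unfolding D(3) .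
  qed (use X Y in auto)
  then have YX: "?Y * ?X = 1\<^sub>m r" by (rule mat_mult_left_right_inverse[OF X Y])
  have "A = ?X * dmat r (e \<circ> \<pi>) * ?Y"
  proof (rule square_eq_matI[of _ r r])
    fix i j assume ij: "i < r" "j < r"
    have XD: "?X * dmat r (e \<circ> \<pi>) \<in> carrier_mat r r" "X * dmat r e \<in> carrier_mat r r" using X D(1) by auto
    have "(?X * dmat r (e \<circ> \<pi>) * ?Y) $$ (i, j) = (\<Sum>q<r. X $$ (i, \<pi> q) * e (\<pi> q) * Y $$ (\<pi> q, j))"
      unfolding mult_entry[OF XD(1) Y ij] using ij by (simp add: mult_dmat_entry[OF X])
    also have "\<dots> = (X * dmat r e * Y) $$ (i, j)"
      unfolding mult_entry[OF XD(2) D(2) ij] re[of "\<lambda>q. X $$ (i, q) * e q * Y $$ (q, j)"]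
      using ij by (simp add: mult_dmat_entry[OF D(1)])
    finally show "A $$ (i, j) = (?X * dmat r (e \<circ> \<pi>) * ?Y) $$ (i, j)"
      using d by (simp add: diag_by_def)
  qed (use X Y D in auto)
  then show ?thesis unfolding diag_by_def using XY YX by simp
qed

section \<open>All eigenvector stacks of a compressed matrix\<close>

text \<open>Eigenvectors for nonzero eigenvalues lie in the range of \<open>U\<close>. In the
  coordinates given by \<open>U\<close> and the eigenvectors \<open>X\<close>, the eigenvalue
  equation becomes entrywise: an entry of \<open>G\<close> survives only where the eigenvalues of
  its row and column agree.\<close>

lemma stack_coordinates:
  assumes U: "full_col_rank m (r * r) U" and A: "diag_by r A X Y e" and E: "E \<in> carrier_mat m (r * r)"
    and BE: "U * kron r (1\<^sub>m r) A * pinv U * E = E * dmat (r * r) (\<lambda>t. f (t mod r))"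
    and f: "\<forall>q<r. f q \<noteq> 0"
  defines "G \<equiv> kron r (1\<^sub>m r) Y * (pinv U * E)"
  shows "G \<in> carrier_mat (r * r) (r * r)" and "E = U * (kron r (1\<^sub>m r) X * G)"
    and "\<And>s t. s < r * r \<Longrightarrow> t < r * r \<Longrightarrow> e (s mod r) * G $$ (s, t) = G $$ (s, t) * f (t mod r)"
proof -
  have cU: "U \<in> carrier_mat m (r * r)" using U unfolding full_col_rank_def by blast
  note D = diag_byD[OF A]
  note p = pinv_full_col_rank[OF U]
  let ?kA = "kron r (1\<^sub>m r) A" and ?kX = "kron r (1\<^sub>m r) X" and ?kY = "kron r (1\<^sub>m r) Y"
  have H: "pinv U * E \<in> carrier_mat (r * r) (r * r)" by (rule mult_carrier_mat[OF p(1) E])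
  show G: "G \<in> carrier_mat (r * r) (r * r)" unfolding G_def by (rule mult_carrier_mat[OF kron_carrier H])
  define R where "R = ?kA * (pinv U * E)"
  have R: "R \<in> carrier_mat (r * r) (r * r)" unfolding R_def by (rule mult_carrier_mat[OF kron_carrier H])
  have "U * ?kA * pinv U * E = U * R"
    unfolding R_def using assoc_mult_mat[OF mult_carrier_mat[OF cU kron_carrier] p(1) E]
      assoc_mult_mat[OF cU kron_carrier H] by simp
  then have UR: "E * dmat (r * r) (\<lambda>t. f (t mod r)) = U * R" using BE by simp
  \<comment> \<open>Nonzero eigenvalues can be divided out, which puts the columns of
    \<open>E\<close> into the range of \<open>U\<close>.\<close>
  have "E = E * dmat (r * r) (\<lambda>t. f (t mod r)) * dmat (r * r) (\<lambda>t. 1 / f (t mod r))"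
  proof (rule square_eq_matI[OF E])
    fix a t assume at: "a < m" "t < r * r"
    have f0: "f (t mod r) \<noteq> 0" using f square_index_div_mod[OF at(2)] by blast
    show "E $$ (a, t) = (E * dmat (r * r) (\<lambda>t. f (t mod r)) * dmat (r * r) (\<lambda>t. 1 / f (t mod r))) $$ (a, t)"
      unfolding mult_dmat_entry[OF mult_carrier_mat[OF E dmat_carrier] at] mult_dmat_entry[OF E at]
      using f0 by simp
  qed (use E in \<open>auto intro: mult_carrier_mat\<close>)
  then have EUS: "E = U * (R * dmat (r * r) (\<lambda>t. 1 / f (t mod r)))"
    unfolding UR assoc_mult_mat[OF cU R dmat_carrier] .
  define S where "S = R * dmat (r * r) (\<lambda>t. 1 / f (t mod r))"
  have S: "S \<in> carrier_mat (r * r) (r * r)" unfolding S_def by (rule mult_carrier_mat[OF R dmat_carrier])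
  have ES: "E = U * S" using EUS by (simp add: S_def)
  have HS: "pinv U * E = S"
    unfolding ES assoc_mult_mat[OF p(1) cU S, symmetric] p(2) using S by simp
  have XY: "?kX * ?kY = 1\<^sub>m (r * r)" by (rule kron_inverse) (use D in auto)
  have YX: "?kY * ?kX = 1\<^sub>m (r * r)" by (rule kron_inverse) (use D in auto)
  have "?kX * G = pinv U * E"
    unfolding G_def assoc_mult_mat[OF kron_carrier kron_carrier H, symmetric] XY by (rule left_mult_one_mat[OF H])
  then show "E = U * (?kX * G)" using HS ES by simp
  have kYA: "?kY * ?kA = dmat (r * r) (\<lambda>s. e (s mod r)) * ?kY"
    using kron_mult[of "1\<^sub>m r" r Y "1\<^sub>m r" A] kron_mult[of "1\<^sub>m r" r "dmat r e" "1\<^sub>m r" Y] D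
    by (simp add: kron_one_dmat)
  have "dmat (r * r) (\<lambda>s. e (s mod r)) * G = ?kY * R"
    unfolding G_def R_def assoc_mult_mat[OF dmat_carrier kron_carrier H, symmetric] kYA[symmetric]
    by (rule assoc_mult_mat[OF kron_carrier kron_carrier H])
  also have "R = pinv U * E * dmat (r * r) (\<lambda>t. f (t mod r))"
    using UR assoc_mult_mat[OF p(1) E dmat_carrier] assoc_mult_mat[OF p(1) cU R] p(2) R by simp
  also have "?kY * (pinv U * E * dmat (r * r) (\<lambda>t. f (t mod r))) = G * dmat (r * r) (\<lambda>t. f (t mod r))"
    unfolding G_def by (rule assoc_mult_mat[OF kron_carrier H dmat_carrier, symmetric])
  finally have DG: "dmat (r * r) (\<lambda>s. e (s mod r)) * G = G * dmat (r * r) (\<lambda>t. f (t mod r))" .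
  fix s t assume st: "s < r * r" "t < r * r"
  show "e (s mod r) * G $$ (s, t) = G $$ (s, t) * f (t mod r)"
    using arg_cong[OF DG, of "\<lambda>M. M $$ (s, t)"] dmat_mult_entry[OF G st] mult_dmat_entry[OF G st] by simp
qed

lemma eigenvector_stack_commute:
  assumes "B \<in> carrier_mat m m" and "eigenvector_stack r B E"
  obtains f where "E \<in> carrier_mat m (r * r)" "vec_space.rank m E = r * r" "inj_on f {..<r}"
    "\<forall>q<r. f q \<noteq> 0" "B * E = E * dmat (r * r) (\<lambda>t. f (t mod r))"
proof -
  obtain f where E: "E \<in> carrier_mat m (r * r)" and rank: "vec_space.rank m E = r * r"
    and f: "inj_on f {..<r}" "f ` {..<r} = {x. x \<noteq> 0 \<and> eigenvalue B x}"
    and ev: "\<forall>p<r. \<forall>q<r. eigenvector B (col E (p * r + q)) (f q)"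
    using assms unfolding eigenvector_stack_def by auto
  have "B * E = E * dmat (r * r) (\<lambda>t. f (t mod r))"
  proof (rule square_eq_matI[of _ m "r * r"])
    fix a t assume at: "a < m" "t < r * r"
    note td = square_index_div_mod[OF at(2)]
    have "eigenvector B (col E t) (f (t mod r))"
      using ev td by (metis div_mult_mod_eq)
    then have "(B *\<^sub>v col E t) $ a = (f (t mod r) \<cdot>\<^sub>v col E t) $ a" by (simp add: eigenvector_def)
    then have "(\<Sum>x<m. B $$ (a, x) * E $$ (x, t)) = f (t mod r) * E $$ (a, t)"
      using at E assms(1) by (simp add: mult_vec_entry[OF assms(1) _ at(1)] del: index_mult_mat_vec)
    then show "(B * E) $$ (a, t) = (E * dmat (r * r) (\<lambda>t. f (t mod r))) $$ (a, t)"
      unfolding mult_entry[OF assms(1) E at] mult_dmat_entry[OF E at] by simp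
  qed (use assms E in \<open>auto intro: mult_carrier_mat\<close>)
  moreover have "\<forall>q<r. f q \<noteq> 0" using f(2) by blast
  ultimately show thesis using that E rank f(1) by blast
qed

text \<open>A stack eigenvalue \<open>f q\<close> outside the range of \<open>e\<close> would make a
  column of the coordinate matrix zero, against the rank. So the order of eigenvalues is a
  permutation \<open>\<pi>\<close> of \<open>e\<close>, and in permuted coordinates only blocks
  within one eigenvalue remain.\<close>

lemma eigenvector_stack_form:
  assumes U: "full_col_rank m (r * r) U" and A: "diag_by r A X Y e" and inj: "inj_on e {..<r}"
    and st: "eigenvector_stack r (U * kron r (1\<^sub>m r) A * pinv U) E"
  obtains \<pi> K where "bij_betw \<pi> {..<r} {..<r}" "\<And>q. q < r \<Longrightarrow> K q \<in> carrier_mat r r"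
    "\<And>q. q < r \<Longrightarrow> det (K q) \<noteq> 0"
    "E = U * kron r (1\<^sub>m r) (Matrix.mat r r (\<lambda>(i, q). X $$ (i, \<pi> q))) * sdiag r K"
proof -
  have cU: "U \<in> carrier_mat m (r * r)" using U unfolding full_col_rank_def by blast
  note p = pinv_full_col_rank[OF U]
  have B: "U * kron r (1\<^sub>m r) A * pinv U \<in> carrier_mat m m"
    by (rule mult_carrier_mat[OF mult_carrier_mat[OF cU kron_carrier] p(1)])
  obtain f where E: "E \<in> carrier_mat m (r * r)" and rank: "vec_space.rank m E = r * r"
    and f: "inj_on f {..<r}" "\<forall>q<r. f q \<noteq> 0"
    and BE: "U * kron r (1\<^sub>m r) A * pinv U * E = E * dmat (r * r) (\<lambda>t. f (t mod r))"
    using eigenvector_stack_commute[OF B st] by blast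
  \<comment> \<open>A vector killed by the coordinate matrix is killed by \<open>E\<close>, hence is
    zero by the rank condition.\<close>
  have ker: "y t = 0" if G: "G \<in> carrier_mat (r * r) (r * r)" and EG: "E = U * (N * G)"
      and N: "N \<in> carrier_mat (r * r) (r * r)"
      and y: "\<And>s. s < r * r \<Longrightarrow> (\<Sum>t<r * r. G $$ (s, t) * y t) = 0" and t: "t < r * r" for G N y t
  proof -
    let ?y = "Matrix.vec (r * r) y"
    have yc: "?y \<in> carrier_vec (r * r)" by simp
    have 0: "G *\<^sub>v ?y = 0\<^sub>v (r * r)"
      using y G by (intro eq_vecI) (auto simp: mult_vec_entry[OF G yc] simp del: index_mult_mat_vec)
    have "E *\<^sub>v ?y = U *\<^sub>v (N *\<^sub>v (G *\<^sub>v ?y))"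
      unfolding EG using assoc_mult_mat_vec[OF cU mult_carrier_mat[OF N G] yc] assoc_mult_mat_vec[OF N G yc] by simp
    also have "\<dots> = 0\<^sub>v m"
    proof -
      have "N *\<^sub>v 0\<^sub>v (r * r) = 0\<^sub>v (r * r)" using N by (intro eq_vecI) (auto simp: scalar_prod_def)
      moreover have "U *\<^sub>v 0\<^sub>v (r * r) = 0\<^sub>v m" using cU by (intro eq_vecI) (auto simp: scalar_prod_def)
      ultimately show ?thesis using 0 by simp
    qed
    finally have "?y = 0\<^sub>v (r * r)" by (rule rank_kernel[OF E rank yc])
    then show ?thesis using t by (metis index_vec index_zero_vec(1))
  qed
  define G0 where "G0 = kron r (1\<^sub>m r) Y * (pinv U * E)"
  note c0 = stack_coordinates[OF U A E BE f(2), folded G0_def]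
  have "\<exists>x<r. f q = e x" if q: "q < r" for q
  proof (rule ccontr)
    assume no: "\<not> (\<exists>x<r. f q = e x)"
    have q2: "q < r * r" using q pair_index_less[of 0 r q] by simp
    have "G0 $$ (s, q) = 0" if s: "s < r * r" for s
    proof -
      have "e (s mod r) \<noteq> f q" using no square_index_div_mod[OF s] by metis
      then show ?thesis using c0(3)[OF s q2] q by (simp add: mult.commute)
    qed
    then have "(if q = q then 1 else 0 :: complex) = 0"
      by (intro ker[OF c0(1,2) kron_carrier _ q2, of "\<lambda>t. if t = q then 1 else 0"])
        (auto simp: if_distrib[of "\<lambda>x. _ * x"] q2 cong: if_cong)
    then show False by simp
  qed
  then obtain \<pi> where pi: "\<And>q. q < r \<Longrightarrow> \<pi> q < r" "\<And>q. q < r \<Longrightarrow> f q = e (\<pi> q)" by metis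
  have "inj_on \<pi> {..<r}" using f(1) pi(2) by (auto simp: inj_on_def)
  then have bij: "bij_betw \<pi> {..<r} {..<r}"
    using pi(1) endo_inj_surj[of "{..<r}" \<pi>] by (auto simp: bij_betw_def)
  define X' Y' where "X' = Matrix.mat r r (\<lambda>(i, q). X $$ (i, \<pi> q))"
    and "Y' = Matrix.mat r r (\<lambda>(q, i). Y $$ (\<pi> q, i))"
  have A': "diag_by r A X' Y' (e \<circ> \<pi>)" unfolding X'_def Y'_def by (rule diag_by_permute[OF A bij])
  define G where "G = kron r (1\<^sub>m r) Y' * (pinv U * E)"
  note c = stack_coordinates[OF U A' E BE f(2), folded G_def]
  define K where "K q = Matrix.mat r r (\<lambda>(p', p). G $$ (p' * r + q, p * r + q))" for q
  have GK: "G = sdiag r K"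
  proof (rule square_eq_matI[OF c(1) sdiag_carrier])
    fix s t assume s: "s < r * r" and t: "t < r * r"
    note sd = square_index_div_mod[OF s] square_index_div_mod[OF t]
    show "G $$ (s, t) = sdiag r K $$ (s, t)"
    proof (cases "s mod r = t mod r")
      case True
      have "K (s mod r) $$ (s div r, t div r) = G $$ (s div r * r + s mod r, t div r * r + s mod r)"
        using sd by (simp add: K_def)
      also have "\<dots> = G $$ (s, t)" unfolding div_mult_mod_eq using True by simp
      finally show ?thesis using s t True by (simp add: sdiag_index)
    next
      case False
      then have "f (s mod r) \<noteq> f (t mod r)" using sd f(1) by (auto simp: inj_on_def)
      then have "G $$ (s, t) = 0"
        using c(3)[OF s t] pi(2)[of "s mod r"] sd by (auto simp: mult.commute)
      then show ?thesis using s t False by (simp add: sdiag_index)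
    qed
  qed
  have "det (K q) \<noteq> 0" if q: "q < r" for q
  proof (rule det_nonzeroI[of _ r], simp add: K_def, intro allI impI)
    fix z p assume z: "\<And>i. i < r \<Longrightarrow> (\<Sum>j<r. K q $$ (i, j) * z j) = 0" and pr: "p < r"
    \<comment> \<open>A kernel vector of one block, extended by zero to the other eigenvalues, is a
      kernel vector of \<open>G\<close>.\<close>
    define y where "y t = (if t mod r = q then z (t div r) else 0)" for t
    have "y (p * r + q) = 0"
    proof (rule ker[OF c(1,2) kron_carrier _ pair_index_less[OF pr q]])
      fix s assume s: "s < r * r"
      note sd = square_index_div_mod[OF s]
      have "(\<Sum>t<r * r. G $$ (s, t) * y t) = (\<Sum>t<r * r. (if s mod r = t mod r then K (s mod r) $$ (s div r, t div r) else 0) *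
          (if t mod r = q then z (t div r) else 0))"
        unfolding GK using s by (simp add: sdiag_index y_def)
      also have "\<dots> = (\<Sum>a<r. \<Sum>b<r. (if s mod r = b then K (s mod r) $$ (s div r, a) else 0) * (if b = q then z a else 0))"
        by (rule sum_lessThan_square)
      also have "\<dots> = (\<Sum>a<r. \<Sum>b<r. if b = q then (if s mod r = q then K q $$ (s div r, a) * z a else 0) else 0)"
        by (intro sum.cong) auto
      also have "\<dots> = (\<Sum>a<r. if s mod r = q then K q $$ (s div r, a) * z a else 0)"
        using q by simp
      also have "\<dots> = 0" using z[of "s div r"] sd by (cases "s mod r = q") auto
      finally show "(\<Sum>t<r * r. G $$ (s, t) * y t) = 0" .
    qed
    then show "z p = 0" using q by (simp add: y_def)
  qed
  moreover have "E = U * kron r (1\<^sub>m r) X' * sdiag r K"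
    using c(2) assoc_mult_mat[OF cU kron_carrier c(1)] by (simp add: GK)
  ultimately show thesis using that[of \<pi> K] bij by (simp add: K_def X'_def)
qed

lemma invertible_mat_of_det:
  fixes A :: "complex mat"
  assumes "A \<in> carrier_mat n n" and "det A \<noteq> 0"
  shows "invertible_mat A"
  using minv[OF assms] assms(1) unfolding invertible_mat_def inverts_mat_def square_mat.simps
  by (metis carrier_matD)

section \<open>Step A: alignment of the eigenspace bases\<close>

text \<open>Block \<open>(a, b)\<close> of \<open>F\<close> is a nonzero scalar times
  \<open>Ki a * K' b\<close>. In the quotient of the blocks \<open>(0, 0)\<close> and
  \<open>(l, 0)\<close> the unknown \<open>K' 0\<close> cancels, leaving \<open>Ki 0 * K l\<close>
  up to a scalar. Multiplying \<open>E\<close> by the inverse replaces every \<open>K l\<close> by a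
  multiple of the common \<open>K 0\<close>, which is a gauge matrix on one bond; the scalars form a
  diagonal gauge on the other.\<close>

lemma Q_hat_of_stacks:
  assumes r: "0 < r" and U: "full_col_rank m (r * r) (unfold1 m r C)" and C: "\<And>a. C a \<in> carrier_mat r r"
    and X: "X \<in> carrier_mat r r" "Y \<in> carrier_mat r r" "X * Y = 1\<^sub>m r" "Y * X = 1\<^sub>m r"
    and X': "X' \<in> carrier_mat r r" and Z: "\<And>p q. p < r \<Longrightarrow> q < r \<Longrightarrow> (Y * X') $$ (p, q) \<noteq> 0"
    and K: "\<And>q. q < r \<Longrightarrow> K q \<in> carrier_mat r r" "\<And>q. q < r \<Longrightarrow> det (K q) \<noteq> 0"
    and K': "\<And>q. q < r \<Longrightarrow> K' q \<in> carrier_mat r r" "\<And>q. q < r \<Longrightarrow> det (K' q) \<noteq> 0"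
    and E: "E = unfold1 m r C * kron r (1\<^sub>m r) X * sdiag r K"
    and E': "E' = unfold1 m r C * kron r (1\<^sub>m r) X' * sdiag r K'"
  defines "z \<equiv> \<lambda>l. (Y * X') $$ (l, 0) / (Y * X') $$ (0, 0)"
  shows "\<And>l. l < r \<Longrightarrow> invertible_mat (F_block r E E' l 0)"
    and "invertible_mat (index_swap r (K_hat r E E'))"
    and "\<And>a. a < m \<Longrightarrow> Q_hat r E E' a = (K 0)\<^sup>T * C a * (X * dmat r z)"
proof -
  let ?U = "unfold1 m r C"
  define Zm where "Zm = Y * X'"
  have Zc: "Zm \<in> carrier_mat r r" unfolding Zm_def using X X' by simp
  define N where "N = kron r (1\<^sub>m r) X * sdiag r K"
  have Nc: "N \<in> carrier_mat (r * r) (r * r)" unfolding N_def by (rule mult_carrier_mat[OF kron_carrier sdiag_carrier])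
  have EN: "E = ?U * N" unfolding E N_def by (rule assoc_mult_mat[OF unfold1_carrier kron_carrier sdiag_carrier])
  define Ki where "Ki q = minv (K q)" for q
  have Ki: "Ki q \<in> carrier_mat r r" "K q * Ki q = 1\<^sub>m r" "Ki q * K q = 1\<^sub>m r" if "q < r" for q
    using minv[OF K(1)[OF that] K(2)[OF that]] by (auto simp: Ki_def)
  have KKi: "sdiag r K * sdiag r Ki = 1\<^sub>m (r * r)" "sdiag r Ki * sdiag r K = 1\<^sub>m (r * r)"
    using sdiag_mult[of r K Ki] sdiag_mult[of r Ki K] K(1) Ki sdiag_one sdiag_cong[of r _ "\<lambda>_. 1\<^sub>m r"] by auto
  have kXY: "kron r (1\<^sub>m r) X * kron r (1\<^sub>m r) Y = 1\<^sub>m (r * r)"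
    by (rule kron_inverse) (use X in auto)
  define Ni where "Ni = sdiag r Ki * kron r (1\<^sub>m r) Y"
  have Nic: "Ni \<in> carrier_mat (r * r) (r * r)" unfolding Ni_def by (rule mult_carrier_mat[OF sdiag_carrier kron_carrier])
  have "N * Ni = kron r (1\<^sub>m r) X * (sdiag r K * sdiag r Ki * kron r (1\<^sub>m r) Y)"
    unfolding N_def assoc_mult_mat[OF kron_carrier sdiag_carrier Nic]
    by (simp add: Ni_def assoc_mult_mat[OF sdiag_carrier sdiag_carrier kron_carrier])
  then have NNi: "N * Ni = 1\<^sub>m (r * r)" unfolding KKi left_mult_one_mat[OF kron_carrier] kXY .
  have EE: "full_col_rank m (r * r) E"
    unfolding EN by (rule full_col_rank_mult[OF U Nc det_nonzero_of_inverse[OF Nc Nic NNi]])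
  note pE = pinv_full_col_rank[OF EE]
  have cE: "E \<in> carrier_mat m (r * r)" using EE unfolding full_col_rank_def by blast
  define N' where "N' = kron r (1\<^sub>m r) X' * sdiag r K'"
  have N'c: "N' \<in> carrier_mat (r * r) (r * r)" unfolding N'_def by (rule mult_carrier_mat[OF kron_carrier sdiag_carrier])
  have "E * (Ni * N') = ?U * (N * Ni * N')"
    unfolding EN assoc_mult_mat[OF unfold1_carrier Nc mult_carrier_mat[OF Nic N'c]] assoc_mult_mat[OF Nc Nic N'c] ..
  then have EE': "E' = E * (Ni * N')"
    unfolding NNi left_mult_one_mat[OF N'c] E'
    unfolding N'_def assoc_mult_mat[OF unfold1_carrier kron_carrier sdiag_carrier] by simp
  have "pinv E * E' = Ni * N'"
    unfolding EE' assoc_mult_mat[OF pE(1) cE mult_carrier_mat[OF Nic N'c], symmetric] pE(2)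
    by (rule left_mult_one_mat[OF mult_carrier_mat[OF Nic N'c]])
  also have "Ni * N' = sdiag r Ki * (kron r (1\<^sub>m r) Y * kron r (1\<^sub>m r) X') * sdiag r K'"
    unfolding Ni_def N'_def
    using assoc_mult_mat[OF mult_carrier_mat[OF sdiag_carrier kron_carrier] kron_carrier sdiag_carrier, of r Ki "1\<^sub>m r" Y "1\<^sub>m r" X' K']
      assoc_mult_mat[OF sdiag_carrier kron_carrier kron_carrier, of r Ki "1\<^sub>m r" Y "1\<^sub>m r" X'] by simp
  also have "kron r (1\<^sub>m r) Y * kron r (1\<^sub>m r) X' = kron r (1\<^sub>m r) Zm"
    using kron_mult[of "1\<^sub>m r" r Y "1\<^sub>m r" X'] X X' by (simp add: Zm_def)
  also have "sdiag r Ki * kron r (1\<^sub>m r) Zm * sdiag r K' = Matrix.mat (r * r) (r * r)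
    (\<lambda>(s, t). Zm $$ (s mod r, t mod r) * (Ki (s mod r) * K' (t mod r)) $$ (s div r, t div r))"
    by (rule sdiag_kron_sdiag[OF Ki(1) K'(1) Zc])
  finally have F: "pinv E * E' = \<dots>" .
  have FB: "F_block r E E' a b = Zm $$ (a, b) \<cdot>\<^sub>m (Ki a * K' b)" if "a < r" "b < r" for a b
  proof (rule square_eq_matI[of _ r r])
    show "Zm $$ (a, b) \<cdot>\<^sub>m (Ki a * K' b) \<in> carrier_mat r r"
      using Ki(1)[OF that(1)] K'(1)[OF that(2)] by simp
    fix p q assume pq: "p < r" "q < r"
    have c: "Ki a * K' b \<in> carrier_mat r r" using Ki(1)[OF that(1)] K'(1)[OF that(2)] by simp
    have "p * r + a < r * r" "q * r + b < r * r" using pq that by (auto intro: pair_index_less)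
    then show "F_block r E E' a b $$ (p, q) = (Zm $$ (a, b) \<cdot>\<^sub>m (Ki a * K' b)) $$ (p, q)"
      unfolding F_block_def F using pq that c carrier_matD[OF c] by simp
  qed (simp add: F_block_def)
  have detKK: "det (Ki a * K' b) \<noteq> 0" "Ki a * K' b \<in> carrier_mat r r" if "a < r" "b < r" for a b
  proof -
    have "det (Ki a) \<noteq> 0" using det_nonzero_of_inverse[OF Ki(1) K(1) Ki(3)] that by blast
    then show "det (Ki a * K' b) \<noteq> 0" using det_mult[OF Ki(1) K'(1)] K'(2) that by simp
    show "Ki a * K' b \<in> carrier_mat r r" using Ki(1) K'(1) that by simp
  qed
  have FBc: "F_block r E E' a b \<in> carrier_mat r r" for a b by (simp add: F_block_def)
  have FBdet: "det (F_block r E E' a b) \<noteq> 0" if "a < r" "b < r" for a b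
    unfolding FB[OF that] det_smult using Z[OF that] detKK[OF that] by (simp add: Zm_def)
  show "invertible_mat (F_block r E E' l 0)" if "l < r" for l
    by (rule invertible_mat_of_det[OF FBc FBdet[OF that r]])
  \<comment> \<open>The blocks of \<open>K_hat\<close>, including \<open>l = 0\<close>, where
    \<open>z 0 = 1\<close> and the block is the identity.\<close>
  define H where "H l = (1 / z l) \<cdot>\<^sub>m (Ki 0 * K l)" for l
  have zl: "z l \<noteq> 0" if "l < r" for l using Z[OF that r] Z[OF r r] by (simp add: z_def)
  have z0: "z 0 = 1" using Z[OF r r] by (simp add: z_def)
  have Hc: "H l \<in> carrier_mat r r" if "l < r" for l unfolding H_def using Ki(1)[OF r] K(1)[OF that] by simp
  have blocks: "(if l = 0 then 1\<^sub>m r else F_block r E E' 0 0 * minv (F_block r E E' l 0)) = H l" if l: "l < r" for l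
  proof (cases "l = 0")
    case True
    then show ?thesis using Ki[OF r] z0 by (simp add: H_def one_smult_mat)
  next
    case False
    have K'i: "minv (K' 0) \<in> carrier_mat r r" "K' 0 * minv (K' 0) = 1\<^sub>m r" "minv (K' 0) * K' 0 = 1\<^sub>m r"
      using minv[OF K'(1)[OF r] K'(2)[OF r]] by auto
    have "minv (F_block r E E' l 0) = (1 / Zm $$ (l, 0)) \<cdot>\<^sub>m (minv (K' 0) * K l)"
    proof (rule minv_eqI[OF FBc])
      show c: "(1 / Zm $$ (l, 0)) \<cdot>\<^sub>m (minv (K' 0) * K l) \<in> carrier_mat r r" using K'i K(1)[OF l] by simp
      have "F_block r E E' l 0 * ((1 / Zm $$ (l, 0)) \<cdot>\<^sub>m (minv (K' 0) * K l))
          = (Ki l * K' 0) * (minv (K' 0) * K l)"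
        unfolding FB[OF l r]
        using mult_smult_assoc_mat[OF detKK(2)[OF l r] c] mult_smult_distrib[OF detKK(2)[OF l r] mult_carrier_mat[OF K'i(1) K(1)[OF l]]]
          Z[OF l r] by (simp add: Zm_def smult_smult_mat one_smult_mat)
      also have "\<dots> = Ki l * (K' 0 * minv (K' 0) * K l)"
        using assoc_mult_mat[OF Ki(1)[OF l] K'(1)[OF r] mult_carrier_mat[OF K'i(1) K(1)[OF l]]]
          assoc_mult_mat[OF K'(1)[OF r] K'i(1) K(1)[OF l]] by simp
      also have "\<dots> = 1\<^sub>m r" using K'i Ki[OF l] K(1)[OF l] by simp
      finally show "F_block r E E' l 0 * ((1 / Zm $$ (l, 0)) \<cdot>\<^sub>m (minv (K' 0) * K l)) = 1\<^sub>m r" .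
    qed
    then have "F_block r E E' 0 0 * minv (F_block r E E' l 0)
        = (Zm $$ (0, 0) / Zm $$ (l, 0)) \<cdot>\<^sub>m ((Ki 0 * K' 0) * (minv (K' 0) * K l))"
      unfolding FB[OF r r]
      using mult_smult_assoc_mat[OF detKK(2)[OF r r] smult_carrier_mat[OF mult_carrier_mat[OF K'i(1) K(1)[OF l]]]]
        mult_smult_distrib[OF detKK(2)[OF r r] mult_carrier_mat[OF K'i(1) K(1)[OF l]]]
      by (simp add: smult_smult_mat one_smult_mat)
    also have "(Ki 0 * K' 0) * (minv (K' 0) * K l) = Ki 0 * (K' 0 * minv (K' 0) * K l)"
      using assoc_mult_mat[OF Ki(1)[OF r] K'(1)[OF r] mult_carrier_mat[OF K'i(1) K(1)[OF l]]]
        assoc_mult_mat[OF K'(1)[OF r] K'i(1) K(1)[OF l]] by simp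
    also have "\<dots> = Ki 0 * K l" using K'i K(1)[OF l] by simp
    finally show ?thesis using False by (simp add: H_def z_def Zm_def)
  qed
  have "K_hat r E E' = diag_block_mat (map H [0..<r])"
    unfolding K_hat_def by (intro arg_cong[of _ _ diag_block_mat] map_cong) (auto simp: blocks)
  then have swap: "index_swap r (K_hat r E E') = sdiag r H" using index_swap_diag_block[OF Hc] by simp
  \<comment> \<open>The inverse of \<open>H l\<close>, written so that multiplication by
    \<open>K l\<close> leaves \<open>z l\<close> times \<open>K 0\<close>.\<close>
  define Hi where "Hi l = z l \<cdot>\<^sub>m (Ki l * K 0)" for l
  have Hic: "Hi l \<in> carrier_mat r r" if "l < r" for l unfolding Hi_def using Ki(1)[OF that] K(1)[OF r] by simp
  have HHi: "H l * Hi l = 1\<^sub>m r" and KHi: "K l * Hi l = z l \<cdot>\<^sub>m K 0" if l: "l < r" for l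
  proof -
    note c = Ki(1)[OF r] K(1)[OF l] Ki(1)[OF l] K(1)[OF r]
    have "K l * (Ki l * K 0) = K 0"
      using assoc_mult_mat[OF c(2-4)] Ki[OF l] c by simp
    then show KHi: "K l * Hi l = z l \<cdot>\<^sub>m K 0"
      unfolding Hi_def using mult_smult_distrib[OF c(2) mult_carrier_mat[OF c(3,4)]] by simp
    have "H l * Hi l = (1 / z l) \<cdot>\<^sub>m (Ki 0 * K l * Hi l)"
      unfolding H_def by (rule mult_smult_assoc_mat[OF mult_carrier_mat[OF c(1,2)] Hic[OF l]])
    also have "Ki 0 * K l * Hi l = z l \<cdot>\<^sub>m (Ki 0 * K 0)"
      unfolding assoc_mult_mat[OF c(1,2) Hic[OF l]] KHi by (rule mult_smult_distrib[OF c(1,4)])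
    finally show "H l * Hi l = 1\<^sub>m r" using Ki[OF r] zl[OF l] by (simp add: smult_smult_mat one_smult_mat)
  qed
  have sHH: "sdiag r H * sdiag r Hi = 1\<^sub>m (r * r)"
    using sdiag_mult[of r H Hi] Hc Hic HHi sdiag_cong[of r "\<lambda>q. H q * Hi q" "\<lambda>_. 1\<^sub>m r"] sdiag_one by simp
  show "invertible_mat (index_swap r (K_hat r E E'))"
    unfolding swap by (rule invertible_mat_of_det[OF sdiag_carrier det_nonzero_of_inverse[OF sdiag_carrier sdiag_carrier sHH]])
  have mi: "minv (index_swap r (K_hat r E E')) = sdiag r Hi"
    unfolding swap by (rule minv_eqI[OF sdiag_carrier sdiag_carrier sHH])
  have "E * minv (index_swap r (K_hat r E E')) = E * sdiag r Hi" by (simp only: mi)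
  also have "E * sdiag r Hi = ?U * N * sdiag r Hi" by (simp only: EN)
  also have "\<dots> = ?U * (kron r (1\<^sub>m r) X * (sdiag r K * sdiag r Hi))"
    unfolding assoc_mult_mat[OF unfold1_carrier Nc sdiag_carrier]
    unfolding N_def assoc_mult_mat[OF kron_carrier sdiag_carrier sdiag_carrier] ..
  also have "sdiag r K * sdiag r Hi = kron r (K 0) (dmat r z)"
    using sdiag_mult[of r K Hi] K(1) Hic KHi sdiag_cong[of r "\<lambda>q. K q * Hi q" "\<lambda>q. z q \<cdot>\<^sub>m K 0"]
      sdiag_smult_eq_kron[OF K(1)[OF r], of z] by simp
  also have "kron r (1\<^sub>m r) X * kron r (K 0) (dmat r z) = kron r ((K 0)\<^sup>T)\<^sup>T (X * dmat r z)"
    using kron_mult[of "1\<^sub>m r" r X "K 0" "dmat r z"] X K(1)[OF r] by simp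
  also have "?U * \<dots> = unfold1 m r (\<lambda>a. (K 0)\<^sup>T * C a * (X * dmat r z))"
    by (rule unfold1_gauge[symmetric]) (use C K(1)[OF r] X in auto)
  finally have *: "E * minv (index_swap r (K_hat r E E')) = unfold1 m r (\<lambda>a. (K 0)\<^sup>T * C a * (X * dmat r z))" .
  show "Q_hat r E E' a = (K 0)\<^sup>T * C a * (X * dmat r z)" if "a < m" for a
    unfolding Q_hat_def *
  proof (rule core_of_unfold1_unfold1[OF _ that])
    have "(K 0)\<^sup>T \<in> carrier_mat r r" using K(1)[OF r] by simp
    then show "(K 0)\<^sup>T * C a * (X * dmat r z) \<in> carrier_mat r r" using C[of a] X(1) by simp
  qed
qed

lemma mult_pinv_kron:
  assumes U: "full_col_rank m (r * r) U" and V: "full_col_rank l (r * r) V"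
    and W1: "W1 \<in> carrier_mat r r" and det: "det W1 \<noteq> 0" and A: "A \<in> carrier_mat r r"
  shows "(U * kron r (1\<^sub>m r) (A * W1) * V\<^sup>T) * pinv (U * kron r (1\<^sub>m r) W1 * V\<^sup>T) = U * kron r (1\<^sub>m r) A * pinv U"
proof -
  note m = minv[OF W1 det]
  have k1: "kron r (1\<^sub>m r) W1 * kron r (1\<^sub>m r) (minv W1) = 1\<^sub>m (r * r)"
    by (rule kron_inverse) (use W1 m in auto)
  have "kron r (1\<^sub>m r) (A * W1) * kron r (1\<^sub>m r) (minv W1) = kron r (1\<^sub>m r) (A * W1 * minv W1)"
    using kron_mult[of "1\<^sub>m r" r "A * W1" "1\<^sub>m r" "minv W1"] A W1 m by simp
  also have "A * W1 * minv W1 = A"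
    unfolding assoc_mult_mat[OF A W1 m(1)] m(2) using A by simp
  finally show ?thesis
    using mult_pinv_cancel[OF U V kron_carrier kron_carrier det_nonzero_of_inverse[OF kron_carrier kron_carrier k1],
        of "1\<^sub>m r" "A * W1"] minv_eqI[OF kron_carrier kron_carrier k1] by simp
qed

section \<open>Existence of eigenvector stacks\<close>

lemma diag_by_eigenvalues_nonzero:
  assumes d: "diag_by r A X Y e" and det: "det A \<noteq> 0" and q: "q < r"
  shows "e q \<noteq> 0"
proof
  assume e: "e q = 0"
  note D = diag_byD[OF d]
  have "X $$ (i, q) = 0" if i: "i < r" for i
  proof (rule det_nonzeroD[OF D(5) det _ i])
    fix j assume j: "j < r"
    have "(A * X) $$ (j, q) = 0" unfolding D(7) mult_dmat_entry[OF D(1) j q] using e by simp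
    then show "(\<Sum>i<r. A $$ (j, i) * X $$ (i, q)) = 0" using mult_entry[OF D(5,1) j q] by simp
  qed
  then have "(Y * X) $$ (q, q) = 0" unfolding mult_entry[OF D(2,1) q q] by simp
  then show False unfolding D(4) using q by simp
qed

lemma eigenvector_col:
  assumes B: "B \<in> carrier_mat m m" and EE: "full_col_rank m k E" and BE: "B * E = E * dmat k g" and t: "t < k"
  shows "eigenvector B (col E t) (g t)"
proof -
  obtain L where E: "E \<in> carrier_mat m k" and L: "L \<in> carrier_mat k m" "L * E = 1\<^sub>m k"
    using EE unfolding full_col_rank_def by blast
  have c: "col E t \<in> carrier_vec m" using E t by simp
  have "B *\<^sub>v col E t = g t \<cdot>\<^sub>v col E t"
  proof (rule eq_vecI)
    fix a assume "a < dim_vec (g t \<cdot>\<^sub>v col E t)"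
    then have a: "a < m" using E by simp
    have "(B *\<^sub>v col E t) $ a = (B * E) $$ (a, t)"
      unfolding mult_entry[OF B E a t] mult_vec_entry[OF B c a] using E t by simp
    also have "\<dots> = (g t \<cdot>\<^sub>v col E t) $ a"
      unfolding BE mult_dmat_entry[OF E a t] using a t E by simp
    finally show "(B *\<^sub>v col E t) $ a = (g t \<cdot>\<^sub>v col E t) $ a" .
  qed (use B E in auto)
  moreover have "col E t \<noteq> 0\<^sub>v m"
  proof
    assume 0: "col E t = 0\<^sub>v m"
    have "E $$ (x, t) = 0" if "x < m" for x
    proof -
      have "col E t $ x = 0" unfolding 0 using that by simp
      then show ?thesis using that t E by simp
    qed
    then have "(L * E) $$ (t, t) = 0" unfolding mult_entry[OF L(1) E t t] by simp
    then show False unfolding L(2) using t by simp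
  qed
  ultimately show ?thesis using c B unfolding eigenvector_def by simp
qed

text \<open>Supplies stacks for an actual run of the algorithm, with the same invertible block
  \<open>K\<close> for all eigenvalues. What needs work is that the compressed matrix has no nonzero
  eigenvalue besides the \<open>e q\<close>.\<close>

lemma eigenvector_stackI:
  assumes U: "full_col_rank m (r * r) U" and d: "diag_by r A X Y e" and inj: "inj_on e {..<r}" and det: "det A \<noteq> 0"
    and K: "K \<in> carrier_mat r r" "det K \<noteq> 0"
  shows "eigenvector_stack r (U * kron r (1\<^sub>m r) A * pinv U) (U * kron r (1\<^sub>m r) X * sdiag r (\<lambda>_. K))"
proof -
  let ?B = "U * kron r (1\<^sub>m r) A * pinv U" and ?E = "U * kron r (1\<^sub>m r) X * sdiag r (\<lambda>_. K)"
  have cU: "U \<in> carrier_mat m (r * r)" using U unfolding full_col_rank_def by blast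
  note D = diag_byD[OF d]
  note p = pinv_full_col_rank[OF U]
  have B: "?B \<in> carrier_mat m m" by (rule mult_carrier_mat[OF mult_carrier_mat[OF cU kron_carrier] p(1)])
  have dX: "det X \<noteq> 0" by (rule det_nonzero_of_inverse[OF D(1-3)])
  have sK: "sdiag r (\<lambda>_. K) = kron r K (1\<^sub>m r)"
  proof -
    have "dmat r (\<lambda>_. 1) = 1\<^sub>m r" by (rule eq_matI) (auto simp: dmat_def)
    then show ?thesis using sdiag_smult_eq_kron[OF K(1), of "\<lambda>_. 1"] by (simp add: one_smult_mat)
  qed
  have N: "kron r (1\<^sub>m r) X * sdiag r (\<lambda>_. K) = kron r K X"
    unfolding sK using kron_mult[of "1\<^sub>m r" r X K "1\<^sub>m r"] D K by simp
  have EU: "?E = U * kron r K X"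
    unfolding assoc_mult_mat[OF cU kron_carrier sdiag_carrier] N ..
  have EE: "full_col_rank m (r * r) ?E"
    unfolding EU by (rule full_col_rank_mult[OF U kron_carrier kron_det_nonzero[OF K(1) D(1) K(2) dX]])
  have cE: "?E \<in> carrier_mat m (r * r)" using EE unfolding full_col_rank_def by blast
  let ?D = "dmat (r * r) (\<lambda>t. e (t mod r))"
  have BE: "?B * ?E = ?E * ?D"
  proof -
    have "pinv U * ?E = kron r K X"
      unfolding EU assoc_mult_mat[OF p(1) cU kron_carrier, symmetric] p(2) by (rule left_mult_one_mat[OF kron_carrier])
    then have "?B * ?E = U * kron r (1\<^sub>m r) A * kron r K X"
      using assoc_mult_mat[OF mult_carrier_mat[OF cU kron_carrier] p(1) cE] by simp
    also have "\<dots> = U * (kron r (1\<^sub>m r) A * kron r K X)" by (rule assoc_mult_mat[OF cU kron_carrier kron_carrier])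
    also have "kron r (1\<^sub>m r) A * kron r K X = kron r K X * kron r (1\<^sub>m r) (dmat r e)"
      using kron_mult[of "1\<^sub>m r" r A K X] kron_mult[of K r X "1\<^sub>m r" "dmat r e"] D K by simp
    also have "U * \<dots> = ?E * ?D" unfolding EU kron_one_dmat by (rule assoc_mult_mat[OF cU kron_carrier dmat_carrier, symmetric])
    finally show ?thesis .
  qed
  have ev: "eigenvector ?B (col ?E t) (e (t mod r))" if t: "t < r * r" for t
    by (rule eigenvector_col[OF B EE BE t])
  have "e ` {..<r} = {x. x \<noteq> 0 \<and> eigenvalue ?B x}"
  proof (intro equalityI subsetI)
    fix x assume "x \<in> e ` {..<r}"
    then obtain q where q: "q < r" "x = e q" by auto
    have "q < r * r" using q pair_index_less[of 0 r q] by simp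
    then have "eigenvector ?B (col ?E q) x" using ev[of q] q by simp
    then show "x \<in> {x. x \<noteq> 0 \<and> eigenvalue ?B x}"
      using diag_by_eigenvalues_nonzero[OF d det q(1)] q unfolding eigenvalue_def mem_Collect_eq by metis
  next
    fix x assume "x \<in> {x. x \<noteq> 0 \<and> eigenvalue ?B x}"
    then obtain w where x: "x \<noteq> 0" and ew: "eigenvector ?B w x" unfolding eigenvalue_def by blast
    then have w: "w \<in> carrier_vec m" "w \<noteq> 0\<^sub>v m" "?B *\<^sub>v w = x \<cdot>\<^sub>v w"
      using B carrier_matD(1)[OF B] unfolding eigenvector_def by auto
    \<comment> \<open>A single eigenvector repeated in all columns has the format required by
      \<open>stack_coordinates\<close>.\<close>
    define F where "F = Matrix.mat m (r * r) (\<lambda>(a, _). w $ a)"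
    have F: "F \<in> carrier_mat m (r * r)" by (simp add: F_def)
    have BF: "?B * F = F * dmat (r * r) (\<lambda>t. (\<lambda>_. x) (t mod r))"
    proof (rule square_eq_matI[of _ m "r * r"])
      fix a t assume at: "a < m" "t < r * r"
      have "(?B * F) $$ (a, t) = (?B *\<^sub>v w) $ a"
        unfolding mult_entry[OF B F at] mult_vec_entry[OF B w(1) at(1)] using at by (simp add: F_def)
      then show "(?B * F) $$ (a, t) = (F * dmat (r * r) (\<lambda>t. (\<lambda>_. x) (t mod r))) $$ (a, t)"
        unfolding mult_dmat_entry[OF F at] w(3) using at w(1) by (simp add: F_def)
    qed (use B F in \<open>auto intro: mult_carrier_mat\<close>)
    have "\<forall>q<r. (\<lambda>_. x) q \<noteq> 0" using x by simp
    note c = stack_coordinates[OF U d F BF this]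
    show "x \<in> e ` {..<r}"
    proof (rule ccontr)
      assume no: "x \<notin> e ` {..<r}"
      have G0: "kron r (1\<^sub>m r) Y * (pinv U * F) = 0\<^sub>m (r * r) (r * r)" (is "?G = _")
      proof (rule square_eq_matI[OF c(1)])
        fix s t assume st: "s < r * r" "t < r * r"
        have "e (s mod r) \<noteq> x" using no square_index_div_mod[OF st(1)] by auto
        then show "?G $$ (s, t) = 0\<^sub>m (r * r) (r * r) $$ (s, t)" using c(3)[OF st] st by (simp add: mult.commute)
      qed auto
      have "F = U * (kron r (1\<^sub>m r) X * ?G)" by (rule c(2))
      then have F0: "F = 0\<^sub>m m (r * r)"
        unfolding G0 right_mult_zero_mat[OF kron_carrier] right_mult_zero_mat[OF cU] .
      \<comment> \<open>For \<open>r = 0\<close> the matrix \<open>F\<close> has no column to read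
        \<open>w\<close> from, but then the compressed matrix is zero and has no nonzero
        eigenvalue.\<close>
      have r0: "0 < r * r"
      proof (rule ccontr)
        assume "\<not> 0 < r * r"
        then have r00: "r = 0" by simp
        have "w = 0\<^sub>v m"
        proof (rule eq_vecI)
          fix a assume "a < dim_vec (0\<^sub>v m :: complex Matrix.vec)"
          then have a: "a < m" by simp
          have UA: "U * kron r (1\<^sub>m r) A \<in> carrier_mat m (r * r)" by (rule mult_carrier_mat[OF cU kron_carrier])
          have "?B $$ (a, b) = 0" if "b < m" for b
            unfolding mult_entry[OF UA p(1) a that] using r00 by simp
          then have "(?B *\<^sub>v w) $ a = 0" unfolding mult_vec_entry[OF B w(1) a] by simp
          then show "w $ a = 0\<^sub>v m $ a" unfolding w(3) using a w(1) x by simp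
        qed (use w in auto)
        then show False using w(2) by simp
      qed
      have "w = 0\<^sub>v m"
      proof (rule eq_vecI)
        fix a assume "a < dim_vec (0\<^sub>v m :: complex Matrix.vec)"
        then have a: "a < m" by simp
        have "w $ a = F $$ (a, 0)" using a r0 by (simp add: F_def)
        then show "w $ a = 0\<^sub>v m $ a" unfolding F0 using a r0 by simp
      qed (use w in auto)
      then show False using w(2) by simp
    qed
  qed
  moreover have "\<forall>p<r. \<forall>q<r. eigenvector ?B (col ?E (p * r + q)) (e q)"
    using ev[OF pair_index_less] by simp
  ultimately show ?thesis
    unfolding eigenvector_stack_def carrier_matD(1)[OF B] using cE rank_full_col_rank[OF EE] inj by blast
qed

section \<open>Gauge factors around the ring and step B\<close>

text \<open>Neighbouring gauge factors cancel. The index \<open>i mod d\<close> lets the empty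
  product at \<open>i = d\<close> start with \<open>A 0\<close>, which cancels against
  \<open>A' 0\<close>.\<close>

lemma foldr_gauge:
  fixes Q P :: "nat \<Rightarrow> nat \<Rightarrow> complex mat" and A A' :: "nat \<Rightarrow> complex mat"
  assumes d: "0 < d" and A: "\<And>k. k < d \<Longrightarrow> A k \<in> carrier_mat r r" "\<And>k. k < d \<Longrightarrow> A' k \<in> carrier_mat r r"
    "\<And>k. k < d \<Longrightarrow> A k * A' k = 1\<^sub>m r" "\<And>k. k < d \<Longrightarrow> A' k * A k = 1\<^sub>m r"
    and Q: "\<And>k a. Q k a \<in> carrier_mat r r"
    and P: "\<And>k. k < d \<Longrightarrow> P k (\<alpha> k) = c k \<cdot>\<^sub>m (A k * Q k (\<alpha> k) * A' (Suc k mod d))"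
    and "i \<le> d"
  shows "foldr (*) (map (\<lambda>k. P k (\<alpha> k)) [i..<d]) (1\<^sub>m r) = (\<Prod>k\<in>{i..<d}. c k) \<cdot>\<^sub>m
    (A (i mod d) * foldr (*) (map (\<lambda>k. Q k (\<alpha> k)) [i..<d]) (1\<^sub>m r) * A' 0)"
  using \<open>i \<le> d\<close>
proof (induction rule: inc_induct)
  case base
  show ?case using A(1)[OF d] A(3)[OF d] by (simp add: one_smult_mat right_mult_one_mat[OF A(1)[OF d]])
next
  case (step i)
  let ?F = "foldr (*) (map (\<lambda>k. Q k (\<alpha> k)) [Suc i..<d]) (1\<^sub>m r)"
  let ?s = "Suc i mod d"
  have id: "i < d" using step by simp
  have s: "?s < d" using d by simp
  have F: "?F \<in> carrier_mat r r" by (rule foldr_mult_entry(1)[OF Q])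
  note c = A(1)[OF id] Q[of i "\<alpha> i"] A(2)[OF s] A(1)[OF s] F A(2)[OF d]
  have AF: "A ?s * ?F * A' 0 \<in> carrier_mat r r" and AQ: "A i * Q i (\<alpha> i) * A' ?s \<in> carrier_mat r r"
    and FA: "?F * A' 0 \<in> carrier_mat r r" and aq: "A i * Q i (\<alpha> i) \<in> carrier_mat r r"
    and qf: "Q i (\<alpha> i) * ?F \<in> carrier_mat r r"
    using c by auto
  have up: "[i..<d] = i # [Suc i..<d]" using id by (rule upt_conv_Cons)
  have "foldr (*) (map (\<lambda>k. P k (\<alpha> k)) [i..<d]) (1\<^sub>m r)
      = (c i \<cdot>\<^sub>m (A i * Q i (\<alpha> i) * A' ?s)) * ((\<Prod>k\<in>{Suc i..<d}. c k) \<cdot>\<^sub>m (A ?s * ?F * A' 0))"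
    unfolding up using step.IH P[OF id] by simp
  also have "\<dots> = (c i * (\<Prod>k\<in>{Suc i..<d}. c k)) \<cdot>\<^sub>m ((A i * Q i (\<alpha> i) * A' ?s) * (A ?s * ?F * A' 0))"
    using mult_smult_assoc_mat[OF AQ smult_carrier_mat[OF AF]] mult_smult_distrib[OF AQ AF] by (simp add: smult_smult_mat)
  also have "(A i * Q i (\<alpha> i) * A' ?s) * (A ?s * ?F * A' 0) = A i * Q i (\<alpha> i) * (A' ?s * A ?s * (?F * A' 0))"
    using assoc_mult_mat[OF aq c(3) AF] assoc_mult_mat[OF c(4) c(5) c(6)] assoc_mult_mat[OF c(3) c(4) FA] by simp
  also have "\<dots> = A i * (Q i (\<alpha> i) * ?F) * A' 0"
    unfolding A(4)[OF s] left_mult_one_mat[OF FA]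
    using assoc_mult_mat[OF aq c(5,6)] assoc_mult_mat[OF c(1,2,5)] by simp
  also have "c i * (\<Prod>k\<in>{Suc i..<d}. c k) = (\<Prod>k\<in>{i..<d}. c k)"
    using id by (simp add: prod.atLeast_Suc_lessThan)
  finally show ?case using id by (simp add: up del: upt_Suc)
qed

lemma mps_state_gauge:
  fixes Q P :: "nat \<Rightarrow> nat \<Rightarrow> complex mat" and A A' :: "nat \<Rightarrow> complex mat"
  assumes d: "0 < d" and A: "\<And>k. k < d \<Longrightarrow> A k \<in> carrier_mat r r" "\<And>k. k < d \<Longrightarrow> A' k \<in> carrier_mat r r"
    "\<And>k. k < d \<Longrightarrow> A k * A' k = 1\<^sub>m r" "\<And>k. k < d \<Longrightarrow> A' k * A k = 1\<^sub>m r"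
    and Q: "\<And>k a. Q k a \<in> carrier_mat r r"
    and P: "\<And>k. k < d \<Longrightarrow> P k (\<alpha> k) = c k \<cdot>\<^sub>m (A k * Q k (\<alpha> k) * A' (Suc k mod d))"
  shows "mps_state d r P \<alpha> = (\<Prod>k<d. c k) * mps_state d r Q \<alpha>"
proof -
  let ?F = "foldr (*) (map (\<lambda>k. Q k (\<alpha> k)) [0..<d]) (1\<^sub>m r)"
  have F: "?F \<in> carrier_mat r r" by (rule foldr_mult_entry(1)[OF Q])
  have c0: "A 0 \<in> carrier_mat r r" "A' 0 \<in> carrier_mat r r" "A' 0 * A 0 = 1\<^sub>m r" using A d by auto
  have AF: "A 0 * ?F \<in> carrier_mat r r" using c0 F by simp
  have AFA: "A 0 * ?F * A' 0 \<in> carrier_mat r r" using AF c0 by simp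
  have "mps_state d r P \<alpha> = mat_trace ((\<Prod>k<d. c k) \<cdot>\<^sub>m (A 0 * ?F * A' 0))"
    using foldr_gauge[of d A r A' Q P \<alpha> c 0] d A Q P by (simp add: mps_state_def atLeast0LessThan)
  also have "\<dots> = (\<Prod>k<d. c k) * mat_trace (A 0 * ?F * A' 0)"
    using carrier_matD[OF AFA] by (simp add: mat_trace_def sum_distrib_left)
  also have "mat_trace (A 0 * ?F * A' 0) = mat_trace (A' 0 * (A 0 * ?F))"
    by (rule mat_trace_mult_commute[OF AF c0(2)])
  also have "A' 0 * (A 0 * ?F) = ?F"
    unfolding assoc_mult_mat[OF c0(2,1) F, symmetric] c0(3) by (rule left_mult_one_mat[OF F])
  finally show ?thesis by (simp add: mps_state_def)
qed

lemma mps_norm_scale: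
  assumes "\<And>\<alpha>. \<alpha> \<in> tuples n {..<d} \<Longrightarrow> mps_state d r P \<alpha> = c * mps_state d r Q \<alpha>"
  shows "mps_norm d r n P = cmod c * mps_norm d r n Q"
proof -
  have "(\<Sum>\<alpha>\<in>tuples n {..<d}. (cmod (mps_state d r P \<alpha>))\<^sup>2)
      = (cmod c)\<^sup>2 * (\<Sum>\<alpha>\<in>tuples n {..<d}. (cmod (mps_state d r Q \<alpha>))\<^sup>2)"
    using assms by (simp add: norm_mult power_mult_distrib sum_distrib_left)
  then show ?thesis by (simp add: mps_norm_def real_sqrt_mult)
qed

lemma mps_state_normalize:
  assumes "0 < d" and Q: "\<And>k a. Q k a \<in> carrier_mat r r"
  shows "mps_state d r (normalize_mps d r n Q) \<alpha> = of_real (1 / mps_norm d r n Q) * mps_state d r Q \<alpha>"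
proof -
  define c where "c k = (if k = 0 then of_real (1 / mps_norm d r n Q) else 1 :: complex)" for k :: nat
  have "mps_state d r (normalize_mps d r n Q) \<alpha> = (\<Prod>k<d. c k) * mps_state d r Q \<alpha>"
    by (rule mps_state_gauge[of d "\<lambda>_. 1\<^sub>m r" r "\<lambda>_. 1\<^sub>m r"])
      (use assms in \<open>auto simp: normalize_mps_def c_def one_smult_mat right_mult_one_mat[OF Q] left_mult_one_mat[OF Q]\<close>)
  also have "(\<Prod>k<d. c k) = of_real (1 / mps_norm d r n Q)"
    using assms(1) by (simp add: c_def prod.delta)
  finally show ?thesis .
qed

lemma mps_norm_normalize:
  assumes "0 < d" and "\<And>k a. Q k a \<in> carrier_mat r r" and "mps_norm d r n Q \<noteq> 0"
  shows "mps_norm d r n (normalize_mps d r n Q) = 1"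
proof -
  have "mps_norm d r n Q \<ge> 0" unfolding mps_norm_def by (intro real_sqrt_ge_zero sum_nonneg) auto
  then show ?thesis
    using mps_norm_scale[of n d r "normalize_mps d r n Q" "of_real (1 / mps_norm d r n Q)" Q]
      mps_state_normalize[OF assms(1,2)] assms(3) by (simp add: norm_divide)
qed

lemma transpose_inverse:
  fixes A :: "complex mat"
  assumes "A \<in> carrier_mat r r" "B \<in> carrier_mat r r" "A * B = 1\<^sub>m r"
  shows "B\<^sup>T * A\<^sup>T = 1\<^sub>m r"
  using transpose_mult[OF assms(1,2)] assms(3) by simp

lemma pinv_mult_inverse:
  assumes U: "full_col_rank m k U" and G: "G \<in> carrier_mat k k" and S: "S \<in> carrier_mat k k" and GS: "G * S = 1\<^sub>m k"
  shows "pinv (U * G) * U = S"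
proof -
  have cU: "U \<in> carrier_mat m k" using U unfolding full_col_rank_def by blast
  have UG: "U * G \<in> carrier_mat m k" by (rule mult_carrier_mat[OF cU G])
  note p = pinv_full_col_rank[OF full_col_rank_mult[OF U G det_nonzero_of_inverse[OF G S GS]]]
  have "U = U * G * S" unfolding assoc_mult_mat[OF cU G S] GS using cU by simp
  then have "pinv (U * G) * U = pinv (U * G) * (U * G * S)" by simp
  also have "\<dots> = pinv (U * G) * (U * G) * S" by (rule assoc_mult_mat[OF p(1) UG S, symmetric])
  finally show ?thesis unfolding p(2) using S by simp
qed

text \<open>Inverting the unfolding of \<open>Q_hat\<close> at the next site leaves
  \<open>Q_tilde\<close> with right gauge the inverse of \<open>A k'\<close> and a left gauge that
  involves the unknown environment. Comparing \<open>Q_tilde\<close> with \<open>Q_hat\<close> at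
  the same site gives a Kronecker product whose top-left block is, up to a scalar, the transposed
  correction of the left gauge. So \<open>W\<close> and the right gauges survive only in that
  scalar.\<close>

lemma Q_check_gauge:
  fixes k d :: nat
  defines "k' \<equiv> Suc k mod d"
  assumes r: "0 < r" and Q: "\<And>s a. Q s a \<in> carrier_mat r r"
    and U: "full_col_rank (n k') (r * r) (unfold1 (n k') r (Q k'))"
    and V: "full_col_rank (n k) (r * r) (unfold2 (n k) r (Q k))"
    and M: "M k 0 = unfold1 (n k') r (Q k') * kron r (1\<^sub>m r) W * (unfold2 (n k) r (Q k))\<^sup>T"
    and W: "W \<in> carrier_mat r r" "det W \<noteq> 0"
    and A: "A k \<in> carrier_mat r r" "A k' \<in> carrier_mat r r" "det (A k) \<noteq> 0" "det (A k') \<noteq> 0"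
    and B: "B k \<in> carrier_mat r r" "B k' \<in> carrier_mat r r" "det (B k) \<noteq> 0" "det (B k') \<noteq> 0"
    and hat: "\<And>a. a < n k \<Longrightarrow> Q_hat r (E k) (E' k) a = A k * Q k a * B k"
      "\<And>a. a < n k' \<Longrightarrow> Q_hat r (E k') (E' k') a = A k' * Q k' a * B k'"
    and a: "a < n k"
  shows "Q_check d r n M E E' k a = (A k' * B k) $$ (0, 0) \<cdot>\<^sub>m (A k * Q k a * minv (A k'))"
proof -
  define A0 A1 B0 B1 where AB: "A0 = A k" "A1 = A k'" "B0 = B k" "B1 = B k'"
  define U1 V0 where UV: "U1 = unfold1 (n k') r (Q k')" "V0 = unfold2 (n k) r (Q k)"
  have cA: "A0 \<in> carrier_mat r r" "A1 \<in> carrier_mat r r" "B0 \<in> carrier_mat r r" "B1 \<in> carrier_mat r r"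
    and dA: "det A0 \<noteq> 0" "det A1 \<noteq> 0" "det B0 \<noteq> 0" "det B1 \<noteq> 0" using A B by (auto simp: AB)
  define iA iB where i: "iA = minv A1" "iB = minv B1"
  have ciA: "iA \<in> carrier_mat r r" "A1 * iA = 1\<^sub>m r" "iA * A1 = 1\<^sub>m r"
    using minv[OF cA(2) dA(2)] by (auto simp: i)
  have ciB: "iB \<in> carrier_mat r r" "B1 * iB = 1\<^sub>m r" "iB * B1 = 1\<^sub>m r"
    using minv[OF cA(4) dA(4)] by (auto simp: i)
  have cU: "U1 \<in> carrier_mat (n k') (r * r)" and cV: "V0 \<in> carrier_mat (n k) (r * r)" by (simp_all add: UV)
  have cVT: "V0\<^sup>T \<in> carrier_mat (r * r) (n k)" using cV by simp
  have TA: "A1\<^sup>T \<in> carrier_mat r r" "iA\<^sup>T \<in> carrier_mat r r" "A0\<^sup>T \<in> carrier_mat r r" using cA ciA by auto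
  have hU: "unfold1 (n k') r (Q_hat r (E k') (E' k')) = U1 * kron r A1\<^sup>T B1"
  proof -
    have "unfold1 (n k') r (Q_hat r (E k') (E' k')) = unfold1 (n k') r (\<lambda>a. A1 * Q k' a * B1)"
      by (rule unfold1_cong) (simp add: hat(2) AB)
    also have "\<dots> = U1 * kron r A1\<^sup>T B1" unfolding UV by (rule unfold1_gauge[OF Q cA(2,4)])
    finally show ?thesis .
  qed
  have GS: "kron r A1\<^sup>T B1 * kron r iA\<^sup>T iB = 1\<^sub>m (r * r)"
    by (rule kron_inverse) (use TA cA ciA ciB transpose_inverse[OF ciA(1) cA(2) ciA(3)] in auto)
  \<comment> \<open>The left gauge of \<open>Q_tilde\<close>; \<open>N\<close> will exchange it for
    \<open>A0\<close>.\<close>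
  define Cc where "Cc = iB * W"
  have cC: "Cc \<in> carrier_mat r r" using ciB W by (simp add: Cc_def)
  have dC: "det Cc \<noteq> 0"
    using det_mult[OF ciB(1) W(1)] det_nonzero_of_inverse[OF ciB(1) cA(4) ciB(3)] W(2) by (simp add: Cc_def)
  define P where "P = U1 * kron r A1\<^sup>T B1"
  have pP: "pinv P \<in> carrier_mat (r * r) (n k')"
    unfolding P_def
    by (rule pinv_full_col_rank(1)[OF full_col_rank_mult[OF U[folded UV] kron_carrier
          det_nonzero_of_inverse[OF kron_carrier kron_carrier GS]]])
  have PU: "pinv P * U1 = kron r iA\<^sup>T iB"
    unfolding P_def by (rule pinv_mult_inverse[OF U[folded UV] kron_carrier kron_carrier GS])
  have kW: "U1 * kron r (1\<^sub>m r) W \<in> carrier_mat (n k') (r * r)" by (rule mult_carrier_mat[OF cU kron_carrier])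
  have "pinv P * M k 0 = pinv P * (U1 * kron r (1\<^sub>m r) W) * V0\<^sup>T"
    unfolding M UV[symmetric] by (rule assoc_mult_mat[OF pP kW cVT, symmetric])
  also have "pinv P * (U1 * kron r (1\<^sub>m r) W) = kron r iA\<^sup>T iB * kron r (1\<^sub>m r) W"
    unfolding PU[symmetric] by (rule assoc_mult_mat[OF pP cU kron_carrier, symmetric])
  also have "\<dots> = kron r iA\<^sup>T Cc"
    using kron_mult[OF TA(2) ciB(1) one_carrier_mat W(1)] TA by (simp add: Cc_def)
  finally have PM: "pinv P * M k 0 = kron r iA\<^sup>T Cc * V0\<^sup>T" .
  have "(pinv P * M k 0)\<^sup>T = V0 * kron r iA Cc\<^sup>T"
    unfolding PM transpose_mult[OF kron_carrier cVT] using kron_transpose[OF TA(2) cC] by simp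
  also have "\<dots> = unfold2 (n k) r (\<lambda>a. Cc * Q k a * iA)"
    unfolding UV by (rule unfold2_gauge[OF Q cC ciA(1), symmetric])
  finally have PMT: "(pinv P * M k 0)\<^sup>T = unfold2 (n k) r (\<lambda>a. Cc * Q k a * iA)" .
  have Tc: "Cc * Q k a * iA \<in> carrier_mat r r" for a using cC Q ciA by simp
  define T where "T = Q_tilde d r n M E E' k"
  have T: "T a = Cc * Q k a * iA" if "a < n k" for a
    unfolding T_def Q_tilde_def Let_def k'_def[symmetric] hU P_def[symmetric] PMT
    by (rule core_of_unfold2_unfold2[OF Tc that])
  have uT: "unfold2 (n k) r T = V0 * kron r iA Cc\<^sup>T"
    unfolding UV unfold2_gauge[OF Q cC ciA(1), symmetric] by (rule unfold2_cong) (simp add: T)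
  have uH: "unfold2 (n k) r (Q_hat r (E k) (E' k)) = V0 * kron r B0 A0\<^sup>T"
  proof -
    have "unfold2 (n k) r (Q_hat r (E k) (E' k)) = unfold2 (n k) r (\<lambda>a. A0 * Q k a * B0)"
      by (rule unfold2_cong) (simp add: hat(1) AB)
    also have "\<dots> = V0 * kron r B0 A0\<^sup>T" unfolding UV by (rule unfold2_gauge[OF Q cA(1,3)])
    finally show ?thesis .
  qed
  define iC where "iC = minv Cc"
  have ciC: "iC \<in> carrier_mat r r" "Cc * iC = 1\<^sub>m r" "iC * Cc = 1\<^sub>m r"
    using minv[OF cC dC] by (auto simp: iC_def)
  have TC: "Cc\<^sup>T \<in> carrier_mat r r" "iC\<^sup>T \<in> carrier_mat r r" using cC ciC by auto
  have GS2: "kron r iA Cc\<^sup>T * kron r A1 iC\<^sup>T = 1\<^sub>m (r * r)"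
    by (rule kron_inverse) (use TC cA ciA transpose_inverse[OF ciC(1) cC ciC(3)] in auto)
  define R where "R = V0 * kron r iA Cc\<^sup>T"
  have pR: "pinv R \<in> carrier_mat (r * r) (n k)"
    unfolding R_def
    by (rule pinv_full_col_rank(1)[OF full_col_rank_mult[OF V[folded UV] kron_carrier
          det_nonzero_of_inverse[OF kron_carrier kron_carrier GS2]]])
  have RV: "pinv R * V0 = kron r A1 iC\<^sup>T"
    unfolding R_def by (rule pinv_mult_inverse[OF V[folded UV] kron_carrier kron_carrier GS2])
  define X where "X = pinv (unfold2 (n k) r T) * unfold2 (n k) r (Q_hat r (E k) (E' k))"
  have X: "X = kron r (A1 * B0) (iC\<^sup>T * A0\<^sup>T)"
    unfolding X_def uT uH R_def[symmetric] assoc_mult_mat[OF pR cV kron_carrier, symmetric] RV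
    by (rule kron_mult[OF cA(2) TC(2) cA(3) TA(3)])
  \<comment> \<open>The top-left block of a Kronecker product is this entry of the first factor
    times the second factor. It depends on the chosen bases and can be 0.\<close>
  define c where "c = (A1 * B0) $$ (0, 0)"
  have ct: "iC\<^sup>T * A0\<^sup>T = (A0 * iC)\<^sup>T" by (rule transpose_mult[OF cA(1) ciC(1), symmetric])
  have cAC: "A0 * iC \<in> carrier_mat r r" using cA ciC by simp
  have N: "(Matrix.mat r r (\<lambda>(s, t). X $$ (s, t)))\<^sup>T = c \<cdot>\<^sub>m (A0 * iC)"
  proof (rule square_eq_matI[of _ r r])
    fix s t assume st: "s < r" "t < r"
    then have st2: "s < r * r" "t < r * r" using pair_index_less[of 0 r] by auto
    show "(Matrix.mat r r (\<lambda>(s, t). X $$ (s, t)))\<^sup>T $$ (s, t) = (c \<cdot>\<^sub>m (A0 * iC)) $$ (s, t)"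
      using st carrier_matD[OF cAC] unfolding X ct c_def by (simp add: kron_index[OF st2(2,1)])
  qed (use cAC in auto)
  have QiA: "Q k a * iA \<in> carrier_mat r r" using Q ciA by simp
  have CQ: "Cc * Q k a \<in> carrier_mat r r" using Q cC by simp
  have "Q_check d r n M E E' k a = c \<cdot>\<^sub>m (A0 * iC) * (Cc * Q k a * iA)"
    unfolding Q_check_def Let_def T_def[symmetric] X_def[symmetric] N T[OF a] ..
  also have "\<dots> = c \<cdot>\<^sub>m (A0 * iC * (Cc * Q k a * iA))" by (rule mult_smult_assoc_mat[OF cAC Tc])
  also have "A0 * iC * (Cc * Q k a * iA) = A0 * (iC * Cc * (Q k a * iA))"
    using assoc_mult_mat[OF cA(1) ciC(1) Tc[of a]] assoc_mult_mat[OF cC Q ciA(1)] assoc_mult_mat[OF ciC(1) cC QiA] by simp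
  also have "\<dots> = A0 * Q k a * iA"
    unfolding ciC(3) left_mult_one_mat[OF QiA] by (rule assoc_mult_mat[OF cA(1) Q ciA(1), symmetric])
  finally show ?thesis by (simp add: AB c_def i)
qed

lemma tuples_less: "\<alpha> \<in> tuples n S \<Longrightarrow> k \<in> S \<Longrightarrow> \<alpha> k < n k"
  by (auto simp: tuples_def PiE_def)

text \<open>The scalars \<open>c k\<close> are pushed into the gauge matrices until their product
  remains at site 0. Normalization fixes its modulus, so a phase is left.\<close>

lemma gauge_equivalent_normalized:
  assumes d: "2 \<le> d" and Q: "\<And>k a. Q k a \<in> carrier_mat r r"
    and A: "\<And>k. k < d \<Longrightarrow> A k \<in> carrier_mat r r" "\<And>k. k < d \<Longrightarrow> det (A k) \<noteq> 0"
    and P: "\<And>k a. k < d \<Longrightarrow> a < n k \<Longrightarrow> P k a = c k \<cdot>\<^sub>m (A k * Q k a * minv (A (Suc k mod d)))"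
    and nQ: "mps_norm d r n Q \<noteq> 0" and nP: "mps_norm d r n P \<noteq> 0"
  shows "gauge_equivalent d r n (normalize_mps d r n P) (normalize_mps d r n Q)"
proof -
  have d0: "0 < d" using d by simp
  note iA = minv[OF A]
  have norm: "mps_norm d r n P = cmod (\<Prod>k<d. c k) * mps_norm d r n Q"
  proof (rule mps_norm_scale)
    fix \<alpha> assume "\<alpha> \<in> tuples n {..<d}"
    then have "\<And>k. k < d \<Longrightarrow> \<alpha> k < n k" using tuples_less by blast
    then show "mps_state d r P \<alpha> = (\<Prod>k<d. c k) * mps_state d r Q \<alpha>"
      by (intro mps_state_gauge[of d A r "\<lambda>k. minv (A k)"]) (use d0 A iA Q P in auto)
  qed
  then have c0: "(\<Prod>k<d. c k) \<noteq> 0" using nP by auto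
  then have ck: "c k \<noteq> 0" if "k < d" for k using that by auto
  \<comment> \<open>Chosen so that \<open>t k = c k * t (Suc k mod d)\<close> at every site except
    0, where the whole product of the \<open>c k\<close> is collected.\<close>
  define t where "t k = (if k = 0 then 1 else \<Prod>i\<in>{k..<d}. c i)" for k
  have t0: "t k \<noteq> 0" if "k < d" for k using ck by (auto simp: t_def)
  have tc: "t k = c k * t (Suc k mod d)" if "k \<in> {1..<d}" for k
  proof (cases "Suc k = d")
    case True
    then have "{k..<d} = {k}" by auto
    then show ?thesis using True that by (simp add: t_def)
  next
    case False
    then show ?thesis using that by (simp add: t_def prod.atLeast_Suc_lessThan)
  qed
  have t1: "c 0 * t (1 mod d) = (\<Prod>k<d. c k)"
    using d by (simp add: t_def atLeast0LessThan[symmetric] prod.atLeast_Suc_lessThan)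
  define L where "L k = (1 / t k) \<cdot>\<^sub>m minv (A k)" for k
  have L: "L k \<in> carrier_mat r r" "minv (L k) = t k \<cdot>\<^sub>m A k" "invertible_mat (L k)" if k: "k < d" for k
  proof -
    note c = iA(1)[OF k k] A(1)[OF k]
    show Lc: "L k \<in> carrier_mat r r" using c by (simp add: L_def)
    have "(1 / t k) \<cdot>\<^sub>m minv (A k) * (t k \<cdot>\<^sub>m A k) = (1 / t k) \<cdot>\<^sub>m (t k \<cdot>\<^sub>m (minv (A k) * A k))"
      using mult_smult_assoc_mat[OF c(1) smult_carrier_mat[OF c(2)]] mult_smult_distrib[OF c] by simp
    also have "\<dots> = 1\<^sub>m r"
      unfolding iA(3)[OF k k] using t0[OF k] by (simp add: smult_smult_mat one_smult_mat)
    finally have inv: "L k * (t k \<cdot>\<^sub>m A k) = 1\<^sub>m r" by (simp add: L_def)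
    show "minv (L k) = t k \<cdot>\<^sub>m A k"
      by (rule minv_eqI[OF Lc _ inv]) (use c in simp)
    show "invertible_mat (L k)"
      by (rule invertible_mat_of_det[OF Lc det_nonzero_of_inverse[OF Lc _ inv]]) (use c in simp)
  qed
  have LQL: "minv (L k) * (s \<cdot>\<^sub>m Q k a) * L (Suc k mod d)
      = (s * t k / t (Suc k mod d)) \<cdot>\<^sub>m (A k * Q k a * minv (A (Suc k mod d)))" if k: "k < d" for k a s
  proof -
    have k': "Suc k mod d < d" using d0 by simp
    note c = A(1)[OF k] Q[of k a] iA(1)[OF k' k']
    have AQ: "A k * Q k a \<in> carrier_mat r r" using c by simp
    show ?thesis
      unfolding L(2)[OF k] unfolding L_def
      using mult_smult_assoc_mat[OF c(1) smult_carrier_mat[OF c(2)]] mult_smult_distrib[OF c(1,2)]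
        mult_smult_assoc_mat[OF AQ smult_carrier_mat[OF c(3)]] mult_smult_distrib[OF AQ c(3)]
      by (simp add: smult_smult_mat mult_ac)
  qed
  define lam where "lam = (\<Prod>k<d. c k) / of_real (cmod (\<Prod>k<d. c k))"
  show ?thesis
    unfolding gauge_equivalent_def
  proof (intro exI[of _ lam] exI[of _ L] conjI ballI allI impI)
    show "cmod lam = 1" using c0 by (simp add: lam_def norm_divide)
    show "L k \<in> carrier_mat r r" "invertible_mat (L k)" if "k < d" for k using L that by auto
    fix a assume a: "a < n 0"
    have t1': "t (1 mod d) \<noteq> 0" using t0 d by simp
    have "lam \<cdot>\<^sub>m (minv (L 0) * normalize_mps d r n Q 0 a * L (1 mod d))
        = (lam * (of_real (1 / mps_norm d r n Q) * t 0 / t (1 mod d))) \<cdot>\<^sub>m (A 0 * Q 0 a * minv (A (1 mod d)))"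
      using LQL[OF d0, of "of_real (1 / mps_norm d r n Q)" a] by (simp add: normalize_mps_def smult_smult_mat)
    also have "lam * (of_real (1 / mps_norm d r n Q) * t 0 / t (1 mod d)) = of_real (1 / mps_norm d r n P) * c 0"
      unfolding norm lam_def t1[symmetric] using t1' by (simp add: t_def field_simps)
    also have "(of_real (1 / mps_norm d r n P) * c 0) \<cdot>\<^sub>m (A 0 * Q 0 a * minv (A (1 mod d))) = normalize_mps d r n P 0 a"
      using P[OF d0 a] by (simp add: normalize_mps_def smult_smult_mat)
    finally show "normalize_mps d r n P 0 a = lam \<cdot>\<^sub>m (minv (L 0) * normalize_mps d r n Q 0 a * L (1 mod d))" ..
  next
    fix k a assume k: "k \<in> {1..<d}" and a: "a < n k"
    then have kd: "k < d" by simp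
    have t': "t (Suc k mod d) \<noteq> 0" using t0 d0 by simp
    show "normalize_mps d r n P k a = minv (L k) * normalize_mps d r n Q k a * L (Suc k mod d)"
      using LQL[OF kd, of 1 a] P[OF kd a] tc[OF k] t' k by (simp add: normalize_mps_def one_smult_mat)
  qed
qed

section \<open>Recovery from exact factorizations of the slices\<close>

lemma cyclic_pred:
  assumes "k < (d::nat)"
  obtains j where "j < d" "Suc j mod d = k"
proof (cases k)
  case 0
  then show thesis using that[of "d - 1"] assms by simp
next
  case (Suc m)
  then show thesis using that[of m] assms by simp
qed

text \<open>The cores \<open>Q\<close> need not be normalized although the slices come from a unit
  vector: the scale factor of the slices can be absorbed into \<open>W\<close>.\<close>

locale exact_data =
  fixes d r :: nat and n :: "nat \<Rightarrow> nat" and Q :: "nat \<Rightarrow> nat \<Rightarrow> complex mat"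
    and M W :: "nat \<Rightarrow> nat \<Rightarrow> complex mat"
  assumes r: "0 < r" and d: "2 \<le> d" and Q: "\<And>k a. Q k a \<in> carrier_mat r r"
    and U: "\<And>k. k < d \<Longrightarrow> full_col_rank (n k) (r * r) (unfold1 (n k) r (Q k))"
    and V: "\<And>k. k < d \<Longrightarrow> full_col_rank (n k) (r * r) (unfold2 (n k) r (Q k))"
    and W: "\<And>j i. W j i \<in> carrier_mat r r"
    and M: "\<And>j i. j < d \<Longrightarrow> i < 4 \<Longrightarrow> M j i = unfold1 (n (Suc j mod d)) r (Q (Suc j mod d)) *
      kron r (1\<^sub>m r) (W j i) * (unfold2 (n j) r (Q j))\<^sup>T"
    and spectral: "\<And>j. j < d \<Longrightarrow> spectral_data r (W j 0) (W j 1) (W j 2) (W j 3)"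
    and norm: "mps_norm d r n Q \<noteq> 0"
begin

lemma pair_matrix:
  assumes j: "j < d" and i: "i < 4" "i' < 4" and A: "A \<in> carrier_mat r r" and WW: "W j i = A * W j i'" and "det (W j i') \<noteq> 0"
  shows "M j i * pinv (M j i') = unfold1 (n (Suc j mod d)) r (Q (Suc j mod d)) * kron r (1\<^sub>m r) A *
    pinv (unfold1 (n (Suc j mod d)) r (Q (Suc j mod d)))"
proof -
  have k: "Suc j mod d < d" using d by simp
  show ?thesis
    unfolding M[OF j i(1)] M[OF j i(2)] WW by (rule mult_pinv_kron[OF U[OF k] V[OF j] W assms(6) A])
qed

lemma eigen_choice_gauge:
  assumes "eigen_choice d r M E E'" and k: "k < d"
  obtains A B where "A \<in> carrier_mat r r" "det A \<noteq> 0" "B \<in> carrier_mat r r" "det B \<noteq> 0"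
    "\<And>a. a < n k \<Longrightarrow> Q_hat r (E k) (E' k) a = A * Q k a * B"
    "\<And>l. l < r \<Longrightarrow> invertible_mat (F_block r (E k) (E' k) l 0)"
    "invertible_mat (index_swap r (K_hat r (E k) (E' k)))"
proof -
  obtain j where j: "j < d" "Suc j mod d = k" using cyclic_pred[OF k] .
  obtain A X Y e C X' Y' e' where det: "det (W j 1) \<noteq> 0" "det (W j 3) \<noteq> 0"
    and A: "diag_by r A X Y e" "inj_on e {..<r}" "W j 0 = A * W j 1"
    and C: "diag_by r C X' Y' e'" "inj_on e' {..<r}" "W j 2 = C * W j 3"
    and Z: "\<forall>p<r. \<forall>q<r. (Y * X') $$ (p, q) \<noteq> 0"
    using spectral[OF j(1)] unfolding spectral_data_def by blast
  note DA = diag_byD[OF A(1)] and DC = diag_byD[OF C(1)]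
  let ?U = "unfold1 (n k) r (Q k)"
  have st: "eigenvector_stack r (?U * kron r (1\<^sub>m r) A * pinv ?U) (E k)"
    "eigenvector_stack r (?U * kron r (1\<^sub>m r) C * pinv ?U) (E' k)"
    using assms(1) j pair_matrix[OF j(1) _ _ DA(5) A(3) det(1)] pair_matrix[OF j(1) _ _ DC(5) C(3) det(2)]
    unfolding eigen_choice_def by auto
  obtain \<pi> K where pi: "bij_betw \<pi> {..<r} {..<r}" and K: "\<And>q. q < r \<Longrightarrow> K q \<in> carrier_mat r r" "\<And>q. q < r \<Longrightarrow> det (K q) \<noteq> 0"
    and E: "E k = ?U * kron r (1\<^sub>m r) (Matrix.mat r r (\<lambda>(i, q). X $$ (i, \<pi> q))) * sdiag r K"
    using eigenvector_stack_form[OF U[OF k] A(1,2) st(1)] by blast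
  obtain \<sigma> K' where sig: "bij_betw \<sigma> {..<r} {..<r}" and K': "\<And>q. q < r \<Longrightarrow> K' q \<in> carrier_mat r r" "\<And>q. q < r \<Longrightarrow> det (K' q) \<noteq> 0"
    and E': "E' k = ?U * kron r (1\<^sub>m r) (Matrix.mat r r (\<lambda>(i, q). X' $$ (i, \<sigma> q))) * sdiag r K'"
    using eigenvector_stack_form[OF U[OF k] C(1,2) st(2)] by blast
  define Xp Yp Xs where "Xp = Matrix.mat r r (\<lambda>(i, q). X $$ (i, \<pi> q))"
    and "Yp = Matrix.mat r r (\<lambda>(q, i). Y $$ (\<pi> q, i))" and "Xs = Matrix.mat r r (\<lambda>(i, q). X' $$ (i, \<sigma> q))"
  note Dp = diag_byD[OF diag_by_permute[OF A(1) pi, folded Xp_def Yp_def]]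
  have Xs: "Xs \<in> carrier_mat r r" by (simp add: Xs_def)
  have Zp: "(Yp * Xs) $$ (p, q) \<noteq> 0" if pq: "p < r" "q < r" for p q
  proof -
    have lt: "\<pi> p < r" "\<sigma> q < r" using pi sig pq by (auto simp: bij_betw_def)
    have "(Yp * Xs) $$ (p, q) = (Y * X') $$ (\<pi> p, \<sigma> q)"
      unfolding mult_entry[OF Dp(2) Xs pq] mult_entry[OF DA(2) DC(1) lt] using pq by (simp add: Yp_def Xs_def)
    then show ?thesis using Z lt by simp
  qed
  define z where "z l = (Yp * Xs) $$ (l, 0) / (Yp * Xs) $$ (0, 0)" for l
  have res: "\<And>l. l < r \<Longrightarrow> invertible_mat (F_block r (E k) (E' k) l 0)"
    "invertible_mat (index_swap r (K_hat r (E k) (E' k)))"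
    "\<And>a. a < n k \<Longrightarrow> Q_hat r (E k) (E' k) a = (K 0)\<^sup>T * Q k a * (Xp * dmat r z)"
    using Q_hat_of_stacks[OF r U[OF k] Q Dp(1-4) Xs Zp K K' E[folded Xp_def] E'[folded Xs_def]]
    unfolding z_def by blast+
  have zl: "z l \<noteq> 0" if "l < r" for l using Zp[OF that r] Zp[OF r r] by (simp add: z_def)
  have dz: "dmat r z * dmat r (\<lambda>l. 1 / z l) = 1\<^sub>m r"
    unfolding dmat_mult by (rule square_eq_matI[of _ r r]) (use zl in \<open>auto simp: dmat_index\<close>)
  have "det (Xp * dmat r z) \<noteq> 0"
    using det_mult[OF Dp(1) dmat_carrier] det_nonzero_of_inverse[OF Dp(1-3)]
      det_nonzero_of_inverse[OF dmat_carrier dmat_carrier dz] by simp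
  moreover have "det ((K 0)\<^sup>T) \<noteq> 0" using det_transpose[OF K(1)[OF r]] K(2)[OF r] by simp
  moreover have "(K 0)\<^sup>T \<in> carrier_mat r r" "Xp * dmat r z \<in> carrier_mat r r" using K(1)[OF r] Dp(1) by auto
  ultimately show thesis using that res by blast
qed

lemma recovery:
  assumes ch: "eigen_choice d r M E E'"
  shows "step_A_defined d r E E'"
    and "mps_norm d r n (Q_check d r n M E E') \<noteq> 0 \<Longrightarrow>
      gauge_equivalent d r n (recovery_output d r n M E E') (normalize_mps d r n Q)"
proof -
  define gauge where "gauge k A B \<longleftrightarrow> A \<in> carrier_mat r r \<and> det A \<noteq> 0 \<and> B \<in> carrier_mat r r \<and> det B \<noteq> 0 \<and>
      (\<forall>a<n k. Q_hat r (E k) (E' k) a = A * Q k a * B) \<and>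
      (\<forall>l<r. invertible_mat (F_block r (E k) (E' k) l 0)) \<and> invertible_mat (index_swap r (K_hat r (E k) (E' k)))"
    for k A B
  have "\<exists>A B. gauge k A B" if "k < d" for k
  proof (rule eigen_choice_gauge[OF ch that])
    fix A B assume "A \<in> carrier_mat r r" "det A \<noteq> 0" "B \<in> carrier_mat r r" "det B \<noteq> 0"
      "\<And>a. a < n k \<Longrightarrow> Q_hat r (E k) (E' k) a = A * Q k a * B"
      "\<And>l. l < r \<Longrightarrow> invertible_mat (F_block r (E k) (E' k) l 0)"
      "invertible_mat (index_swap r (K_hat r (E k) (E' k)))"
    then have "gauge k A B" by (simp add: gauge_def)
    then show ?thesis by blast
  qed
  then obtain A B where "\<And>k. k < d \<Longrightarrow> gauge k (A k) (B k)" by metis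
  then have AB: "\<And>k. k < d \<Longrightarrow> A k \<in> carrier_mat r r" "\<And>k. k < d \<Longrightarrow> det (A k) \<noteq> 0"
    "\<And>k. k < d \<Longrightarrow> B k \<in> carrier_mat r r" "\<And>k. k < d \<Longrightarrow> det (B k) \<noteq> 0"
    "\<And>k a. k < d \<Longrightarrow> a < n k \<Longrightarrow> Q_hat r (E k) (E' k) a = A k * Q k a * B k"
    and inv: "\<And>k. k < d \<Longrightarrow> \<forall>l<r. invertible_mat (F_block r (E k) (E' k) l 0)"
    "\<And>k. k < d \<Longrightarrow> invertible_mat (index_swap r (K_hat r (E k) (E' k)))"
    unfolding gauge_def by blast+
  show "step_A_defined d r E E'" unfolding step_A_defined_def using inv by simp
  have check: "Q_check d r n M E E' k a = (A (Suc k mod d) * B k) $$ (0, 0) \<cdot>\<^sub>m (A k * Q k a * minv (A (Suc k mod d)))"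
    if k: "k < d" and a: "a < n k" for k a
  proof -
    have k': "Suc k mod d < d" using d by simp
    have "det (W k 0) \<noteq> 0" using spectral[OF k] unfolding spectral_data_def by blast
    note det = this
    show ?thesis
      by (rule Q_check_gauge[where W = "W k 0" and A = A and B = B and n = n and Q = Q and k = k and d = d
          and r = r and M = M and E = E and E' = E', OF r Q U[OF k'] V[OF k] M[OF k zero_less_numeral] W det
          AB(1)[OF k] AB(1)[OF k'] AB(2)[OF k] AB(2)[OF k'] AB(3)[OF k] AB(3)[OF k'] AB(4)[OF k] AB(4)[OF k']
          AB(5)[OF k] AB(5)[OF k'] a])
  qed
  assume nz: "mps_norm d r n (Q_check d r n M E E') \<noteq> 0"
  show "gauge_equivalent d r n (recovery_output d r n M E E') (normalize_mps d r n Q)"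
    unfolding recovery_output_def
    by (rule gauge_equivalent_normalized[where A = A, OF d Q AB(1,2) check norm nz])
qed

text \<open>The scalar \<open>c k\<close> pairs the first row of the gauge at the next site with the
  first column of the eigenvector matrix at \<open>k\<close>. Eigenspace bases are free, so the
  gauge at each site may be prescribed, and every such pairing can be made nonzero.\<close>

lemma exists_choice: "\<exists>E E'. eigen_choice d r M E E' \<and> mps_norm d r n (Q_check d r n M E E') \<noteq> 0"
proof -
  have d0: "0 < d" using d by simp
  define good where "good k X Y X' \<longleftrightarrow> X \<in> carrier_mat r r \<and> Y \<in> carrier_mat r r \<and> X * Y = 1\<^sub>m r \<and> Y * X = 1\<^sub>m r \<and> X' \<in> carrier_mat r r \<and>
      (\<forall>p<r. \<forall>q<r. (Y * X') $$ (p, q) \<noteq> 0) \<and>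
      (\<forall>j<d. Suc j mod d = k \<longrightarrow> (\<forall>L\<in>carrier_mat r r. det L \<noteq> 0 \<longrightarrow>
        eigenvector_stack r (M j 0 * pinv (M j 1)) (unfold1 (n k) r (Q k) * kron r (1\<^sub>m r) X * sdiag r (\<lambda>_. L)) \<and>
        eigenvector_stack r (M j 2 * pinv (M j 3)) (unfold1 (n k) r (Q k) * kron r (1\<^sub>m r) X' * sdiag r (\<lambda>_. L))))" for k X Y X'
  have "\<exists>X Y X'. good k X Y X'" if k: "k < d" for k
  proof -
    obtain j where j: "j < d" "Suc j mod d = k" using cyclic_pred[OF k] .
    have uniq: "j' = j" if "j' < d" "Suc j' mod d = k" for j'
    proof -
      have "Suc i mod d = (if Suc i = d then 0 else Suc i)" if "i < d" for i using that by auto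
      then show ?thesis using that j by (auto split: if_splits)
    qed
    obtain A X Y e C X' Y' e' where det: "det (W j 0) \<noteq> 0" "det (W j 1) \<noteq> 0" "det (W j 2) \<noteq> 0" "det (W j 3) \<noteq> 0"
      and A: "diag_by r A X Y e" "inj_on e {..<r}" "W j 0 = A * W j 1"
      and C: "diag_by r C X' Y' e'" "inj_on e' {..<r}" "W j 2 = C * W j 3"
      and Z: "\<forall>p<r. \<forall>q<r. (Y * X') $$ (p, q) \<noteq> 0"
      using spectral[OF j(1)] unfolding spectral_data_def by blast
    note DA = diag_byD[OF A(1)] and DC = diag_byD[OF C(1)]
    have dA: "det A \<noteq> 0" "det C \<noteq> 0"
      using det_mult[OF DA(5) W[of j 1]] det_mult[OF DC(5) W[of j 3]] det A(3) C(3) by auto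
    let ?U = "unfold1 (n k) r (Q k)"
    have M1: "M j 0 * pinv (M j 1) = ?U * kron r (1\<^sub>m r) A * pinv ?U"
      using pair_matrix[OF j(1) _ _ DA(5) A(3) det(2)] j(2) by simp
    have M2: "M j 2 * pinv (M j 3) = ?U * kron r (1\<^sub>m r) C * pinv ?U"
      using pair_matrix[OF j(1) _ _ DC(5) C(3) det(4)] j(2) by simp
    have "\<forall>L\<in>carrier_mat r r. det L \<noteq> 0 \<longrightarrow>
        eigenvector_stack r (M j 0 * pinv (M j 1)) (?U * kron r (1\<^sub>m r) X * sdiag r (\<lambda>_. L)) \<and>
        eigenvector_stack r (M j 2 * pinv (M j 3)) (?U * kron r (1\<^sub>m r) X' * sdiag r (\<lambda>_. L))"
      unfolding M1 M2
      using eigenvector_stackI[OF U[OF k] A(1,2) dA(1)] eigenvector_stackI[OF U[OF k] C(1,2) dA(2)] by blast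
    then show ?thesis unfolding good_def using DA(1-4) DC(1) Z uniq by blast
  qed
  then obtain X Y X' where "\<And>k. k < d \<Longrightarrow> good k (X k) (Y k) (X' k)" by metis
  then have X: "\<And>k. k < d \<Longrightarrow> X k \<in> carrier_mat r r" "\<And>k. k < d \<Longrightarrow> Y k \<in> carrier_mat r r"
      "\<And>k. k < d \<Longrightarrow> X k * Y k = 1\<^sub>m r" "\<And>k. k < d \<Longrightarrow> Y k * X k = 1\<^sub>m r" "\<And>k. k < d \<Longrightarrow> X' k \<in> carrier_mat r r"
    and Z: "\<And>k p q. k < d \<Longrightarrow> p < r \<Longrightarrow> q < r \<Longrightarrow> (Y k * X' k) $$ (p, q) \<noteq> 0"
    and st: "\<And>k j L. k < d \<Longrightarrow> j < d \<Longrightarrow> Suc j mod d = k \<Longrightarrow> L \<in> carrier_mat r r \<Longrightarrow> det L \<noteq> 0 \<Longrightarrow>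
        eigenvector_stack r (M j 0 * pinv (M j 1)) (unfold1 (n k) r (Q k) * kron r (1\<^sub>m r) (X k) * sdiag r (\<lambda>_. L)) \<and>
        eigenvector_stack r (M j 2 * pinv (M j 3)) (unfold1 (n k) r (Q k) * kron r (1\<^sub>m r) (X' k) * sdiag r (\<lambda>_. L))"
    unfolding good_def by blast+
  have "\<exists>i<r. X k $$ (i, 0) \<noteq> 0" if k: "k < d" for k
  proof (rule ccontr)
    assume "\<not> ?thesis"
    then have "(Y k * X k) $$ (0, 0) = 0" unfolding mult_entry[OF X(2,1)[OF k] r r] by simp
    then show False unfolding X(4)[OF k] using r by simp
  qed
  then obtain i where i: "\<And>k. k < d \<Longrightarrow> i k < r" "\<And>k. k < d \<Longrightarrow> X k $$ (i k, 0) \<noteq> 0" by metis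
  \<comment> \<open>The first row of the gauge matrix at the site after \<open>k\<close> picks a nonzero entry of the first column of \<open>X k\<close>.\<close>
  define L :: "nat \<Rightarrow> complex mat" where "L k = swaprows_mat r 0 (i k)" for k
  have L: "L k \<in> carrier_mat r r" "det (L k) \<noteq> 0" if "k < d" for k
  proof -
    show "L k \<in> carrier_mat r r" by (simp add: L_def)
    show "det (L k) \<noteq> 0"
    proof (cases "i k = 0")
      case True
      have "L k = 1\<^sub>m r" unfolding L_def True by (rule eq_matI) auto
      then show ?thesis by simp
    next
      case False
      then show ?thesis unfolding L_def using r i(1)[OF that] by (simp add: det_swaprows_mat)
    qed
  qed
  define prd where "prd k = (if k = 0 then d - 1 else k - 1)" for k
  have prd: "prd k < d" if "k < d" for k using that by (auto simp: prd_def)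
  have prd_Suc: "prd (Suc k mod d) = k" if "k < d" for k
    using that by (cases "Suc k = d") (auto simp: prd_def)
  define E E' where "E k = unfold1 (n k) r (Q k) * kron r (1\<^sub>m r) (X k) * sdiag r (\<lambda>_. L (prd k))"
    and "E' k = unfold1 (n k) r (Q k) * kron r (1\<^sub>m r) (X' k) * sdiag r (\<lambda>_. L (prd k))" for k
  have ch: "eigen_choice d r M E E'"
    unfolding eigen_choice_def
  proof (intro allI impI)
    fix j assume j: "j < d"
    then have s: "Suc j mod d < d" using d0 by simp
    show "eigenvector_stack r (M j 0 * pinv (M j 1)) (E (Suc j mod d)) \<and>
         eigenvector_stack r (M j 2 * pinv (M j 3)) (E' (Suc j mod d))"
      unfolding E_def E'_def by (rule st[OF s j refl L[OF prd[OF s]]])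
  qed
  define z where "z k l = (Y k * X' k) $$ (l, 0) / (Y k * X' k) $$ (0, 0)" for k l
  define A B where "A k = (L (prd k))\<^sup>T" and "B k = X k * dmat r (z k)" for k
  have A: "A k \<in> carrier_mat r r" "det (A k) \<noteq> 0" if "k < d" for k
    using L[OF prd[OF that]] det_transpose[OF L(1)[OF prd[OF that]]] by (auto simp: A_def)
  have zl: "z k l \<noteq> 0" if "k < d" "l < r" for k l using Z[OF that r] Z[OF that(1) r r] by (simp add: z_def)
  have B: "B k \<in> carrier_mat r r" "det (B k) \<noteq> 0" if k: "k < d" for k
  proof -
    show "B k \<in> carrier_mat r r" using X(1)[OF k] by (simp add: B_def)
    have dz: "dmat r (z k) * dmat r (\<lambda>l. 1 / z k l) = 1\<^sub>m r"
      unfolding dmat_mult by (rule square_eq_matI[of _ r r]) (use zl[OF k] in \<open>auto simp: dmat_index\<close>)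
    show "det (B k) \<noteq> 0"
      using det_mult[OF X(1)[OF k] dmat_carrier, of "z k"] det_nonzero_of_inverse[OF X(1-3)[OF k]]
        det_nonzero_of_inverse[OF dmat_carrier dmat_carrier dz] by (simp add: B_def)
  qed
  have hat: "Q_hat r (E k) (E' k) a = A k * Q k a * B k" if k: "k < d" and a: "a < n k" for k a
    unfolding A_def B_def z_def
    by (rule Q_hat_of_stacks(3)[OF r U[OF k] Q X(1-4)[OF k] X(5)[OF k] Z[OF k] _ _ _ _ _ _ a])
      (use L[OF prd[OF k]] in \<open>auto simp: E_def E'_def\<close>)
  define c where "c k = (A (Suc k mod d) * B k) $$ (0, 0)" for k
  have check: "Q_check d r n M E E' k a = c k \<cdot>\<^sub>m (A k * Q k a * minv (A (Suc k mod d)))"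
    if k: "k < d" and a: "a < n k" for k a
  proof -
    have k': "Suc k mod d < d" using d0 by simp
    have "det (W k 0) \<noteq> 0" using spectral[OF k] unfolding spectral_data_def by blast
    note det = this
    show ?thesis
      unfolding c_def
      by (rule Q_check_gauge[where W = "W k 0" and A = A and B = B and n = n and Q = Q and k = k and d = d
          and r = r and M = M and E = E and E' = E', OF r Q U[OF k'] V[OF k] M[OF k zero_less_numeral] W det
          A(1)[OF k] A(1)[OF k'] A(2)[OF k] A(2)[OF k'] B(1)[OF k] B(1)[OF k'] B(2)[OF k] B(2)[OF k']
          hat[OF k] hat[OF k'] a])
  qed
  have ck: "c k \<noteq> 0" if k: "k < d" for k
  proof -
    have k': "Suc k mod d < d" using d0 by simp
    have "c k = (\<Sum>x<r. A (Suc k mod d) $$ (0, x) * B k $$ (x, 0))"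
      unfolding c_def by (rule mult_entry[OF A(1)[OF k'] B(1)[OF k] r r])
    also have "\<dots> = (\<Sum>x<r. if x = i k then X k $$ (i k, 0) * z k 0 else 0)"
    proof (rule sum.cong[OF refl])
      fix x assume x: "x \<in> {..<r}"
      have "A (Suc k mod d) $$ (0, x) = (if x = i k then 1 else 0)"
        unfolding A_def prd_Suc[OF k] L_def using x r i(1)[OF k] by auto
      moreover have "B k $$ (x, 0) = X k $$ (x, 0) * z k 0"
        unfolding B_def using x by (intro mult_dmat_entry[OF X(1)[OF k] _ r]) simp
      ultimately show "A (Suc k mod d) $$ (0, x) * B k $$ (x, 0) = (if x = i k then X k $$ (i k, 0) * z k 0 else 0)"
        by simp
    qed
    also have "\<dots> = X k $$ (i k, 0) * z k 0" using i(1)[OF k] by simp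
    finally show ?thesis using i(2)[OF k] zl[OF k r] by simp
  qed
  have "mps_norm d r n (Q_check d r n M E E') = cmod (\<Prod>k<d. c k) * mps_norm d r n Q"
  proof (rule mps_norm_scale)
    fix \<alpha> assume "\<alpha> \<in> tuples n {..<d}"
    then have "\<And>k. k < d \<Longrightarrow> \<alpha> k < n k" using tuples_less by blast
    then show "mps_state d r (Q_check d r n M E E') \<alpha> = (\<Prod>k<d. c k) * mps_state d r Q \<alpha>"
      by (intro mps_state_gauge[of d A r "\<lambda>k. minv (A k)"]) (use d0 A minv[OF A] Q check in auto)
  qed
  moreover have "(\<Prod>k<d. c k) \<noteq> 0" using ck by simp
  ultimately have "mps_norm d r n (Q_check d r n M E E') \<noteq> 0" using norm by simp
  then show ?thesis using ch by blast
qed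

end

section \<open>Generic functionals\<close>

text \<open>The functional with coefficients \<open>x ^ a\<close> takes on \<open>v\<close> the
  value at \<open>x\<close> of the polynomial with coefficients \<open>v\<close>. It remains to
  avoid the finitely many roots of these polynomials.\<close>

lemma generic_functional:
  fixes vs :: "(nat \<Rightarrow> complex) set"
  assumes "finite vs" and "\<And>v. v \<in> vs \<Longrightarrow> \<exists>a<m. v a \<noteq> 0"
  obtains u where "\<And>v. v \<in> vs \<Longrightarrow> (\<Sum>a<m. u a * v a) \<noteq> 0"
proof -
  define p where "p v = (\<Sum>a<m. monom (v a) a)" for v :: "nat \<Rightarrow> complex"
  have "p v \<noteq> 0" if v: "v \<in> vs" for v
  proof
    assume p0: "p v = 0"
    obtain a where a: "a < m" "v a \<noteq> 0" using assms(2)[OF v] by blast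
    have "coeff (p v) a = (\<Sum>b<m. if b = a then v b else 0)"
      unfolding p_def coeff_sum by (intro sum.cong) auto
    then show False using a p0 by simp
  qed
  then have "(\<Prod>v\<in>vs. p v) \<noteq> 0" using assms(1) by simp
  then have "finite {x. poly (\<Prod>v\<in>vs. p v) x = 0}" by (rule poly_roots_finite)
  then obtain x where "poly (\<Prod>v\<in>vs. p v) x \<noteq> 0"
    using infinite_UNIV_char_0[where 'a = complex] by (metis (mono_tags, lifting) finite_subset mem_Collect_eq subsetI)
  then have x: "poly (p v) x \<noteq> 0" if "v \<in> vs" for v
    using assms(1) that by (auto simp: poly_prod)
  show thesis
  proof (rule that[of "\<lambda>a. x ^ a"])
    fix v assume "v \<in> vs"
    then show "(\<Sum>a<m. x ^ a * v a) \<noteq> 0"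
      using x by (simp add: p_def poly_sum poly_monom mult.commute)
  qed
qed

text \<open>Independence gives two coordinates \<open>x0\<close> and \<open>x1\<close> with nonzero
  minor \<open>D\<close>; Cramer's rule on these coordinates yields the dual basis.\<close>

lemma dual_functionals:
  fixes \<alpha> \<beta> :: "'i \<Rightarrow> complex"
  assumes J: "finite J" and "\<exists>x\<in>J. \<alpha> x \<noteq> 0" and indep: "\<And>c. \<exists>x\<in>J. \<beta> x \<noteq> c * \<alpha> x"
  obtains f g where "(\<Sum>x\<in>J. f x * \<alpha> x) = 1" "(\<Sum>x\<in>J. f x * \<beta> x) = 0"
    "(\<Sum>x\<in>J. g x * \<alpha> x) = 0" "(\<Sum>x\<in>J. g x * \<beta> x) = 1"
proof -
  obtain x0 where x0: "x0 \<in> J" "\<alpha> x0 \<noteq> 0" using assms(2) by blast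
  obtain x1 where x1: "x1 \<in> J" "\<beta> x1 \<noteq> \<beta> x0 / \<alpha> x0 * \<alpha> x1" using indep by blast
  define D where "D = \<alpha> x0 * \<beta> x1 - \<alpha> x1 * \<beta> x0"
  have D: "D \<noteq> 0" using x0 x1 by (auto simp: D_def field_simps)
  have ne: "x0 \<noteq> x1" using x0 x1 by auto
  define h where "h a b x = (if x = x0 then a else if x = x1 then b else 0)" for a b :: complex and x
  have h: "(\<Sum>x\<in>J. h a b x * \<gamma> x) = a * \<gamma> x0 + b * \<gamma> x1" for a b and \<gamma> :: "'i \<Rightarrow> complex"
  proof -
    have "(\<Sum>x\<in>J. h a b x * \<gamma> x) = (\<Sum>x\<in>J. (if x = x0 then a * \<gamma> x else 0) + (if x = x1 then b * \<gamma> x else 0))"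
      using ne by (intro sum.cong) (auto simp: h_def)
    then show ?thesis using J x0 x1 by (simp add: sum.distrib)
  qed
  have lin: "p / D * a + - q / D * b = (p * a - q * b) / D" "- p / D * a + q / D * b = (q * b - p * a) / D" for p q a b
    by (simp_all add: diff_divide_distrib)
  show thesis
    by (rule that[of "h (\<beta> x1 / D) (- \<beta> x0 / D)" "h (- \<alpha> x1 / D) (\<alpha> x0 / D)"])
      (use D in \<open>unfold h lin, simp_all add: D_def mult.commute\<close>)
qed

text \<open>
  A ratio of differences which is not real separates a matrix from the conjugate of its diagonal
  part, which enters the environment of \<open>dephased_chain\<close> below.
\<close>

lemma moebius_ratio:
  fixes t1 t2 t3 :: complex
  assumes "t1 \<noteq> 0" "t2 \<noteq> 0" "t3 \<noteq> 0" "t1 \<noteq> t2" "t1 \<noteq> t3" "t2 \<noteq> t3"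
  obtains z where "1 + z * t1 \<noteq> 0" "1 + z * t2 \<noteq> 0" "1 + z * t3 \<noteq> 0"
    "- (t1 / (1 + z * t1)) = \<i> * (t2 / (1 + z * t2) - t3 / (1 + z * t3))"
proof -
  define K where "K = - t1 / (t2 - t3)"
  have K: "K \<noteq> 0" using assms by (simp add: K_def)
  \<comment> \<open>The required ratio with denominators cleared, as a quadratic in
    \<open>z\<close>; its leading coefficient is nonzero, so a root exists.\<close>
  define p where "p = [:K - \<i>, K * (t2 + t3) - \<i> * t1, K * t2 * t3:]"
  have "\<not> constant (poly p)"
    using K assms by (simp add: constant_degree p_def)
  then obtain z where z: "poly p z = 0" using fundamental_theorem_of_algebra by blast
  have eq: "K * (1 + z * t2) * (1 + z * t3) = \<i> * (1 + z * t1)"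
    using z by (simp add: p_def algebra_simps)
  have n1: "1 + z * t1 \<noteq> 0"
  proof
    assume 0: "1 + z * t1 = 0"
    then have "z \<noteq> 0" by auto
    have "1 + z * t2 = 0 \<or> 1 + z * t3 = 0" using eq 0 K by auto
    then have "z * t1 = z * t2 \<or> z * t1 = z * t3" using 0 by (metis add_left_cancel)
    then show False using \<open>z \<noteq> 0\<close> assms by auto
  qed
  then have n: "1 + z * t2 \<noteq> 0" "1 + z * t3 \<noteq> 0" using eq by auto
  have d: "t2 - t3 \<noteq> 0" using assms by simp
  have "- t1 * ((1 + z * t2) * (1 + z * t3)) = \<i> * (1 + z * t1) * (t2 - t3)"
    using eq d by (simp add: K_def field_simps)
  then have "- (t1 / (1 + z * t1)) = \<i> * (t2 - t3) / ((1 + z * t2) * (1 + z * t3))"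
    using n n1 by (simp add: divide_simps)
  also have "\<dots> = \<i> * (t2 / (1 + z * t2) - t3 / (1 + z * t3))"
    using n by (simp add: divide_simps) (simp add: algebra_simps)
  finally show thesis using that n n1 by blast
qed

section \<open>First order perturbation\<close>

definition germ :: "(real \<Rightarrow> complex) \<Rightarrow> complex \<Rightarrow> complex \<Rightarrow> bool" where
  "germ f a b \<longleftrightarrow> f 0 = a \<and> (f has_vector_derivative b) (at 0)"

lemma germ_const: "germ (\<lambda>_. c) c 0"
  by (simp add: germ_def)

lemma germ_affine: "germ (\<lambda>\<epsilon>. a + of_real \<epsilon> * b) a b"
proof -
  have "((\<lambda>\<epsilon>::real. a + \<epsilon> *\<^sub>R b) has_vector_derivative b) (at 0)"
    by (auto intro!: derivative_eq_intros)
  then show ?thesis by (simp add: germ_def scaleR_conv_of_real)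
qed

lemma germ_add: "germ f a b \<Longrightarrow> germ g a' b' \<Longrightarrow> germ (\<lambda>\<epsilon>. f \<epsilon> + g \<epsilon>) (a + a') (b + b')"
  by (auto simp: germ_def intro: has_vector_derivative_add)

lemma germ_mult: "germ f a b \<Longrightarrow> germ g a' b' \<Longrightarrow> germ (\<lambda>\<epsilon>. f \<epsilon> * g \<epsilon>) (a * a') (a * b' + b * a')"
  unfolding germ_def using has_vector_derivative_mult by blast

lemma germ_cnj: "germ f a b \<Longrightarrow> germ (\<lambda>\<epsilon>. cnj (f \<epsilon>)) (cnj a) (cnj b)"
  unfolding germ_def using bounded_linear.has_vector_derivative[OF bounded_linear_cnj] by blast

lemma germ_sum:
  "(\<And>x. x \<in> S \<Longrightarrow> germ (f x) (a x) (b x)) \<Longrightarrow> germ (\<lambda>\<epsilon>. \<Sum>x\<in>S. f x \<epsilon>) (\<Sum>x\<in>S. a x) (\<Sum>x\<in>S. b x)"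
  by (induction S rule: infinite_finite_induct) (auto intro: germ_const germ_add)

lemma germ_isCont: "germ f a b \<Longrightarrow> isCont f 0"
  unfolding germ_def using has_vector_derivative_continuous by blast

text \<open>The difference quotient, completed by the derivative, allows division by
  \<open>\<epsilon>\<close> within functions continuous at 0.\<close>

lemma germ_quotient:
  assumes "germ f a b"
  shows "isCont (\<lambda>\<epsilon>. if \<epsilon> = 0 then b else (f \<epsilon> - a) / of_real \<epsilon>) 0"
proof -
  have f0: "f 0 = a" and "(f has_derivative (\<lambda>x. x *\<^sub>R b)) (at 0)"
    using assms by (auto simp: germ_def has_vector_derivative_def)
  then have "((\<lambda>y. norm (f y - f 0 - (y - 0) *\<^sub>R b) / norm (y - 0)) \<longlongrightarrow> 0) (at 0)"
    by (simp add: has_derivative_iff_norm)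
  then have "((\<lambda>y. norm ((f y - a) / of_real y - b)) \<longlongrightarrow> 0) (at 0)"
  proof (rule Lim_transform_eventually)
    have "norm (f y - f 0 - (y - 0) *\<^sub>R b) / norm (y - 0) = norm ((f y - a) / of_real y - b)" if "y \<noteq> 0" for y
    proof -
      have "(f y - a) / of_real y - b = (f y - f 0 - (y - 0) *\<^sub>R b) / of_real y"
        using that f0 by (simp add: scaleR_conv_of_real field_simps)
      then show ?thesis by (simp add: norm_divide)
    qed
    then show "\<forall>\<^sub>F y in at 0. norm (f y - f 0 - (y - 0) *\<^sub>R b) / norm (y - 0) = norm ((f y - a) / of_real y - b)"
      by (auto simp: eventually_at_filter)
  qed
  then have "((\<lambda>y. (f y - a) / of_real y - b) \<longlongrightarrow> 0) (at 0)" by (rule tendsto_norm_zero_cancel)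
  then have "((\<lambda>y. (f y - a) / of_real y) \<longlongrightarrow> b) (at 0)" by (rule LIM_zero_cancel)
  then have "((\<lambda>\<epsilon>. if \<epsilon> = 0 then b else (f \<epsilon> - a) / of_real \<epsilon>) \<longlongrightarrow> b) (at 0)"
    by (rule Lim_transform_eventually) (auto simp: eventually_at_filter)
  then show ?thesis by (simp add: isCont_def)
qed

text \<open>A family starting at the scalar matrix \<open>c\<close>. Its derivative is split into
  \<open>c\<close> times the matrix \<open>F\<close>, which is to be controlled, and a multiple
  \<open>y\<close> of the identity, which only shifts eigenvalues.\<close>

definition scalar_germ :: "nat \<Rightarrow> (real \<Rightarrow> complex mat) \<Rightarrow> complex \<Rightarrow> complex mat \<Rightarrow> complex \<Rightarrow> bool" where
  "scalar_germ r W c F y \<longleftrightarrow> c \<noteq> 0 \<and> F \<in> carrier_mat r r \<and> (\<forall>\<epsilon>. W \<epsilon> \<in> carrier_mat r r) \<and>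
     (\<forall>i<r. \<forall>j<r. germ (\<lambda>\<epsilon>. W \<epsilon> $$ (i, j)) (c * (1\<^sub>m r) $$ (i, j)) (c * F $$ (i, j) + y * (1\<^sub>m r) $$ (i, j)))"

lemma scalar_germ_mat_in: "scalar_germ r W c F y \<Longrightarrow> cont.mat_in r r W"
  unfolding scalar_germ_def cont.mat_in_def using germ_isCont by blast

lemma scalar_germ_at_0:
  assumes "scalar_germ r W c F y"
  shows "W 0 = c \<cdot>\<^sub>m 1\<^sub>m r"
  using assms by (intro square_eq_matI[of _ r r]) (auto simp: scalar_germ_def germ_def)

lemma adj_mat_scalar:
  assumes "c \<noteq> 0"
  shows "adj_mat (c \<cdot>\<^sub>m 1\<^sub>m r) = (c ^ r / c) \<cdot>\<^sub>m (1\<^sub>m r :: complex mat)"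
proof -
  have c: "c \<cdot>\<^sub>m 1\<^sub>m r \<in> carrier_mat r r" by simp
  note a = adj_mat[OF c]
  have "c \<cdot>\<^sub>m adj_mat (c \<cdot>\<^sub>m 1\<^sub>m r) = c \<cdot>\<^sub>m 1\<^sub>m r * adj_mat (c \<cdot>\<^sub>m 1\<^sub>m r)"
    using mult_smult_assoc_mat[OF one_carrier_mat a(1), of c] a(1) by simp
  also have "\<dots> = c ^ r \<cdot>\<^sub>m 1\<^sub>m r" unfolding a(2) by simp
  finally have "(1 / c) \<cdot>\<^sub>m (c \<cdot>\<^sub>m adj_mat (c \<cdot>\<^sub>m 1\<^sub>m r)) = (1 / c) \<cdot>\<^sub>m (c ^ r \<cdot>\<^sub>m 1\<^sub>m r)" by simp
  then show ?thesis using assms by (simp add: smult_smult_mat one_smult_mat)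
qed

text \<open>The difference of \<open>W\<close> divided by \<open>c\<close> and \<open>V\<close>
  divided by \<open>c'\<close> is of order \<open>\<epsilon>\<close>. Dividing by
  \<open>\<epsilon>\<close> makes the pencil coefficients blow up at 0, while the pencil extends
  continuously with value a multiple of \<open>F - F'\<close>.\<close>

lemma pencil_limit:
  assumes W: "scalar_germ r W c F y" and V: "scalar_germ r V c' F' y'" and s: "s \<noteq> 0"
  obtains P \<alpha> \<tau> where "cont.mat_in r r P" "P 0 = s \<cdot>\<^sub>m (F - F')"
    "\<And>\<epsilon>. 0 < \<epsilon> \<Longrightarrow> P \<epsilon> = pencil (\<alpha> \<epsilon>) (\<tau> \<epsilon>) (W \<epsilon>) (V \<epsilon>)" "\<And>\<epsilon>. 0 < \<epsilon> \<Longrightarrow> \<alpha> \<epsilon> \<noteq> 0"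
proof -
  have c: "c \<noteq> 0" "c' \<noteq> 0" and F: "F \<in> carrier_mat r r" "F' \<in> carrier_mat r r"
    and cW: "\<And>\<epsilon>. W \<epsilon> \<in> carrier_mat r r" and cV: "\<And>\<epsilon>. V \<epsilon> \<in> carrier_mat r r"
    using W V by (auto simp: scalar_germ_def)
  \<comment> \<open>The identity part of the first order difference, removed through
    \<open>\<tau>\<close>.\<close>
  define k where "k = y / c - y' / c'"
  \<comment> \<open>Compensates the scalar \<open>c' ^ r / c'\<close> by which the adjugate of
    \<open>V\<close> acts at 0.\<close>
  define s' where "s' = s * c' / c' ^ r"
  define \<alpha> \<tau> where "\<alpha> \<epsilon> = s' / (c * of_real \<epsilon>)" and "\<tau> \<epsilon> = s' * (1 / (c' * of_real \<epsilon>) + k / c')" for \<epsilon> :: real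
  define qW where "qW i j \<epsilon> = (if \<epsilon> = 0 then c * F $$ (i, j) + y * (1\<^sub>m r) $$ (i, j)
      else (W \<epsilon> $$ (i, j) - c * (1\<^sub>m r) $$ (i, j)) / of_real \<epsilon>)" for i j \<epsilon>
  define qV where "qV i j \<epsilon> = (if \<epsilon> = 0 then c' * F' $$ (i, j) + y' * (1\<^sub>m r) $$ (i, j)
      else (V \<epsilon> $$ (i, j) - c' * (1\<^sub>m r) $$ (i, j)) / of_real \<epsilon>)" for i j \<epsilon>
  define G where "G \<epsilon> = Matrix.mat r r (\<lambda>(i, j). s' * (qW i j \<epsilon> / c - qV i j \<epsilon> / c' - k / c' * V \<epsilon> $$ (i, j)))" for \<epsilon>
  have G: "cont.mat_in r r G"
  proof (rule cont.mat_inI)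
    fix i j assume ij: "i < r" "j < r"
    have gW: "germ (\<lambda>\<epsilon>. W \<epsilon> $$ (i, j)) (c * (1\<^sub>m r) $$ (i, j)) (c * F $$ (i, j) + y * (1\<^sub>m r) $$ (i, j))"
      and gV: "germ (\<lambda>\<epsilon>. V \<epsilon> $$ (i, j)) (c' * (1\<^sub>m r) $$ (i, j)) (c' * F' $$ (i, j) + y' * (1\<^sub>m r) $$ (i, j))"
      using W V ij unfolding scalar_germ_def by blast+
    have "isCont (qW i j) 0" "isCont (qV i j) 0" "isCont (\<lambda>\<epsilon>. V \<epsilon> $$ (i, j)) 0"
      using germ_quotient[OF gW] germ_quotient[OF gV] germ_isCont[OF gV]
      unfolding qW_def[abs_def] qV_def[abs_def] by blast+
    then have "isCont (\<lambda>\<epsilon>. s' * (qW i j \<epsilon> / c - qV i j \<epsilon> / c' - k / c' * V \<epsilon> $$ (i, j))) 0"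
      using c by (intro continuous_intros) auto
    then show "isCont (\<lambda>\<epsilon>. G \<epsilon> $$ (i, j)) 0" using ij by (simp add: G_def)
  qed (simp add: G_def)
  define P where "P \<epsilon> = G \<epsilon> * adj_mat (V \<epsilon>)" for \<epsilon>
  have "cont.mat_in r r P"
    unfolding P_def using cont.mat_in_mult[OF G cont.adj_in[OF scalar_germ_mat_in[OF V]]] .
  moreover have "P 0 = s \<cdot>\<^sub>m (F - F')"
  proof -
    have V0: "V 0 $$ (i, j) = c' * (1\<^sub>m r) $$ (i, j)" if "i < r" "j < r" for i j
      unfolding scalar_germ_at_0[OF V] using that by simp
    have "G 0 = s' \<cdot>\<^sub>m (F - F')"
      using F c by (intro square_eq_matI[of _ r r]) (auto simp: G_def qW_def qV_def V0 k_def field_simps)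
    then have "P 0 = s' \<cdot>\<^sub>m (F - F') * ((c' ^ r / c') \<cdot>\<^sub>m 1\<^sub>m r)"
      unfolding P_def scalar_germ_at_0[OF V] adj_mat_scalar[OF c(2)] by simp
    also have "\<dots> = (c' ^ r / c') \<cdot>\<^sub>m (s' \<cdot>\<^sub>m (F - F'))"
      using F by (subst mult_smult_distrib[of _ r r _ r]) auto
    also have "\<dots> = s \<cdot>\<^sub>m (F - F')" using c by (simp add: smult_smult_mat s'_def)
    finally show ?thesis .
  qed
  moreover have "P \<epsilon> = pencil (\<alpha> \<epsilon>) (\<tau> \<epsilon>) (W \<epsilon>) (V \<epsilon>)" if e: "0 < \<epsilon>" for \<epsilon>
  proof -
    have "G \<epsilon> = \<alpha> \<epsilon> \<cdot>\<^sub>m W \<epsilon> - \<tau> \<epsilon> \<cdot>\<^sub>m V \<epsilon>"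
    proof (rule square_eq_matI[of _ r r])
      show "\<alpha> \<epsilon> \<cdot>\<^sub>m W \<epsilon> - \<tau> \<epsilon> \<cdot>\<^sub>m V \<epsilon> \<in> carrier_mat r r" using cV[of \<epsilon>] by (simp add: minus_carrier_mat)
      fix i j assume ij: "i < r" "j < r"
      have "G \<epsilon> $$ (i, j) = \<alpha> \<epsilon> * W \<epsilon> $$ (i, j) - \<tau> \<epsilon> * V \<epsilon> $$ (i, j)"
        using ij e c by (simp add: G_def qW_def qV_def \<alpha>_def \<tau>_def diff_divide_distrib algebra_simps)
      then show "G \<epsilon> $$ (i, j) = (\<alpha> \<epsilon> \<cdot>\<^sub>m W \<epsilon> - \<tau> \<epsilon> \<cdot>\<^sub>m V \<epsilon>) $$ (i, j)"
        using ij cW[of \<epsilon>] cV[of \<epsilon>] by simp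
    qed (simp add: G_def)
    then show ?thesis by (simp add: P_def pencil_def)
  qed
  moreover have "\<alpha> \<epsilon> \<noteq> 0" if "0 < \<epsilon>" for \<epsilon> using that c s by (simp add: \<alpha>_def s'_def)
  ultimately show thesis using that by blast
qed

text \<open>At 0 the determinants are powers of nonzero scalars and the rescaled pencils have the
  prescribed limits. By continuity the certificate is nonzero at some small positive
  \<open>\<epsilon>\<close>, whose pencil coefficients are then fixed.\<close>

lemma spectral_cert_of_germs:
  assumes W: "\<And>i::nat. i < 4 \<Longrightarrow> scalar_germ r (W i) (c i) (F i) (y i)"
    and s: "s \<noteq> 0" "s' \<noteq> 0" and nz: "pair_cert r (s \<cdot>\<^sub>m (F 0 - F 1)) (s' \<cdot>\<^sub>m (F 2 - F 3)) \<noteq> 0"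
  obtains \<epsilon> \<alpha> \<tau> where "0 < \<epsilon>" "\<alpha> 0 \<noteq> 0" "\<alpha> 1 \<noteq> 0"
    "spectral_cert r \<alpha> \<tau> (W 0 \<epsilon>) (W 1 \<epsilon>) (W 2 \<epsilon>) (W 3 \<epsilon>) \<noteq> 0"
proof -
  have W4: "scalar_germ r (W 0) (c 0) (F 0) (y 0)" "scalar_germ r (W 1) (c 1) (F 1) (y 1)"
    "scalar_germ r (W 2) (c 2) (F 2) (y 2)" "scalar_germ r (W 3) (c 3) (F 3) (y 3)"
    using W[of 0] W[of 1] W[of 2] W[of 3] by simp_all
  obtain P \<alpha> \<tau> where P: "cont.mat_in r r P" "P 0 = s \<cdot>\<^sub>m (F 0 - F 1)"
    "\<And>\<epsilon>. 0 < \<epsilon> \<Longrightarrow> P \<epsilon> = pencil (\<alpha> \<epsilon>) (\<tau> \<epsilon>) (W 0 \<epsilon>) (W 1 \<epsilon>)" "\<And>\<epsilon>. 0 < \<epsilon> \<Longrightarrow> \<alpha> \<epsilon> \<noteq> 0"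
    using pencil_limit[OF W4(1,2) s(1)] by metis
  obtain P' \<alpha>' \<tau>' where P': "cont.mat_in r r P'" "P' 0 = s' \<cdot>\<^sub>m (F 2 - F 3)"
    "\<And>\<epsilon>. 0 < \<epsilon> \<Longrightarrow> P' \<epsilon> = pencil (\<alpha>' \<epsilon>) (\<tau>' \<epsilon>) (W 2 \<epsilon>) (W 3 \<epsilon>)" "\<And>\<epsilon>. 0 < \<epsilon> \<Longrightarrow> \<alpha>' \<epsilon> \<noteq> 0"
    using pencil_limit[OF W4(3,4) s(2)] by metis
  define f where "f \<epsilon> = det (W 0 \<epsilon>) * det (W 1 \<epsilon>) * det (W 2 \<epsilon>) * det (W 3 \<epsilon>) * pair_cert r (P \<epsilon>) (P' \<epsilon>)" for \<epsilon>
  have cont: "isCont f 0"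
    unfolding f_def by (intro cont.mult cont.det_in[of r] cont.pair_cert_in scalar_germ_mat_in[OF W4(1)]
        scalar_germ_mat_in[OF W4(2)] scalar_germ_mat_in[OF W4(3)] scalar_germ_mat_in[OF W4(4)] P P')
  have "det (W i 0) \<noteq> 0" if "i < 4" for i
    unfolding scalar_germ_at_0[OF W[OF that]] using W[OF that] by (simp add: scalar_germ_def)
  note dets = this
  have "f 0 \<noteq> 0" unfolding f_def P P' using nz dets[of 0] dets[of 1] dets[of 2] dets[of 3] by simp
  then obtain \<epsilon> where e: "0 < \<epsilon>" "f \<epsilon> \<noteq> 0" using isCont_nonzero_ex cont by blast
  show thesis
  proof (rule that[OF e(1)])
    show "(\<lambda>i. if i = 0 then \<alpha> \<epsilon> else \<alpha>' \<epsilon>) 0 \<noteq> 0" "(\<lambda>i. if i = 0 then \<alpha> \<epsilon> else \<alpha>' \<epsilon>) 1 \<noteq> 0"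
      using P(4)[OF e(1)] P'(4)[OF e(1)] by auto
    show "spectral_cert r (\<lambda>i. if i = 0 then \<alpha> \<epsilon> else \<alpha>' \<epsilon>) (\<lambda>i. if i = 0 then \<tau> \<epsilon> else \<tau>' \<epsilon>)
        (W 0 \<epsilon>) (W 1 \<epsilon>) (W 2 \<epsilon>) (W 3 \<epsilon>) \<noteq> 0"
      using e(2) by (simp add: f_def spectral_cert_def P(3)[OF e(1)] P'(3)[OF e(1)])
  qed
qed

section \<open>Perturbations of product states\<close>

lemma env_Cons:
  "env r K I (s # ss) x y x' y' = (\<Sum>z<r. \<Sum>z'<r. (\<Sum>a\<in>I s. K s a x z * cnj (K s a x' z')) * env r K I ss z y z' y')"
proof -
  have "env r K I (s # ss) x y x' y' = (\<Sum>z<r. \<Sum>a\<in>I s. \<Sum>z'<r. K s a x z * cnj (K s a x' z') * env r K I ss z y z' y')"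
    unfolding env.simps by (rule sum.swap)
  also have "\<dots> = (\<Sum>z<r. \<Sum>z'<r. \<Sum>a\<in>I s. K s a x z * cnj (K s a x' z') * env r K I ss z y z' y')"
    by (intro sum.cong[OF refl] sum.swap)
  finally show ?thesis by (simp add: sum_distrib_right)
qed

text \<open>Identities at level 0 of the pair reduce the fixed conjugated product to a Kronecker
  delta, so the environment is the trace over the bra bonds of the chain.\<close>

lemma env_matrix_one:
  assumes "Q j 0 = 1\<^sub>m r" and "Q (Suc j mod d) 0 = 1\<^sub>m r" and "x < r" and "y < r"
  shows "env_matrix d r n Q j h v $$ (x, y) = (\<Sum>p<r. env r (contracted n h v Q) (levels n h) (rest d j) x y p p)"
proof -
  have "(\<Sum>w<r. (1\<^sub>m r) $$ (p, w) * (1\<^sub>m r) $$ (w, q)) = (if p = q then 1 else 0 :: complex)"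
    if "p < r" "q < r" for p q
  proof -
    have "(\<Sum>w<r. (1\<^sub>m r) $$ (p, w) * (1\<^sub>m r) $$ (w, q)) = (1\<^sub>m r * 1\<^sub>m r :: complex mat) $$ (p, q)"
      by (rule mult_entry[symmetric, OF one_carrier_mat one_carrier_mat that])
    then show ?thesis using that by simp
  qed
  then have "(\<Sum>p<r. \<Sum>q<r. cnj (\<Sum>w<r. (1\<^sub>m r) $$ (p, w) * (1\<^sub>m r) $$ (w, q)) *
      env r (contracted n h v Q) (levels n h) (rest d j) x y q p)
    = (\<Sum>p<r. \<Sum>q<r. if q = p then env r (contracted n h v Q) (levels n h) (rest d j) x y p p else 0)"
    by (intro sum.cong refl) (auto simp del: cnj_sum index_one_mat)
  then show ?thesis using assms by (simp add: env_matrix_def del: cnj_sum index_one_mat)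
qed

lemma sum_delta2:
  fixes f :: "nat \<Rightarrow> nat \<Rightarrow> complex"
  assumes "x < r" "x' < r"
  shows "(\<Sum>z<r. \<Sum>z'<r. (if x = z \<and> x' = z' then c else 0) * f z z') = c * f x x'"
proof -
  have "(\<Sum>z<r. \<Sum>z'<r. (if x = z \<and> x' = z' then c else 0) * f z z')
      = (\<Sum>z<r. \<Sum>z'<r. if z' = x' then (if z = x then c * f z z' else 0) else 0)"
    by (intro sum.cong refl) auto
  then show ?thesis using assms by simp
qed

lemma sum_delta2':
  fixes f :: "nat \<Rightarrow> nat \<Rightarrow> complex"
  assumes "y < r" "y' < r"
  shows "(\<Sum>z<r. \<Sum>z'<r. f z z' * (if z = y \<and> z' = y' then c else 0)) = c * f y y'"
proof -
  have "(\<Sum>z<r. \<Sum>z'<r. f z z' * (if z = y \<and> z' = y' then c else 0))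
      = (\<Sum>z<r. \<Sum>z'<r. (if y = z \<and> y' = z' then c else 0) * f z z')"
    by (intro sum.cong refl) auto
  then show ?thesis using sum_delta2[OF assms] by simp
qed

text \<open>At 0 every site acts as the scalar \<open>N I u s\<close>, and the first order term is
  given by the Leibniz rule over sites. \<open>p\<close> pairs the perturbation of a site with its
  conjugated base vector; \<open>T\<close> adds the perturbation of the ket to that of the
  bra.\<close>

lemma env_germ:
  fixes K :: "real \<Rightarrow> nat \<Rightarrow> nat \<Rightarrow> nat \<Rightarrow> nat \<Rightarrow> complex"
  defines "N \<equiv> \<lambda>I u s. \<Sum>a\<in>I s. u s a * cnj (u s a :: complex)"
    and "p \<equiv> \<lambda>I P u s x y. \<Sum>a\<in>I s. P s a x y * cnj (u s a :: complex)"
  defines "T \<equiv> \<lambda>I P u s x y x' y'. (if x = y then cnj (p I P u s x' y') else 0) + (if x' = y' then p I P u s x y else 0)"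
  assumes dist: "distinct ss"
    and K: "\<And>s a x z. s \<in> set ss \<Longrightarrow> a \<in> I s \<Longrightarrow> x < r \<Longrightarrow> z < r \<Longrightarrow>
      germ (\<lambda>\<epsilon>. K \<epsilon> s a x z) (u s a * (if x = z then 1 else 0)) (P s a x z)"
    and lt: "x < r" "x' < r" "y < r" "y' < (r::nat)"
  shows "germ (\<lambda>\<epsilon>. env r (K \<epsilon>) I ss x y x' y') (if x = y \<and> x' = y' then \<Prod>s\<in>set ss. N I u s else 0)
    (\<Sum>s\<in>set ss. (\<Prod>s'\<in>set ss - {s}. N I u s') * T I P u s x y x' y')"
  using dist K lt(1,2)
proof (induction ss arbitrary: x x')
  case Nil
  then show ?case by (simp add: germ_const)
next
  case (Cons s ss)
  let ?N = "N I u" and ?T = "T I P u"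
  define M where "M = (\<Prod>s\<in>set ss. ?N s)"
  define D where "D x x' = (\<Sum>s\<in>set ss. (\<Prod>s'\<in>set ss - {s}. ?N s') * ?T s x y x' y')" for x x'
  have s: "s \<notin> set ss" and dss: "distinct ss" using Cons.prems by auto
  have IH: "germ (\<lambda>\<epsilon>. env r (K \<epsilon>) I ss z y z' y') (if z = y \<and> z' = y' then M else 0) (D z z')"
    if "z < r" "z' < r" for z z'
    unfolding M_def D_def using that Cons.prems by (intro Cons.IH) auto
  have Tg: "germ (\<lambda>\<epsilon>. \<Sum>a\<in>I s. K \<epsilon> s a x z * cnj (K \<epsilon> s a x' z'))
      (if x = z \<and> x' = z' then ?N s else 0) (?T s x z x' z')" if z: "z < r" "z' < r" for z z'
  proof -
    have "germ (\<lambda>\<epsilon>. \<Sum>a\<in>I s. K \<epsilon> s a x z * cnj (K \<epsilon> s a x' z'))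
      (\<Sum>a\<in>I s. u s a * (if x = z then 1 else 0) * cnj (u s a * (if x' = z' then 1 else 0)))
      (\<Sum>a\<in>I s. u s a * (if x = z then 1 else 0) * cnj (P s a x' z') + P s a x z * cnj (u s a * (if x' = z' then 1 else 0)))"
      by (intro germ_sum germ_mult germ_cnj Cons.prems(2)) (use z Cons.prems in simp_all)
    moreover have "(\<Sum>a\<in>I s. u s a * (if x = z then 1 else 0) * cnj (u s a * (if x' = z' then 1 else 0)))
        = (if x = z \<and> x' = z' then ?N s else 0)"
      by (auto simp: N_def)
    moreover have "(\<Sum>a\<in>I s. u s a * (if x = z then 1 else 0) * cnj (P s a x' z') + P s a x z * cnj (u s a * (if x' = z' then 1 else 0)))
        = ?T s x z x' z'"
      by (auto simp: T_def p_def sum.distrib mult.commute)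
    ultimately show ?thesis by simp
  qed
  have "germ (\<lambda>\<epsilon>. env r (K \<epsilon>) I (s # ss) x y x' y')
     (\<Sum>z<r. \<Sum>z'<r. (if x = z \<and> x' = z' then ?N s else 0) * (if z = y \<and> z' = y' then M else 0))
     (\<Sum>z<r. \<Sum>z'<r. (if x = z \<and> x' = z' then ?N s else 0) * D z z' + ?T s x z x' z' * (if z = y \<and> z' = y' then M else 0))"
    unfolding env_Cons by (intro germ_sum germ_mult Tg IH) simp_all
  moreover have "(\<Sum>z<r. \<Sum>z'<r. (if x = z \<and> x' = z' then ?N s else 0) * (if z = y \<and> z' = y' then M else 0))
      = (if x = y \<and> x' = y' then \<Prod>s\<in>set (s # ss). ?N s else 0)"
    unfolding sum_delta2[OF Cons.prems(3,4)] using s by (simp add: M_def)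
  moreover have "(\<Sum>z<r. \<Sum>z'<r. (if x = z \<and> x' = z' then ?N s else 0) * D z z' + ?T s x z x' z' * (if z = y \<and> z' = y' then M else 0))
      = ?N s * D x x' + M * ?T s x y x' y'"
    unfolding sum.distrib sum_delta2[OF Cons.prems(3,4)]
    using sum_delta2'[OF lt(3,4), of "\<lambda>z z'. ?T s x z x' z'" M] by (simp add: mult.commute)
  moreover have "(\<Sum>q\<in>set (s # ss). (\<Prod>s'\<in>set (s # ss) - {q}. ?N s') * ?T q x y x' y') = ?N s * D x x' + M * ?T s x y x' y'"
  proof -
    have "(\<Prod>s'\<in>set (s # ss) - {q}. ?N s') = ?N s * (\<Prod>s'\<in>set ss - {q}. ?N s')" if "q \<in> set ss" for q
    proof -
      have "set (s # ss) - {q} = insert s (set ss - {q})" using that s by auto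
      then show ?thesis using s by simp
    qed
    moreover have "set (s # ss) - {s} = set ss" using s by auto
    ultimately show ?thesis using s by (simp add: D_def M_def sum_distrib_left mult.assoc)
  qed
  ultimately show ?case by simp
qed

lemma smult_one_index:
  "x < r \<Longrightarrow> y < r \<Longrightarrow> (c \<cdot>\<^sub>m 1\<^sub>m r + e \<cdot>\<^sub>m P) $$ (x, y) = (if x = y then c else 0) + e * (P $$ (x, y) :: complex)"
  if "P \<in> carrier_mat r r"
  using that by simp

text \<open>These cores can fail to suffice only if \<open>d \<ge> 4\<close> and all four slices use the same site.\<close>

definition perturbed_scalars ::
  "nat \<Rightarrow> nat set \<Rightarrow> (nat \<Rightarrow> nat \<Rightarrow> complex) \<Rightarrow> (nat \<Rightarrow> nat \<Rightarrow> complex mat) \<Rightarrow> real \<Rightarrow> nat \<Rightarrow> nat \<Rightarrow> complex mat" where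
  "perturbed_scalars r J u P \<epsilon> s a = (if s \<in> J then 1\<^sub>m r else u s a \<cdot>\<^sub>m 1\<^sub>m r + of_real \<epsilon> \<cdot>\<^sub>m P s a)"

text \<open>By the hypothesis \<open>zero\<close>, perturbations are orthogonal to the base vectors,
  so uncontracted sites drop out at first order and only \<open>h\<close> is seen. The perturbed bra
  contributes its trace times the identity, which goes into the scalar part.\<close>

lemma perturbed_scalars_scalar_germ:
  assumes j: "j < d" and d: "2 \<le> d" and r: "0 < r" and P: "\<And>s a. P s a \<in> carrier_mat r r"
    and h: "h \<in> set (rest d j)"
    and N: "\<And>s. s \<in> set (rest d j) \<Longrightarrow> (\<Sum>a<n s. u s a * cnj (u s a)) \<noteq> 0"
    and zero: "\<And>s x y. s \<in> set (rest d j) \<Longrightarrow> x < r \<Longrightarrow> y < r \<Longrightarrow> (\<Sum>a<n s. P s a $$ (x, y) * cnj (u s a)) = 0"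
    and uv: "(\<Sum>b<n h. v $ b * u h b) \<noteq> 0"
  shows "\<exists>c y. scalar_germ r (\<lambda>\<epsilon>. env_matrix d r n (perturbed_scalars r {j, Suc j mod d} u P \<epsilon>) j h v) c
    (Matrix.mat r r (\<lambda>(x, y). (\<Sum>b<n h. v $ b * P h b $$ (x, y)) / (\<Sum>b<n h. v $ b * u h b))) y"
proof -
  define k where "k = Suc j mod d"
  define ss where "ss = rest d j"
  let ?Q = "perturbed_scalars r {j, k} u P"
  have dist: "distinct ss" and set: "set ss = {..<d} - {j, k}"
    using rest_props[OF j d] by (auto simp: ss_def k_def)
  define U where "U = (\<Sum>b<n h. v $ b * u h b)"
  define Pv where "Pv x y = (\<Sum>b<n h. v $ b * P h b $$ (x, y))" for x y
  define u' where "u' s a = (if s = h then U else u s a)" for s and a :: nat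
  define P' where "P' s a x y = (if s = h then Pv x y else P s a $$ (x, y))" for s and a :: nat and x y
  let ?C = "\<lambda>\<epsilon>. contracted n h v (?Q \<epsilon>)"
  have K: "germ (\<lambda>\<epsilon>. ?C \<epsilon> s a x z) (u' s a * (if x = z then 1 else 0)) (P' s a x z)"
    if s: "s \<in> set ss" and xz: "x < r" "z < r" for s a x z
  proof -
    have sjk: "s \<notin> {j, k}" using s set by auto
    have hjk: "h \<notin> {j, k}" using h set by (auto simp: ss_def)
    have "?C \<epsilon> s a x z = u' s a * (if x = z then 1 else 0) + of_real \<epsilon> * P' s a x z" for \<epsilon>
    proof (cases "s = h")
      case True
      have "?C \<epsilon> s a x z = (\<Sum>b<n h. v $ b * ((if x = z then u h b else 0) + of_real \<epsilon> * P h b $$ (x, z)))"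
        using True hjk xz P by (simp add: contracted_def perturbed_scalars_def smult_one_index)
      also have "\<dots> = u' s a * (if x = z then 1 else 0) + of_real \<epsilon> * P' s a x z"
        using True by (auto simp: u'_def P'_def U_def Pv_def sum.distrib sum_distrib_left distrib_left mult_ac)
      finally show ?thesis .
    next
      case False
      then show ?thesis using sjk xz P
        by (auto simp: contracted_def perturbed_scalars_def smult_one_index u'_def P'_def)
    qed
    then show ?thesis using germ_affine by simp
  qed
  let ?L = "levels n h"
  define N' where "N' s = (\<Sum>a\<in>?L s. u' s a * cnj (u' s a))" for s
  define p where "p s x y = (\<Sum>a\<in>?L s. P' s a x y * cnj (u' s a))" for s x y
  have hss: "h \<in> set ss" using h by (simp add: ss_def)
  have p0: "p s x y = 0" if "s \<in> set ss" "s \<noteq> h" "x < r" "y < r" for s x y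
    using zero[of s x y] that by (simp add: p_def P'_def u'_def levels_def ss_def)
  have ph: "p h x y = Pv x y * cnj U" for x y by (simp add: p_def P'_def u'_def levels_def)
  have Nh: "N' h = U * cnj U" by (simp add: N'_def u'_def levels_def)
  define M where "M = (\<Prod>s\<in>set ss - {h}. N' s)"
  have M0: "M \<noteq> 0"
    unfolding M_def using N by (auto simp: N'_def u'_def levels_def ss_def)
  have prodN: "(\<Prod>s\<in>set ss. N' s) = M * (U * cnj U)"
    unfolding M_def Nh[symmetric] using prod.remove[OF finite_set hss, of N'] by (simp add: mult.commute)
  have E: "germ (\<lambda>\<epsilon>. env r (?C \<epsilon>) ?L ss x y q q) (if x = y then M * (U * cnj U) else 0)
      (M * ((if x = y then cnj (Pv q q) * U else 0) + Pv x y * cnj U))" if lt: "x < r" "y < r" "q < r" for x y q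
  proof -
    have D: "(\<Sum>s\<in>set ss. (\<Prod>s'\<in>set ss - {s}. N' s') *
        ((if x = y then cnj (p s q q) else 0) + (if q = q then p s x y else 0)))
      = (\<Sum>s\<in>set ss. if s = h then M * ((if x = y then cnj (Pv q q) * U else 0) + Pv x y * cnj U) else 0)"
      using lt by (intro sum.cong refl) (auto simp: p0 ph M_def)
    then have D: "(\<Sum>s\<in>set ss. (\<Prod>s'\<in>set ss - {s}. N' s') *
        ((if x = y then cnj (p s q q) else 0) + (if q = q then p s x y else 0)))
      = M * ((if x = y then cnj (Pv q q) * U else 0) + Pv x y * cnj U)"
      using hss by simp
    show ?thesis
      using env_germ[of ss ?L r ?C u' P' x q y q, OF dist K lt(1,3,2,3)]
      unfolding N'_def[symmetric] p_def[symmetric] D prodN by (simp only: simp_thms)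
  qed
  define tr where "tr = (\<Sum>q<r. Pv q q)"
  have "germ (\<lambda>\<epsilon>. env_matrix d r n (?Q \<epsilon>) j h v $$ (x, y)) (of_nat r * (M * (U * cnj U)) * (1\<^sub>m r) $$ (x, y))
      (of_nat r * (M * (U * cnj U)) * (Pv x y / U) + M * cnj tr * U * (1\<^sub>m r) $$ (x, y))" if xy: "x < r" "y < r" for x y
  proof -
    have "germ (\<lambda>\<epsilon>. \<Sum>q<r. env r (?C \<epsilon>) ?L ss x y q q) (\<Sum>q<r. if x = y then M * (U * cnj U) else 0)
      (\<Sum>q<r. M * ((if x = y then cnj (Pv q q) * U else 0) + Pv x y * cnj U))"
      using xy by (intro germ_sum E) auto
    moreover have "env_matrix d r n (?Q \<epsilon>) j h v $$ (x, y) = (\<Sum>q<r. env r (?C \<epsilon>) ?L ss x y q q)" for \<epsilon>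
      unfolding ss_def using xy by (intro env_matrix_one) (auto simp: perturbed_scalars_def k_def)
    moreover have "(\<Sum>q<r. if x = y then M * (U * cnj U) else 0) = of_nat r * (M * (U * cnj U)) * (1\<^sub>m r) $$ (x, y)"
      using xy by simp
    moreover have "(\<Sum>q<r. M * ((if x = y then cnj (Pv q q) * U else 0) + Pv x y * cnj U))
        = of_nat r * (M * (U * cnj U)) * (Pv x y / U) + M * cnj tr * U * (1\<^sub>m r) $$ (x, y)"
      using xy uv by (auto simp: tr_def U_def[symmetric] distrib_left sum.distrib sum_distrib_left sum_distrib_right mult_ac)
    ultimately show ?thesis by (simp only:)
  qed
  then have "scalar_germ r (\<lambda>\<epsilon>. env_matrix d r n (?Q \<epsilon>) j h v) (of_nat r * (M * (U * cnj U)))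
      (Matrix.mat r r (\<lambda>(x, y). Pv x y / U)) (M * cnj tr * U)"
    unfolding scalar_germ_def using r M0 uv by (auto simp: U_def[symmetric] env_matrix_def)
  then show ?thesis unfolding k_def U_def Pv_def by blast
qed

text \<open>
  For slices which all use the site \<open>h\<close>: the second site \<open>t\<close> restricts the conjugate chain to its
  diagonal, so that the first order term is \<open>\<tau> N\<close> plus the conjugate of its diagonal part only.
\<close>

definition dephased_chain ::
  "nat \<Rightarrow> nat \<Rightarrow> nat \<Rightarrow> (nat \<Rightarrow> complex) \<Rightarrow> (nat \<Rightarrow> complex) \<Rightarrow> complex mat \<Rightarrow> real \<Rightarrow> nat \<Rightarrow> nat \<Rightarrow> complex mat" where
  "dephased_chain r h t u f N \<epsilon> s a =
     (if s = h then u a \<cdot>\<^sub>m 1\<^sub>m r + (of_real \<epsilon> * f a) \<cdot>\<^sub>m N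
      else if s = t then Matrix.mat r r (\<lambda>(x, y). if x = a \<and> y = a then 1 else 0)
      else if a = 0 then 1\<^sub>m r else 0\<^sub>m r r)"

text \<open>Bond indices change only at \<open>h\<close>, and \<open>t\<close> forces ket and bra
  indices to agree where it stands. If \<open>t\<close> comes after \<open>h\<close> this constrains
  the right ends of the chain, otherwise the left ends.\<close>

lemma dephased_env:
  fixes K :: "real \<Rightarrow> nat \<Rightarrow> nat \<Rightarrow> nat \<Rightarrow> nat \<Rightarrow> complex" and H :: "real \<Rightarrow> nat \<Rightarrow> nat \<Rightarrow> complex"
  assumes "distinct ss" and ht: "h \<noteq> t"
    and T: "\<And>\<epsilon> s x z x' z'. s \<in> set ss \<Longrightarrow> x < r \<Longrightarrow> z < r \<Longrightarrow> x' < r \<Longrightarrow> z' < r \<Longrightarrow>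
      (\<Sum>a\<in>I s. K \<epsilon> s a x z * cnj (K \<epsilon> s a x' z')) =
      (if s = h then H \<epsilon> x z * cnj (H \<epsilon> x' z')
       else if x = z \<and> x' = z' then (if s = t \<and> x \<noteq> x' then 0 else 1) else 0)"
  shows "h \<notin> set ss \<Longrightarrow> \<forall>\<epsilon>. \<forall>x<r. \<forall>y<r. \<forall>x'<r. \<forall>y'<r. env r (K \<epsilon>) I ss x y x' y'
        = (if x = y \<and> x' = y' then (if t \<in> set ss \<and> x \<noteq> x' then 0 else 1) else 0)"
    and "h \<in> set ss \<Longrightarrow> t \<notin> set ss \<Longrightarrow> \<forall>\<epsilon>. \<forall>x<r. \<forall>y<r. \<forall>x'<r. \<forall>y'<r. env r (K \<epsilon>) I ss x y x' y'
        = H \<epsilon> x y * cnj (H \<epsilon> x' y')"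
    and "h \<in> set ss \<Longrightarrow> t \<in> set ss \<Longrightarrow>
      (\<forall>\<epsilon>. \<forall>x<r. \<forall>y<r. \<forall>x'<r. \<forall>y'<r. env r (K \<epsilon>) I ss x y x' y' = (if y = y' then H \<epsilon> x y * cnj (H \<epsilon> x' y') else 0)) \<or>
      (\<forall>\<epsilon>. \<forall>x<r. \<forall>y<r. \<forall>x'<r. \<forall>y'<r. env r (K \<epsilon>) I ss x y x' y' = (if x = x' then H \<epsilon> x y * cnj (H \<epsilon> x' y') else 0))"
  using assms(1) T
proof (induction ss)
  case Nil
  {
    case 1 then show ?case by simp
  next
    case 2 then show ?case by simp
  next
    case 3 then show ?case by simp
  }
next
  case (Cons s ss)
  have D: "env r (K \<epsilon>) I (s # ss) x y x' y' = (if s = t \<and> x \<noteq> x' then 0 else 1) * env r (K \<epsilon>) I ss x y x' y'"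
    if "s \<noteq> h" "x < r" "x' < r" and T: "\<And>\<epsilon> q x z x' z'. q \<in> set (s # ss) \<Longrightarrow> x < r \<Longrightarrow> z < r \<Longrightarrow> x' < r \<Longrightarrow> z' < r \<Longrightarrow>
      (\<Sum>a\<in>I q. K \<epsilon> q a x z * cnj (K \<epsilon> q a x' z')) =
      (if q = h then H \<epsilon> x z * cnj (H \<epsilon> x' z')
       else if x = z \<and> x' = z' then (if q = t \<and> x \<noteq> x' then 0 else 1) else 0)" for \<epsilon> x y x' y'
  proof -
    have "env r (K \<epsilon>) I (s # ss) x y x' y' = (\<Sum>z<r. \<Sum>z'<r.
        (if x = z \<and> x' = z' then (if s = t \<and> x \<noteq> x' then 0 else 1) else 0) * env r (K \<epsilon>) I ss z y z' y')"
      unfolding env_Cons by (intro sum.cong refl arg_cong2[of _ _ _ _ times], subst T) (use that in auto)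
    then show ?thesis unfolding sum_delta2[OF that(2,3)] .
  qed
  have Hs: "env r (K \<epsilon>) I (h # ss) x y x' y' = (if y' = y \<or> t \<notin> set ss then H \<epsilon> x y * cnj (H \<epsilon> x' y') else 0)"
    if sh: "s = h" and lt: "x < r" "y < r" "x' < r" "y' < r"
      and IH: "\<forall>\<epsilon>. \<forall>x<r. \<forall>y<r. \<forall>x'<r. \<forall>y'<r. env r (K \<epsilon>) I ss x y x' y'
        = (if x = y \<and> x' = y' then (if t \<in> set ss \<and> x \<noteq> x' then 0 else 1) else 0)"
      and T: "\<And>\<epsilon> q x z x' z'. q \<in> set (s # ss) \<Longrightarrow> x < r \<Longrightarrow> z < r \<Longrightarrow> x' < r \<Longrightarrow> z' < r \<Longrightarrow>
      (\<Sum>a\<in>I q. K \<epsilon> q a x z * cnj (K \<epsilon> q a x' z')) =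
      (if q = h then H \<epsilon> x z * cnj (H \<epsilon> x' z')
       else if x = z \<and> x' = z' then (if q = t \<and> x \<noteq> x' then 0 else 1) else 0)" for \<epsilon> x y x' y'
  proof -
    have "env r (K \<epsilon>) I (h # ss) x y x' y' = (\<Sum>z<r. \<Sum>z'<r. H \<epsilon> x z * cnj (H \<epsilon> x' z') *
        (if z = y \<and> z' = y' then (if t \<in> set ss \<and> y \<noteq> y' then 0 else 1) else 0))"
      unfolding env_Cons
    proof (intro sum.cong refl arg_cong2[of _ _ _ _ times])
      fix z z' assume z: "z \<in> {..<r}" "z' \<in> {..<r}"
      show "(\<Sum>a\<in>I h. K \<epsilon> h a x z * cnj (K \<epsilon> h a x' z')) = H \<epsilon> x z * cnj (H \<epsilon> x' z')"
        using T[of h x z x' z' \<epsilon>] sh lt z by simp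
      show "env r (K \<epsilon>) I ss z y z' y' = (if z = y \<and> z' = y' then (if t \<in> set ss \<and> y \<noteq> y' then 0 else 1) else 0)"
        using IH lt z by auto
    qed
    also have "\<dots> = (if t \<in> set ss \<and> y \<noteq> y' then 0 else 1) * (H \<epsilon> x y * cnj (H \<epsilon> x' y'))"
      by (rule sum_delta2'[OF lt(2,4)])
    finally show ?thesis by auto
  qed
  {
    case 1
    have IH: "\<forall>\<epsilon>. \<forall>x<r. \<forall>y<r. \<forall>x'<r. \<forall>y'<r. env r (K \<epsilon>) I ss x y x' y'
        = (if x = y \<and> x' = y' then (if t \<in> set ss \<and> x \<noteq> x' then 0 else 1) else 0)"
      by (rule Cons.IH(1)) (use 1 in auto)
    show ?case using D[OF _ _ _ 1(3)] IH 1(1,2) by (auto simp del: env.simps)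
  next
    case 2
    show ?case
    proof (cases "s = h")
      case True
      have IH: "\<forall>\<epsilon>. \<forall>x<r. \<forall>y<r. \<forall>x'<r. \<forall>y'<r. env r (K \<epsilon>) I ss x y x' y'
        = (if x = y \<and> x' = y' then (if t \<in> set ss \<and> x \<noteq> x' then 0 else 1) else 0)"
        by (rule Cons.IH(1)) (use 2 True in auto)
      show ?thesis using Hs[OF True _ _ _ _ IH 2(4)] True 2(2) by (auto simp del: env.simps)
    next
      case False
      have IH: "\<forall>\<epsilon>. \<forall>x<r. \<forall>y<r. \<forall>x'<r. \<forall>y'<r. env r (K \<epsilon>) I ss x y x' y' = H \<epsilon> x y * cnj (H \<epsilon> x' y')"
        by (rule Cons.IH(2)) (use 2 False in auto)
      show ?thesis using D[OF False _ _ 2(4)] IH 2(2) by (auto simp del: env.simps)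
    qed
  next
    case 3
    show ?case
    proof (cases "s = h")
      case True
      have IH: "\<forall>\<epsilon>. \<forall>x<r. \<forall>y<r. \<forall>x'<r. \<forall>y'<r. env r (K \<epsilon>) I ss x y x' y'
        = (if x = y \<and> x' = y' then (if t \<in> set ss \<and> x \<noteq> x' then 0 else 1) else 0)"
        by (rule Cons.IH(1)) (use 3 True in auto)
      have "t \<in> set ss" using 3(2) True ht by auto
      then show ?thesis using Hs[OF True _ _ _ _ IH 3(4)] True by (intro disjI1) (auto simp del: env.simps)
    next
      case False
      show ?thesis
      proof (cases "s = t")
        case True
        have "t \<notin> set ss" using 3(3) True by auto
        then have IH: "\<forall>\<epsilon>. \<forall>x<r. \<forall>y<r. \<forall>x'<r. \<forall>y'<r. env r (K \<epsilon>) I ss x y x' y' = H \<epsilon> x y * cnj (H \<epsilon> x' y')"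
          by (intro Cons.IH(2)) (use 3 False in auto)
        show ?thesis using D[OF False _ _ 3(4)] IH True by (intro disjI2) (auto simp del: env.simps)
      next
        case st: False
        have "(\<forall>\<epsilon>. \<forall>x<r. \<forall>y<r. \<forall>x'<r. \<forall>y'<r. env r (K \<epsilon>) I ss x y x' y' = (if y = y' then H \<epsilon> x y * cnj (H \<epsilon> x' y') else 0)) \<or>
          (\<forall>\<epsilon>. \<forall>x<r. \<forall>y<r. \<forall>x'<r. \<forall>y'<r. env r (K \<epsilon>) I ss x y x' y' = (if x = x' then H \<epsilon> x y * cnj (H \<epsilon> x' y') else 0))"
          by (rule Cons.IH(3)) (use 3 False st in auto)
        moreover have "env r (K \<epsilon>) I (s # ss) x y x' y' = env r (K \<epsilon>) I ss x y x' y'" if "x < r" "x' < r" for \<epsilon> x y x' y'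
          using D[OF False that 3(4)] st by (simp del: env.simps)
        ultimately show ?thesis by presburger
      qed
    qed
  }
qed

text \<open>The bra enters as a diagonal entry of \<open>H\<close>, in row \<open>x\<close> or
  \<open>y\<close>. Its first order part is multiplied by the scalar base value of the ket, which
  vanishes unless \<open>x = y\<close>, so both orders of \<open>h\<close> and \<open>t\<close> give
  the same germ.\<close>

lemma dephased_chain_scalar_germ:
  fixes f :: "nat \<Rightarrow> complex"
  assumes j: "j < d" and d: "2 \<le> d" and N: "N \<in> carrier_mat r r"
    and h: "h \<in> set (rest d j)" and t: "t \<in> set (rest d j)" and ht: "h \<noteq> t"
    and n: "\<And>s. s < d \<Longrightarrow> r \<le> n s" and r: "0 < r"
    and uv: "(\<Sum>b<n h. v $ b * u b) \<noteq> 0"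
  defines "\<tau> \<equiv> (\<Sum>b<n h. v $ b * f b) / (\<Sum>b<n h. v $ b * u b)"
  shows "\<exists>c. scalar_germ r (\<lambda>\<epsilon>. env_matrix d r n (dephased_chain r h t u f N \<epsilon>) j h v) c
    (Matrix.mat r r (\<lambda>(x, y). \<tau> * N $$ (x, y) + (if x = y then cnj (\<tau> * N $$ (x, x)) else 0))) 0"
proof -
  define k where "k = Suc j mod d"
  define ss where "ss = rest d j"
  let ?Q = "dephased_chain r h t u f N"
  let ?C = "\<lambda>\<epsilon>. contracted n h v (?Q \<epsilon>)" and ?L = "levels n h"
  have dist: "distinct ss" and set: "set ss = {..<d} - {j, k}"
    using rest_props[OF j d] by (auto simp: ss_def k_def)
  define U F where "U = (\<Sum>b<n h. v $ b * u b)" and "F = (\<Sum>b<n h. v $ b * f b)"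
  define H where "H \<epsilon> x y = U * (if x = y then 1 else 0) + of_real \<epsilon> * (F * N $$ (x, y))" for \<epsilon> x y
  have "(\<Sum>a\<in>?L s. ?C \<epsilon> s a x z * cnj (?C \<epsilon> s a x' z')) =
      (if s = h then H \<epsilon> x z * cnj (H \<epsilon> x' z')
       else if x = z \<and> x' = z' then (if s = t \<and> x \<noteq> x' then 0 else 1) else 0)"
    if s: "s \<in> set ss" and lt: "x < r" "z < r" "x' < r" "z' < r" for \<epsilon> s x z x' z'
  proof -
    consider "s = h" | "s = t" "s \<noteq> h" | "s \<noteq> h" "s \<noteq> t" by blast
    then show ?thesis
    proof cases
      case 1
      have "?C \<epsilon> s a x z = H \<epsilon> x z" if "x < r" "z < r" for a x z
      proof -
        have "?C \<epsilon> s a x z = (\<Sum>b<n h. v $ b * ((if x = z then u b else 0) + of_real \<epsilon> * f b * N $$ (x, z)))"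
          using 1 that N by (simp add: contracted_def dephased_chain_def smult_one_index)
        also have "\<dots> = H \<epsilon> x z"
          by (auto simp: H_def U_def F_def sum.distrib sum_distrib_left sum_distrib_right distrib_left mult_ac)
        finally show ?thesis .
      qed
      then show ?thesis using 1 lt by (simp add: levels_def)
    next
      case 2
      have "?C \<epsilon> s a x z * cnj (?C \<epsilon> s a x' z') = (if a = x then (if x = z \<and> x' = z' \<and> x = x' then 1 else 0) else 0)" for a
        using 2 lt by (auto simp: contracted_def dephased_chain_def)
      moreover have "x < n s" using n[of s] s set lt by auto
      ultimately show ?thesis using 2 by (auto simp: levels_def)
    next
      case 3
      have "?C \<epsilon> s a x z * cnj (?C \<epsilon> s a x' z') = (if a = 0 then (if x = z \<and> x' = z' then 1 else 0) else 0)" for a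
        using 3 lt by (auto simp: contracted_def dephased_chain_def)
      moreover have "0 < n s" using n[of s] s set r by auto
      ultimately show ?thesis using 3 by (auto simp: levels_def)
    qed
  qed
  then have E: "(\<forall>\<epsilon>. \<forall>x<r. \<forall>y<r. \<forall>x'<r. \<forall>y'<r. env r (?C \<epsilon>) ?L ss x y x' y' = (if y = y' then H \<epsilon> x y * cnj (H \<epsilon> x' y') else 0)) \<or>
      (\<forall>\<epsilon>. \<forall>x<r. \<forall>y<r. \<forall>x'<r. \<forall>y'<r. env r (?C \<epsilon>) ?L ss x y x' y' = (if x = x' then H \<epsilon> x y * cnj (H \<epsilon> x' y') else 0))"
    using h t by (intro dephased_env(3)[OF dist ht]) (auto simp: ss_def)
  have tau: "\<tau> = F / U" and U0: "U \<noteq> 0" using uv by (simp_all add: \<tau>_def U_def F_def)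
  have hjk: "h \<noteq> j" "h \<noteq> k" "t \<noteq> j" "t \<noteq> k" using h t set by (auto simp: ss_def)
  have W: "env_matrix d r n (?Q \<epsilon>) j h v $$ (x, y) = (\<Sum>q<r. env r (?C \<epsilon>) ?L ss x y q q)"
    if "x < r" "y < r" for \<epsilon> x y
    unfolding ss_def using that hjk by (intro env_matrix_one) (auto simp: dephased_chain_def k_def)
  \<comment> \<open>The trace over the bra bonds keeps one term, at \<open>y\<close> or at
    \<open>x\<close> according to the position of \<open>t\<close>.\<close>
  have "\<exists>e. \<forall>\<epsilon>. \<forall>x<r. \<forall>y<r. (\<Sum>q<r. env r (?C \<epsilon>) ?L ss x y q q) = H \<epsilon> x y * cnj (H \<epsilon> (e x y) (e x y)) \<and> (e x y = x \<or> e x y = y)"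
    using E
  proof
    assume A: "\<forall>\<epsilon>. \<forall>x<r. \<forall>y<r. \<forall>x'<r. \<forall>y'<r. env r (?C \<epsilon>) ?L ss x y x' y' = (if y = y' then H \<epsilon> x y * cnj (H \<epsilon> x' y') else 0)"
    have "(\<Sum>q<r. env r (?C \<epsilon>) ?L ss x y q q) = (\<Sum>q<r. if q = y then H \<epsilon> x y * cnj (H \<epsilon> y y) else 0)" if "x < r" "y < r" for \<epsilon> x y
      using A that by (intro sum.cong refl) auto
    then show ?thesis by (intro exI[of _ "\<lambda>x y. y"]) simp
  next
    assume A: "\<forall>\<epsilon>. \<forall>x<r. \<forall>y<r. \<forall>x'<r. \<forall>y'<r. env r (?C \<epsilon>) ?L ss x y x' y' = (if x = x' then H \<epsilon> x y * cnj (H \<epsilon> x' y') else 0)"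
    have "(\<Sum>q<r. env r (?C \<epsilon>) ?L ss x y q q) = (\<Sum>q<r. if q = x then H \<epsilon> x y * cnj (H \<epsilon> x x) else 0)" if "x < r" "y < r" for \<epsilon> x y
      using A that by (intro sum.cong refl) auto
    then show ?thesis by (intro exI[of _ "\<lambda>x y. x"]) simp
  qed
  then obtain e where e: "\<And>\<epsilon> x y. x < r \<Longrightarrow> y < r \<Longrightarrow> (\<Sum>q<r. env r (?C \<epsilon>) ?L ss x y q q) = H \<epsilon> x y * cnj (H \<epsilon> (e x y) (e x y))"
    "\<And>x y. x < r \<Longrightarrow> y < r \<Longrightarrow> e x y = x \<or> e x y = y" by metis
  have "germ (\<lambda>\<epsilon>. env_matrix d r n (?Q \<epsilon>) j h v $$ (x, y)) (U * cnj U * (1\<^sub>m r) $$ (x, y))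
      (U * cnj U * (\<tau> * N $$ (x, y) + (if x = y then cnj (\<tau> * N $$ (x, x)) else 0)))" if xy: "x < r" "y < r" for x y
  proof -
    let ?e = "e x y"
    have gH: "germ (\<lambda>\<epsilon>. H \<epsilon> x y) (U * (if x = y then 1 else 0)) (F * N $$ (x, y))" for x y
      unfolding H_def by (rule germ_affine)
    have "germ (\<lambda>\<epsilon>. H \<epsilon> x y * cnj (H \<epsilon> ?e ?e)) (U * (if x = y then 1 else 0) * cnj (U * (if ?e = ?e then 1 else 0)))
        (U * (if x = y then 1 else 0) * cnj (F * N $$ (?e, ?e)) + F * N $$ (x, y) * cnj (U * (if ?e = ?e then 1 else 0)))"
      by (intro germ_mult germ_cnj gH)
    moreover have "U * (if x = y then 1 else 0) * cnj (U * (if ?e = ?e then 1 else 0)) = U * cnj U * (1\<^sub>m r) $$ (x, y)"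
      using xy by simp
    moreover have "U * (if x = y then 1 else 0) * cnj (F * N $$ (?e, ?e)) + F * N $$ (x, y) * cnj (U * (if ?e = ?e then 1 else 0))
        = U * cnj U * (\<tau> * N $$ (x, y) + (if x = y then cnj (\<tau> * N $$ (x, x)) else 0))"
      using e(2)[OF xy] U0 by (auto simp: tau field_simps)
    ultimately show ?thesis by (simp only: W[OF xy] e(1)[OF xy])
  qed
  then have "scalar_germ r (\<lambda>\<epsilon>. env_matrix d r n (?Q \<epsilon>) j h v) (U * cnj U)
      (Matrix.mat r r (\<lambda>(x, y). \<tau> * N $$ (x, y) + (if x = y then cnj (\<tau> * N $$ (x, x)) else 0))) 0"
    unfolding scalar_germ_def using uv by (auto simp: U_def[symmetric] env_matrix_def)
  then show ?thesis by blast
qed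

section \<open>Nonvanishing of the certificate\<close>

text \<open>A square matrix with rows \<open>v\<close>, \<open>w\<close> and otherwise zeros is
  singular once it has a third row.\<close>

lemma orthogonal_functional:
  fixes v w :: "nat \<Rightarrow> complex"
  assumes "3 \<le> m"
  obtains q where "\<exists>a<m. q a \<noteq> 0" "(\<Sum>a<m. q a * v a) = 0" "(\<Sum>a<m. q a * w a) = 0"
proof -
  define A where "A = Matrix.mat m m (\<lambda>(i, j). if i = 0 then v j else if i = 1 then w j else 0)"
  have A: "A \<in> carrier_mat m m" by (simp add: A_def)
  have AT: "A\<^sup>T \<in> carrier_mat m m" using A by simp
  have uc: "unit_vec m 2 \<in> carrier_vec m" by simp
  have "A\<^sup>T *\<^sub>v unit_vec m 2 = 0\<^sub>v m"
  proof (rule eq_vecI)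
    fix i assume "i < dim_vec (0\<^sub>v m :: complex Matrix.vec)"
    then have i: "i < m" by simp
    have "(\<Sum>x<m. A\<^sup>T $$ (i, x) * unit_vec m 2 $ x) = 0"
      using i assms by (intro sum.neutral) (auto simp: A_def unit_vec_def)
    then show "(A\<^sup>T *\<^sub>v unit_vec m 2) $ i = 0\<^sub>v m $ i"
      unfolding mult_vec_entry[OF AT uc i] using i by simp
  qed (use AT in auto)
  moreover have "unit_vec m 2 \<noteq> (0\<^sub>v m :: complex Matrix.vec)" using assms by simp
  ultimately have "det (A\<^sup>T) = 0" using det_0_iff_vec_prod_zero[OF AT] uc by blast
  then have "det A = 0" using det_transpose[OF A] by simp
  then obtain x where x: "x \<in> carrier_vec m" "x \<noteq> 0\<^sub>v m" "A *\<^sub>v x = 0\<^sub>v m"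
    using det_0_iff_vec_prod_zero[OF A] by blast
  have "\<exists>a<m. x $ a \<noteq> 0"
  proof (rule ccontr)
    assume "\<not> ?thesis"
    then have "x = 0\<^sub>v m" using x(1) by (intro eq_vecI) auto
    then show False using x(2) by simp
  qed
  moreover have row: "(\<Sum>a<m. A $$ (i, a) * x $ a) = 0" if "i < m" for i
    using mult_vec_entry[OF A x(1) that] x(3) that by simp
  have "(\<Sum>a<m. x $ a * v a) = 0" using row[of 0] assms by (simp add: A_def mult.commute)
  moreover have "(\<Sum>a<m. x $ a * w a) = 0" using row[of 1] assms by (simp add: A_def mult.commute)
  ultimately show thesis using that by blast
qed

text \<open>Each \<open>w i\<close> lives at the single site \<open>h i\<close>, so everything
  depends on which sites coincide. A vector \<open>q\<close> annihilating the given slice vectors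
  but not \<open>c\<close> rules out accidental relations; when all four sites coincide the
  corrections \<open>c\<close> cancel and nonplanarity is needed.\<close>

lemma difference_independent:
  fixes h n :: "nat \<Rightarrow> nat" and v u c :: "nat \<Rightarrow> nat \<Rightarrow> complex" and U :: "nat \<Rightarrow> complex" and S :: "nat set"
  assumes nonpar: "\<And>i i'. i < 4 \<Longrightarrow> i' < 4 \<Longrightarrow> i \<noteq> i' \<Longrightarrow> h i = h i' \<Longrightarrow> \<exists>a<n (h i). v i a / U i \<noteq> v i' a / U i'"
    and q: "\<And>i i'. i < 4 \<Longrightarrow> i' < 4 \<Longrightarrow> h i = h i' \<Longrightarrow>
      \<exists>q. (\<Sum>a<n (h i). q a * v i a) = 0 \<and> (\<Sum>a<n (h i). q a * v i' a) = 0 \<and> (\<Sum>a<n (h i). q a * c (h i) a) \<noteq> 0"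
    and nonplanar: "h 1 = h 0 \<Longrightarrow> h 2 = h 0 \<Longrightarrow> h 3 = h 0 \<Longrightarrow>
      \<not> (\<exists>k. \<forall>a<n (h 0). v 2 a / U 2 - v 3 a / U 3 = k * (v 0 a / U 0 - v 1 a / U 1))"
    and S: "\<And>i. i < 4 \<Longrightarrow> h i \<in> S"
  defines "w \<equiv> \<lambda>i s a. if s = h i then v i a / U i - c s a else 0"
  shows "\<exists>s\<in>S. \<exists>a<n s. w 0 s a - w 1 s a \<noteq> 0"
    and "\<exists>s\<in>S. \<exists>a<n s. w 2 s a - w 3 s a \<noteq> k * (w 0 s a - w 1 s a)"
proof -
  have lin: "(\<Sum>a<m. q a * (x a / U i - y a)) = (\<Sum>a<m. q a * x a) / U i - (\<Sum>a<m. q a * y a)"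
    for m and q x y :: "nat \<Rightarrow> complex" and i
    by (simp add: right_diff_distrib sum_subtractf sum_divide_distrib)
  \<comment> \<open>Applying \<open>q\<close> to a proportionality leaves only the term with
    \<open>c\<close>, so the factor is 1; then the normalized vectors agree, which is
    excluded.\<close>
  have F3: "\<exists>a<n (h i). v i a / U i - c (h i) a \<noteq> k * (v i' a / U i' - c (h i) a)"
    if i: "i < 4" "i' < 4" "i \<noteq> i'" "h i = h i'" for i i' k
  proof (rule ccontr)
    assume "\<not> ?thesis"
    then have eq: "v i a / U i - c (h i) a = k * (v i' a / U i' - c (h i) a)" if "a < n (h i)" for a using that by blast
    obtain q where q: "(\<Sum>a<n (h i). q a * v i a) = 0" "(\<Sum>a<n (h i). q a * v i' a) = 0" "(\<Sum>a<n (h i). q a * c (h i) a) \<noteq> 0"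
      using q[OF i(1,2,4)] by blast
    have "(\<Sum>a<n (h i). q a * (v i a / U i - c (h i) a)) = (\<Sum>a<n (h i). k * (q a * (v i' a / U i' - c (h i) a)))"
      using eq by (intro sum.cong) (auto simp: mult_ac)
    then have "(\<Sum>a<n (h i). q a * c (h i) a) = k * (\<Sum>a<n (h i). q a * c (h i) a)"
      unfolding sum_distrib_left[symmetric] lin using q by simp
    then have k: "k = 1" using q(3) by simp
    obtain a where "a < n (h i)" "v i a / U i \<noteq> v i' a / U i'" using nonpar[OF i] by blast
    then show False using eq[of a] k by simp
  qed
  have F1: "\<exists>a<n (h i). v i a / U i - c (h i) a \<noteq> 0" if i: "i < 4" for i
  proof (rule ccontr)
    assume "\<not> ?thesis"
    then have eq: "v i a / U i - c (h i) a = 0" if "a < n (h i)" for a using that by blast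
    obtain q where q: "(\<Sum>a<n (h i). q a * v i a) = 0" "(\<Sum>a<n (h i). q a * c (h i) a) \<noteq> 0"
      using q[OF i i refl] by blast
    have "(\<Sum>a<n (h i). q a * (v i a / U i - c (h i) a)) = 0" using eq by simp
    then show False unfolding lin using q by simp
  qed
  show "\<exists>s\<in>S. \<exists>a<n s. w 0 s a - w 1 s a \<noteq> 0"
  proof (cases "h 0 = h 1")
    case True
    then obtain a where "a < n (h 0)" "v 0 a / U 0 \<noteq> v 1 a / U 1" using nonpar[of 0 1] by auto
    then show ?thesis using True S[of 0] by (intro bexI[of _ "h 0"] exI[of _ a]) (auto simp: w_def)
  next
    case False
    obtain a where "a < n (h 0)" "v 0 a / U 0 - c (h 0) a \<noteq> 0" using F1[of 0] by auto
    then show ?thesis using False S[of 0] by (intro bexI[of _ "h 0"] exI[of _ a]) (auto simp: w_def)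
  qed
  show "\<exists>s\<in>S. \<exists>a<n s. w 2 s a - w 3 s a \<noteq> k * (w 0 s a - w 1 s a)"
  proof (rule ccontr)
    assume "\<not> ?thesis"
    then have E: "w 2 s a - w 3 s a = k * (w 0 s a - w 1 s a)" if "s \<in> S" "a < n s" for s a
      using that by blast
    have Eh: "w 2 (h i) a - w 3 (h i) a = k * (w 0 (h i) a - w 1 (h i) a)" if "i < 4" "a < n (h i)" for i a
      using E[OF S[OF that(1)] that(2)] .
    have F2: False if "h 2 = h 3" "\<And>a. a < n (h 2) \<Longrightarrow> v 2 a / U 2 = v 3 a / U 3"
      using nonpar[of 2 3] that by auto
    show False
    proof (cases "h 0 = h 1")
      case h01: True
      show False
      proof (cases "h 2 = h 3")
        case h23: True
        show False
        proof (cases "h 2 = h 0")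
          case True
          then have "\<forall>a<n (h 0). v 2 a / U 2 - v 3 a / U 3 = k * (v 0 a / U 0 - v 1 a / U 1)"
            using Eh[of 0] h01 h23 by (auto simp: w_def)
          then show False using nonplanar True h01 h23 by metis
        next
          case False
          show False by (rule F2[OF h23]) (use Eh[of 2] False h01 h23 in \<open>auto simp: w_def\<close>)
        qed
      next
        case h23: False
        show False
        proof (cases "h 2 = h 0")
          case False
          then show False using F1[of 2] Eh[of 2] h01 h23 by (auto simp: w_def)
        next
          case True
          then show False using F1[of 3] Eh[of 3] h01 h23 by (auto simp: w_def)
        qed
      qed
    next
      case h01: False
      show False
      proof (cases "h 2 = h 3")
        case h23: True
        have "k = 0"
        proof (cases "h 0 = h 2")
          case False
          then show ?thesis using F1[of 0] Eh[of 0] h01 h23 by (auto simp: w_def)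
        next
          case True
          obtain a where a: "a < n (h 1)" "v 1 a / U 1 - c (h 1) a \<noteq> 0" using F1[of 1] by auto
          have "w 2 (h 1) a = 0" "w 3 (h 1) a = 0" "w 0 (h 1) a = 0" using True h01 h23 by (auto simp: w_def)
          moreover have "w 1 (h 1) a = v 1 a / U 1 - c (h 1) a" by (simp add: w_def)
          ultimately show ?thesis using Eh[of 1 a] a by simp
        qed
        then show False by (intro F2[OF h23]) (use Eh[of 2] h23 in \<open>auto simp: w_def\<close>)
      next
        case h23: False
        \<comment> \<open>Either a site of the second pair is missed by the first pair, or both
          pairs use the same two sites in one of two orders.\<close>
        consider "h 2 \<noteq> h 0" "h 2 \<noteq> h 1" | "h 3 \<noteq> h 0" "h 3 \<noteq> h 1" | "h 2 = h 0" "h 3 = h 1" | "h 2 = h 1" "h 3 = h 0"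
          using h23 by metis
        then show False
        proof cases
          case 1
          then show False using F1[of 2] Eh[of 2] h23 by (auto simp: w_def)
        next
          case 2
          then show False using F1[of 3] Eh[of 3] h23 by (auto simp: w_def)
        next
          case 3
          then show False using F3[of 2 0 k] Eh[of 2] h01 h23 by (auto simp: w_def)
        next
          case 4
          obtain a where a: "a < n (h 2)" "v 2 a / U 2 - c (h 2) a \<noteq> - k * (v 1 a / U 1 - c (h 2) a)"
            using F3[of 2 1 "- k"] 4 by auto
          have "w 3 (h 2) a = 0" "w 0 (h 2) a = 0" using 4 h01 by (auto simp: w_def)
          moreover have "w 2 (h 2) a = v 2 a / U 2 - c (h 2) a" "w 1 (h 2) a = v 1 a / U 1 - c (h 2) a"
            using 4 by (auto simp: w_def)
          ultimately show False using Eh[of 2 a] a by (simp add: right_diff_distrib)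
        qed
      qed
    qed
  qed
qed

text \<open>The functional \<open>u\<close> vanishes on \<open>x\<close> but not on
  \<open>z\<close>, and \<open>x\<close> is nonzero. Hence \<open>x\<close> and \<open>z\<close> are
  independent vectors in the span of \<open>v0\<close> and \<open>v1\<close>, and they span it;
  \<open>D\<close> is the determinant of the base change.\<close>

lemma plane_spanned:
  fixes v0 v1 x z u :: "nat \<Rightarrow> complex"
  assumes x: "\<And>a. a < m \<Longrightarrow> x a = q0 * v0 a + q1 * v1 a" and z: "\<And>a. a < m \<Longrightarrow> z a = p0 * v0 a + p1 * v1 a"
    and ux: "(\<Sum>a<m. u a * x a) = 0" and uz: "(\<Sum>a<m. u a * z a) \<noteq> 0" and x0: "\<exists>a<m. x a \<noteq> 0"
  shows "\<exists>s t. \<forall>a<m. v0 a = s * x a + t * z a" and "\<exists>s t. \<forall>a<m. v1 a = s * x a + t * z a"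
proof -
  define D where "D = p0 * q1 - p1 * q0"
  have e0: "q1 * z a - p1 * x a = D * v0 a" and e1: "p0 * x a - q0 * z a = D * v1 a" if "a < m" for a
    using x[OF that] z[OF that] by (simp_all add: D_def algebra_simps)
  have ulin: "(\<Sum>a<m. u a * (s * z a - t * x a)) = s * (\<Sum>a<m. u a * z a)" for s t
  proof -
    have "(\<Sum>a<m. u a * (s * z a - t * x a)) = s * (\<Sum>a<m. u a * z a) - t * (\<Sum>a<m. u a * x a)"
      by (simp add: right_diff_distrib sum_subtractf sum_distrib_left mult_ac)
    then show ?thesis using ux by simp
  qed
  have D: "D \<noteq> 0"
  proof
    assume D: "D = 0"
    have "(\<Sum>a<m. u a * (q1 * z a - p1 * x a)) = 0" using e0 D by (intro sum.neutral) auto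
    then have q1: "q1 = 0" using ulin uz by simp
    have "(\<Sum>a<m. u a * (q0 * z a - p0 * x a)) = 0" using e1 D by (intro sum.neutral) auto
    then have "q0 = 0" using ulin uz by simp
    then show False using x x0 q1 by auto
  qed
  show "\<exists>s t. \<forall>a<m. v0 a = s * x a + t * z a"
  proof -
    have "v0 a = - p1 / D * x a + q1 / D * z a" if "a < m" for a
    proof -
      have "v0 a = (q1 * z a - p1 * x a) / D" using e0[OF that] D by simp
      then show ?thesis by (simp add: diff_divide_distrib)
    qed
    then show ?thesis by blast
  qed
  show "\<exists>s t. \<forall>a<m. v1 a = s * x a + t * z a"
  proof -
    have "v1 a = p0 / D * x a + - q0 / D * z a" if "a < m" for a
    proof -
      have "v1 a = (p0 * x a - q0 * z a) / D" using e1[OF that] D by simp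
      then show ?thesis by (simp add: diff_divide_distrib)
    qed
    then show ?thesis by blast
  qed
qed

lemma inj_of_nat_complex: "inj_on (\<lambda>a::nat. of_nat a :: complex) A"
  by (simp add: inj_on_def)

definition certified :: "nat \<Rightarrow> nat \<Rightarrow> (nat \<Rightarrow> nat) \<Rightarrow> nat \<Rightarrow> (nat \<Rightarrow> nat) \<Rightarrow> (nat \<Rightarrow> complex Matrix.vec) \<Rightarrow> bool" where
  "certified d r n j h v \<longleftrightarrow> (\<exists>Q \<alpha> \<tau>. (\<forall>s a. Q s a \<in> carrier_mat r r) \<and> \<alpha> 0 \<noteq> 0 \<and> \<alpha> 1 \<noteq> 0 \<and>
     spectral_cert r \<alpha> \<tau> (env_matrix d r n Q j (h 0) (v 0)) (env_matrix d r n Q j (h 1) (v 1))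
       (env_matrix d r n Q j (h 2) (v 2)) (env_matrix d r n Q j (h 3) (v 3)) \<noteq> 0)"

text \<open>Functionals dual to the differences \<open>w 0 - w 1\<close> and
  \<open>w 2 - w 3\<close> serve as coefficients of a diagonal matrix and of the cyclic shift. The
  perturbations so obtained make the first order differences of the two pairs exactly these
  matrices.\<close>

lemma certified_of_independent:
  fixes u :: "nat \<Rightarrow> nat \<Rightarrow> complex" and v :: "nat \<Rightarrow> complex Matrix.vec"
  assumes j: "j < d" and d: "2 \<le> d" and r: "0 < r" and h: "\<And>i. i < 4 \<Longrightarrow> h i \<in> set (rest d j)"
    and N: "\<And>s. s \<in> set (rest d j) \<Longrightarrow> (\<Sum>a<n s. u s a * cnj (u s a)) \<noteq> 0"
    and U: "\<And>i. i < 4 \<Longrightarrow> (\<Sum>b<n (h i). v i $ b * u (h i) b) \<noteq> 0"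
  defines "w \<equiv> \<lambda>i s a. if s = h i then v i $ a / (\<Sum>b<n (h i). v i $ b * u (h i) b)
      - cnj (u s a) / (\<Sum>a<n s. u s a * cnj (u s a)) else 0"
  assumes "\<exists>s\<in>set (rest d j). \<exists>a<n s. w 0 s a - w 1 s a \<noteq> 0"
    and "\<And>k. \<exists>s\<in>set (rest d j). \<exists>a<n s. w 2 s a - w 3 s a \<noteq> k * (w 0 s a - w 1 s a)"
  shows "certified d r n j h v"
proof -
  define S where "S = set (rest d j)"
  define J where "J = Sigma S (\<lambda>s. {..<n s})"
  have fin: "finite S" "finite J" by (auto simp: S_def J_def)
  define \<alpha> \<beta> where "\<alpha> = (\<lambda>(s, a). w 0 s a - w 1 s a)" and "\<beta> = (\<lambda>(s, a). w 2 s a - w 3 s a)"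
  have "\<exists>x\<in>J. \<alpha> x \<noteq> 0" using assms(8) by (force simp: J_def S_def \<alpha>_def)
  moreover have "\<exists>x\<in>J. \<beta> x \<noteq> k * \<alpha> x" for k using assms(9)[of k] by (force simp: J_def S_def \<alpha>_def \<beta>_def)
  ultimately obtain f g where fg: "(\<Sum>x\<in>J. f x * \<alpha> x) = 1" "(\<Sum>x\<in>J. f x * \<beta> x) = 0"
    "(\<Sum>x\<in>J. g x * \<alpha> x) = 0" "(\<Sum>x\<in>J. g x * \<beta> x) = 1"
    using dual_functionals[OF fin(2), of \<alpha> \<beta>] by blast
  define Ns where "Ns s = (\<Sum>a<n s. u s a * cnj (u s a))" for s
  define Uv where "Uv i = (\<Sum>b<n (h i). v i $ b * u (h i) b)" for i
  \<comment> \<open>Orthogonality to \<open>u s\<close> isolates the contracted site at first order.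
    The removed component reappears, by duality, as the conjugated correction in
    \<open>w\<close>.\<close>
  define proj where "proj f s a = f (s, a) - (\<Sum>b<n s. f (s, b) * cnj (u s b)) / Ns s * u s a" for f :: "nat \<times> nat \<Rightarrow> complex" and s a
  have proj0: "(\<Sum>a<n s. proj f s a * cnj (u s a)) = 0" if "s \<in> S" for f s
  proof -
    have "(\<Sum>a<n s. proj f s a * cnj (u s a)) = (\<Sum>a<n s. f (s, a) * cnj (u s a))
        - (\<Sum>b<n s. f (s, b) * cnj (u s b)) / Ns s * Ns s"
      by (simp add: proj_def left_diff_distrib sum_subtractf sum_distrib_left Ns_def mult.assoc)
    then show ?thesis using N that by (simp add: Ns_def S_def)
  qed
  have pair: "(\<Sum>b<n (h i). v i $ b * proj f (h i) b) / Uv i = (\<Sum>x\<in>J. f x * (case x of (s, a) \<Rightarrow> w i s a))" if i: "i < 4" for f i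
  proof -
    have "(\<Sum>x\<in>J. f x * (case x of (s, a) \<Rightarrow> w i s a)) = (\<Sum>s\<in>S. \<Sum>a<n s. f (s, a) * w i s a)"
      unfolding J_def using fin by (subst sum.Sigma) (auto intro: sum.cong)
    also have "\<dots> = (\<Sum>s\<in>S. if s = h i then (\<Sum>a<n (h i). f (h i, a) * (v i $ a / Uv i - cnj (u (h i) a) / Ns (h i))) else 0)"
      by (intro sum.cong refl) (auto simp: w_def Uv_def Ns_def)
    also have "\<dots> = (\<Sum>a<n (h i). f (h i, a) * (v i $ a / Uv i - cnj (u (h i) a) / Ns (h i)))"
      using h[OF i] fin by (simp add: S_def)
    also have "\<dots> = (\<Sum>a<n (h i). v i $ a * f (h i, a)) / Uv i - (\<Sum>a<n (h i). f (h i, a) * cnj (u (h i) a)) / Ns (h i)"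
      by (simp add: right_diff_distrib sum_subtractf sum_divide_distrib mult_ac)
    also have "\<dots> = (\<Sum>b<n (h i). v i $ b * proj f (h i) b) / Uv i"
    proof -
      define \<phi> where "\<phi> = (\<Sum>b<n (h i). f (h i, b) * cnj (u (h i) b)) / Ns (h i)"
      have pf: "proj f (h i) b = f (h i, b) - \<phi> * u (h i) b" for b by (simp add: proj_def \<phi>_def)
      have "(\<Sum>b<n (h i). v i $ b * proj f (h i) b) = (\<Sum>a<n (h i). v i $ a * f (h i, a))
          - \<phi> * Uv i"
        unfolding pf by (simp add: right_diff_distrib sum_subtractf sum_distrib_left Uv_def mult_ac)
      then have "(\<Sum>b<n (h i). v i $ b * proj f (h i) b) = (\<Sum>a<n (h i). v i $ a * f (h i, a))
          - (\<Sum>b<n (h i). f (h i, b) * cnj (u (h i) b)) / Ns (h i) * Uv i" by (simp add: \<phi>_def)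
      then show ?thesis using U[OF i] by (simp add: Uv_def diff_divide_distrib)
    qed
    finally show ?thesis by simp
  qed
  define Z where "Z = dmat r of_nat"
  define X where "X = cyclic_shift r"
  have ZX: "Z \<in> carrier_mat r r" "X \<in> carrier_mat r r" by (simp_all add: Z_def X_def)
  define P where "P s a = proj f s a \<cdot>\<^sub>m Z + proj g s a \<cdot>\<^sub>m X" for s a
  have P: "P s a \<in> carrier_mat r r" for s a using ZX by (simp add: P_def)
  have Pxy: "P s a $$ (x, y) = proj f s a * Z $$ (x, y) + proj g s a * X $$ (x, y)" if "x < r" "y < r" for s a x y
    using that ZX by (simp add: P_def)
  define F where "F i = Matrix.mat r r (\<lambda>(x, y). (\<Sum>b<n (h i). v i $ b * P (h i) b $$ (x, y)) / Uv i)" for i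
  define co where "co f i = (\<Sum>x\<in>J. f x * (case x of (s, a) \<Rightarrow> w i s a))" for f :: "nat \<times> nat \<Rightarrow> complex" and i
  have Fxy: "F i $$ (x, y) = co f i * Z $$ (x, y) + co g i * X $$ (x, y)" if "i < 4" "x < r" "y < r" for i x y
  proof -
    have "(\<Sum>b<n (h i). v i $ b * P (h i) b $$ (x, y)) = (\<Sum>b<n (h i). v i $ b * proj f (h i) b) * Z $$ (x, y)
        + (\<Sum>b<n (h i). v i $ b * proj g (h i) b) * X $$ (x, y)"
      using that by (simp add: Pxy distrib_left sum.distrib sum_distrib_right mult.assoc)
    then show ?thesis
      using that by (simp add: F_def co_def pair[OF that(1), symmetric] add_divide_distrib)
  qed
  have co: "co f 0 - co f 1 = 1" "co f 2 - co f 3 = 0" "co g 0 - co g 1 = 0" "co g 2 - co g 3 = 1"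
    using fg by (auto simp: co_def \<alpha>_def \<beta>_def case_prod_unfold right_diff_distrib sum_subtractf)
  have F01: "F 0 - F 1 = Z"
  proof (rule square_eq_matI[of _ r r])
    fix x y assume xy: "x < r" "y < r"
    have "F 0 $$ (x, y) - F 1 $$ (x, y) = (co f 0 - co f 1) * Z $$ (x, y) + (co g 0 - co g 1) * X $$ (x, y)"
      using xy by (simp add: Fxy algebra_simps)
    then show "(F 0 - F 1) $$ (x, y) = Z $$ (x, y)" using co xy by (simp add: F_def)
  qed (use ZX in \<open>auto simp: F_def\<close>)
  have F23: "F 2 - F 3 = X"
  proof (rule square_eq_matI[of _ r r])
    fix x y assume xy: "x < r" "y < r"
    have "F 2 $$ (x, y) - F 3 $$ (x, y) = (co f 2 - co f 3) * Z $$ (x, y) + (co g 2 - co g 3) * X $$ (x, y)"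
      using xy by (simp add: Fxy algebra_simps)
    then show "(F 2 - F 3) $$ (x, y) = X $$ (x, y)" using co xy by (simp add: F_def)
  qed (use ZX in \<open>auto simp: F_def\<close>)
  have zero: "(\<Sum>a<n s. P s a $$ (x, y) * cnj (u s a)) = 0" if "s \<in> set (rest d j)" "x < r" "y < r" for s x y
  proof -
    have "(\<Sum>a<n s. P s a $$ (x, y) * cnj (u s a)) = (\<Sum>a<n s. proj f s a * cnj (u s a)) * Z $$ (x, y)
        + (\<Sum>a<n s. proj g s a * cnj (u s a)) * X $$ (x, y)"
    proof -
      have "P s a $$ (x, y) * cnj (u s a) = proj f s a * cnj (u s a) * Z $$ (x, y) + proj g s a * cnj (u s a) * X $$ (x, y)" for a
        using that by (simp add: Pxy distrib_right distrib_left mult_ac)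
      then show ?thesis by (simp add: sum.distrib sum_distrib_right)
    qed
    then show ?thesis using proj0 that by (simp add: S_def)
  qed
  let ?Q = "perturbed_scalars r {j, Suc j mod d} u P"
  have "\<forall>i. \<exists>c y. i < 4 \<longrightarrow> scalar_germ r (\<lambda>\<epsilon>. env_matrix d r n (?Q \<epsilon>) j (h i) (v i)) c (F i) y"
    using perturbed_scalars_scalar_germ[where u = u and P = P and d = d and n = n and j = j and r = r, OF j d r P h N zero U]
    unfolding F_def Uv_def by blast
  then obtain c y where "\<And>i. i < 4 \<Longrightarrow> scalar_germ r (\<lambda>\<epsilon>. env_matrix d r n (?Q \<epsilon>) j (h i) (v i)) (c i) (F i) (y i)"
    by metis
  moreover have "pair_cert r (1 \<cdot>\<^sub>m (F 0 - F 1)) (1 \<cdot>\<^sub>m (F 2 - F 3)) \<noteq> 0"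
    unfolding F01 F23 one_smult_mat Z_def X_def
    by (rule pair_cert_dmat_cyclic_shift[OF r inj_of_nat_complex])
  ultimately obtain \<epsilon> \<alpha> \<tau> where "0 < \<epsilon>" "\<alpha> 0 \<noteq> 0" "\<alpha> 1 \<noteq> 0"
    "spectral_cert r \<alpha> \<tau> (env_matrix d r n (?Q \<epsilon>) j (h 0) (v 0)) (env_matrix d r n (?Q \<epsilon>) j (h 1) (v 1))
       (env_matrix d r n (?Q \<epsilon>) j (h 2) (v 2)) (env_matrix d r n (?Q \<epsilon>) j (h 3) (v 3)) \<noteq> 0"
    using spectral_cert_of_germs[of r "\<lambda>i \<epsilon>. env_matrix d r n (?Q \<epsilon>) j (h i) (v i)" c F y 1 1, OF _ one_neq_zero one_neq_zero] by blast
  moreover have "?Q \<epsilon> s a \<in> carrier_mat r r" for s a using P by (simp add: perturbed_scalars_def)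
  ultimately show ?thesis unfolding certified_def by blast
qed

text \<open>For coplanar vectors a complex linear first order term would give proportional
  differences. In the dephased chain the term is \<tau> times \<open>N\<close> plus the conjugate of
  its diagonal: coefficients that differ by the factor \<open>\<i>\<close> let an imaginary diagonal
  cancel in one difference and double in the other.\<close>

lemma certified_of_equal_sites:
  fixes v :: "nat \<Rightarrow> complex Matrix.vec"
  assumes j: "j < d" and d: "4 \<le> d" and r: "2 \<le> r" and h: "h \<in> set (rest d j)" and n: "\<And>s. s < d \<Longrightarrow> r \<le> n s"
    and v0: "\<And>i. i < 4 \<Longrightarrow> \<exists>a<n h. v i $ a \<noteq> 0"
    and nonpar: "\<And>i i' c. i < 4 \<Longrightarrow> i' < 4 \<Longrightarrow> i \<noteq> i' \<Longrightarrow> \<exists>a<n h. v i $ a \<noteq> c * v i' $ a"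
  shows "certified d r n j (\<lambda>_. h) v"
proof -
  have d2: "2 \<le> d" and r0: "0 < r" using d r by auto
  define m where "m = n h"
  have "\<exists>t\<in>set (rest d j). t \<noteq> h"
  proof (rule ccontr)
    assume "\<not> ?thesis"
    then have "set (rest d j) \<subseteq> {h}" by auto
    then have "card (set (rest d j)) \<le> 1" using card_mono[of "{h}"] by simp
    moreover have "card (set (rest d j)) = d - 2"
      using distinct_card[OF rest_props(1)[OF j d2]] by (simp add: rest_def)
    ultimately show False using d by simp
  qed
  then obtain t where t: "t \<in> set (rest d j)" "h \<noteq> t" by blast
  obtain u where u: "\<And>x. x \<in> (\<lambda>i a. v i $ a) ` {..<4} \<Longrightarrow> (\<Sum>a<m. u a * x a) \<noteq> 0"
    using generic_functional[of "(\<lambda>i a. v i $ a) ` {..<4}" m] v0 unfolding m_def by auto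
  define U where "U i = (\<Sum>a<m. v i $ a * u a)" for i
  have U: "U i \<noteq> 0" if "i < 4" for i
    using u[of "\<lambda>a. v i $ a"] that by (auto simp: U_def mult.commute)
  \<comment> \<open>A functional that is nonzero on these combinations has pairwise different ratios
    \<open>G i / U i\<close>.\<close>
  define D where "D p a = U (snd p) * v (fst p) $ a - U (fst p) * v (snd p) $ a" for p :: "nat \<times> nat" and a
  have D: "\<exists>a<m. D (i, i') a \<noteq> 0" if i: "i < 4" "i' < 4" "i \<noteq> i'" for i i'
  proof -
    obtain a where a: "a < m" "v i $ a \<noteq> U i / U i' * v i' $ a" using nonpar[OF i] unfolding m_def by blast
    then have "D (i, i') a \<noteq> 0" using U[OF i(2)] by (auto simp: D_def field_simps)
    then show ?thesis using a by blast
  qed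
  obtain f0 where f0: "\<And>x. x \<in> D ` {(i, i'). i < 4 \<and> i' < 4 \<and> i \<noteq> i'} \<Longrightarrow> (\<Sum>a<m. f0 a * x a) \<noteq> 0"
  proof (rule generic_functional[of "D ` {(i, i'). i < 4 \<and> i' < 4 \<and> i \<noteq> i'}" m])
    have "finite ({..<4::nat} \<times> {..<4::nat})" by simp
    then show "finite (D ` {(i, i'). i < 4 \<and> i' < 4 \<and> i \<noteq> i'})"
      by (rule finite_imageI[OF finite_subset[rotated]]) auto
  qed (use D in auto)
  define G where "G i = (\<Sum>a<m. v i $ a * f0 a)" for i
  define t' where "t' i = G i / U i - G 0 / U 0" for i
  have "U i' * G i - U i * G i' \<noteq> 0" if "i < 4" "i' < 4" "i \<noteq> i'" for i i'
  proof -
    have "(\<Sum>a<m. f0 a * D (i, i') a) = U i' * G i - U i * G i'"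
      by (simp add: D_def G_def right_diff_distrib sum_subtractf sum_distrib_left mult_ac)
    then show ?thesis using f0[of "D (i, i')"] that by auto
  qed
  then have ne: "t' i \<noteq> t' i'" if "i < 4" "i' < 4" "i \<noteq> i'" for i i'
    using that U[OF that(1)] U[OF that(2)] by (auto simp: t'_def field_simps)
  have t0: "t' 0 = 0" by (simp add: t'_def)
  obtain z where z: "1 + z * t' 1 \<noteq> 0" "1 + z * t' 2 \<noteq> 0" "1 + z * t' 3 \<noteq> 0"
    "- (t' 1 / (1 + z * t' 1)) = \<i> * (t' 2 / (1 + z * t' 2) - t' 3 / (1 + z * t' 3))"
    using moebius_ratio[of "t' 1" "t' 2" "t' 3"] ne[of 1 0] ne[of 2 0] ne[of 3 0] ne[of 1 2] ne[of 1 3] ne[of 2 3] t0 by auto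
  have zi: "1 + z * t' i \<noteq> 0" if i: "i < 4" for i
  proof -
    consider "i = 0" | "i = 1" | "i = 2" | "i = 3" using i by linarith
    then show ?thesis by cases (use z t0 in auto)
  qed
  define c0 where "c0 = G 0 / U 0"
  \<comment> \<open>Shifting by \<open>u\<close> normalizes the ratio at slice 0 to 0; adding
    \<open>z\<close> times \<open>f\<close> to \<open>u\<close> next turns each ratio
    \<open>t' i\<close> into \<open>t' i / (1 + z * t' i)\<close>.\<close>
  define f where "f a = f0 a - c0 * u a" for a
  define u' where "u' a = u a + z * f a" for a
  have fv: "(\<Sum>a<m. v i $ a * f a) = t' i * U i" if "i < 4" for i
  proof -
    have "(\<Sum>a<m. v i $ a * f a) = G i - c0 * U i"
      by (simp add: f_def G_def U_def right_diff_distrib sum_subtractf sum_distrib_left mult_ac)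
    then show ?thesis using U[OF that] by (simp add: t'_def c0_def left_diff_distrib)
  qed
  have uv: "(\<Sum>a<m. v i $ a * u' a) = U i * (1 + z * t' i)" if "i < 4" for i
  proof -
    have "(\<Sum>a<m. v i $ a * u' a) = U i + z * (\<Sum>a<m. v i $ a * f a)"
      by (simp add: u'_def U_def distrib_left sum.distrib sum_distrib_left mult_ac)
    then show ?thesis using fv[OF that] by (simp add: distrib_left mult_ac)
  qed
  define \<tau> where "\<tau> i = t' i / (1 + z * t' i)" for i
  have tau: "(\<Sum>a<m. v i $ a * f a) / (\<Sum>a<m. v i $ a * u' a) = \<tau> i" if "i < 4" for i
    unfolding fv[OF that] uv[OF that] \<tau>_def using U[OF that] by simp
  define \<delta> where "\<delta> = \<tau> 2 - \<tau> 3"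
  have d01: "\<tau> 0 - \<tau> 1 = \<i> * \<delta>" using z(4) t0 by (simp add: \<tau>_def \<delta>_def)
  have d0: "\<delta> \<noteq> 0"
  proof
    assume "\<delta> = 0"
    then have "t' 2 / (1 + z * t' 2) = t' 3 / (1 + z * t' 3)" by (simp add: \<delta>_def \<tau>_def)
    then have "t' 2 * (1 + z * t' 3) = t' 3 * (1 + z * t' 2)" using z(2,3) by (simp add: frac_eq_eq)
    then have "t' 2 = t' 3" by (simp add: algebra_simps)
    then show False using ne[of 2 3] by simp
  qed
  \<comment> \<open>\<open>A \<eta>\<close> will be \<open>\<eta>\<close> times the first
    difference. The diagonal entries acquire -2 from the square of \<open>\<i>\<close> and from
    adding the conjugate; the shift stays with small weight \<open>\<eta>\<close>, which continuity
    at 0 tolerates.\<close>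
  define zd :: "nat \<Rightarrow> complex" where "zd a = - 2 * of_nat a" for a
  define A where "A \<eta> = Matrix.mat r r (\<lambda>(x, y). zd x * (if x = y then 1 else 0) + of_real \<eta> * (\<i> * cyclic_shift r $$ (x, y)))" for \<eta>
  have "cont.mat_in r r A"
  proof (rule cont.mat_inI)
    fix x y assume "x < r" "y < r"
    then show "isCont (\<lambda>\<eta>. A \<eta> $$ (x, y)) 0" by (simp add: A_def)
  qed (simp add: A_def)
  then have cont: "isCont (\<lambda>\<eta>. pair_cert r (A \<eta>) (cyclic_shift r)) 0"
    by (intro cont.pair_cert_in cont.mat_in_const) auto
  have A0: "A 0 = dmat r zd" by (rule square_eq_matI[of _ r r]) (auto simp: A_def dmat_index)
  have "inj_on zd {..<r}" by (auto simp: inj_on_def zd_def)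
  then have "pair_cert r (A 0) (cyclic_shift r) \<noteq> 0"
    unfolding A0 by (rule pair_cert_dmat_cyclic_shift[OF r0])
  then obtain \<eta> where eta: "0 < \<eta>" "pair_cert r (A \<eta>) (cyclic_shift r) \<noteq> 0"
    using isCont_nonzero_ex[OF cont] by blast
  \<comment> \<open>After multiplication by \<open>\<delta>\<close> the diagonal is imaginary and
    the rest is the shift. The diagonal disappears from \<open>F 2 - F 3\<close> and, after the
    extra factor \<open>\<i>\<close>, is real in \<open>F 0 - F 1\<close>.\<close>
  define N where "N = Matrix.mat r r (\<lambda>(x, y). (cyclic_shift r $$ (x, y) + (if x = y then \<i> * of_nat x / of_real \<eta> else 0)) / \<delta>)"
  have N: "N \<in> carrier_mat r r" by (simp add: N_def)
  have Nxy: "\<delta> * N $$ (x, y) = cyclic_shift r $$ (x, y) + (if x = y then \<i> * of_nat x / of_real \<eta> else 0)" if "x < r" "y < r" for x y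
    using that d0 by (simp add: N_def)
  have S0: "cyclic_shift r $$ (x, x) = 0" if "x < r" for x
  proof -
    have "Suc x mod r \<noteq> x" using that r by (cases "Suc x = r") auto
    then show ?thesis using that by (simp add: cyclic_shift_def)
  qed
  define F where "F i = Matrix.mat r r (\<lambda>(x, y). \<tau> i * N $$ (x, y) + (if x = y then cnj (\<tau> i * N $$ (x, x)) else 0))" for i
  let ?Q = "dephased_chain r h t u' f N"
  have "\<exists>c. scalar_germ r (\<lambda>\<epsilon>. env_matrix d r n (?Q \<epsilon>) j h (v i)) c (F i) 0" if i: "i < 4" for i
  proof -
    have "(\<Sum>b<n h. v i $ b * u' b) \<noteq> 0" using uv[OF i] U[OF i] zi[OF i] by (simp add: m_def)
    then show ?thesis
      unfolding F_def tau[OF i, symmetric] unfolding m_def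
      using j d2 N h t n r0 by (intro dephased_chain_scalar_germ) auto
  qed
  then obtain c where c: "\<And>i. i < 4 \<Longrightarrow> scalar_germ r (\<lambda>\<epsilon>. env_matrix d r n (?Q \<epsilon>) j h (v i)) (c i) (F i) 0" by metis
  have F23: "1 \<cdot>\<^sub>m (F 2 - F 3) = cyclic_shift r"
  proof (rule square_eq_matI[of _ r r])
    fix x y assume xy: "x < r" "y < r"
    have "F 2 $$ (x, y) - F 3 $$ (x, y) = \<delta> * N $$ (x, y) + (if x = y then cnj (\<delta> * N $$ (x, x)) else 0)"
      using xy by (simp add: F_def \<delta>_def algebra_simps)
    also have "\<dots> = cyclic_shift r $$ (x, y)"
      unfolding Nxy[OF xy] Nxy[OF xy(1,1)] using S0[OF xy(1)] by auto
    finally show "(1 \<cdot>\<^sub>m (F 2 - F 3)) $$ (x, y) = cyclic_shift r $$ (x, y)" using xy by (simp add: F_def)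
  qed (auto simp: F_def)
  have F01: "of_real \<eta> \<cdot>\<^sub>m (F 0 - F 1) = A \<eta>"
  proof (rule square_eq_matI[of _ r r])
    fix x y assume xy: "x < r" "y < r"
    have "F 0 $$ (x, y) - F 1 $$ (x, y) = (\<tau> 0 - \<tau> 1) * N $$ (x, y) + (if x = y then cnj ((\<tau> 0 - \<tau> 1) * N $$ (x, x)) else 0)"
      using xy by (simp add: F_def algebra_simps)
    also have "\<dots> = \<i> * (\<delta> * N $$ (x, y)) + (if x = y then cnj (\<i> * (\<delta> * N $$ (x, x))) else 0)"
      unfolding d01 by (simp add: mult.assoc)
    also have "of_real \<eta> * \<dots> = A \<eta> $$ (x, y)"
      unfolding Nxy[OF xy] Nxy[OF xy(1,1)] using S0[OF xy(1)] xy eta(1) by (auto simp: A_def zd_def field_simps)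
    finally have "of_real \<eta> * (F 0 $$ (x, y) - F 1 $$ (x, y)) = A \<eta> $$ (x, y)" .
    then show "(of_real \<eta> \<cdot>\<^sub>m (F 0 - F 1)) $$ (x, y) = A \<eta> $$ (x, y)" using xy by (simp add: F_def)
  qed (auto simp: F_def A_def)
  have "pair_cert r (of_real \<eta> \<cdot>\<^sub>m (F 0 - F 1)) (1 \<cdot>\<^sub>m (F 2 - F 3)) \<noteq> 0" unfolding F01 F23 by (rule eta(2))
  then obtain \<epsilon> \<alpha> \<tau>' where "0 < \<epsilon>" "\<alpha> 0 \<noteq> 0" "\<alpha> 1 \<noteq> 0"
    "spectral_cert r \<alpha> \<tau>' (env_matrix d r n (?Q \<epsilon>) j h (v 0)) (env_matrix d r n (?Q \<epsilon>) j h (v 1))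
       (env_matrix d r n (?Q \<epsilon>) j h (v 2)) (env_matrix d r n (?Q \<epsilon>) j h (v 3)) \<noteq> 0"
    using spectral_cert_of_germs[of r "\<lambda>i \<epsilon>. env_matrix d r n (?Q \<epsilon>) j h (v i)" c F "\<lambda>_. 0" "of_real \<eta>" 1, OF c _ one_neq_zero] eta(1)
    by (metis less_irrefl of_real_eq_0_iff)
  moreover have "?Q \<epsilon> s a \<in> carrier_mat r r" for s a using N by (simp add: dephased_chain_def)
  ultimately show ?thesis unfolding certified_def by blast
qed

text \<open>Slices at one common site with d \<ge> 4 use the dephased chain. Otherwise base vectors
  \<open>u\<close> in general position are needed, and the finitely many vectors to be avoided must
  be fixed before \<open>u\<close> is chosen.\<close>

lemma certified_of_different_choices:
  assumes d: "3 \<le> d" and r: "2 \<le> r" and n: "\<forall>k<d. r\<^sup>2 \<le> n k" and diff: "different_choices d n h v" and j: "j < d"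
  shows "certified d r n j (h j) (v j)"
proof -
  define H where "H = h j"
  define V where "V i a = v j i $ a" for i a
  have d2: "2 \<le> d" and r0: "0 < r" using d r by auto
  note choices = mp[OF spec[OF diff[unfolded different_choices_def]] j]
  note valid = choices[THEN conjunct1, rule_format]
  have HH: "H i \<in> set (rest d j)" if "i < 4" for i
    using valid[OF that] unfolding H_def rest_props(2)[OF j d2] by (rule conjunct1)
  have Hd: "H i < d" if "i < 4" for i using HH[OF that] rest_props(2)[OF j d2] by auto
  have Vc: "v j i \<in> carrier_vec (n (H i))" if "i < 4" for i
    using valid[OF that] unfolding H_def by simp
  have V0: "\<exists>a<n (H i). V i a \<noteq> 0" if "i < 4" for i
  proof (rule ccontr)
    assume "\<not> ?thesis"
    then have "(\<Sum>a<n (H i). (cmod (v j i $ a))\<^sup>2) = 0" by (simp add: V_def)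
    moreover have "(\<Sum>a<n (H i). (cmod (v j i $ a))\<^sup>2) = 1"
      using valid[OF \<open>i < 4\<close>] unfolding H_def by simp
    ultimately show False by simp
  qed
  have nonpar: "\<exists>a<n (H i). V i a \<noteq> c * V i' a" if i: "i < 4" "i' < 4" "i \<noteq> i'" "H i = H i'" for i i' c
  proof (rule ccontr)
    assume "\<not> ?thesis"
    then have "v j i = c \<cdot>\<^sub>v v j i'"
      using Vc[OF i(1)] Vc[OF i(2)] i(4) by (intro eq_vecI) (auto simp: V_def)
    moreover have "v j i \<noteq> c \<cdot>\<^sub>v v j i'"
      using choices[THEN conjunct2, THEN conjunct1, rule_format, OF i(1,2)] i(3,4) unfolding H_def by simp
    ultimately show False by simp
  qed
  have rn: "r \<le> n s" and n4: "4 \<le> n s" if "s < d" for s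
  proof -
    have "r * r \<le> n s" using n that by (simp add: power2_eq_square)
    moreover have "r * 1 \<le> r * r" "2 * 2 \<le> r * r" using r by (intro mult_le_mono; simp)+
    ultimately show "r \<le> n s" "4 \<le> n s" by linarith+
  qed
  show ?thesis
  proof (cases "4 \<le> d \<and> (\<forall>i<4. H i = H 0)")
    case True
    then have d4: "4 \<le> d" and "\<forall>i<4. H i = H 0" by (rule conjunct1, rule conjunct2)
    then have H4: "H i = H 0" if "i < 4" for i using that by blast
    have "certified d r n j (\<lambda>_. H 0) (v j)"
    proof (rule certified_of_equal_sites[OF j d4 r HH rn])
      show "\<exists>a<n (H 0). v j i $ a \<noteq> 0" if "i < 4" for i using V0[OF that] H4[OF that] by (simp add: V_def)
      show "\<exists>a<n (H 0). v j i $ a \<noteq> c * v j i' $ a" if "i < 4" "i' < 4" "i \<noteq> i'" for i i' c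
        using nonpar[OF that] H4[OF that(1)] H4[OF that(2)] by (simp add: V_def)
    qed simp_all
    then show ?thesis
      using H4[of 1] H4[of 2] H4[of 3] unfolding certified_def H_def by simp
  next
    case False
    define orth where "orth i i' x \<longleftrightarrow> (\<exists>a<n (H i). x a \<noteq> 0) \<and> (\<Sum>a<n (H i). x a * V i a) = 0 \<and>
      (\<Sum>a<n (H i). x a * V i' a) = 0" for i i' x
    define q where "q i i' = (SOME x. orth i i' x)" for i i'
    have orth: "orth i i' (q i i')" if i: "i < 4" for i i'
    proof -
      have m: "3 \<le> n (H i)" using n4[OF Hd[OF i]] by linarith
      have "\<exists>x. orth i i' x"
        by (rule orthogonal_functional[OF m, of "V i" "V i'"], rule exI, unfold orth_def, intro conjI)
      then show ?thesis unfolding q_def by (rule someI_ex)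
    qed
    note q = orth[unfolded orth_def, THEN conjunct1] orth[unfolded orth_def, THEN conjunct2, THEN conjunct1]
      orth[unfolded orth_def, THEN conjunct2, THEN conjunct2]
    \<comment> \<open>Nonzero vectors in both the span of the first two and the span of the last two
      slice vectors. The notion does not involve \<open>u\<close>, so \<open>u\<close> can be chosen
      nonzero on one of them.\<close>
    define common where "common s z \<longleftrightarrow> (\<exists>a<n s. z a \<noteq> 0) \<and>
      (\<exists>p0 p1 p2 p3. \<forall>a<n s. z a = p0 * V 0 a + p1 * V 1 a \<and> z a = p2 * V 2 a + p3 * V 3 a)" for s z
    define Z where "Z s = (if \<exists>z. common s z then {SOME z. common s z} else {})" for s
    have Z: "common s z" if "z \<in> Z s" for s z
      using that someI_ex[of "common s"] by (auto simp: Z_def split: if_splits)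
    have Zne: "\<exists>z\<in>Z s. common s z" if "common s x" for s x
      using that someI[of "common s" x] by (auto simp: Z_def)
    define e0 where "e0 = (\<lambda>a::nat. if a = 0 then 1 else 0 :: complex)"
    \<comment> \<open>Being nonzero on these vectors gives, in turn: nonzero overlaps
      \<open>Uv\<close>, a nonzero \<open>u s\<close> and hence \<open>Ns\<close>, a correction term
      not annihilated by \<open>q\<close>, and the vector \<open>z\<close> needed for
      nonplanarity.\<close>
    define B where "B s = V ` {i. i < 4 \<and> H i = s} \<union> {e0} \<union>
      (\<lambda>p a. cnj (q (fst p) (snd p) a)) ` ({i. i < 4 \<and> H i = s} \<times> {..<4}) \<union> Z s" for s
    have fin: "finite (B s)" for s by (simp add: B_def Z_def)
    have nz: "\<exists>a<n s. x a \<noteq> 0" if s: "s < d" and x: "x \<in> B s" for s x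
    proof -
      consider i where "x = V i" "i < 4" "H i = s" | "x = e0" | i i' where "x = (\<lambda>a. cnj (q i i' a))" "i < 4" "H i = s" | "x \<in> Z s"
        using x by (auto simp: B_def)
      then show ?thesis
      proof cases
        case 1
        then show ?thesis using V0 by blast
      next
        case 2
        then show ?thesis using n4[OF s] by (intro exI[of _ 0]) (auto simp: e0_def)
      next
        case 3
        then show ?thesis using q(1)[of i i'] by auto
      next
        case 4
        then show ?thesis using Z by (auto simp: common_def)
      qed
    qed
    define u where "u s = (SOME u. \<forall>x\<in>B s. (\<Sum>a<n s. u a * x a) \<noteq> 0)" for s
    have u: "(\<Sum>a<n s. u s a * x a) \<noteq> 0" if s: "s < d" "x \<in> B s" for s x
    proof -
      have "\<exists>u. \<forall>x\<in>B s. (\<Sum>a<n s. u a * x a) \<noteq> 0"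
        by (rule generic_functional[OF fin nz[OF s(1)]], assumption, intro exI ballI)
      from someI_ex[OF this] s(2) show ?thesis unfolding u_def by (rule bspec)
    qed
    define Ns where "Ns s = (\<Sum>a<n s. u s a * cnj (u s a))" for s
    define Uv where "Uv i = (\<Sum>b<n (H i). v j i $ b * u (H i) b)" for i
    have N: "Ns s \<noteq> 0" if s: "s < d" for s
    proof
      assume "Ns s = 0"
      moreover have "Ns s = of_real (\<Sum>a<n s. (cmod (u s a))\<^sup>2)" 
        unfolding Ns_def of_real_sum complex_norm_square ..
      ultimately have "(\<Sum>a<n s. (cmod (u s a))\<^sup>2) = 0" by (metis of_real_eq_0_iff)
      then have "u s a = 0" if "a < n s" for a using that by (simp add: sum_nonneg_eq_0_iff)
      then have "(\<Sum>a<n s. u s a * e0 a) = 0" by simp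
      moreover have "e0 \<in> B s" by (simp add: B_def)
      ultimately show False using u[OF s] by blast
    qed
    have Us: "(\<Sum>a<n (H i). u (H i) a * V i a) = Uv i" for i by (simp add: Uv_def V_def mult.commute)
    have U: "Uv i \<noteq> 0" if "i < 4" for i
    proof -
      have "V i \<in> B (H i)" using that by (simp add: B_def)
      then show ?thesis using u[OF Hd[OF that]] unfolding Us[symmetric] by blast
    qed
    have nonpar': "\<exists>a<n (H i). V i a / Uv i \<noteq> V i' a / Uv i'" if i: "i < 4" "i' < 4" "i \<noteq> i'" "H i = H i'" for i i'
    proof -
      obtain a where "a < n (H i)" "V i a \<noteq> Uv i / Uv i' * V i' a" using nonpar[OF i] by blast
      then show ?thesis using U[OF i(1)] U[OF i(2)] by (auto simp: field_simps)
    qed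
    have q': "\<exists>q. (\<Sum>a<n (H i). q a * V i a) = 0 \<and> (\<Sum>a<n (H i). q a * V i' a) = 0 \<and>
        (\<Sum>a<n (H i). q a * (cnj (u (H i) a) / Ns (H i))) \<noteq> 0" if i: "i < 4" "i' < 4" "H i = H i'" for i i'
    proof (intro exI[of _ "q i i'"] conjI q[OF i(1)])
      have "(\<lambda>a. cnj (q i i' a)) \<in> (\<lambda>p a. cnj (q (fst p) (snd p) a)) ` ({k. k < 4 \<and> H k = H i} \<times> {..<4})"
        using i by (intro image_eqI[of _ _ "(i, i')"]) auto
      then have "(\<lambda>a. cnj (q i i' a)) \<in> B (H i)" by (simp add: B_def)
      then have X: "(\<Sum>a<n (H i). u (H i) a * cnj (q i i' a)) \<noteq> 0" using u[OF Hd[OF i(1)]] by blast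
      have eq: "(\<Sum>a<n (H i). q i i' a * (cnj (u (H i) a) / Ns (H i)))
          = cnj (\<Sum>a<n (H i). u (H i) a * cnj (q i i' a)) / Ns (H i)"
        by (simp add: sum_divide_distrib mult.commute)
      show "(\<Sum>a<n (H i). q i i' a * (cnj (u (H i) a) / Ns (H i))) \<noteq> 0"
        unfolding eq using X N[OF Hd[OF i(1)]] by (simp del: cnj_sum)
    qed
    \<comment> \<open>Here d = 3. A proportionality would put the difference \<open>x\<close>, on
      which \<open>u\<close> vanishes, into both planes, along with \<open>z\<close>, on which
      \<open>u\<close> does not vanish. Then \<open>x\<close> and \<open>z\<close> span both planes,
      so all four vectors lie in one plane, against \<open>different_choices\<close>.\<close>
    have nonplanar: "\<not> (\<exists>k. \<forall>a<n (H 0). V 2 a / Uv 2 - V 3 a / Uv 3 = k * (V 0 a / Uv 0 - V 1 a / Uv 1))"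
      if eq: "H 1 = H 0" "H 2 = H 0" "H 3 = H 0"
    proof
      assume "\<exists>k. \<forall>a<n (H 0). V 2 a / Uv 2 - V 3 a / Uv 3 = k * (V 0 a / Uv 0 - V 1 a / Uv 1)"
      then obtain k where k: "\<And>a. a < n (H 0) \<Longrightarrow> V 2 a / Uv 2 - V 3 a / Uv 3 = k * (V 0 a / Uv 0 - V 1 a / Uv 1)" by blast
      have eqi: "H i = H 0" if "i < 4" for i
      proof -
        consider "i = 0" | "i = 1" | "i = 2" | "i = 3" using \<open>i < 4\<close> by linarith
        then show ?thesis by cases (use eq in auto)
      qed
      then have "\<not> 4 \<le> d" using False by blast
      then have d3: "d = 3" using d by simp
      define m where "m = n (H 0)"
      define x where "x a = V 2 a / Uv 2 - V 3 a / Uv 3" for a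
      have x23: "x a = 1 / Uv 2 * V 2 a + - 1 / Uv 3 * V 3 a" if "a < m" for a by (simp add: x_def)
      have x01: "x a = k / Uv 0 * V 0 a + - k / Uv 1 * V 1 a" if "a < m" for a
        using k that by (simp add: x_def m_def right_diff_distrib)
      have x0: "\<exists>a<m. x a \<noteq> 0" using nonpar'[of 2 3] eq by (simp add: x_def m_def)
      have Um: "(\<Sum>a<m. u (H 0) a * V i a) = Uv i" if "i < 4" for i using Us[of i] eqi[OF that] by (simp add: m_def)
      have "(\<Sum>a<m. u (H 0) a * x a) = (\<Sum>a<m. u (H 0) a * V 2 a) / Uv 2 - (\<Sum>a<m. u (H 0) a * V 3 a) / Uv 3"
        by (simp add: x_def right_diff_distrib sum_subtractf sum_divide_distrib)
      then have ux: "(\<Sum>a<m. u (H 0) a * x a) = 0" using Um[of 2] Um[of 3] U[of 2] U[of 3] by simp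
      have x4: "\<forall>a<m. x a = k / Uv 0 * V 0 a + - k / Uv 1 * V 1 a \<and> x a = 1 / Uv 2 * V 2 a + - 1 / Uv 3 * V 3 a"
        using x01 x23 by blast
      have "common (H 0) x"
        unfolding common_def m_def[symmetric] by (rule conjI[OF x0]) (intro exI, rule x4)
      from Zne[OF this] obtain z where z: "z \<in> Z (H 0)" "common (H 0) z" by blast
      have "z \<in> B (H 0)" unfolding B_def using z(1) by (rule UnI2)
      then have uz: "(\<Sum>a<m. u (H 0) a * z a) \<noteq> 0"
        unfolding m_def by (rule u[rotated]) (simp add: Hd)
      obtain p0 p1 p2 p3 where pz: "\<forall>a<m. z a = p0 * V 0 a + p1 * V 1 a \<and> z a = p2 * V 2 a + p3 * V 3 a"
        using z(2)[unfolded common_def, folded m_def, THEN conjunct2] by (elim exE) (rule that)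
      have p: "z a = p0 * V 0 a + p1 * V 1 a" "z a = p2 * V 2 a + p3 * V 3 a" if "a < m" for a
        using pz[rule_format, OF that] by (rule conjunct1, rule conjunct2)
      have span01: "\<exists>s t. \<forall>a<m. V 0 a = s * x a + t * z a" "\<exists>s t. \<forall>a<m. V 1 a = s * x a + t * z a"
        by (rule plane_spanned[where x = x and z = z and u = "u (H 0)"]; fact x01 p(1) ux uz x0)+
      have span23: "\<exists>s t. \<forall>a<m. V 2 a = s * x a + t * z a" "\<exists>s t. \<forall>a<m. V 3 a = s * x a + t * z a"
        by (rule plane_spanned[where x = x and z = z and u = "u (H 0)"]; fact x23 p(2) ux uz x0)+
      have span: "\<exists>s t. \<forall>a<m. V i a = s * x a + t * z a" if "i < 4" for i
      proof -
        have "i = 0 \<or> i = 1 \<or> i = 2 \<or> i = 3" using \<open>i < 4\<close> by linarith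
        then show ?thesis using span01 span23 by (elim disjE) (simp_all only:)
      qed
      have "\<exists>s t. v j i = s \<cdot>\<^sub>v Matrix.vec m x + t \<cdot>\<^sub>v Matrix.vec m z" if i: "i < 4" for i
      proof -
        obtain s t where st: "\<forall>a<m. V i a = s * x a + t * z a" using span[OF i] by blast
        have vc: "v j i \<in> carrier_vec m" using Vc[OF i] eqi[OF i] by (simp add: m_def)
        have dim: "dim_vec (v j i) = m" using vc by (rule carrier_vecD)
        have entry: "v j i $ a = s * x a + t * z a" if "a < m" for a
          using st[rule_format, OF that] unfolding V_def .
        have "v j i = s \<cdot>\<^sub>v Matrix.vec m x + t \<cdot>\<^sub>v Matrix.vec m z"
          by (rule eq_vecI) (simp_all add: dim entry)
        then show ?thesis by (intro exI)
      qed
      moreover have "\<not> (\<exists>x\<in>carrier_vec m. \<exists>y\<in>carrier_vec m. \<forall>i<4. \<exists>a b. v j i = a \<cdot>\<^sub>v x + b \<cdot>\<^sub>v y)"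
        using choices[THEN conjunct2, THEN conjunct2, THEN mp, OF d3] unfolding m_def H_def .
      ultimately show False by (meson vec_carrier)
    qed
    note ind = difference_independent[where h = H and n = n and v = V and U = Uv and
      c = "\<lambda>s a. cnj (u s a) / Ns s" and S = "set (rest d j)", OF nonpar' q' nonplanar HH]
    have "certified d r n j H (v j)"
    proof (rule certified_of_independent[where u = u, OF j d2 r0 HH])
      show "(\<Sum>a<n s. u s a * cnj (u s a)) \<noteq> 0" if "s \<in> set (rest d j)" for s
        using N[of s] that rest_props(2)[OF j d2] by (simp add: Ns_def)
      show "(\<Sum>b<n (H i). v j i $ b * u (H i) b) \<noteq> 0" if "i < 4" for i using U[OF that] by (simp add: Uv_def)
    qed (assumption | rule ind[unfolded V_def Uv_def Ns_def])+
    then show ?thesis by (simp add: H_def)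
  qed
qed

section \<open>Generic cores\<close>

definition core_index :: "nat \<Rightarrow> nat \<Rightarrow> (nat \<Rightarrow> nat) \<Rightarrow> (nat \<times> nat \<times> nat \<times> nat) set" where
  "core_index d r n = (SIGMA k:{..<d}. {..<n k} \<times> {..<r} \<times> {..<r})"

lemma cores_of_carrier [simp]: "cores_of r \<omega> k a \<in> carrier_mat r r"
  by (simp add: cores_of_def)

lemma cores_of_eq:
  assumes "\<And>s a. Q s a \<in> carrier_mat r r"
  shows "cores_of r (\<lambda>(s, a, x, y). Q s a $$ (x, y)) = Q"
  using carrier_matD[OF assms] by (intro ext eq_matI) (auto simp: cores_of_def)

lemma AE_core_measure_nonzero:
  assumes "line_poly (core_index d r n) f" and "f \<omega> \<noteq> 0"
  shows "AE \<omega> in core_measure d r n. f \<omega> \<noteq> 0"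
proof -
  have "finite (core_index d r n)" by (simp add: core_index_def)
  from line_poly_AE_nonzero[OF this assms] show ?thesis
    unfolding core_measure_def core_index_def .
qed

lemma cores_of_in:
  assumes "k < d" and "a < n k"
  shows "line_poly.mat_in (core_index d r n) r r (\<lambda>\<omega>. cores_of r \<omega> k a)"
proof (rule line_poly.mat_inI)
  fix x y assume "x < r" "y < r"
  then show "line_poly (core_index d r n) (\<lambda>\<omega>. cores_of r \<omega> k a $$ (x, y))"
    using assms by (simp add: cores_of_def core_index_def line_poly_coord)
qed simp

lemma line_poly_cores_of:
  assumes "k < d" and "a < n k" and "x < r" and "y < r"
  shows "line_poly (core_index d r n) (\<lambda>\<omega>. cores_of r \<omega> k a $$ (x, y))"
  using assms by (intro line_poly.mat_inD(2)[OF cores_of_in]) auto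

lemma gram_in:
  assumes A: "line_poly.mat_in I m k A"
  shows "line_poly I (\<lambda>\<omega>. det (mat_adjoint (A \<omega>) * A \<omega>))"
proof (intro line_poly.det_in[of I k] line_poly.mat_in_mult[of I k m] A line_poly.mat_inI)
  note c = line_poly.mat_inD(1)[OF A]
  show "mat_adjoint (A \<omega>) \<in> carrier_mat k m" for \<omega> using c by simp
  fix i l assume "i < k" "l < m"
  then show "line_poly I (\<lambda>\<omega>. mat_adjoint (A \<omega>) $$ (i, l))"
    unfolding mat_adjoint_index[OF c \<open>i < k\<close> \<open>l < m\<close>]
    by (intro line_poly_cnj line_poly.mat_inD(2)[OF A])
qed

lemma full_col_rank_of_unit_rows:
  assumes P: "P \<in> carrier_mat m k" and "k \<le> m"
    and unit: "\<And>c c'. c < k \<Longrightarrow> c' < k \<Longrightarrow> P $$ (c, c') = (if c = c' then 1 else 0)"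
  shows "full_col_rank m k P"
proof -
  define L where "L = Matrix.mat k m (\<lambda>(c, a). if a = c then 1 else 0 :: complex)"
  have L: "L \<in> carrier_mat k m" by (simp add: L_def)
  have "L * P = 1\<^sub>m k"
  proof (rule square_eq_matI[of _ k k])
    fix c c' assume c: "c < k" "c' < k"
    have "(L * P) $$ (c, c') = (\<Sum>a<m. if a = c then P $$ (c, c') else 0)"
      unfolding mult_entry[OF L P c] using c by (intro sum.cong) (auto simp: L_def)
    then show "(L * P) $$ (c, c') = 1\<^sub>m k $$ (c, c')" using c assms(2) unit by simp
  qed (use L P in auto)
  then show ?thesis using L P unfolding full_col_rank_def by blast
qed

lemma AE_full_col_rank:
  assumes k: "k < d" and n: "r * r \<le> n k"
  shows "AE \<omega> in core_measure d r n. full_col_rank (n k) (r * r) (unfold1 (n k) r (cores_of r \<omega> k))"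
    and "AE \<omega> in core_measure d r n. full_col_rank (n k) (r * r) (unfold2 (n k) r (cores_of r \<omega> k))"
proof -
  let ?I = "core_index d r n"
  have in1: "line_poly.mat_in ?I (n k) (r * r) (\<lambda>\<omega>. unfold1 (n k) r (cores_of r \<omega> k))"
  proof (rule line_poly.mat_inI)
    fix a c assume "a < n k" "c < r * r"
    then show "line_poly ?I (\<lambda>\<omega>. unfold1 (n k) r (cores_of r \<omega> k) $$ (a, c))"
      using k by (simp add: unfold1_def line_poly_cores_of square_index_div_mod)
  qed simp
  have in2: "line_poly.mat_in ?I (n k) (r * r) (\<lambda>\<omega>. unfold2 (n k) r (cores_of r \<omega> k))"
  proof (rule line_poly.mat_inI)
    fix a c assume "a < n k" "c < r * r"
    then show "line_poly ?I (\<lambda>\<omega>. unfold2 (n k) r (cores_of r \<omega> k) $$ (a, c))"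
      using k by (simp add: unfold2_def line_poly_cores_of square_index_div_mod)
  qed simp
  \<comment> \<open>Slice \<open>a\<close> is the matrix unit whose flattened position is
    \<open>a\<close>, so the top rows of the unfolding form an identity; \<open>w2\<close> does the
    same for the transposed order.\<close>
  define w1 where "w1 = (\<lambda>(s :: nat, a, x, y). if a = x * r + y then 1 else 0 :: complex)"
  define w2 where "w2 = (\<lambda>(s :: nat, a, x, y). if a = y * r + x then 1 else 0 :: complex)"
  have "full_col_rank (n k) (r * r) (unfold1 (n k) r (cores_of r w1 k))"
    using n by (intro full_col_rank_of_unit_rows)
      (auto simp: unfold1_def cores_of_def w1_def square_index_div_mod)
  from AE_core_measure_nonzero[OF gram_in[OF in1] gram_of_full_col_rank[OF this]]
  show "AE \<omega> in core_measure d r n. full_col_rank (n k) (r * r) (unfold1 (n k) r (cores_of r \<omega> k))"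
    by eventually_elim (rule full_col_rank_of_gram, simp_all)
  have "full_col_rank (n k) (r * r) (unfold2 (n k) r (cores_of r w2 k))"
    using n by (intro full_col_rank_of_unit_rows)
      (auto simp: unfold2_def cores_of_def w2_def square_index_div_mod)
  from AE_core_measure_nonzero[OF gram_in[OF in2] gram_of_full_col_rank[OF this]]
  show "AE \<omega> in core_measure d r n. full_col_rank (n k) (r * r) (unfold2 (n k) r (cores_of r \<omega> k))"
    by eventually_elim (rule full_col_rank_of_gram, simp_all)
qed

lemma env_matrix_carrier [simp]: "env_matrix d r n Q j h v \<in> carrier_mat r r"
  by (simp add: env_matrix_def)

lemma env_matrix_in:
  assumes j: "j < d" and d: "2 \<le> d" and h: "h \<in> set (rest d j)" and n: "\<And>s. s < d \<Longrightarrow> 0 < n s"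
  shows "line_poly.mat_in (core_index d r n) r r (\<lambda>\<omega>. env_matrix d r n (cores_of r \<omega>) j h v)"
proof (rule line_poly.mat_inI)
  let ?I = "core_index d r n"
  fix x y assume xy: "x < r" "y < r"
  have k: "Suc j mod d < d" using d by simp
  have hd: "h < d" using h rest_props(2)[OF j d] by auto
  have K: "line_poly ?I (\<lambda>\<omega>. contracted n h v (cores_of r \<omega>) s a x y)"
    if s: "s \<in> set (rest d j)" "a \<in> levels n h s" "x < r" "y < r" for s a x y
  proof (cases "s = h")
    case True
    have "line_poly ?I (\<lambda>\<omega>. \<Sum>b<n h. v $ b * cores_of r \<omega> h b $$ (x, y))"
      using hd s by (intro line_poly_sum line_poly_mult line_poly_const line_poly_cores_of) auto
    then show ?thesis using True by (simp add: contracted_def)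
  next
    case False
    have "line_poly ?I (\<lambda>\<omega>. cores_of r \<omega> s a $$ (x, y))"
      using False s rest_props(2)[OF j d] by (intro line_poly_cores_of) (auto simp: levels_def)
    then show ?thesis using False by (simp add: contracted_def)
  qed
  have "line_poly ?I (\<lambda>\<omega>. \<Sum>p<r. \<Sum>q<r.
     cnj (\<Sum>w<r. cores_of r \<omega> j 0 $$ (p, w) * cores_of r \<omega> (Suc j mod d) 0 $$ (w, q)) *
     env r (contracted n h v (cores_of r \<omega>)) (levels n h) (rest d j) x y q p)"
    using j k n xy by (intro line_poly_sum line_poly_mult line_poly_cnj line_poly_cores_of env_line_poly K) auto
  then show "line_poly ?I (\<lambda>\<omega>. env_matrix d r n (cores_of r \<omega>) j h v $$ (x, y))"
    using xy by (simp add: env_matrix_def)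
qed simp

text \<open>The pencil constants are taken from the certified point and kept fixed, which makes the
  certificate one polynomial function of the cores.\<close>

lemma AE_spectral_data:
  assumes j: "j < d" and d: "2 \<le> d" and n: "\<And>s. s < d \<Longrightarrow> 0 < n s"
    and h: "\<And>i. i < 4 \<Longrightarrow> h i \<in> set (rest d j)" and cert: "certified d r n j h v"
  shows "AE \<omega> in core_measure d r n. spectral_data r
    (env_matrix d r n (cores_of r \<omega>) j (h 0) (v 0)) (env_matrix d r n (cores_of r \<omega>) j (h 1) (v 1))
    (env_matrix d r n (cores_of r \<omega>) j (h 2) (v 2)) (env_matrix d r n (cores_of r \<omega>) j (h 3) (v 3))"
proof -
  obtain Q \<alpha> \<tau> where Q: "\<And>s a. Q s a \<in> carrier_mat r r" and \<alpha>: "\<alpha> 0 \<noteq> 0" "\<alpha> 1 \<noteq> 0"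
    and nz: "spectral_cert r \<alpha> \<tau> (env_matrix d r n Q j (h 0) (v 0)) (env_matrix d r n Q j (h 1) (v 1))
       (env_matrix d r n Q j (h 2) (v 2)) (env_matrix d r n Q j (h 3) (v 3)) \<noteq> 0"
    using cert unfolding certified_def by blast
  let ?f = "\<lambda>\<omega>. spectral_cert r \<alpha> \<tau>
    (env_matrix d r n (cores_of r \<omega>) j (h 0) (v 0)) (env_matrix d r n (cores_of r \<omega>) j (h 1) (v 1))
    (env_matrix d r n (cores_of r \<omega>) j (h 2) (v 2)) (env_matrix d r n (cores_of r \<omega>) j (h 3) (v 3))"
  have "line_poly (core_index d r n) ?f"
    using h by (intro line_poly.spectral_cert_in env_matrix_in[OF j d] n) auto
  moreover have "?f (\<lambda>(s, a, x, y). Q s a $$ (x, y)) \<noteq> 0" unfolding cores_of_eq[OF Q] by (rule nz)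
  ultimately have "AE \<omega> in core_measure d r n. ?f \<omega> \<noteq> 0" by (rule AE_core_measure_nonzero)
  then show ?thesis
    by eventually_elim (rule spectral_data_of_cert[OF env_matrix_carrier env_matrix_carrier env_matrix_carrier env_matrix_carrier \<alpha>])
qed

lemma foldr_cores_in:
  assumes "\<And>k. k \<in> set ks \<Longrightarrow> k < d \<and> \<alpha> k < n k"
  shows "line_poly.mat_in (core_index d r n) r r (\<lambda>\<omega>. foldr (*) (map (\<lambda>k. cores_of r \<omega> k (\<alpha> k)) ks) (1\<^sub>m r))"
  using assms
proof (induction ks)
  case (Cons k ks)
  have "line_poly.mat_in (core_index d r n) r r (\<lambda>\<omega>. cores_of r \<omega> k (\<alpha> k) * foldr (*) (map (\<lambda>k. cores_of r \<omega> k (\<alpha> k)) ks) (1\<^sub>m r))"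
    using Cons by (intro line_poly.mat_in_mult[of _ r r] cores_of_in) auto
  then show ?case by simp
qed (simp add: line_poly.mat_in_const)

lemma AE_mps_norm_nonzero:
  assumes r: "0 < r" and n: "\<And>s. s < d \<Longrightarrow> 0 < n s"
  shows "AE \<omega> in core_measure d r n. mps_norm d r n (cores_of r \<omega>) \<noteq> 0"
proof -
  define \<alpha> where "\<alpha> = restrict (\<lambda>_. 0 :: nat) {..<d}"
  have \<alpha>: "\<alpha> \<in> tuples n {..<d}" using n by (simp add: \<alpha>_def tuples_def PiE_def)
  have F: "line_poly.mat_in (core_index d r n) r r (\<lambda>\<omega>. foldr (*) (map (\<lambda>k. cores_of r \<omega> k (\<alpha> k)) [0..<d]) (1\<^sub>m r))"
    using n by (intro foldr_cores_in) (auto simp: \<alpha>_def)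
  have eq: "mps_state d r (cores_of r \<omega>) \<alpha> = (\<Sum>i<r. foldr (*) (map (\<lambda>k. cores_of r \<omega> k (\<alpha> k)) [0..<d]) (1\<^sub>m r) $$ (i, i))" for \<omega>
    unfolding mps_state_def mat_trace_def carrier_matD(1)[OF line_poly.mat_inD(1)[OF F]] ..
  have "line_poly (core_index d r n) (\<lambda>\<omega>. mps_state d r (cores_of r \<omega>) \<alpha>)"
    unfolding eq by (intro line_poly_sum line_poly.mat_inD(2)[OF F]) auto
  \<comment> \<open>With all slices equal to the identity every amplitude is the trace
    \<open>r\<close>.\<close>
  moreover have "mps_state d r (cores_of r (\<lambda>(s, a, x, y). 1\<^sub>m r $$ (x, y))) \<alpha> \<noteq> 0"
  proof -
    have "foldr (*) (map (\<lambda>k. 1\<^sub>m r) ks) (1\<^sub>m r) = (1\<^sub>m r :: complex mat)" for ks :: "nat list"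
      by (induction ks) auto
    then show ?thesis
      unfolding cores_of_eq[of "\<lambda>_ _. 1\<^sub>m r", OF one_carrier_mat] mps_state_def mat_trace_def using r by simp
  qed
  ultimately have "AE \<omega> in core_measure d r n. mps_state d r (cores_of r \<omega>) \<alpha> \<noteq> 0"
    by (rule AE_core_measure_nonzero)
  then show ?thesis
  proof eventually_elim
    case (elim \<omega>)
    have "finite (tuples n {..<d})" unfolding tuples_def by (intro finite_PiE) auto
    then have "0 < (\<Sum>\<alpha>\<in>tuples n {..<d}. (cmod (mps_state d r (cores_of r \<omega>) \<alpha>))\<^sup>2)"
      using elim \<alpha> by (intro sum_pos2[OF _ \<alpha>]) auto
    then show ?case by (simp add: mps_norm_def)
  qed
qed

lemma marginal_slice_scale:
  assumes "\<And>\<alpha>. \<phi> \<alpha> = c * \<psi> \<alpha>"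
  shows "marginal_slice n (marginal d n \<phi>) h v j k = (c * cnj c) \<cdot>\<^sub>m marginal_slice n (marginal d n \<psi>) h v j k"
proof (rule eq_matI)
  have m: "marginal d n \<phi> S \<alpha> \<beta> = c * cnj c * marginal d n \<psi> S \<alpha> \<beta>" for S \<alpha> \<beta>
    unfolding marginal_def assms sum_distrib_left by (intro sum.cong refl) (simp add: mult_ac)
  fix x y assume "x < dim_row ((c * cnj c) \<cdot>\<^sub>m marginal_slice n (marginal d n \<psi>) h v j k)"
    "y < dim_col ((c * cnj c) \<cdot>\<^sub>m marginal_slice n (marginal d n \<psi>) h v j k)"
  then have "x < n k" "y < n j" by (simp_all add: marginal_slice_def)
  then show "marginal_slice n (marginal d n \<phi>) h v j k $$ (x, y)
      = ((c * cnj c) \<cdot>\<^sub>m marginal_slice n (marginal d n \<psi>) h v j k) $$ (x, y)"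
    unfolding marginal_slice_def
    by (simp add: m sum_distrib_left) (intro sum.cong refl, simp add: mult_ac)
qed (simp_all add: marginal_slice_def)

lemma spectral_data_smult:
  assumes c: "c \<noteq> 0" and W: "W1 \<in> carrier_mat r r" "W3 \<in> carrier_mat r r" and data: "spectral_data r W0 W1 W2 W3"
  shows "spectral_data r (c \<cdot>\<^sub>m W0) (c \<cdot>\<^sub>m W1) (c \<cdot>\<^sub>m W2) (c \<cdot>\<^sub>m W3)"
proof -
  obtain A X Y e C X' Y' e' where D: "diag_by r A X Y e" "inj_on e {..<r}" "W0 = A * W1"
    "diag_by r C X' Y' e'" "inj_on e' {..<r}" "W2 = C * W3" "\<forall>p<r. \<forall>q<r. (Y * X') $$ (p, q) \<noteq> 0"
    using data unfolding spectral_data_def by blast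
  have AC: "A \<in> carrier_mat r r" "C \<in> carrier_mat r r" using D(1,4) by (auto simp: diag_by_def)
  have "c \<cdot>\<^sub>m W0 = A * (c \<cdot>\<^sub>m W1)" "c \<cdot>\<^sub>m W2 = C * (c \<cdot>\<^sub>m W3)"
    unfolding D(3,6) mult_smult_distrib[OF AC(1) W(1)] mult_smult_distrib[OF AC(2) W(2)] by (rule refl)+
  moreover have "det (c \<cdot>\<^sub>m W0) \<noteq> 0" "det (c \<cdot>\<^sub>m W1) \<noteq> 0" "det (c \<cdot>\<^sub>m W2) \<noteq> 0" "det (c \<cdot>\<^sub>m W3) \<noteq> 0"
    using data c by (auto simp: spectral_data_def)
  ultimately show ?thesis unfolding spectral_data_def using D(1,2,4,5,7) by blast
qed

lemma kron_smult:
  assumes "B \<in> carrier_mat r r"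
  shows "kron r A (c \<cdot>\<^sub>m B) = c \<cdot>\<^sub>m kron r A B"
  using assms by (intro eq_matI) (auto simp: kron_def square_index_div_mod)

text \<open>Genericity is known for the raw cores, whereas the data come from the normalized state.
  Normalization multiplies every slice by the same nonzero \<open>s\<close>, which is moved into the
  environments and leaves their quotients unchanged.\<close>

lemma recovery_of_generic_cores:
  fixes C :: "nat \<Rightarrow> nat \<Rightarrow> complex mat"
  assumes d: "3 \<le> d" and r: "0 < r" and C: "\<And>k a. C k a \<in> carrier_mat r r"
    and h: "\<And>j i. j < d \<Longrightarrow> i < 4 \<Longrightarrow> h j i \<in> {..<d} - {j, Suc j mod d}"
    and U: "\<And>k. k < d \<Longrightarrow> full_col_rank (n k) (r * r) (unfold1 (n k) r (C k))"
    and V: "\<And>k. k < d \<Longrightarrow> full_col_rank (n k) (r * r) (unfold2 (n k) r (C k))"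
    and spectral: "\<And>j. j < d \<Longrightarrow> spectral_data r
      (env_matrix d r n C j (h j 0) (v j 0)) (env_matrix d r n C j (h j 1) (v j 1))
      (env_matrix d r n C j (h j 2) (v j 2)) (env_matrix d r n C j (h j 3) (v j 3))"
    and norm: "mps_norm d r n C \<noteq> 0"
  defines "Q \<equiv> normalize_mps d r n C"
  defines "M \<equiv> \<lambda>j i. marginal_slice n (marginal d n (mps_state d r Q)) (h j i) (v j i) j (Suc j mod d)"
  shows "mps_norm d r n Q = 1"
    and "\<exists>E E'. eigen_choice d r M E E' \<and> mps_norm d r n (Q_check d r n M E E') \<noteq> 0"
    and "eigen_choice d r M E E' \<Longrightarrow> step_A_defined d r E E'"
    and "eigen_choice d r M E E' \<Longrightarrow> mps_norm d r n (Q_check d r n M E E') \<noteq> 0 \<Longrightarrow>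
      gauge_equivalent d r n (recovery_output d r n M E E') Q"
proof -
  have d0: "0 < d" and d2: "2 \<le> d" using d by auto
  show "mps_norm d r n Q = 1" unfolding Q_def by (rule mps_norm_normalize[OF d0 C norm])
  define c :: complex where "c = of_real (1 / mps_norm d r n C)"
  define s where "s = c * cnj c"
  have s: "s \<noteq> 0" using norm by (simp add: s_def c_def)
  define W where "W j i = s \<cdot>\<^sub>m env_matrix d r n C j (h j i) (v j i)" for j i
  interpret exact_data d r n C M W
  proof
    show "W j i \<in> carrier_mat r r" for j i by (simp add: W_def)
    show "spectral_data r (W j 0) (W j 1) (W j 2) (W j 3)" if "j < d" for j
      unfolding W_def by (rule spectral_data_smult[OF s env_matrix_carrier env_matrix_carrier spectral[OF that]])
    fix j i :: nat assume ji: "j < d" "i < 4"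
    define k where "k = Suc j mod d"
    let ?U = "unfold1 (n k) r (C k)" and ?V = "(unfold2 (n j) r (C j))\<^sup>T"
      and ?E = "kron r (1\<^sub>m r) (env_matrix d r n C j (h j i) (v j i))"
    have "M j i = s \<cdot>\<^sub>m marginal_slice n (marginal d n (mps_state d r C)) (h j i) (v j i) j k"
      unfolding M_def Q_def s_def k_def
      by (rule marginal_slice_scale) (simp only: mps_state_normalize[OF d0 C] c_def)
    also have "\<dots> = s \<cdot>\<^sub>m (?U * ?E * ?V)"
      unfolding k_def marginal_slice_eq[OF C ji(1) d h[OF ji]] ..
    also have "\<dots> = ?U * (s \<cdot>\<^sub>m ?E) * ?V"
    proof -
      have E: "?E \<in> carrier_mat (r * r) (r * r)" by (simp add: kron_def)
      have Vc: "?V \<in> carrier_mat (r * r) (n j)" by simp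
      show ?thesis
        unfolding mult_smult_distrib[OF unfold1_carrier E]
          mult_smult_assoc_mat[OF mult_carrier_mat[OF unfold1_carrier E] Vc] ..
    qed
    also have "\<dots> = ?U * kron r (1\<^sub>m r) (W j i) * ?V"
      unfolding W_def kron_smult[OF env_matrix_carrier] ..
    finally show "M j i = unfold1 (n (Suc j mod d)) r (C (Suc j mod d)) * kron r (1\<^sub>m r) (W j i) * (unfold2 (n j) r (C j))\<^sup>T"
      by (simp only: k_def)
  qed (use r d2 C U V norm in auto)
  show "\<exists>E E'. eigen_choice d r M E E' \<and> mps_norm d r n (Q_check d r n M E E') \<noteq> 0" by (rule exists_choice)
  show "eigen_choice d r M E E' \<Longrightarrow> step_A_defined d r E E'" by (rule recovery(1))
  show "eigen_choice d r M E E' \<Longrightarrow> mps_norm d r n (Q_check d r n M E E') \<noteq> 0 \<Longrightarrow>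
      gauge_equivalent d r n (recovery_output d r n M E E') Q" unfolding Q_def by (rule recovery(2))
qed

text \<open>Every admissible choice of eigenvectors is covered. The norm condition says that step C
  does not divide by 0, and the existence clause shows that runs satisfying it occur.\<close>

theorem theorem3:
  fixes d r :: nat
    and n :: "nat \<Rightarrow> nat"
    and \<mu> :: "(nat \<times> nat \<times> nat \<times> nat \<Rightarrow> complex) measure"
    and h :: "nat \<Rightarrow> nat \<Rightarrow> nat"
    and v :: "nat \<Rightarrow> nat \<Rightarrow> complex Matrix.vec"
  assumes "3 \<le> d" and "2 \<le> r" and "\<forall>k<d. r\<^sup>2 \<le> n k"
    and "prob_space \<mu>"
    and "sets \<mu> = sets (core_measure d r n)"
    and "absolutely_continuous (core_measure d r n) \<mu>"
    and "different_choices d n h v"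
  shows "AE \<omega> in \<mu>.
    (let Q = normalize_mps d r n (cores_of r \<omega>);
         \<rho> = marginal d n (mps_state d r Q);
         M = (\<lambda>j i. marginal_slice n \<rho> (h j i) (v j i) j (Suc j mod d))
     in mps_norm d r n Q = 1 \<and>
        (\<exists>E E'. eigen_choice d r M E E' \<and> mps_norm d r n (Q_check d r n M E E') \<noteq> 0) \<and>
        (\<forall>E E'. eigen_choice d r M E E' \<longrightarrow>
           step_A_defined d r E E' \<and>
           (mps_norm d r n (Q_check d r n M E E') \<noteq> 0 \<longrightarrow>
              gauge_equivalent d r n (recovery_output d r n M E E') Q)))"
proof -
  have d2: "2 \<le> d" and r0: "0 < r" using assms(1,2) by auto
  have n: "r * r \<le> n k" if "k < d" for k using assms(3) that by (simp add: power2_eq_square)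
  have n0: "0 < n k" if "k < d" for k
    using n[OF that] r0 by (metis mult_is_0 not_gr_zero le_zero_eq)
  have h: "h j i \<in> {..<d} - {j, Suc j mod d}" if "j < d" "i < 4" for j i
    using assms(7) that unfolding different_choices_def by blast
  then have hr: "h j i \<in> set (rest d j)" if "j < d" "i < 4" for j i
    using that rest_props(2)[OF that(1) d2] by blast
  let ?spec = "\<lambda>\<omega> j. spectral_data r
    (env_matrix d r n (cores_of r \<omega>) j (h j 0) (v j 0)) (env_matrix d r n (cores_of r \<omega>) j (h j 1) (v j 1))
    (env_matrix d r n (cores_of r \<omega>) j (h j 2) (v j 2)) (env_matrix d r n (cores_of r \<omega>) j (h j 3) (v j 3))"
  have "AE \<omega> in core_measure d r n. (\<forall>k\<in>{..<d}. full_col_rank (n k) (r * r) (unfold1 (n k) r (cores_of r \<omega> k)))"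
    by (intro AE_finite_allI AE_full_col_rank n) auto
  moreover have "AE \<omega> in core_measure d r n. (\<forall>k\<in>{..<d}. full_col_rank (n k) (r * r) (unfold2 (n k) r (cores_of r \<omega> k)))"
    by (intro AE_finite_allI AE_full_col_rank n) auto
  moreover have "AE \<omega> in core_measure d r n. (\<forall>j\<in>{..<d}. ?spec \<omega> j)"
  proof (rule AE_finite_allI)
    fix j assume "j \<in> {..<d}"
    then have j: "j < d" by simp
    show "AE \<omega> in core_measure d r n. ?spec \<omega> j"
      by (rule AE_spectral_data[OF j d2 n0 hr[OF j] certified_of_different_choices[OF assms(1,2,3,7) j]])
  qed simp
  moreover have "AE \<omega> in core_measure d r n. mps_norm d r n (cores_of r \<omega>) \<noteq> 0"
    by (rule AE_mps_norm_nonzero[OF r0 n0])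
  ultimately have "AE \<omega> in core_measure d r n.
    (let Q = normalize_mps d r n (cores_of r \<omega>);
         \<rho> = marginal d n (mps_state d r Q);
         M = (\<lambda>j i. marginal_slice n \<rho> (h j i) (v j i) j (Suc j mod d))
     in mps_norm d r n Q = 1 \<and>
        (\<exists>E E'. eigen_choice d r M E E' \<and> mps_norm d r n (Q_check d r n M E E') \<noteq> 0) \<and>
        (\<forall>E E'. eigen_choice d r M E E' \<longrightarrow>
           step_A_defined d r E E' \<and>
           (mps_norm d r n (Q_check d r n M E E') \<noteq> 0 \<longrightarrow>
              gauge_equivalent d r n (recovery_output d r n M E E') Q)))"
  proof eventually_elim
    case (elim \<omega>)
    have U: "full_col_rank (n k) (r * r) (unfold1 (n k) r (cores_of r \<omega> k))"
      and V: "full_col_rank (n k) (r * r) (unfold2 (n k) r (cores_of r \<omega> k))" and S: "?spec \<omega> k" if "k < d" for k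
      using elim(1-3) that by blast+
    note rec = recovery_of_generic_cores[of d r "cores_of r \<omega>" h n v, OF assms(1) r0 cores_of_carrier h U V S elim(4)]
    show ?case unfolding Let_def by (intro conjI allI impI rec)
  qed
  then show ?thesis by (rule absolutely_continuous_AE[OF assms(5,6)])
qed

end
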